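(* Let $T^6=\mathbb{R}^6/\mathbb{Z}^6$ be a six-dimensional torus with any flat metric, let $S^1=\mathbb{R}/\mathbb{Z}$ be the circle, and let a finite cyclic group $G$ act freely and isometrically on the Riemannian product $S^1\times T^6$ in such a way that every $g\in G$ acts by $$(x,\bar x)\mapsto (x+a,\;A\bar x+\bar a),\qquad (x,\bar x)\in S^1\times T^6,$$ for some $(a,\bar a)\in S^1\times T^6$ and $A\in SL(6,\mathbb{Z})$ (depending on $g$; $A$ is regarded as acting on $T^6$). Assume that $(S^1\times T^6)/G$ is an oriented flat manifold with holonomy group $G$, and that $a\neq 0$ in $\mathbb{R}/\mathbb{Z}$ for every $g\neq 1$. Let $M^7:=(S^1\times T^6)/G$ be endowed with the induced flat metric. Then $\eta(M^7)\in\mathbb{Z}$.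
   Context: The $\eta$ invariant of the signature operator. Let $Y$ be a closed oriented Riemannian manifold of dimension $4n-1$, $\ast$ the Hodge duality operator on $Y$ and $d$ the exterior derivative. Define the first order self-adjoint elliptic operator $B$ on differential forms by $B\phi=(-1)^{n+p+1}(\epsilon\ast d-d\ast)\phi$, where $\epsilon=1$ if $\phi$ is a $2p$-form and $\epsilon=-1$ if $\phi$ is a $(2p-1)$-form. $B$ preserves the parity of forms; $B^{ev}$ denotes its restriction to even forms. It has pure point spectrum. The function $\eta(s,Y)=\sum_{\lambda\neq 0}\operatorname{sign}(\lambda)\,\dim(\lambda)\,|\lambda|^{-s}$, where the sum is over nonzero eigenvalues $\lambda$ of $B^{ev}$ with multiplicity $\dim(\lambda)$, converges for $\operatorname{Re}(s)$ large, and has a meromorphic continuation to $\mathbb{C}$ which is finite at $s=0$. Put $\eta(Y)=\eta(0,Y)$. A flat manifold is a closed Riemannian manifold with zero sectional curvature; it is isometric to $\mathbb{R}^m/\Gamma$ with $\Gamma\subset O(m)\ltimes\mathbb{R}^m$ discrete, torsion-free and cocompact, and its holonomy group is the finite group $\Gamma/(\Gamma\cap\mathbb{R}^m)$, i.e. the image of $\Gamma$ in $O(m)$. "Holonomy group $G$" for $(S^1\times T^6)/G$ means that the covering group $G$ of $S^1\times T^6\to (S^1\times T^6)/G$ is identified with the holonomy group, i.e. the translation subgroup of the fundamental group is exactly $\pi_1(S^1\times T^6)=\mathbb{Z}^7$. *)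

theory Defs
  imports
    "HOL-Complex_Analysis.Complex_Analysis"
    "HOL-Algebra.Group_Action"
    "HOL-Algebra.Elementary_Groups"
    "HOL-Library.Function_Algebras"
begin

section \<open>Differential forms on a Euclidean space\<close>

text \<open>
  An element of the exterior algebra of the dual of \<open>'a\<close> is a function on lists of vectors: its
  values on lists of length \<open>p\<close> are its degree \<open>p\<close> component. A differential form
  assigns such an element to every point.
\<close>

type_synonym 'a form = "'a \<Rightarrow> 'a list \<Rightarrow> real"

definition alternating :: "('a::real_vector list \<Rightarrow> real) \<Rightarrow> bool" where
  "alternating f \<longleftrightarrow>
     (\<forall>us vs. linear (\<lambda>v. f (us @ v # vs))) \<and> (\<forall>vs. \<not> distinct vs \<longrightarrow> f vs = 0)"

primrec Ck :: "nat \<Rightarrow> ('a::euclidean_space \<Rightarrow> real) \<Rightarrow> bool" where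
  "Ck 0 f \<longleftrightarrow> continuous_on UNIV f"
| "Ck (Suc k) f \<longleftrightarrow>
     (\<forall>x. f differentiable (at x)) \<and> (\<forall>v. Ck k (\<lambda>x. frechet_derivative f (at x) v))"

definition smooth_function :: "('a::euclidean_space \<Rightarrow> real) \<Rightarrow> bool" where
  "smooth_function f \<longleftrightarrow> (\<forall>k. Ck k f)"

definition degree_part :: "nat \<Rightarrow> 'a form \<Rightarrow> 'a form" where
  "degree_part k \<omega> = (\<lambda>x vs. if length vs = k then \<omega> x vs else 0)"

definition even_form :: "'a form \<Rightarrow> bool" where
  "even_form \<omega> \<longleftrightarrow> (\<forall>x vs. odd (length vs) \<longrightarrow> \<omega> x vs = 0)"

definition form_pullback :: "('a::euclidean_space \<Rightarrow> 'a) \<Rightarrow> 'a form \<Rightarrow> 'a form" where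
  "form_pullback \<gamma> \<omega> = (\<lambda>x vs. \<omega> (\<gamma> x) (map (frechet_derivative \<gamma> (at x)) vs))"

definition exterior_derivative :: "'a::euclidean_space form \<Rightarrow> 'a form" where
  "exterior_derivative \<omega> = (\<lambda>x vs. \<Sum>i<length vs. (-1) ^ i *
     frechet_derivative (\<lambda>y. \<omega> y (take i vs @ drop (Suc i) vs)) (at x) (vs ! i))"

section \<open>Flat metrics, orientations and the Hodge star\<close>

definition inner_product_on :: "('a::euclidean_space \<Rightarrow> 'a \<Rightarrow> real) \<Rightarrow> bool" where
  "inner_product_on m \<longleftrightarrow>
     bilinear m \<and> (\<forall>u v. m u v = m v u) \<and> (\<forall>v. v \<noteq> 0 \<longrightarrow> m v v > 0)"

definition orthonormal_basis :: "('a::euclidean_space \<Rightarrow> 'a \<Rightarrow> real) \<Rightarrow> 'a set \<Rightarrow> bool" where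
  "orthonormal_basis m E \<longleftrightarrow> finite E \<and> card E = DIM('a) \<and>
     (\<forall>u\<in>E. \<forall>v\<in>E. m u v = (if u = v then 1 else 0))"

text \<open>
  An orientation is given by its Riemannian volume form; for every constant metric there are
  exactly two volume forms, which differ by a sign.
\<close>

definition volume_form ::
    "('a::euclidean_space \<Rightarrow> 'a \<Rightarrow> real) \<Rightarrow> ('a list \<Rightarrow> real) \<Rightarrow> bool" where
  "volume_form m vol \<longleftrightarrow> alternating vol \<and>
     (\<forall>vs. length vs \<noteq> DIM('a) \<longrightarrow> vol vs = 0) \<and>
     (\<forall>es. distinct es \<and> orthonormal_basis m (set es) \<longrightarrow> \<bar>vol es\<bar> = 1)"

text \<open>
  On a \<open>p\<close>-form, \<open>(* \<omega>) (ws) = \<Sum> \<omega> (e\<^sub>I) vol (e\<^sub>I, ws)\<close>, the sum over the increasing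
  \<open>p\<close>-tuples \<open>I\<close> of indices of an orthonormal basis; equivalently, over all \<open>p\<close>-tuples of basis
  vectors, divided by \<open>p!\<close>. This is independent of the basis, and it is the star operator with
  \<open>\<alpha> \<and> * \<beta> = \<langle>\<alpha>, \<beta>\<rangle> vol\<close>.
\<close>

definition hodge_star ::
    "('a::euclidean_space \<Rightarrow> 'a \<Rightarrow> real) \<Rightarrow> ('a list \<Rightarrow> real) \<Rightarrow> 'a form \<Rightarrow> 'a form" where
  "hodge_star m vol \<omega> = (\<lambda>x ws.
     let p = DIM('a) - length ws; E = (SOME E. orthonormal_basis m E)
     in (\<Sum>us\<in>{us. set us \<subseteq> E \<and> length us = p}. \<omega> x us * vol (us @ ws)) / fact p)"

section \<open>The signature operator and its eta invariant\<close>

text \<open>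
  The dimension is \<open>4 n - 1\<close>. On \<open>2 p\<close>-forms and on \<open>(2 p - 1)\<close>-forms the operator is
  \<open>(-1) ^ (n + p + 1) (\<epsilon> * d - d *)\<close>, with \<open>\<epsilon> = 1\<close> and \<open>\<epsilon> = -1\<close> respectively; in both
  cases \<open>p = (k + 1) div 2\<close> for the degree \<open>k\<close>.
\<close>

definition signature_operator ::
    "('a::euclidean_space \<Rightarrow> 'a \<Rightarrow> real) \<Rightarrow> ('a list \<Rightarrow> real) \<Rightarrow> 'a form \<Rightarrow> 'a form" where
  "signature_operator m vol \<omega> = (\<lambda>x vs. \<Sum>k\<le>DIM('a).
     let n = (DIM('a) + 1) div 4; p = (k + 1) div 2; \<epsilon> = (if even k then 1 else -1);
         \<phi> = degree_part k \<omega>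
     in (-1) ^ (n + p + 1) *
        (\<epsilon> * hodge_star m vol (exterior_derivative \<phi>) x vs
         - exterior_derivative (hodge_star m vol \<phi>) x vs))"

text \<open>
  Let \<open>\<Gamma>\<close> be a group of isometries acting freely and properly discontinuously on \<open>'a\<close> with the
  constant metric \<open>m\<close>. The smooth differential forms on the flat manifold \<open>'a / \<Gamma>\<close> are
  represented by their pullbacks to the universal cover \<open>'a\<close>.
\<close>

definition quotient_form :: "('a::euclidean_space \<Rightarrow> 'a) set \<Rightarrow> 'a form \<Rightarrow> bool" where
  "quotient_form \<Gamma> \<omega> \<longleftrightarrow> (\<forall>x. alternating (\<omega> x)) \<and>
     (\<forall>vs. smooth_function (\<lambda>x. \<omega> x vs)) \<and> (\<forall>\<gamma>\<in>\<Gamma>. form_pullback \<gamma> \<omega> = \<omega>)"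

definition form_scale :: "real \<Rightarrow> 'a form \<Rightarrow> 'a form" where
  "form_scale c \<omega> = (\<lambda>x vs. c * \<omega> x vs)"

lemma vector_space_form_scale: "vector_space form_scale"
  by unfold_locales (auto simp: form_scale_def fun_eq_iff algebra_simps)

definition even_eigenspace ::
    "('a::euclidean_space \<Rightarrow> 'a) set \<Rightarrow> ('a \<Rightarrow> 'a \<Rightarrow> real) \<Rightarrow> ('a list \<Rightarrow> real) \<Rightarrow> real \<Rightarrow> 'a form set"
  where
  "even_eigenspace \<Gamma> m vol l =
     {\<omega>. quotient_form \<Gamma> \<omega> \<and> even_form \<omega> \<and> signature_operator m vol \<omega> = form_scale l \<omega>}"

definition eigenvalues ::
    "('a::euclidean_space \<Rightarrow> 'a) set \<Rightarrow> ('a \<Rightarrow> 'a \<Rightarrow> real) \<Rightarrow> ('a list \<Rightarrow> real) \<Rightarrow> real set" where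
  "eigenvalues \<Gamma> m vol = {l. \<exists>\<omega>\<in>even_eigenspace \<Gamma> m vol l. \<omega> \<noteq> 0}"

definition multiplicity_of ::
    "('a::euclidean_space \<Rightarrow> 'a) set \<Rightarrow> ('a \<Rightarrow> 'a \<Rightarrow> real) \<Rightarrow> ('a list \<Rightarrow> real) \<Rightarrow> real \<Rightarrow> nat" where
  "multiplicity_of \<Gamma> m vol l = vector_space.dim form_scale (even_eigenspace \<Gamma> m vol l)"

text \<open>
  A meromorphic continuation of the eta function to the whole plane, finite at 0. Analyticity at
  0 is required explicitly because \<^const>\<open>meromorphic_on\<close> does not constrain the values at
  isolated points.
\<close>

definition eta_continuation ::
    "('a::euclidean_space \<Rightarrow> 'a) set \<Rightarrow> ('a \<Rightarrow> 'a \<Rightarrow> real) \<Rightarrow> ('a list \<Rightarrow> real) \<Rightarrow>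
     (complex \<Rightarrow> complex) \<Rightarrow> bool" where
  "eta_continuation \<Gamma> m vol F \<longleftrightarrow>
     F meromorphic_on UNIV \<and> F analytic_on {0} \<and>
     (\<exists>c. \<forall>s. Re s > c \<longrightarrow>
       ((\<lambda>l. of_real (sgn l) * of_nat (multiplicity_of \<Gamma> m vol l) * of_real \<bar>l\<bar> powr (- s))
          has_sum F s) (eigenvalues \<Gamma> m vol - {0}))"

definition eta_invariant ::
    "('a::euclidean_space \<Rightarrow> 'a) set \<Rightarrow> ('a \<Rightarrow> 'a \<Rightarrow> real) \<Rightarrow> ('a list \<Rightarrow> real) \<Rightarrow> complex" where
  "eta_invariant \<Gamma> m vol = (THE v. \<exists>F. eta_continuation \<Gamma> m vol F \<and> F 0 = v)"

section \<open>The torus and its quotients\<close>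

definition integer_lattice :: "(real \<times> (real ^ 6)) set" where
  "integer_lattice = {(k, z). k \<in> \<int> \<and> (\<forall>i. z $ i \<in> \<int>)}"

definition torus_point :: "real \<times> (real ^ 6) \<Rightarrow> (real \<times> (real ^ 6)) set" where
  "torus_point p = {q. q - p \<in> integer_lattice}"

definition torus :: "(real \<times> (real ^ 6)) set set" where
  "torus = range torus_point"

definition product_metric ::
    "((real ^ 6) \<Rightarrow> (real ^ 6) \<Rightarrow> real) \<Rightarrow> real \<times> (real ^ 6) \<Rightarrow> real \<times> (real ^ 6) \<Rightarrow> real" where
  "product_metric h = (\<lambda>(s, u) (t, v). s * t + h u v)"

text \<open>
  For a free action of \<open>G\<close> on the torus these lifts are the covering transformations of the
  universal cover of the quotient of the torus by \<open>G\<close>, that is, its fundamental group.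
\<close>

definition deck_group ::
    "('g, 'b) monoid_scheme \<Rightarrow>
     ('g \<Rightarrow> (real \<times> (real ^ 6)) set \<Rightarrow> (real \<times> (real ^ 6)) set) \<Rightarrow>
     (real \<times> (real ^ 6) \<Rightarrow> real \<times> (real ^ 6)) set" where
  "deck_group G \<phi> = {\<gamma>. continuous_on UNIV \<gamma> \<and>
     (\<exists>g\<in>carrier G. \<forall>p. torus_point (\<gamma> p) = \<phi> g (torus_point p))}"

end

(*
  On even forms on R^7 the signature operator of a flat metric is the constant coefficient operator
  D = sum_e C(e) d/de over an orthonormal basis, with C a Clifford multiplication. Let e0 = (1, 0) be
  the direction of the circle, which every deck transformation fixes. Then J = d/de0 + l C(e0) maps
  the eigenforms of D for l to those for -l, and only its kernel contributes to the spectral asymmetry.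
  The kernel consists of the forms cos(l t) w - sin(l t) C(e0) w, with w constant and t the coordinate
  on the circle, which are invariant exactly when the generator rho of the holonomy rotates w by the
  angle l / r with respect to the complex structure C(e0); here r is the order of G. Hence l = 2 pi n,
  and the asymmetry is an r-periodic function of n. The eta function is then a combination of Hurwitz
  zeta functions with value sum_j (kappa_j - kappa_(r-j)) (1/2 - j/r) at 0, where kappa_j is the real
  dimension of the space on which rho acts as the rotation by 2 pi j / r.

  This value is an integer as soon as r divides sum_j j kappa_j. Since kappa_j is twice a complex
  dimension, it suffices that the complex determinant of rho, an r-th root of unity, is real. By the
  Cartan-Dieudonne theorem rho is a product of pairs of reflections; each pair commutes with a
  reflection in a vector orthogonal to both, and this reflection anticommutes with C(e0), so that it
  conjugates the complex determinant of the pair.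
*)
theory Submission
  imports Defs "Jordan_Normal_Form.Determinant"
begin

text \<open>Only differences between the multiplicities of l and -l enter; the spectrum is never
  computed. The operator satisfies D C(e0) + C(e0) D = -2 d/de0, hence D J = -l J on the eigenspace
  of l. Following J by d/de0 - l C(e0) gives d^2/de0^2 + l^2, which on a Fourier mode of length |l|
  / (2 pi) vanishes only for frequencies along e0, and there the eigenvalue equation already gives J
  = 0. So J identifies the eigenspaces of l and -l modulo its kernels. Fourier series on the
  covering torus also take the place of elliptic theory: they bound the multiplicities and give
  absolute convergence for Re s > 14, twice the dimension. The term 1/2 - j/r is the value at 0 of
  the Hurwitz zeta function of j/r. The reflections come in pairs because A has determinant 1, and
  dimension 6 leaves room for the orthogonal vector. A reflection that fixes e0 anticommutes with
  C(e0) because it reverses the orientation and with it the star. Reality suffices because the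
  product of the eigenvalues over a real basis is the square of the complex determinant, which is 1
  for a real root of unity.\<close>

section \<open>Inner products and orthonormal bases\<close>

lemma inner_product_onD:
  assumes "inner_product_on m"
  shows "bilinear m" "m u v = m v u" "v \<noteq> 0 \<Longrightarrow> m v v > 0"
    "m (u + u') v = m u v + m u' v" "m u (v + v') = m u v + m u v'"
    "m (c *\<^sub>R u) v = c * m u v" "m u (c *\<^sub>R v) = c * m u v"
    "m 0 v = 0" "m u 0 = 0" "m (u - u') v = m u v - m u' v" "m u (v - v') = m u v - m u v'"
    "m (- u) v = - m u v" "m u (- v) = - m u v"
proof -
  show b: "bilinear m" and "m u v = m v u" and "v \<noteq> 0 \<Longrightarrow> m v v > 0"
    using assms by (auto simp: inner_product_on_def)
  show "m (u + u') v = m u v + m u' v" "m u (v + v') = m u v + m u v'"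
    "m (c *\<^sub>R u) v = c * m u v" "m u (c *\<^sub>R v) = c * m u v"
    "m 0 v = 0" "m u 0 = 0" "m (u - u') v = m u v - m u' v" "m u (v - v') = m u v - m u v'"
    "m (- u) v = - m u v" "m u (- v) = - m u v"
    using b by (simp_all add: bilinear_ladd bilinear_radd bilinear_lmul bilinear_rmul bilinear_lzero
        bilinear_rzero bilinear_lsub bilinear_rsub bilinear_lneg bilinear_rneg)
qed

lemma inner_product_on_sum:
  assumes "inner_product_on m"
  shows "m (\<Sum>i\<in>I. c i *\<^sub>R f i) v = (\<Sum>i\<in>I. c i * m (f i) v)"
    and "m v (\<Sum>i\<in>I. c i *\<^sub>R f i) = (\<Sum>i\<in>I. c i * m v (f i))"
proof -
  have l1: "linear (\<lambda>u. m u v)" and l2: "linear (m v)"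
    using inner_product_onD(1)[OF assms] by (auto simp: bilinear_def)
  show "m (\<Sum>i\<in>I. c i *\<^sub>R f i) v = (\<Sum>i\<in>I. c i * m (f i) v)"
    using linear_sum[OF l1, of "\<lambda>i. c i *\<^sub>R f i" I] by (simp add: inner_product_onD[OF assms])
  show "m v (\<Sum>i\<in>I. c i *\<^sub>R f i) = (\<Sum>i\<in>I. c i * m v (f i))"
    using linear_sum[OF l2, of "\<lambda>i. c i *\<^sub>R f i" I] by (simp add: inner_product_onD[OF assms])
qed

definition orthonormal_on :: "('a::euclidean_space \<Rightarrow> 'a \<Rightarrow> real) \<Rightarrow> 'a set \<Rightarrow> bool" where
  "orthonormal_on m E \<longleftrightarrow> (\<forall>u\<in>E. \<forall>v\<in>E. m u v = (if u = v then 1 else 0))"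

lemma orthonormal_on_independent:
  assumes m: "inner_product_on m" and E: "orthonormal_on m E"
  shows "independent E"
proof (rule independent_explicit_finite_subsets[THEN iffD2], intro allI impI ballI)
  fix S u w assume S: "S \<subseteq> E" "finite S" and s: "(\<Sum>v\<in>S. u v *\<^sub>R v) = 0" and w: "w \<in> S"
  have "0 = m (\<Sum>v\<in>S. u v *\<^sub>R v) w" using s inner_product_onD(8)[OF m] by simp
  also have "\<dots> = (\<Sum>v\<in>S. u v * m v w)" by (rule inner_product_on_sum[OF m])
  also have "\<dots> = (\<Sum>v\<in>S. if v = w then u v else 0)"
    using S w E by (intro sum.cong refl) (simp add: orthonormal_on_def subset_iff)
  also have "\<dots> = u w" using S w by simp
  finally show "u w = 0" by simp
qed

lemma orthonormal_basis_orthonormal: "orthonormal_basis m E \<Longrightarrow> orthonormal_on m E"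
  by (auto simp: orthonormal_basis_def orthonormal_on_def)

lemma orthonormal_basis_span:
  fixes m :: "'a::euclidean_space \<Rightarrow> 'a \<Rightarrow> real"
  assumes m: "inner_product_on m" and E: "orthonormal_basis m E"
  shows "span E = UNIV"
proof -
  have "independent E" using orthonormal_on_independent[OF m orthonormal_basis_orthonormal[OF E]] .
  then show ?thesis
    using card_ge_dim_independent[of E UNIV] E by (auto simp: orthonormal_basis_def)
qed

lemma orthonormal_basis_expand:
  fixes m :: "'a::euclidean_space \<Rightarrow> 'a \<Rightarrow> real"
  assumes m: "inner_product_on m" and E: "orthonormal_basis m E"
  shows "v = (\<Sum>e\<in>E. m v e *\<^sub>R e)"
proof -
  have fin: "finite E" using E by (simp add: orthonormal_basis_def)
  have "v \<in> span E" using orthonormal_basis_span[OF m E] by simp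
  then obtain c where c: "v = (\<Sum>e\<in>E. c e *\<^sub>R e)" using span_finite[OF fin] by auto
  have "m v e = c e" if "e \<in> E" for e
  proof -
    have "m v e = (\<Sum>x\<in>E. c x * m x e)" by (subst c) (rule inner_product_on_sum[OF m])
    also have "\<dots> = (\<Sum>x\<in>E. if x = e then c x else 0)"
      using that E by (intro sum.cong) (auto simp: orthonormal_basis_def)
    finally show ?thesis using that fin by simp
  qed
  then show ?thesis using c by (metis (no_types, lifting) sum.cong)
qed

text \<open>Independence bounds the size of orthonormal sets, so a largest one containing
  \<open>F\<close> exists. If it did not span, the normalised residual of a vector outside its span
  could be adjoined.\<close>

lemma orthonormal_basis_extend:
  fixes m :: "'a::euclidean_space \<Rightarrow> 'a \<Rightarrow> real"
  assumes m: "inner_product_on m" and F: "orthonormal_on m F"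
  obtains E where "F \<subseteq> E" "orthonormal_basis m E"
proof -
  have bound: "card G \<le> DIM('a) \<and> finite G" if "orthonormal_on m G" for G
    using orthonormal_on_independent[OF m that] independent_bound by blast
  define P where "P = (\<lambda>G. orthonormal_on m G \<and> F \<subseteq> G)"
  have "\<exists>G. P G \<and> (\<forall>H. P H \<longrightarrow> card H \<le> card G)"
    using F bound by (intro ex_has_greatest_nat[of P F card "DIM('a) + 1"]) (auto simp: P_def less_Suc_eq_le)
  then obtain G where G: "P G" and max: "\<And>H. P H \<Longrightarrow> card H \<le> card G" by blast
  have o: "orthonormal_on m G" and FG: "F \<subseteq> G" and fin: "finite G" using G bound by (auto simp: P_def)
  have "span G = UNIV"
  proof (rule ccontr)
    assume "span G \<noteq> UNIV"
    then obtain v where v: "v \<notin> span G" by blast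
    define w where "w = v - (\<Sum>e\<in>G. m v e *\<^sub>R e)"
    have "(\<Sum>e\<in>G. m v e *\<^sub>R e) \<in> span G" by (intro span_sum span_scale span_base)
    then have w0: "w \<noteq> 0" using v by (auto simp: w_def)
    have wG: "m w e = 0" if "e \<in> G" for e
    proof -
      have "m (\<Sum>x\<in>G. m v x *\<^sub>R x) e = (\<Sum>x\<in>G. m v x * m x e)" by (rule inner_product_on_sum[OF m])
      also have "\<dots> = (\<Sum>x\<in>G. if x = e then m v x else 0)"
        using that o by (intro sum.cong) (auto simp: orthonormal_on_def)
      also have "\<dots> = m v e" using that fin by simp
      finally show ?thesis by (simp add: w_def inner_product_onD[OF m])
    qed
    define u where "u = (1 / sqrt (m w w)) *\<^sub>R w"
    have pos: "m w w > 0" using inner_product_onD(3)[OF m w0] .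
    have uu: "m u u = 1" using pos by (simp add: u_def inner_product_onD[OF m])
    have uG: "m u e = 0" "m e u = 0" if "e \<in> G" for e
      using wG[OF that] by (simp_all add: u_def inner_product_onD(6,7)[OF m] inner_product_onD(2)[OF m, of e])
    have "u \<notin> G" using uu uG by force
    moreover have "P (insert u G)" using o FG uu uG by (auto simp: P_def orthonormal_on_def)
    ultimately show False using max[of "insert u G"] fin by auto
  qed
  then have "card G = DIM('a)"
    using orthonormal_on_independent[OF m o] by (metis dim_UNIV dim_span_eq_card_independent)
  then have "orthonormal_basis m G" using o fin by (auto simp: orthonormal_basis_def orthonormal_on_def)
  then show ?thesis using that FG by blast
qed

lemma orthonormal_basis_exists:
  assumes "inner_product_on m" shows "\<exists>E. orthonormal_basis m E"
  using orthonormal_basis_extend[OF assms, of "{}"] by (auto simp: orthonormal_on_def)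

section \<open>Alternating functions on lists\<close>

text \<open>The value type is arbitrary because the same calculus serves real forms and their
  complex Fourier coefficients. Only equal neighbours are required to give 0, the condition that is
  convenient in inductions along the list; repetitions at a distance follow by moving an
  entry.\<close>

definition alt :: "('a::real_vector list \<Rightarrow> 'b::real_vector) \<Rightarrow> bool" where
  "alt f \<longleftrightarrow> (\<forall>us vs. linear (\<lambda>v. f (us @ v # vs))) \<and> (\<forall>us x vs. f (us @ x # x # vs) = 0)"

lemma alt_linear: "alt f \<Longrightarrow> linear (\<lambda>v. f (us @ v # vs))"
  and alt_adj: "alt f \<Longrightarrow> f (us @ x # x # vs) = 0"
  by (auto simp: alt_def)

lemma alt_add: "alt f \<Longrightarrow> f (us @ (x + y) # vs) = f (us @ x # vs) + f (us @ y # vs)"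
  and alt_scale: "alt f \<Longrightarrow> f (us @ (c *\<^sub>R x) # vs) = c *\<^sub>R f (us @ x # vs)"
  using linear_add[OF alt_linear[of f us vs], of x y] linear_scale[OF alt_linear[of f us vs], of c x] by simp_all

lemma alt_sum: "alt f \<Longrightarrow> f (us @ (\<Sum>i\<in>I. c i *\<^sub>R g i) # vs) = (\<Sum>i\<in>I. c i *\<^sub>R f (us @ g i # vs))"
  using linear_sum[OF alt_linear[of f us vs], of "\<lambda>i. c i *\<^sub>R g i" I] by (simp add: alt_scale)

lemma alt_sum_hd: "alt f \<Longrightarrow> f ((\<Sum>i\<in>I. c i *\<^sub>R g i) # vs) = (\<Sum>i\<in>I. c i *\<^sub>R f (g i # vs))"
  using alt_sum[of f "[]"] by simp

lemma alt_swap: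
  assumes "alt f" shows "f (us @ x # y # vs) = - f (us @ y # x # vs)"
proof -
  have a: "f (us @ (x + y) # z # vs) = f (us @ x # z # vs) + f (us @ y # z # vs)" for z
    by (rule alt_add[OF assms])
  have b: "f (us @ z # (x + y) # vs) = f (us @ z # x # vs) + f (us @ z # y # vs)" for z
    using alt_add[OF assms, of "us @ [z]" x y vs] by simp
  have "0 = f (us @ (x + y) # (x + y) # vs)" by (simp add: alt_adj[OF assms])
  also have "\<dots> = f (us @ x # y # vs) + f (us @ y # x # vs)"
    unfolding a b by (simp add: alt_adj[OF assms])
  finally show ?thesis by (simp add: eq_neg_iff_add_eq_0)
qed

lemma alt_move:
  assumes "alt f" shows "f (ws @ us @ x # vs) = (-1) ^ length us *\<^sub>R f (ws @ x # us @ vs)"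
proof (induction us arbitrary: ws)
  case (Cons u us)
  have "f (ws @ (u # us) @ x # vs) = (-1) ^ length us *\<^sub>R f (ws @ u # x # us @ vs)"
    using Cons.IH[of "ws @ [u]"] by simp
  also have "f (ws @ u # x # us @ vs) = - f (ws @ x # u # us @ vs)" by (rule alt_swap[OF assms])
  finally show ?case by simp
qed simp

lemma alt_move_hd: "alt f \<Longrightarrow> f (us @ x # vs) = (-1) ^ length us *\<^sub>R f (x # us @ vs)"
  using alt_move[of f "[]" us x vs] by simp

lemma alt_not_distinct:
  assumes "alt f" "\<not> distinct vs" shows "f vs = 0"
proof -
  obtain xs ys zs y where "vs = xs @ [y] @ ys @ [y] @ zs" using not_distinct_decomp[OF assms(2)] by blast
  then have "f vs = f ((xs @ [y]) @ ys @ y # zs)" by simp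
  also have "\<dots> = (-1) ^ length ys *\<^sub>R f ((xs @ [y]) @ y # ys @ zs)" by (rule alt_move[OF assms(1)])
  also have "f ((xs @ [y]) @ y # ys @ zs) = 0" using alt_adj[OF assms(1)] by simp
  finally show ?thesis by simp
qed

lemma alternating_iff_alt: "alternating f \<longleftrightarrow> alt f"
proof
  show "alt f" if "alternating f"
    using that by (auto simp: alternating_def alt_def)
  show "alternating f" if "alt f"
    using that alt_not_distinct by (auto simp: alternating_def alt_def)
qed

text \<open>Among more than \<open>DIM('a)\<close> distinct vectors one is a combination of the
  others; expanding it leaves only terms with a repeated entry.\<close>

lemma alt_exceeds_dim:
  fixes f :: "'a::euclidean_space list \<Rightarrow> 'b::real_vector"
  assumes f: "alt f" and len: "length vs > DIM('a)" shows "f vs = 0"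
proof (cases "distinct vs")
  case True
  then have "card (set vs) > DIM('a)" using len by (simp add: distinct_card)
  then have "dependent (set vs)" using independent_bound by (meson not_le)
  then obtain v where v: "v \<in> set vs" "v \<in> span (set vs - {v})" by (auto simp: dependent_def)
  then obtain xs ys where vs: "vs = xs @ v # ys" by (meson split_list)
  obtain c where c: "v = (\<Sum>w\<in>set vs - {v}. c w *\<^sub>R w)" using v(2) span_finite[of "set vs - {v}"] by auto
  have "f (xs @ w # ys) = 0" if "w \<in> set vs - {v}" for w
    using that vs by (intro alt_not_distinct[OF f]) auto
  then have "f (xs @ (\<Sum>w\<in>set vs - {v}. c w *\<^sub>R w) # ys) = 0" by (simp add: alt_sum[OF f])
  then have "f (xs @ v # ys) = 0" unfolding c[symmetric] .
  then show ?thesis by (simp only: vs)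
qed (rule alt_not_distinct[OF f])

lemma alt_slot: "alt f \<Longrightarrow> alt (\<lambda>us. f (v # us))"
  using alt_linear[of f "v # us" for us] alt_adj[of f "v # us" for us] by (simp add: alt_def)

lemma alt_combine: "alt f \<Longrightarrow> alt g \<Longrightarrow> alt (\<lambda>vs. a *\<^sub>R f vs + b *\<^sub>R g vs)"
  unfolding alt_def by (auto intro!: linear_compose_add linear_compose_scale_right)

lemma alt_eq_on_basis:
  assumes f: "alt f" and g: "alt g" and E: "finite E" "span E = UNIV"
    and eq: "\<And>us. set us \<subseteq> E \<Longrightarrow> length us = length vs \<Longrightarrow> f us = g us"
  shows "f vs = g vs"
proof -
  \<comment> \<open>The prefix \<open>us\<close> collects the entries that have already been
    expanded in \<open>E\<close>.\<close>
  have "f (us @ vs) = g (us @ vs)"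
    if "set us \<subseteq> E" "\<And>ws. set ws \<subseteq> E \<Longrightarrow> length ws = length us + length vs \<Longrightarrow> f ws = g ws" for us
    using that
  proof (induction vs arbitrary: us)
    case (Cons v vs)
    have "v \<in> span E" using E by simp
    then obtain c where c: "v = (\<Sum>e\<in>E. c e *\<^sub>R e)" using span_finite[OF E(1)] by auto
    have "f ((us @ [e]) @ vs) = g ((us @ [e]) @ vs)" if "e \<in> E" for e
      using that Cons.prems by (intro Cons.IH) auto
    then show ?case by (subst (1 2) c) (simp add: alt_sum[OF f] alt_sum[OF g])
  qed simp
  from this[of "[]"] show ?thesis using eq by simp
qed

section \<open>Exterior multiplication and contraction\<close>

text \<open>Exterior product of the covector \<open>m v\<close> with a form. Recursion along the
  argument list, with the form generalised, turns most identities into short inductions;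
  \<open>wedge_eq_sum\<close> recovers the usual alternating sum.\<close>

primrec wedge ::
    "('a \<Rightarrow> 'a \<Rightarrow> real) \<Rightarrow> 'a \<Rightarrow> ('a list \<Rightarrow> 'b::real_vector) \<Rightarrow> 'a list \<Rightarrow> 'b" where
  "wedge m v \<omega> [] = 0"
| "wedge m v \<omega> (x # vs) = m v x *\<^sub>R \<omega> vs - wedge m v (\<lambda>us. \<omega> (x # us)) vs"

lemma wedge_eq_sum:
  "wedge m v \<omega> vs =
    (\<Sum>i<length vs. ((-1) ^ i * m v (vs ! i)) *\<^sub>R \<omega> (take i vs @ drop (Suc i) vs))"
proof (induction vs arbitrary: \<omega>)
  case (Cons x vs)
  have "(\<Sum>i<length vs. ((-1) ^ Suc i * m v (vs ! i)) *\<^sub>R \<omega> (x # take i vs @ drop (Suc i) vs))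
    = - wedge m v (\<lambda>us. \<omega> (x # us)) vs"
    unfolding Cons sum_negf[symmetric] by simp
  then show ?case
    unfolding length_Cons sum.lessThan_Suc_shift by simp
qed simp

lemma wedge_append:
  "wedge m v \<omega> (us @ ws) = wedge m v (\<lambda>xs. \<omega> (xs @ ws)) us
     + (-1) ^ length us *\<^sub>R wedge m v (\<lambda>xs. \<omega> (us @ xs)) ws"
  by (induction us arbitrary: \<omega>) simp_all

lemma wedge_cong:
  assumes "\<And>us. Suc (length us) = length vs \<Longrightarrow> \<omega> us = \<omega>' us"
  shows "wedge m v \<omega> vs = wedge m v \<omega>' vs"
  unfolding wedge_eq_sum by (intro sum.cong refl arg_cong2[where f = "(*\<^sub>R)"] assms) auto

lemma wedge_linear: "linear L \<Longrightarrow> wedge m v (\<lambda>us. L (\<omega> us)) vs = L (wedge m v \<omega> vs)"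
  by (induction vs arbitrary: \<omega>) (simp_all add: linear_0 linear_diff linear_scale)

lemma wedge_zero: "wedge m v (\<lambda>us. 0) vs = 0"
  by (induction vs) simp_all

lemma wedge_add: "wedge m v (\<lambda>us. f us + g us) vs = wedge m v f vs + wedge m v g vs"
  and wedge_diff: "wedge m v (\<lambda>us. f us - g us) vs = wedge m v f vs - wedge m v g vs"
  and wedge_scaleR: "wedge m v (\<lambda>us. c *\<^sub>R f us) vs = c *\<^sub>R wedge m v f vs"
  and wedge_neg: "wedge m v (\<lambda>us. - f us) vs = - wedge m v f vs"
  by (induction vs arbitrary: f g) (simp_all add: algebra_simps)

lemma wedge_sum: "wedge m v (\<lambda>us. \<Sum>i\<in>I. f i us) vs = (\<Sum>i\<in>I. wedge m v (f i) vs)"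
  by (induction I rule: infinite_finite_induct) (simp_all add: wedge_zero wedge_add)

lemma wedge_scale_values: "wedge m v (\<lambda>us. r us *\<^sub>R y) vs = wedge m v r vs *\<^sub>R y"
  by (rule wedge_linear) (auto intro!: linearI simp: algebra_simps)

lemma alt_wedge:
  assumes m: "bilinear m" and f: "alt f" shows "alt (wedge m v f)"
  unfolding alt_def
proof (intro conjI allI)
  have lm: "linear (m v)" using m by (simp add: bilinear_def)
  show "linear (\<lambda>x. wedge m v f (us @ x # vs))" for us vs
    using f
  proof (induction us arbitrary: f)
    case Nil
    have "linear (\<lambda>x. m v x *\<^sub>R f vs)"
      by (rule linearI) (simp_all add: linear_add[OF lm] linear_scale[OF lm] algebra_simps)
    moreover have "linear (\<lambda>x. wedge m v (\<lambda>us. f (x # us)) vs)"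
      using alt_add[OF Nil, of "[]"] alt_scale[OF Nil, of "[]"]
      by (intro linearI) (simp_all add: wedge_add wedge_scaleR)
    ultimately show ?case by (simp add: linear_compose_sub)
  next
    case (Cons u us)
    show ?case using alt_linear[OF Cons.prems, of us vs] Cons.IH[OF alt_slot[OF Cons.prems]]
      by (simp add: linear_compose_sub linear_compose_scale_right)
  qed
  show "wedge m v f (us @ x # x # vs) = 0" for us x vs
    using f
  proof (induction us arbitrary: f)
    case Nil
    have "f (x # x # us) = 0" for us using alt_adj[OF Nil, of "[]"] by simp
    then show ?case by (simp add: wedge_zero)
  next
    case (Cons u us)
    show ?case using alt_adj[OF Cons.prems, of us] Cons.IH[OF alt_slot[OF Cons.prems]] by simp
  qed
qed

lemma wedge_wedge: "wedge m v (wedge m v \<omega>) vs = 0"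
proof (induction vs arbitrary: \<omega>)
  case (Cons x vs)
  have "wedge m v (wedge m v \<omega>) (x # vs)
     = m v x *\<^sub>R wedge m v \<omega> vs - wedge m v (\<lambda>us. m v x *\<^sub>R \<omega> us - wedge m v (\<lambda>ws. \<omega> (x # ws)) us) vs"
    by simp
  also have "\<dots> = 0" using Cons by (simp add: wedge_diff wedge_scaleR)
  finally show ?case .
qed simp

lemma wedge_pullback:
  assumes "\<And>x. m (g v) (g x) = m v x"
  shows "wedge m (g v) \<omega> (map g vs) = wedge m v (\<lambda>us. \<omega> (map g us)) vs"
  by (induction vs arbitrary: \<omega>) (simp_all add: assms)

lemma wedge_vector_combine:
  assumes "bilinear m"
  shows "wedge m (a *\<^sub>R u + b *\<^sub>R v) \<omega> vs = a *\<^sub>R wedge m u \<omega> vs + b *\<^sub>R wedge m v \<omega> vs"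
  by (induction vs arbitrary: \<omega>)
    (simp_all add: bilinear_ladd[OF assms] bilinear_lmul[OF assms] algebra_simps)

text \<open>In the i-th term of the wedge product the sum over the basis reassembles the i-th
  argument, and moving it back to its place cancels the sign. The identity presents any form of
  positive degree through wedge products with forms of one degree less, which drives the inductions
  on the degree below.\<close>

lemma euler_identity:
  fixes m :: "'a::euclidean_space \<Rightarrow> 'a \<Rightarrow> real"
  assumes m: "inner_product_on m" and E: "orthonormal_basis m E" and f: "alt f"
  shows "(\<Sum>e\<in>E. wedge m e (\<lambda>us. f (e # us)) vs) = real (length vs) *\<^sub>R f vs"
proof -
  have "(\<Sum>e\<in>E. wedge m e (\<lambda>us. f (e # us)) vs)
    = (\<Sum>i<length vs. (-1) ^ i *\<^sub>R (\<Sum>e\<in>E. m (vs ! i) e *\<^sub>R f (e # take i vs @ drop (Suc i) vs)))"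
    unfolding wedge_eq_sum
    by (subst sum.swap) (intro sum.cong refl, simp add: scaleR_sum_right inner_product_onD(2)[OF m])
  also have "\<dots> = (\<Sum>i<length vs. (-1) ^ i *\<^sub>R f (vs ! i # take i vs @ drop (Suc i) vs))"
    unfolding alt_sum_hd[OF f, symmetric] orthonormal_basis_expand[OF m E, symmetric] ..
  also have "\<dots> = (\<Sum>i<length vs. f vs)"
  proof (rule sum.cong[OF refl])
    fix i assume i: "i \<in> {..<length vs}"
    have "f vs = f (take i vs @ vs ! i # drop (Suc i) vs)" using i by (simp add: id_take_nth_drop[symmetric])
    also have "\<dots> = (-1) ^ i *\<^sub>R f (vs ! i # take i vs @ drop (Suc i) vs)"
      using i by (subst alt_move_hd[OF f]) simp
    finally show "(-1) ^ i *\<^sub>R f (vs ! i # take i vs @ drop (Suc i) vs) = f vs" by simp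
  qed
  finally show ?thesis by (simp add: sum_constant_scaleR)
qed

section \<open>The star operator on alternating functions\<close>

definition tuples :: "'a set \<Rightarrow> nat \<Rightarrow> 'a list set" where
  "tuples E p = {us. set us \<subseteq> E \<and> length us = p}"

lemma finite_tuples: "finite E \<Longrightarrow> finite (tuples E p)"
  unfolding tuples_def by (rule finite_lists_length_eq)

lemma tuples_0: "tuples E 0 = {[]}"
  by (auto simp: tuples_def)

text \<open>Inserting an entry at position \<open>i\<close> is inverse to deleting the entry there
  and recording it.\<close>

lemma sum_tuples_insert:
  fixes F :: "'a list \<Rightarrow> 'b::comm_monoid_add"
  assumes "i \<le> p"
  shows "(\<Sum>us\<in>tuples E (Suc p). F us)
    = (\<Sum>us\<in>tuples E p. \<Sum>e\<in>E. F (take i us @ e # drop i us))"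
  unfolding sum.cartesian_product
proof (rule sum.reindex_bij_witness[where
      i = "\<lambda>(us, e). take i us @ e # drop i us" and
      j = "\<lambda>us. (take i us @ drop (Suc i) us, us ! i)"], goal_cases)
  case (1 a)
  then show ?case using assms by (simp add: tuples_def min_def id_take_nth_drop[symmetric])
next
  case (2 a)
  have "set (take i a) \<subseteq> E" "set (drop (Suc i) a) \<subseteq> E" "a ! i \<in> E"
    using 2 assms set_take_subset[of i a] set_drop_subset[of "Suc i" a] nth_mem[of i a]
    by (auto simp: tuples_def)
  then show ?case using 2 assms by (simp add: tuples_def min_def)
next
  case (3 b)
  then show ?case using assms by (auto simp: tuples_def min_def nth_append)
next
  case (4 b)
  then obtain us e where b: "b = (us, e)" "us \<in> tuples E p" "e \<in> E" by auto
  then show ?case using assms set_take_subset[of i us] set_drop_subset[of i us]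
    by (auto simp: tuples_def)
next
  case (5 a)
  then show ?case using assms by (simp add: tuples_def min_def id_take_nth_drop[symmetric])
qed

text \<open>Each of the \<open>Suc p\<close> positions contributes the same contraction; the
  resulting factor turns \<open>fact (Suc p)\<close> into \<open>fact p\<close> in the formulas for
  the star.\<close>

lemma sum_tuples_contract:
  fixes K :: "nat \<Rightarrow> 'a list \<Rightarrow> 'b::real_vector"
  assumes "\<And>i us. i \<le> p \<Longrightarrow> us \<in> tuples E p \<Longrightarrow> (\<Sum>e\<in>E. K i (take i us @ e # drop i us)) = R us"
  shows "(\<Sum>us\<in>tuples E (Suc p). \<Sum>i<Suc p. K i us) = real (Suc p) *\<^sub>R (\<Sum>us\<in>tuples E p. R us)"
proof -
  have "(\<Sum>us\<in>tuples E (Suc p). \<Sum>i<Suc p. K i us) = (\<Sum>i<Suc p. \<Sum>us\<in>tuples E (Suc p). K i us)"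
    by (rule sum.swap)
  also have "\<dots> = (\<Sum>i<Suc p. \<Sum>us\<in>tuples E p. R us)"
  proof (rule sum.cong[OF refl])
    fix i assume "i \<in> {..<Suc p}"
    then have "i \<le> p" by simp
    then show "(\<Sum>us\<in>tuples E (Suc p). K i us) = (\<Sum>us\<in>tuples E p. R us)"
      unfolding sum_tuples_insert[OF \<open>i \<le> p\<close>] using assms by (intro sum.cong) auto
  qed
  finally show ?thesis by (simp only: sum_constant_scaleR card_lessThan)
qed

text \<open>\<open>hodge_star\<close> picks its basis by \<open>SOME\<close>; here the basis is a
  parameter, and values may lie in any real vector space. For lists longer than the dimension the
  truncated subtraction leaves only the empty tuple, on which a volume form gives 0.\<close>

definition star ::
    "'a::euclidean_space set \<Rightarrow> ('a list \<Rightarrow> real) \<Rightarrow> ('a list \<Rightarrow> 'b::real_vector) \<Rightarrow> 'a list \<Rightarrow> 'b"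
  where "star E vol \<omega> ws = (\<Sum>us\<in>tuples E (DIM('a) - length ws).
    (vol (us @ ws) / fact (DIM('a) - length ws)) *\<^sub>R \<omega> us)"

lemma star_cong:
  fixes ws :: "'a::euclidean_space list"
  assumes "\<And>us. length us = DIM('a) - length ws \<Longrightarrow> \<omega> us = \<omega>' us"
  shows "star E vol \<omega> ws = star E vol \<omega>' ws"
  unfolding star_def by (intro sum.cong refl) (simp add: assms tuples_def)

lemma star_linear: "linear L \<Longrightarrow> star E vol (\<lambda>us. L (\<omega> us)) ws = L (star E vol \<omega> ws)"
  by (simp add: star_def linear_sum linear_scale)

lemma star_add: "star E vol (\<lambda>us. f us + g us) ws = star E vol f ws + star E vol g ws"
  and star_diff: "star E vol (\<lambda>us. f us - g us) ws = star E vol f ws - star E vol g ws"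
  and star_scaleR: "star E vol (\<lambda>us. c *\<^sub>R f us) ws = c *\<^sub>R star E vol f ws"
  and star_neg: "star E vol (\<lambda>us. - f us) ws = - star E vol f ws"
  and star_zero: "star E vol (\<lambda>us. 0) ws = 0"
  by (simp_all add: star_def sum.distrib sum_subtractf algebra_simps scaleR_sum_right sum_negf)

lemma star_sum: "star E vol (\<lambda>us. \<Sum>i\<in>I. f i us) ws = (\<Sum>i\<in>I. star E vol (f i) ws)"
  by (induction I rule: infinite_finite_induct) (simp_all add: star_zero star_add)

locale oriented_inner_product =
  fixes m :: "'a::euclidean_space \<Rightarrow> 'a \<Rightarrow> real" and vol :: "'a list \<Rightarrow> real" and E :: "'a set"
  assumes ip: "inner_product_on m" and volume: "volume_form m vol"
    and onb: "orthonormal_basis m E"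
begin

lemma finite_E: "finite E" and card_E: "card E = DIM('a)"
  using onb by (auto simp: orthonormal_basis_def)

lemma alt_vol: "alt vol" and vol_length: "length vs \<noteq> DIM('a) \<Longrightarrow> vol vs = 0"
  using volume by (auto simp: volume_form_def alternating_iff_alt)

lemma bilinear_m: "bilinear m" and m_commute: "m u v = m v u"
  using inner_product_onD[OF ip] by auto

lemmas m_simps = inner_product_onD(4-)[OF ip]
lemmas expand = orthonormal_basis_expand[OF ip onb]

lemma alt_star: "alt (star E vol \<omega>)"
  unfolding alt_def
proof (intro conjI allI)
  fix us vs and x :: 'a
  show "linear (\<lambda>v. star E vol \<omega> (us @ v # vs))"
    using alt_add[OF alt_vol, of "ts @ us" _ _ vs for ts] alt_scale[OF alt_vol, of "ts @ us" _ _ vs for ts]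
    by (intro linearI)
      (simp_all add: star_def add_divide_distrib scaleR_add_left sum.distrib scaleR_sum_right)
  show "star E vol \<omega> (us @ x # x # vs) = 0"
    using alt_adj[OF alt_vol, of "ts @ us" x vs for ts] by (simp add: star_def)
qed

lemma alt_wedge_m: "alt f \<Longrightarrow> alt (wedge m v f)"
  by (rule alt_wedge[OF bilinear_m])

lemma star_too_long:
  assumes "length ws > DIM('a)" shows "star E vol \<omega> ws = 0"
  using assms by (simp add: star_def tuples_0 vol_length)

text \<open>Moving the i-th basis vector to the front of \<open>vol\<close> absorbs the sign of the
  i-th wedge term; summation over the basis then reassembles \<open>v\<close> there. The sign left
  over comes from moving \<open>v\<close> behind the \<open>p\<close> remaining entries.\<close>

lemma star_wedge:
  assumes ws: "length ws < DIM('a)"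
  shows "star E vol (wedge m v \<omega>) ws = (-1) ^ (DIM('a) - length ws - 1) *\<^sub>R star E vol \<omega> (v # ws)"
proof -
  define p where "p = DIM('a) - length ws - 1"
  have p: "DIM('a) - length ws = Suc p" "DIM('a) - length (v # ws) = p" using ws by (auto simp: p_def)
  define K where "K = (\<lambda>i us. (vol (us @ ws) / fact (Suc p) * ((-1) ^ i * m v (us ! i))) *\<^sub>R
    \<omega> (take i us @ drop (Suc i) us))"
  have "star E vol (wedge m v \<omega>) ws = (\<Sum>us\<in>tuples E (Suc p). \<Sum>i<Suc p. K i us)"
    unfolding star_def p wedge_eq_sum K_def scaleR_sum_right
    by (intro sum.cong) (auto simp: tuples_def)
  also have "\<dots> = real (Suc p) *\<^sub>R (\<Sum>us\<in>tuples E p. (vol (v # us @ ws) / fact (Suc p)) *\<^sub>R \<omega> us)"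
  proof (rule sum_tuples_contract)
    fix i us assume i: "i \<le> p" and us: "us \<in> tuples E p"
    have "K i (take i us @ e # drop i us) = (m v e * vol (e # us @ ws) / fact (Suc p)) *\<^sub>R \<omega> us" for e
    proof -
      have "vol (take i us @ e # drop i us @ ws) = (-1) ^ i * vol (e # us @ ws)"
        using alt_move_hd[OF alt_vol, of "take i us" e "drop i us @ ws"] i us
        by (simp add: tuples_def min_def flip: append_assoc)
      then show ?thesis using i us by (simp add: K_def tuples_def nth_append min_def)
    qed
    then have "(\<Sum>e\<in>E. K i (take i us @ e # drop i us))
      = ((\<Sum>e\<in>E. m v e * vol (e # us @ ws)) / fact (Suc p)) *\<^sub>R \<omega> us"
      by (simp only: scaleR_sum_left sum_divide_distrib)
    also have "(\<Sum>e\<in>E. m v e * vol (e # us @ ws)) = vol (v # us @ ws)"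
      using alt_sum_hd[OF alt_vol, of "m v" "\<lambda>e. e" E "us @ ws"] expand[of v] by simp
    finally show "(\<Sum>e\<in>E. K i (take i us @ e # drop i us)) = (vol (v # us @ ws) / fact (Suc p)) *\<^sub>R \<omega> us" .
  qed
  also have "\<dots> = (\<Sum>us\<in>tuples E p. (vol (v # us @ ws) / fact p) *\<^sub>R \<omega> us)"
    by (simp add: scaleR_sum_right del: of_nat_Suc)
  also have "\<dots> = (-1) ^ p *\<^sub>R star E vol \<omega> (v # ws)"
    unfolding star_def p scaleR_sum_right
  proof (intro sum.cong refl)
    fix us assume "us \<in> tuples E p"
    then have "vol (us @ v # ws) = (-1) ^ p * vol (v # us @ ws)"
      using alt_move_hd[OF alt_vol, of us v ws] by (simp add: tuples_def)
    then show "(vol (v # us @ ws) / fact p) *\<^sub>R \<omega> us = (-1) ^ p *\<^sub>R (vol (us @ v # ws) / fact p) *\<^sub>R \<omega> us"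
      by simp
  qed
  finally show ?thesis by (simp add: p_def)
qed

lemma star_contract:
  assumes f: "alt f" and ws: "length ws \<le> DIM('a)"
  shows "star E vol (\<lambda>us. f (v # us)) ws = (-1) ^ (DIM('a) - length ws) *\<^sub>R wedge m v (star E vol f) ws"
proof (cases "ws = []")
  case True
  then show ?thesis
    by (simp add: star_def alt_exceeds_dim[OF f] tuples_def)
next
  case False
  define p where "p = DIM('a) - length ws"
  have len: "Suc (length us) = length ws \<Longrightarrow> DIM('a) - length us = Suc p" for us :: "'a list"
    using ws False by (cases ws) (auto simp: p_def)
  \<comment> \<open>A form of degree \<open>DIM('a) + 1\<close> vanishes; splitting this wedge
    product over \<open>us @ ws\<close> by \<open>wedge_append\<close> transfers the exterior
    multiplication from \<open>ws\<close> to \<open>us\<close>.\<close>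
  have vol0: "wedge m v vol (us @ ws) = 0" if "us \<in> tuples E (Suc p)" for us
    using that ws by (intro alt_exceeds_dim[OF alt_wedge_m[OF alt_vol]]) (auto simp: tuples_def p_def)
  define K where "K = (\<lambda>i us. ((-1) ^ p * ((-1) ^ i * m v (us ! i)) * vol (take i us @ drop (Suc i) us @ ws)
     / fact (Suc p)) *\<^sub>R f us)"
  have "wedge m v (star E vol f) ws
    = wedge m v (\<lambda>xs. \<Sum>us\<in>tuples E (Suc p). vol (us @ xs) *\<^sub>R (1 / fact (Suc p)) *\<^sub>R f us) ws"
    by (intro wedge_cong) (simp add: star_def len)
  also have "\<dots> = (\<Sum>us\<in>tuples E (Suc p). wedge m v (\<lambda>xs. vol (us @ xs)) ws *\<^sub>R (1 / fact (Suc p)) *\<^sub>R f us)"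
    by (simp only: wedge_sum wedge_scale_values)
  also have "\<dots> = (\<Sum>us\<in>tuples E (Suc p). \<Sum>i<Suc p. K i us)"
  proof (intro sum.cong refl)
    fix us assume us: "us \<in> tuples E (Suc p)"
    have "wedge m v (\<lambda>xs. vol (us @ xs)) ws = (-1) ^ p * wedge m v (\<lambda>xs. vol (xs @ ws)) us"
      using vol0[OF us] us unfolding wedge_append by (cases "even p") (simp_all add: tuples_def)
    also have "\<dots> = (\<Sum>i<Suc p. (-1) ^ p * ((-1) ^ i * m v (us ! i)) * vol (take i us @ drop (Suc i) us @ ws))"
      using us unfolding wedge_eq_sum by (simp add: tuples_def sum_distrib_left mult.assoc del: sum.lessThan_Suc)
    finally show "wedge m v (\<lambda>xs. vol (us @ xs)) ws *\<^sub>R (1 / fact (Suc p)) *\<^sub>R f us = (\<Sum>i<Suc p. K i us)"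
      unfolding K_def scaleR_sum_left[symmetric] sum_divide_distrib[symmetric] by simp
  qed
  also have "\<dots> = real (Suc p) *\<^sub>R (\<Sum>us\<in>tuples E p. ((-1) ^ p * vol (us @ ws) / fact (Suc p)) *\<^sub>R f (v # us))"
  proof (rule sum_tuples_contract)
    fix i us assume i: "i \<le> p" and us: "us \<in> tuples E p"
    have "K i (take i us @ e # drop i us)
      = ((-1) ^ p * vol (us @ ws) / fact (Suc p)) *\<^sub>R m v e *\<^sub>R f (e # us)" for e
    proof -
      have "f (take i us @ e # drop i us) = (-1) ^ i *\<^sub>R f (e # us)"
        using alt_move_hd[OF f, of "take i us" e "drop i us"] i us
        by (simp add: tuples_def min_def)
      then show ?thesis using i us
        by (simp add: K_def tuples_def nth_append min_def flip: append_assoc)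
    qed
    then have "(\<Sum>e\<in>E. K i (take i us @ e # drop i us))
      = ((-1) ^ p * vol (us @ ws) / fact (Suc p)) *\<^sub>R (\<Sum>e\<in>E. m v e *\<^sub>R f (e # us))"
      by (simp only: scaleR_sum_right)
    also have "(\<Sum>e\<in>E. m v e *\<^sub>R f (e # us)) = f (v # us)"
      using alt_sum_hd[OF f, of "m v" "\<lambda>e. e" E us] expand[of v] by simp
    finally show "(\<Sum>e\<in>E. K i (take i us @ e # drop i us))
      = ((-1) ^ p * vol (us @ ws) / fact (Suc p)) *\<^sub>R f (v # us)" .
  qed
  also have "\<dots> = (-1) ^ p *\<^sub>R star E vol (\<lambda>us. f (v # us)) ws"
    unfolding star_def p_def[symmetric] by (simp add: scaleR_sum_right del: of_nat_Suc)
  finally show ?thesis by (simp add: p_def[symmetric])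
qed

lemma star_const:
  assumes "length ws = DIM('a)" shows "star E vol \<omega> ws = vol ws *\<^sub>R \<omega> []"
  using assms by (simp add: star_def tuples_0)

text \<open>Only the orderings of \<open>E\<close> contribute, each with the square 1.\<close>

lemma sum_vol_squared: "(\<Sum>us\<in>tuples E (DIM('a)). vol us * vol us) = fact (DIM('a))"
proof -
  let ?D = "{us. length us = DIM('a) \<and> distinct us \<and> set us \<subseteq> E}"
  have fin: "finite ?D" using finite_tuples[OF finite_E, of "DIM('a)"] by (rule finite_subset[rotated]) (auto simp: tuples_def)
  have "vol us * vol us = 1" if "us \<in> ?D" for us
  proof -
    have "set us = E" using that card_subset_eq[of E "set us"] finite_E card_E by (simp add: distinct_card)
    then have "\<bar>vol us\<bar> = 1" using that volume onb by (auto simp: volume_form_def)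
    then show ?thesis by (auto simp: abs_if split: if_splits)
  qed
  then have "(\<Sum>us\<in>?D. vol us * vol us) = real (card ?D)" by simp
  also have "card ?D = fact (DIM('a))"
    using card_lists_distinct_length_eq[OF finite_E, of "DIM('a)"] card_E by (simp add: fact_prod)
  finally have "(\<Sum>us\<in>?D. vol us * vol us) = fact (DIM('a))" by simp
  moreover have "(\<Sum>us\<in>tuples E (DIM('a)). vol us * vol us) = (\<Sum>us\<in>?D. vol us * vol us)"
    using alt_not_distinct[OF alt_vol]
    by (intro sum.mono_neutral_right finite_tuples finite_E) (auto simp: tuples_def)
  ultimately show ?thesis by simp
qed

text \<open>\<open>star_wedge\<close> followed by \<open>star_contract\<close> returns to the wedge
  product; the two signs multiply to -1 to the power \<open>DIM('a) - 1\<close>, which is where odd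
  dimension enters.\<close>

lemma star_star_wedge:
  assumes odd: "odd DIM('a)"
  shows "star E vol (star E vol (wedge m v \<omega>)) ws = wedge m v (star E vol (star E vol \<omega>)) ws"
proof -
  consider "ws = []" | "0 < length ws" "length ws \<le> DIM('a)" | "DIM('a) < length ws" by fastforce
  then show ?thesis
  proof cases
    case 1
    have "star E vol (wedge m v \<omega>) us = 0" if "length us = DIM('a)" for us
      using that by (simp add: star_const)
    then show ?thesis using 1 star_cong[of "[]" "star E vol (wedge m v \<omega>)" "\<lambda>us. 0" E vol] by (simp add: star_zero)
  next
    case 2
    define p where "p = DIM('a) - length ws"
    have p: "p < DIM('a)" "length ws = DIM('a) - p" using 2 by (auto simp: p_def)
    have "star E vol (star E vol (wedge m v \<omega>)) ws
      = star E vol (\<lambda>us. (-1) ^ (DIM('a) - p - 1) *\<^sub>R star E vol \<omega> (v # us)) ws"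
    proof (intro star_cong)
      fix us :: "'a list" assume "length us = DIM('a) - length ws"
      then have "length us = p" by (simp add: p_def)
      then show "star E vol (wedge m v \<omega>) us = (-1) ^ (DIM('a) - p - 1) *\<^sub>R star E vol \<omega> (v # us)"
        using star_wedge[of us v \<omega>] p(1) by simp
    qed
    also have "\<dots> = ((-1) ^ (DIM('a) - p - 1) * (-1) ^ p) *\<^sub>R wedge m v (star E vol (star E vol \<omega>)) ws"
      unfolding star_scaleR star_contract[OF alt_star 2(2)] by (simp add: p_def)
    also have "(-1) ^ (DIM('a) - p - 1) * (-1) ^ p = (1 :: real)"
    proof -
      have "even (DIM('a) - p - 1 + p)" using p(1) odd by simp
      then show ?thesis unfolding power_add[symmetric] by simp
    qed
    finally show ?thesis by simp
  next
    case 3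
    then show ?thesis
      using alt_exceeds_dim[OF alt_wedge_m[OF alt_star]] by (simp add: star_too_long)
  qed
qed

text \<open>In degree 0 the claim is \<open>sum_vol_squared\<close>. Above it,
  \<open>euler_identity\<close> writes the form through wedge products with forms of lower degree,
  past which the double star moves by \<open>star_star_wedge\<close>.\<close>

lemma star_star:
  assumes odd: "odd DIM('a)" and f: "alt f"
  shows "star E vol (star E vol f) ws = f ws"
  using f
proof (induction "length ws" arbitrary: ws f)
  case 0
  have "star E vol (star E vol f) [] = (\<Sum>us\<in>tuples E (DIM('a)). (vol us * vol us / fact (DIM('a))) *\<^sub>R f [])"
    unfolding star_def[of E vol "star E vol f"] by (intro sum.cong) (simp_all add: tuples_def star_const)
  also have "\<dots> = f []"
    by (simp add: sum_vol_squared flip: scaleR_sum_left sum_divide_distrib)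
  finally show ?case using 0 by simp
next
  case (Suc n)
  show ?case
  proof (cases "length ws \<le> DIM('a)")
    case True
    have "real (length ws) *\<^sub>R star E vol (star E vol f) ws
      = star E vol (star E vol (\<lambda>us. real (length ws) *\<^sub>R f us)) ws"
      by (simp add: star_scaleR[abs_def])
    also have "\<dots> = star E vol (star E vol (\<lambda>us. \<Sum>e\<in>E. wedge m e (\<lambda>xs. f (e # xs)) us)) ws"
      using True by (intro star_cong) (simp add: euler_identity[OF ip onb Suc.prems])
    also have "\<dots> = (\<Sum>e\<in>E. wedge m e (star E vol (star E vol (\<lambda>xs. f (e # xs)))) ws)"
      by (simp add: star_sum[abs_def] star_star_wedge[OF odd])
    also have "\<dots> = (\<Sum>e\<in>E. wedge m e (\<lambda>xs. f (e # xs)) ws)"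
      using Suc.hyps alt_slot[OF Suc.prems] by (intro sum.cong refl wedge_cong) auto
    also have "\<dots> = real (length ws) *\<^sub>R f ws" by (rule euler_identity[OF ip onb Suc.prems])
    finally show ?thesis using Suc.hyps(2) by (metis nat.distinct(1) of_nat_eq_0_iff real_vector.scale_left_imp_eq)
  next
    case False
    then show ?thesis using alt_exceeds_dim[OF Suc.prems] by (simp add: star_too_long)
  qed
qed

text \<open>Needed because \<open>hodge_star\<close> fixes its basis by choice. At full length the
  value is \<open>vol ws *\<^sub>R f []\<close> for every basis; \<open>euler_identity\<close> and
  \<open>star_wedge\<close> reduce shorter lists to longer ones.\<close>

lemma star_basis_independent:
  assumes E': "orthonormal_basis m E'" and f: "alt f"
  shows "star E' vol f ws = star E vol f ws"
proof -
  interpret E': oriented_inner_product m vol E' by unfold_locales (use ip volume E' in auto)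
  show ?thesis
  proof (cases "length ws \<le> DIM('a)")
    case False
    then show ?thesis by (simp add: star_too_long E'.star_too_long)
  next
    case True
    then show ?thesis using f
    proof (induction "DIM('a) - length ws" arbitrary: ws f)
      case 0
      then show ?case by (simp add: star_const E'.star_const)
    next
      case (Suc n)
      have len: "length ws < DIM('a)" using Suc.hyps(2) by simp
      have split: "(\<Sum>e\<in>E. wedge m e (\<lambda>xs. f (e # xs)) us) = real (Suc n) *\<^sub>R f us"
        if "length us = DIM('a) - length ws" for us
        using that Suc.hyps(2) by (simp add: euler_identity[OF ip onb Suc.prems(2)])
      have "real (Suc n) *\<^sub>R star E' vol f ws
        = (\<Sum>e\<in>E. (-1) ^ (DIM('a) - length ws - 1) *\<^sub>R star E' vol (\<lambda>xs. f (e # xs)) (e # ws))"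
        using star_cong[where E = E' and vol = vol and ws = ws and \<omega> = "\<lambda>us. \<Sum>e\<in>E. wedge m e (\<lambda>xs. f (e # xs)) us"
          and \<omega>' = "\<lambda>us. real (Suc n) *\<^sub>R f us", OF split, symmetric]
        by (simp add: star_scaleR star_sum E'.star_wedge[OF len] del: of_nat_Suc)
      also have "\<dots> = (\<Sum>e\<in>E. (-1) ^ (DIM('a) - length ws - 1) *\<^sub>R star E vol (\<lambda>xs. f (e # xs)) (e # ws))"
      proof (intro sum.cong refl arg_cong2[where f = "(*\<^sub>R)"])
        fix e
        have "n = DIM('a) - length (e # ws)" using Suc.hyps(2) by simp
        then show "star E' vol (\<lambda>xs. f (e # xs)) (e # ws) = star E vol (\<lambda>xs. f (e # xs)) (e # ws)"
          using len by (intro Suc.hyps(1) alt_slot Suc.prems(2)) auto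
      qed
      also have "\<dots> = real (Suc n) *\<^sub>R star E vol f ws"
        using star_cong[where E = E and vol = vol and ws = ws and \<omega> = "\<lambda>us. \<Sum>e\<in>E. wedge m e (\<lambda>xs. f (e # xs)) us"
          and \<omega>' = "\<lambda>us. real (Suc n) *\<^sub>R f us", OF split]
        by (simp add: star_scaleR star_sum star_wedge[OF len] del: of_nat_Suc)
      finally show ?case by (simp del: of_nat_Suc)
    qed
  qed
qed

text \<open>The isometry \<open>g\<close> carries \<open>E\<close> to another orthonormal basis, so
  this is basis independence; \<delta> records whether \<open>g\<close> preserves the
  orientation.\<close>

lemma star_pullback:
  assumes g: "linear g" "\<And>u v. m (g u) (g v) = m u v" and d: "\<And>vs. vol (map g vs) = \<delta> * vol vs" "\<delta> * \<delta> = 1"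
    and f: "alt f"
  shows "star E vol (\<lambda>us. f (map g us)) ws = \<delta> *\<^sub>R star E vol f (map g ws)"
proof -
  have inj: "inj g"
  proof (rule linear_injective_0[OF g(1), THEN iffD2], intro allI impI)
    fix x assume "g x = 0"
    then have "m x x = 0" using g(2)[of x x] by (simp add: m_simps)
    then show "x = 0" using inner_product_onD(3)[OF ip, of x] by force
  qed
  have "card (g ` E) = card E" by (rule card_image) (rule inj_on_subset[OF inj subset_UNIV])
  then have onb': "orthonormal_basis m (g ` E)"
    using onb g(2) inj by (auto simp: orthonormal_basis_def inj_def)
  let ?p = "DIM('a) - length ws"
  have "star E vol (\<lambda>us. f (map g us)) ws
    = \<delta> *\<^sub>R (\<Sum>us\<in>tuples E ?p. (vol (map g us @ map g ws) / fact ?p) *\<^sub>R f (map g us))"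
    using d(1)[of "_ @ ws"] d(2) by (simp add: star_def scaleR_sum_right flip: mult.assoc)
  also have "(\<Sum>us\<in>tuples E ?p. (vol (map g us @ map g ws) / fact ?p) *\<^sub>R f (map g us))
    = (\<Sum>us\<in>map g ` tuples E ?p. (vol (us @ map g ws) / fact ?p) *\<^sub>R f us)"
    using inj by (subst sum.reindex) (auto simp: inj_on_def inj_map_eq_map)
  also have "map g ` tuples E ?p = tuples (g ` E) ?p"
  proof (intro equalityI subsetI)
    fix us assume "us \<in> tuples (g ` E) ?p"
    then have "us \<in> lists (g ` E)" "length us = ?p" by (auto simp: tuples_def)
    then show "us \<in> map g ` tuples E ?p" unfolding lists_image by (auto simp: tuples_def in_lists_conv_set)
  qed (auto simp: tuples_def subset_iff)
  also have "(\<Sum>us\<in>tuples (g ` E) ?p. (vol (us @ map g ws) / fact ?p) *\<^sub>R f us) = star (g ` E) vol f (map g ws)"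
    by (simp add: star_def)
  also have "\<dots> = star E vol f (map g ws)" by (rule star_basis_independent[OF onb' f])
  finally show ?thesis .
qed

end

section \<open>Clifford multiplication\<close>

text \<open>The symbol of the signature operator on even forms of a seven-dimensional space,
  collected into one formula; \<open>signature_operator_eq\<close> is the link. The value 0 on odd
  lists makes every result an even form.\<close>

definition clifford :: "('a::euclidean_space \<Rightarrow> 'a \<Rightarrow> real) \<Rightarrow> ('a list \<Rightarrow> real) \<Rightarrow> 'a set \<Rightarrow> 'a \<Rightarrow>
    ('a list \<Rightarrow> 'b::real_vector) \<Rightarrow> 'a list \<Rightarrow> 'b" where
  "clifford m vol E v \<psi> vs = (if even (length vs)
     then (-1) ^ (length vs div 2) *\<^sub>R star E vol (\<lambda>us. wedge m v \<psi> us - \<psi> (v # us)) vs else 0)"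

lemma clifford_linear:
  "linear L \<Longrightarrow> clifford m vol E v (\<lambda>us. L (\<psi> us)) vs = L (clifford m vol E v \<psi> vs)"
proof -
  assume L: "linear L"
  have "(\<lambda>us. wedge m v (\<lambda>us. L (\<psi> us)) us - L (\<psi> (v # us))) = (\<lambda>us. L (wedge m v \<psi> us - \<psi> (v # us)))"
    by (simp add: wedge_linear[OF L] linear_diff[OF L])
  then show ?thesis
    by (simp add: clifford_def star_linear[OF L] linear_scale[OF L] linear_0[OF L])
qed

lemma clifford_add:
    "clifford m vol E v (\<lambda>us. f us + g us) vs = clifford m vol E v f vs + clifford m vol E v g vs"
  and clifford_scaleR: "clifford m vol E v (\<lambda>us. c *\<^sub>R f us) vs = c *\<^sub>R clifford m vol E v f vs"
  and clifford_zero: "clifford m vol E v (\<lambda>us. 0) vs = 0"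
  by (simp_all add: clifford_def wedge_add wedge_scaleR wedge_zero star_add star_diff star_scaleR star_zero
      algebra_simps)

lemma clifford_sum:
  "clifford m vol E v (\<lambda>us. \<Sum>i\<in>I. f i us) vs = (\<Sum>i\<in>I. clifford m vol E v (f i) vs)"
  by (induction I rule: infinite_finite_induct) (simp_all add: clifford_zero clifford_add)

definition even_alt :: "('a::real_vector list \<Rightarrow> 'b::real_vector) \<Rightarrow> bool" where
  "even_alt f \<longleftrightarrow> alt f \<and> (\<forall>vs. odd (length vs) \<longrightarrow> f vs = 0)"

lemma even_alt_combine: "even_alt f \<Longrightarrow> even_alt g \<Longrightarrow> even_alt (\<lambda>vs. a *\<^sub>R f vs + b *\<^sub>R g vs)"
  by (simp add: even_alt_def alt_combine)

locale seven_space = oriented_inner_product m vol E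
  for m :: "'a::euclidean_space \<Rightarrow> 'a \<Rightarrow> real" and vol E +
  assumes dim7: "DIM('a) = 7"
begin

abbreviation C :: "'a \<Rightarrow> ('a list \<Rightarrow> 'b::real_vector) \<Rightarrow> 'a list \<Rightarrow> 'b" where "C \<equiv> clifford m vol E"

lemma clifford_vector_combine:
  assumes "alt \<psi>"
  shows "C (a *\<^sub>R u + b *\<^sub>R v) \<psi> vs = a *\<^sub>R C u \<psi> vs + b *\<^sub>R C v \<psi> vs"
  using alt_add[OF assms, of "[]"] alt_scale[OF assms, of "[]"]
  by (simp add: clifford_def wedge_vector_combine[OF bilinear_m] star_add star_diff star_scaleR algebra_simps)

lemma clifford_vector_sum:
  assumes "alt \<psi>"
  shows "C (\<Sum>i\<in>I. c i *\<^sub>R f i) \<psi> vs = (\<Sum>i\<in>I. c i *\<^sub>R C (f i) \<psi> vs)"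
proof (induction I rule: infinite_finite_induct)
  case (insert x F)
  then show ?case using clifford_vector_combine[OF assms, of "c x" "f x" 1] by simp
qed (use clifford_vector_combine[OF assms, of 0 0 0 0] in simp_all)

lemma even_alt_clifford: "alt \<psi> \<Longrightarrow> even_alt (C v \<psi>)"
proof -
  assume "alt \<psi>"
  have eq: "C v \<psi> vs = (if even (length vs) then (-1) ^ (length vs div 2) else 0) *\<^sub>R
    star E vol (\<lambda>us. wedge m v \<psi> us - \<psi> (v # us)) vs" for vs
    by (simp add: clifford_def)
  have "alt (C v \<psi>)"
    unfolding alt_def
  proof (intro conjI allI)
    show "linear (\<lambda>x. C v \<psi> (us @ x # vs))" for us vs
      unfolding eq length_append list.size by (intro linear_compose_scale_right alt_linear[OF alt_star])
  qed (simp add: eq alt_adj[OF alt_star])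
  then show ?thesis by (simp add: even_alt_def clifford_def)
qed

text \<open>Let \<open>K\<close> be exterior multiplication minus contraction. The two anticommute
  up to \<open>m v v\<close>, so \<open>K\<close> squares to the negative of that number. The sign
  in \<open>clifford\<close> is such that \<open>K\<close> passes the star at the cost of
  \<open>(-1) ^ t\<close>, which a second such sign cancels; then \<open>star_star\<close> removes
  the two stars.\<close>

lemma clifford_square:
  fixes \<psi> :: "'a list \<Rightarrow> 'b::real_vector"
  assumes \<psi>: "even_alt \<psi>"
  shows "C v (C v \<psi>) vs = - m v v *\<^sub>R \<psi> vs"
proof -
  have alt: "alt \<psi>" using \<psi> by (simp add: even_alt_def)
  let ?S = "star E vol"
  define K :: "('a list \<Rightarrow> 'b) \<Rightarrow> 'a list \<Rightarrow> 'b" where "K = (\<lambda>f us. wedge m v f us - f (v # us))"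
  have K_eq: "K f us = wedge m v f us - f (v # us)" for f us by (simp add: K_def)
  have aK: "alt (K f)" if "alt f" for f :: "'a list \<Rightarrow> 'b"
    using alt_combine[OF alt_wedge_m[OF that, of v] alt_slot[OF that, of v], of 1 "-1"] by (simp add: K_def[abs_def])
  have Ceq: "C v f us = (-1) ^ (length us div 2) *\<^sub>R ?S (K f) us" if "even (length us)" for f :: "'a list \<Rightarrow> 'b" and us
    using that by (simp add: clifford_def K_def)
  have KK: "K (K \<psi>) us = - m v v *\<^sub>R \<psi> us" for us
  proof -
    have "\<psi> (v # v # us) = 0" using alt_adj[OF alt, of "[]"] by simp
    then show ?thesis by (simp add: K_def wedge_diff wedge_wedge)
  qed
  consider "odd (length vs)" | "even (length vs)" "length vs \<le> 6" | "even (length vs)" "length vs > 7"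
    using dim7 by fastforce
  then show ?thesis
  proof cases
    case 1
    then show ?thesis using \<psi> by (simp add: clifford_def even_alt_def)
  next
    case 3
    then show ?thesis using alt_exceeds_dim[OF alt, of vs] by (simp add: clifford_def star_too_long dim7)
  next
    case 2
    define t where "t = length vs div 2"
    have t: "length vs = 2 * t" "t \<le> 3" using 2 by (auto simp: t_def)
    have "K (C v \<psi>) us = (-1) ^ t *\<^sub>R ?S (K (K \<psi>)) us" if us: "length us = 7 - length vs" for us
    proof -
      have u: "length us = 2 * (3 - t) + 1" using us t by linarith
      have e: "7 - length us = 2 * t" using u t by linarith
      have "wedge m v (C v \<psi>) us = wedge m v (\<lambda>ws. (-1) ^ (3 - t) *\<^sub>R ?S (K \<psi>) ws) us"
        using u by (intro wedge_cong) (simp add: Ceq)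
      also have "\<dots> = (-1) ^ (3 - t) *\<^sub>R ?S (\<lambda>us. K \<psi> (v # us)) us"
        using star_contract[OF aK[OF alt], of us v] u t dim7 e by (simp add: wedge_scaleR)
      finally have 1: "wedge m v (C v \<psi>) us = (-1) ^ (3 - t) *\<^sub>R ?S (\<lambda>us. K \<psi> (v # us)) us" .
      have "?S (wedge m v (K \<psi>)) us = (-1) ^ (2 * t - 1) *\<^sub>R ?S (K \<psi>) (v # us)" if "length us < 7"
        using star_wedge[of us v "K \<psi>"] that dim7 e by simp
      \<comment> \<open>At length 7 \<open>star_wedge\<close> does not apply, but a wedge product
        has no part of degree 0 and the star none of degree 8.\<close>
      moreover have "?S (wedge m v (K \<psi>)) us = 0 \<and> ?S (K \<psi>) (v # us) = 0" if "\<not> length us < 7"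
        using that dim7 u by (simp add: star_const star_too_long)
      ultimately have "?S (K \<psi>) (v # us) = - ?S (wedge m v (K \<psi>)) us"
        using e by (cases "length us < 7") (auto simp: minus_one_power_iff split: if_splits)
      moreover have "length (v # us) div 2 = Suc (3 - t)" using u by simp
      ultimately have 2: "C v \<psi> (v # us) = (-1) ^ (3 - t) *\<^sub>R ?S (wedge m v (K \<psi>)) us"
        using Ceq[of "v # us" \<psi>] u by simp
      have sg: "(-1) ^ (3 - t) = - ((-1) ^ t :: real)"
        using t(2) by (cases "even t") (auto simp: minus_one_power_iff)
      have 3: "?S (K (K \<psi>)) us = ?S (wedge m v (K \<psi>)) us - ?S (\<lambda>us. K \<psi> (v # us)) us"
        unfolding K_eq[of "K \<psi>", abs_def] by (rule star_diff)
      show ?thesis unfolding K_eq[of "C v \<psi>"] 1 2 3 sg by (simp add: algebra_simps)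
    qed
    then have "?S (K (C v \<psi>)) vs = ?S (\<lambda>us. (-1) ^ t *\<^sub>R ?S (K (K \<psi>)) us) vs"
      by (intro star_cong) (simp add: dim7)
    then have "C v (C v \<psi>) vs = ?S (?S (K (K \<psi>))) vs"
      using 2 by (simp add: Ceq star_scaleR t_def)
    also have "\<dots> = K (K \<psi>) vs" using aK[OF aK[OF alt]] by (intro star_star) (simp_all add: dim7)
    finally show ?thesis by (simp add: KK)
  qed
qed

text \<open>Polarisation: \<open>clifford_square\<close> is applied to \<open>u + v\<close>,
  \<open>u\<close> and \<open>v\<close>.\<close>

lemma clifford_anticommute:
  fixes \<psi> :: "'a list \<Rightarrow> 'b::real_vector"
  assumes \<psi>: "even_alt \<psi>"
  shows "C u (C v \<psi>) vs + C v (C u \<psi>) vs = - (2 * m u v) *\<^sub>R \<psi> vs"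
proof -
  have a: "alt \<psi>" using \<psi> by (simp add: even_alt_def)
  have aC: "alt (C w \<psi>)" for w using even_alt_clifford[OF a] by (simp add: even_alt_def)
  have "C (u + v) (C (u + v) \<psi>) vs = - m (u + v) (u + v) *\<^sub>R \<psi> vs" by (rule clifford_square[OF \<psi>])
  moreover have add: "C (u + v) f ws = C u f ws + C v f ws" if "alt f" for f :: "'a list \<Rightarrow> 'b" and ws
    using clifford_vector_combine[OF that, of 1 u 1 v] by simp
  have "C (u + v) (C (u + v) \<psi>) vs = C (u + v) (\<lambda>us. C u \<psi> us + C v \<psi> us) vs"
    by (rule arg_cong[where f = "\<lambda>f. C (u + v) f vs"]) (simp add: add[OF a] fun_eq_iff)
  then have "C (u + v) (C (u + v) \<psi>) vs = C u (C u \<psi>) vs + C v (C u \<psi>) vs + (C u (C v \<psi>) vs + C v (C v \<psi>) vs)"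
    by (simp add: clifford_add add[OF aC])
  ultimately have "C u (C u \<psi>) vs + C v (C u \<psi>) vs + (C u (C v \<psi>) vs + C v (C v \<psi>) vs)
      = - m (u + v) (u + v) *\<^sub>R \<psi> vs" by simp
  then show ?thesis
    unfolding clifford_square[OF \<psi>] by (simp add: m_simps m_commute[of v u] algebra_simps eq_neg_iff_add_eq_0)
qed

text \<open>Wedge product and contraction are natural under isometries, so the sign comes from
  \<open>star_pullback\<close> alone. With \<delta> = -1 and \<open>g v = v\<close>, pullback by
  \<open>g\<close> anticommutes with \<open>C v\<close>; this is the source of the conjugation of
  complex determinants.\<close>

lemma clifford_pullback:
  assumes g: "linear g" "\<And>u v. m (g u) (g v) = m u v"
    and d: "\<And>vs. vol (map g vs) = \<delta> * vol vs" "\<delta> * \<delta> = 1" and \<psi>: "alt \<psi>"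
  shows "C v (\<lambda>us. \<psi> (map g us)) vs = \<delta> *\<^sub>R C (g v) \<psi> (map g vs)"
proof -
  have a: "alt (\<lambda>us. wedge m (g v) \<psi> us - \<psi> (g v # us))"
    using alt_combine[OF alt_wedge_m[OF \<psi>, of "g v"] alt_slot[OF \<psi>, of "g v"], of 1 "-1"] by simp
  have "wedge m v (\<lambda>us. \<psi> (map g us)) us = wedge m (g v) \<psi> (map g us)" for us
    by (rule wedge_pullback[symmetric]) (rule g(2))
  then show ?thesis using star_pullback[OF g d a, of vs] by (simp add: clifford_def)
qed

end

section \<open>Smooth functions and forms\<close>

abbreviation fderiv :: "('a::euclidean_space \<Rightarrow> real) \<Rightarrow> 'a \<Rightarrow> 'a \<Rightarrow> real" where
  "fderiv f x v \<equiv> frechet_derivative f (at x) v"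

lemma smooth_functionD:
  assumes "smooth_function f"
  shows "f differentiable (at x)" "smooth_function (\<lambda>x. fderiv f x v)" "continuous_on UNIV f"
proof -
  have "Ck (Suc k) f" for k using assms by (simp add: smooth_function_def del: Ck.simps)
  then show "f differentiable (at x)" "smooth_function (\<lambda>x. fderiv f x v)"
    by (auto simp: smooth_function_def)
  show "continuous_on UNIV f" using assms by (metis Ck.simps(1) smooth_function_def)
qed

lemma smooth_function_has_derivative:
  "smooth_function f \<Longrightarrow> (f has_derivative fderiv f x) (at x)"
  using smooth_functionD(1) frechet_derivative_works by blast

lemma linear_fderiv: "smooth_function f \<Longrightarrow> linear (fderiv f x)"
  using smooth_functionD(1) linear_frechet_derivative by blast

lemma fderiv_combine:
  assumes "f differentiable (at x)" "g differentiable (at x)"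
  shows "fderiv (\<lambda>x. a * f x + b * g x) x v = a * fderiv f x v + b * fderiv g x v"
    and "(\<lambda>x. a * f x + b * g x) differentiable (at x)"
proof -
  have "((\<lambda>x. a * f x + b * g x) has_derivative (\<lambda>v. a * fderiv f x v + b * fderiv g x v)) (at x)"
    using assms by (auto intro!: derivative_eq_intros simp: frechet_derivative_works)
  from fun_cong[OF frechet_derivative_at[OF this]] differentiableI[OF this]
  show "fderiv (\<lambda>x. a * f x + b * g x) x v = a * fderiv f x v + b * fderiv g x v"
    "(\<lambda>x. a * f x + b * g x) differentiable (at x)" by simp_all
qed

lemma Ck_combine: "Ck k f \<Longrightarrow> Ck k g \<Longrightarrow> Ck k (\<lambda>x. a * f x + b * g x)"
proof (induction k arbitrary: f g)
  case 0 then show ?case by (auto intro!: continuous_intros)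
next
  case (Suc k)
  then show ?case by (simp add: fderiv_combine)
qed

lemma smooth_combine:
  "smooth_function f \<Longrightarrow> smooth_function g \<Longrightarrow> smooth_function (\<lambda>x. a * f x + b * g x)"
  by (simp add: smooth_function_def Ck_combine)

lemma Ck_zero: "Ck k (\<lambda>x. 0)"
  by (induction k) auto

lemma smooth_zero: "smooth_function (\<lambda>x. 0)"
  by (simp add: smooth_function_def Ck_zero)

lemma smooth_sum:
  assumes "\<And>i. i \<in> I \<Longrightarrow> smooth_function (f i)"
  shows "smooth_function (\<lambda>x. \<Sum>i\<in>I. c i * f i x)
    \<and> fderiv (\<lambda>x. \<Sum>i\<in>I. c i * f i x) x v = (\<Sum>i\<in>I. c i * fderiv (f i) x v)"
  using assms
proof (induction I rule: infinite_finite_induct)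
  case (insert j F)
  then have *: "smooth_function (f j)" "smooth_function (\<lambda>x. \<Sum>i\<in>F. c i * f i x)" by auto
  have "(\<lambda>x. \<Sum>i\<in>insert j F. c i * f i x) = (\<lambda>x. c j * f j x + 1 * (\<Sum>i\<in>F. c i * f i x))"
    using insert.hyps by simp
  then show ?case
    using insert smooth_combine[OF *, of "c j" 1]
      fderiv_combine(1)[OF smooth_functionD(1)[OF *(1), of x] smooth_functionD(1)[OF *(2), of x], of "c j" 1 v]
    by simp
qed (auto simp: smooth_zero)

lemma smooth_line_derivative:
  assumes "smooth_function f"
  shows "((\<lambda>t. f (x + t *\<^sub>R v)) has_real_derivative fderiv f (x + t *\<^sub>R v) v) (at t)"
proof -
  have "((\<lambda>t. x + t *\<^sub>R v) has_derivative (\<lambda>s. s *\<^sub>R v)) (at t)"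
    by (auto intro!: derivative_eq_intros)
  from has_derivative_compose[OF this smooth_function_has_derivative[OF assms]]
  have "((\<lambda>t. f (x + t *\<^sub>R v)) has_derivative (\<lambda>s. fderiv f (x + t *\<^sub>R v) (s *\<^sub>R v))) (at t)" .
  then show ?thesis
    by (simp add: has_field_derivative_def linear_scale[OF linear_fderiv[OF assms]] mult_commute_abs)
qed

text \<open>Both mixed derivatives are limits of the same second difference.\<close>

lemma mixed_derivatives_second_difference:
  assumes f: "smooth_function f" and s: "s > 0"
  obtains a b where "0 < a" "a < s" "0 < b" "b < s"
    "f (x + s *\<^sub>R u + s *\<^sub>R v) - f (x + s *\<^sub>R u) - f (x + s *\<^sub>R v) + f x
       = s * s * fderiv (\<lambda>y. fderiv f y u) (x + a *\<^sub>R u + b *\<^sub>R v) v"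
proof -
  have "\<exists>z>0. z < s \<and> (f (x + s *\<^sub>R v + s *\<^sub>R u) - f (x + s *\<^sub>R u)) - (f (x + s *\<^sub>R v + 0 *\<^sub>R u) - f (x + 0 *\<^sub>R u))
     = (s - 0) * (fderiv f (x + s *\<^sub>R v + z *\<^sub>R u) u - fderiv f (x + z *\<^sub>R u) u)"
    by (rule MVT2[OF s]) (intro DERIV_diff smooth_line_derivative[OF f])
  then obtain a where a: "0 < a" "a < s"
    "f (x + s *\<^sub>R v + s *\<^sub>R u) - f (x + s *\<^sub>R u) - f (x + s *\<^sub>R v) + f x
      = s * (fderiv f (x + s *\<^sub>R v + a *\<^sub>R u) u - fderiv f (x + a *\<^sub>R u) u)" by auto
  have "\<exists>z>0. z < s \<and> fderiv f ((x + a *\<^sub>R u) + s *\<^sub>R v) u - fderiv f ((x + a *\<^sub>R u) + 0 *\<^sub>R v) u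
     = (s - 0) * fderiv (\<lambda>y. fderiv f y u) ((x + a *\<^sub>R u) + z *\<^sub>R v) v"
    by (rule MVT2[OF s]) (rule smooth_line_derivative[OF smooth_functionD(2)[OF f]])
  then obtain b where "0 < b" "b < s" "fderiv f (x + a *\<^sub>R u + s *\<^sub>R v) u - fderiv f (x + a *\<^sub>R u) u
     = s * fderiv (\<lambda>y. fderiv f y u) (x + a *\<^sub>R u + b *\<^sub>R v) v" by auto
  with a show ?thesis by (intro that[of a b]) (simp_all add: algebra_simps)
qed

lemma mixed_derivatives_commute:
  assumes f: "smooth_function f"
  shows "fderiv (\<lambda>y. fderiv f y u) x v = fderiv (\<lambda>y. fderiv f y v) x u"
proof (rule ccontr)
  define h where "h = (\<lambda>u v x. fderiv (\<lambda>y. fderiv f y u) x v)"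
  assume "\<not> ?thesis"
  then have e: "0 < \<bar>h u v x - h v u x\<bar> / 2" by (simp add: h_def)
  have cont: "continuous_on UNIV (h u v)" for u v
    unfolding h_def by (intro smooth_functionD(2,3) f)
  have "\<exists>d>0. \<forall>y. dist y x < d \<longrightarrow> dist (h u v y) (h u v x) < \<bar>h u v x - h v u x\<bar> / 2"
    "\<exists>d>0. \<forall>y. dist y x < d \<longrightarrow> dist (h v u y) (h v u x) < \<bar>h u v x - h v u x\<bar> / 2"
    using cont e unfolding continuous_on_iff by blast+
  then obtain d1 d2 where d: "d1 > 0" "\<And>y. dist y x < d1 \<Longrightarrow> dist (h u v y) (h u v x) < \<bar>h u v x - h v u x\<bar> / 2"
    "d2 > 0" "\<And>y. dist y x < d2 \<Longrightarrow> dist (h v u y) (h v u x) < \<bar>h u v x - h v u x\<bar> / 2" by blast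
  \<comment> \<open>The intermediate points lie within \<open>s * (norm u + norm v)\<close> of
    \<open>x\<close>; the 1 excludes a zero denominator and makes the bound strict.\<close>
  define s where "s = min d1 d2 / (norm u + norm v + 1)"
  have n: "norm u + norm v + 1 > 0" using norm_ge_zero[of u] norm_ge_zero[of v] by linarith
  have s: "s > 0" using d n by (simp add: s_def)
  have close: "dist (x + a *\<^sub>R w + b *\<^sub>R w') x < min d1 d2"
    if "0 < a" "a < s" "0 < b" "b < s" "norm w + norm w' = norm u + norm v" for a b w w'
  proof -
    have "dist (x + a *\<^sub>R w + b *\<^sub>R w') x \<le> a * norm w + b * norm w'"
      using that norm_triangle_ineq[of "a *\<^sub>R w" "b *\<^sub>R w'"] by (simp add: dist_norm add.assoc)
    also have "\<dots> \<le> s * norm w + s * norm w'" using that by (intro add_mono mult_right_mono) auto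
    also have "\<dots> = s * (norm u + norm v)" using that by (metis distrib_left)
    also have "\<dots> < s * (norm u + norm v + 1)" using s by simp
    also have "\<dots> = min d1 d2" using n by (simp add: s_def)
    finally show ?thesis .
  qed
  obtain a b where ab: "0 < a" "a < s" "0 < b" "b < s"
    "f (x + s *\<^sub>R u + s *\<^sub>R v) - f (x + s *\<^sub>R u) - f (x + s *\<^sub>R v) + f x = s * s * h u v (x + a *\<^sub>R u + b *\<^sub>R v)"
    using mixed_derivatives_second_difference[OF f s, of x u v] unfolding h_def by blast
  obtain a' b' where ab': "0 < a'" "a' < s" "0 < b'" "b' < s"
    "f (x + s *\<^sub>R v + s *\<^sub>R u) - f (x + s *\<^sub>R v) - f (x + s *\<^sub>R u) + f x = s * s * h v u (x + a' *\<^sub>R v + b' *\<^sub>R u)"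
    using mixed_derivatives_second_difference[OF f s, of x v u] unfolding h_def by blast
  have sw: "x + s *\<^sub>R v + s *\<^sub>R u = x + s *\<^sub>R u + s *\<^sub>R v" by (simp add: algebra_simps)
  have "s * s * h u v (x + a *\<^sub>R u + b *\<^sub>R v) = s * s * h v u (x + a' *\<^sub>R v + b' *\<^sub>R u)"
    using ab(5) ab'(5)[unfolded sw] by linarith
  then have eq: "h u v (x + a *\<^sub>R u + b *\<^sub>R v) = h v u (x + a' *\<^sub>R v + b' *\<^sub>R u)" using s by simp
  define p where "p = h v u (x + a' *\<^sub>R v + b' *\<^sub>R u)"
  have "\<bar>p - h u v x\<bar> < \<bar>h u v x - h v u x\<bar> / 2"
    using close[OF ab(1-4), of u v] d(2)[of "x + a *\<^sub>R u + b *\<^sub>R v"] by (simp add: eq p_def dist_real_def)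
  moreover have "\<bar>p - h v u x\<bar> < \<bar>h u v x - h v u x\<bar> / 2"
    using close[OF ab'(1-4), of v u] d(4)[of "x + a' *\<^sub>R v + b' *\<^sub>R u"] by (simp add: p_def dist_real_def)
  ultimately have "\<bar>p - h u v x\<bar> + \<bar>p - h v u x\<bar> < \<bar>h u v x - h v u x\<bar>"
    using add_strict_mono by fastforce
  moreover have "\<bar>h u v x - h v u x\<bar> \<le> \<bar>p - h u v x\<bar> + \<bar>p - h v u x\<bar>" by linarith
  ultimately show False using not_le by blast
qed

section \<open>Directional derivatives and smooth forms\<close>

definition dirderiv :: "'a::euclidean_space \<Rightarrow> 'a form \<Rightarrow> 'a form" where
  "dirderiv v \<omega> = (\<lambda>x vs. fderiv (\<lambda>y. \<omega> y vs) x v)"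

definition smooth_form :: "'a::euclidean_space form \<Rightarrow> bool" where
  "smooth_form \<omega> \<longleftrightarrow> (\<forall>x. alt (\<omega> x)) \<and> (\<forall>vs. smooth_function (\<lambda>x. \<omega> x vs))"

lemma smooth_formD:
  assumes "smooth_form \<omega>" shows "alt (\<omega> x)" "smooth_function (\<lambda>x. \<omega> x vs)"
  using assms by (auto simp: smooth_form_def)

lemma smooth_form_combine:
  "smooth_form \<omega> \<Longrightarrow> smooth_form \<eta> \<Longrightarrow> smooth_form (\<lambda>x vs. a * \<omega> x vs + b * \<eta> x vs)"
  using alt_combine[of "\<omega> x" "\<eta> x" a b for x] by (simp add: smooth_form_def smooth_combine)

lemma dirderiv_combine:
  assumes "smooth_form \<omega>" "smooth_form \<eta>"
  shows "dirderiv v (\<lambda>x vs. a * \<omega> x vs + b * \<eta> x vs) = (\<lambda>x vs. a * dirderiv v \<omega> x vs + b * dirderiv v \<eta> x vs)"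
  using smooth_formD(2)[OF assms(1)] smooth_formD(2)[OF assms(2)]
  by (simp add: dirderiv_def fun_eq_iff fderiv_combine(1) smooth_functionD(1))

lemma alt_dirderiv:
  assumes "smooth_form \<omega>" shows "alt (dirderiv v \<omega> x)"
  unfolding alt_def
proof (intro conjI allI)
  note a = smooth_formD(1)[OF assms] and d = smooth_functionD(1)[OF smooth_formD(2)[OF assms]]
  show "linear (\<lambda>w. dirderiv v \<omega> x (us @ w # vs))" for us vs
  proof (rule linearI)
    fix w w' and c
    show "dirderiv v \<omega> x (us @ (w + w') # vs) = dirderiv v \<omega> x (us @ w # vs) + dirderiv v \<omega> x (us @ w' # vs)"
      using fderiv_combine(1)[OF d[of "us @ w # vs" x] d[of "us @ w' # vs" x], of 1 1]
      by (simp add: dirderiv_def alt_add[OF a])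
    show "dirderiv v \<omega> x (us @ (c *\<^sub>R w) # vs) = c *\<^sub>R dirderiv v \<omega> x (us @ w # vs)"
      using fderiv_combine(1)[OF d[of "us @ w # vs" x] d[of "us @ w # vs" x], of c 0]
      by (simp add: dirderiv_def alt_scale[OF a])
  qed
  show "dirderiv v \<omega> x (us @ w # w # vs) = 0" for us w vs
    by (simp add: dirderiv_def alt_adj[OF a])
qed

lemma smooth_form_dirderiv: "smooth_form \<omega> \<Longrightarrow> smooth_form (dirderiv v \<omega>)"
  using alt_dirderiv[of \<omega> v] smooth_functionD(2)[OF smooth_formD(2), of \<omega>]
  by (simp add: smooth_form_def dirderiv_def)

lemma dirderiv_commute: "smooth_form \<omega> \<Longrightarrow> dirderiv u (dirderiv v \<omega>) = dirderiv v (dirderiv u \<omega>)"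
  by (simp add: dirderiv_def fun_eq_iff mixed_derivatives_commute[OF smooth_formD(2)])

lemma linear_dirderiv: "smooth_form \<omega> \<Longrightarrow> linear (\<lambda>v. dirderiv v \<omega> x vs)"
  unfolding dirderiv_def by (rule linear_fderiv) (rule smooth_formD(2))

definition degree_component :: "nat \<Rightarrow> ('a list \<Rightarrow> 'b::real_vector) \<Rightarrow> 'a list \<Rightarrow> 'b" where
  "degree_component k f = (\<lambda>vs. if length vs = k then f vs else 0)"

lemma alt_degree_component: "alt f \<Longrightarrow> alt (degree_component k f)"
  unfolding alt_def degree_component_def
proof (intro conjI allI; elim conjE)
  fix us vs
  assume l: "\<forall>us vs. linear (\<lambda>v. f (us @ v # vs))"
  show "linear (\<lambda>v. if length (us @ v # vs) = k then f (us @ v # vs) else 0)"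
    by (cases "Suc (length us + length vs) = k") (simp_all add: l linear_zero)
qed simp

lemma smooth_form_degree_part: "smooth_form \<omega> \<Longrightarrow> smooth_form (degree_part k \<omega>)"
proof -
  assume \<omega>: "smooth_form \<omega>"
  have "degree_part k \<omega> x = degree_component k (\<omega> x)" for x
    by (simp add: degree_part_def degree_component_def)
  moreover have "smooth_function (\<lambda>x. degree_part k \<omega> x vs)" for vs
    using smooth_formD(2)[OF \<omega>] by (cases "length vs = k") (simp_all add: degree_part_def smooth_zero)
  ultimately show ?thesis
    using smooth_formD(1)[OF \<omega>] alt_degree_component by (metis smooth_form_def)
qed

lemma dirderiv_degree_part: "dirderiv v (degree_part k \<omega>) x = degree_component k (dirderiv v \<omega> x)"
  by (auto simp: dirderiv_def degree_part_def degree_component_def)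

section \<open>The signature operator in an orthonormal frame\<close>

context oriented_inner_product
begin

lemma exterior_derivative_eq:
  assumes \<omega>: "smooth_form \<omega>"
  shows "exterior_derivative \<omega> x vs = (\<Sum>e\<in>E. wedge m e (dirderiv e \<omega> x) vs)"
proof -
  have "(\<Sum>e\<in>E. wedge m e (dirderiv e \<omega> x) vs)
    = (\<Sum>i<length vs. (-1) ^ i * (\<Sum>e\<in>E. m (vs ! i) e * dirderiv e \<omega> x (take i vs @ drop (Suc i) vs)))"
    unfolding wedge_eq_sum
    by (subst sum.swap) (intro sum.cong refl, simp add: sum_distrib_left m_commute mult.assoc)
  also have "\<dots> = exterior_derivative \<omega> x vs"
    unfolding exterior_derivative_def
  proof (intro sum.cong refl arg_cong2[where f = "(*)"])
    fix i
    let ?ws = "take i vs @ drop (Suc i) vs"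
    have "dirderiv (vs ! i) \<omega> x ?ws = (\<Sum>e\<in>E. m (vs ! i) e * dirderiv e \<omega> x ?ws)"
      using linear_sum[OF linear_dirderiv[OF \<omega>, of x ?ws], of "\<lambda>e. m (vs ! i) e *\<^sub>R e" E]
      unfolding expand[of "vs ! i", symmetric] by (simp add: linear_scale[OF linear_dirderiv[OF \<omega>]])
    then show "(\<Sum>e\<in>E. m (vs ! i) e * dirderiv e \<omega> x ?ws) = fderiv (\<lambda>y. \<omega> y ?ws) x (vs ! i)"
      by (simp add: dirderiv_def)
  qed
  finally show ?thesis by simp
qed

lemma hodge_star_eq:
  assumes "alt (\<omega> x)"
  shows "hodge_star m vol \<omega> x ws = star E vol (\<omega> x) ws"
proof -
  have "orthonormal_basis m (SOME E. orthonormal_basis m E)"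
    using orthonormal_basis_exists[OF ip] by (rule someI_ex)
  then have "star (SOME E. orthonormal_basis m E) vol (\<omega> x) ws = star E vol (\<omega> x) ws"
    by (rule star_basis_independent) (rule assms)
  then show ?thesis
    by (simp add: hodge_star_def Let_def star_def tuples_def sum_divide_distrib mult.commute)
qed

lemma smooth_form_star:
  assumes \<omega>: "smooth_form \<omega>"
  shows "smooth_form (\<lambda>x. star E vol (\<omega> x))"
    and "dirderiv v (\<lambda>x. star E vol (\<omega> x)) x = star E vol (dirderiv v \<omega> x)"
proof -
  note s = smooth_sum[where f = "\<lambda>us x. \<omega> x us", OF smooth_formD(2)[OF \<omega>]]
  show "smooth_form (\<lambda>x. star E vol (\<omega> x))"
    unfolding smooth_form_def
  proof (intro conjI allI alt_star)
    show "smooth_function (\<lambda>x. star E vol (\<omega> x) vs)" for vs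
      unfolding star_def using s by (simp del: times_divide_eq_left)
  qed
  show "dirderiv v (\<lambda>x. star E vol (\<omega> x)) x = star E vol (dirderiv v \<omega> x)"
    unfolding dirderiv_def star_def using s by (simp add: fun_eq_iff del: times_divide_eq_left)
qed

lemma alt_sum_wedge: "(\<And>e. alt (f e)) \<Longrightarrow> alt (\<lambda>vs. \<Sum>e\<in>I. wedge m e (f e) vs)"
proof (induction I rule: infinite_finite_induct)
  case (insert x F)
  then show ?case using alt_combine[OF alt_wedge_m[of "f x" x], of _ 1 1] by simp
qed (simp_all add: alt_def linear_zero)

end

context seven_space
begin

text \<open>On a list of length q only two degrees contribute: 6 - q through the star of d, and 8 -
  q through d of the star. With n = 2 both receive the sign \<open>(-1) ^ (q div 2)\<close>, once
  the minus in front of the second term is included, and \<open>star_contract\<close> turns the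
  second into a contraction.\<close>

lemma clifford_degrees:
  fixes \<psi> :: "'a list \<Rightarrow> real"
  assumes \<psi>: "even_alt \<psi>"
  shows "(\<Sum>k\<le>7. (-1) ^ (2 + (k + 1) div 2 + 1) *
      ((if even k then 1 else -1) * star E vol (wedge m e (degree_component k \<psi>)) vs
        - wedge m e (star E vol (degree_component k \<psi>)) vs)) = C e \<psi> vs"
proof -
  have alt: "alt \<psi>" and ev: "\<And>vs. odd (length vs) \<Longrightarrow> \<psi> vs = 0" using \<psi> by (auto simp: even_alt_def)
  let ?q = "length vs"
  define A where "A = star E vol (wedge m e \<psi>) vs"
  define B where "B = wedge m e (star E vol \<psi>) vs"
  have w1: "star E vol (wedge m e (degree_component k \<psi>)) vs = (if ?q \<le> 6 \<and> k = 6 - ?q then A else 0)" for k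
  proof (cases "?q \<le> 6 \<and> k = 6 - ?q")
    case True
    then show ?thesis unfolding A_def
      by (auto intro!: star_cong wedge_cong simp: dim7 degree_component_def)
  next
    case False
    have "star E vol (wedge m e (degree_component k \<psi>)) vs = star E vol (\<lambda>us. 0) vs"
    proof (cases "?q \<le> 7")
      case True
      have "wedge m e (degree_component k \<psi>) us = 0" if "length us = 7 - ?q" for us
      proof (cases us)
        case (Cons a list)
        then have "wedge m e (degree_component k \<psi>) us = wedge m e (\<lambda>us. 0) us"
          using False that by (intro wedge_cong) (auto simp: degree_component_def)
        then show ?thesis by (simp add: wedge_zero)
      qed simp
      then show ?thesis by (intro star_cong) (simp add: dim7)
    qed (simp add: star_too_long dim7)
    then show ?thesis using False by (auto simp: star_zero)
  qed
  have w2: "wedge m e (star E vol (degree_component k \<psi>)) vs = (if ?q \<le> 8 \<and> k = 8 - ?q then B else 0)" for k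
  proof (cases "?q \<le> 8 \<and> k = 8 - ?q")
    case True
    have "star E vol (degree_component k \<psi>) us = star E vol \<psi> us" if "Suc (length us) = ?q" for us
      using True that by (intro star_cong) (auto simp: dim7 degree_component_def)
    then show ?thesis using True by (auto simp: B_def intro!: wedge_cong)
  next
    case False
    have "star E vol (degree_component k \<psi>) us = 0" if us: "Suc (length us) = ?q" for us
    proof (cases "?q \<le> 8")
      case True
      then have "star E vol (degree_component k \<psi>) us = star E vol (\<lambda>us. 0) us"
        using False us by (intro star_cong) (auto simp: dim7 degree_component_def)
      then show ?thesis by (simp add: star_zero)
    next
      case False
      then show ?thesis using us by (simp add: star_too_long dim7)
    qed
    then have "wedge m e (star E vol (degree_component k \<psi>)) vs = wedge m e (\<lambda>us. 0) vs"
      by (intro wedge_cong)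
    then show ?thesis using False by (auto simp: wedge_zero)
  qed
  have A0: "A = 0" if "odd ?q"
  proof -
    have "wedge m e \<psi> us = 0" if "length us = 7 - ?q" for us
    proof (cases us)
      case (Cons a list)
      then have "wedge m e \<psi> us = wedge m e (\<lambda>us. 0) us"
        using \<open>odd ?q\<close> that by (intro wedge_cong ev) (auto, presburger)
      then show ?thesis by (simp add: wedge_zero)
    qed simp
    then have "A = star E vol (\<lambda>us. 0) vs" unfolding A_def by (intro star_cong) (simp add: dim7)
    then show ?thesis by (simp add: star_zero)
  qed
  have B0: "B = 0" if "odd ?q" "?q \<le> 8"
  proof -
    have "star E vol \<psi> us = 0" if us: "Suc (length us) = ?q" for us
    proof -
      have "star E vol \<psi> us = star E vol (\<lambda>us. 0) us"
        using \<open>odd ?q\<close> \<open>?q \<le> 8\<close> us by (intro star_cong ev) (auto simp: dim7, presburger)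
      then show ?thesis by (simp add: star_zero)
    qed
    then have "B = wedge m e (\<lambda>us. 0) vs" unfolding B_def by (intro wedge_cong)
    then show ?thesis by (simp add: wedge_zero)
  qed
  have B1: "B = 0" if "?q \<ge> 8"
    unfolding B_def using that by (intro alt_exceeds_dim[OF alt_wedge_m[OF alt_star]]) (simp add: dim7)
  \<comment> \<open>For q = 0 the degree 8 lies outside the sum over k, while \<open>Cq\<close>
    still contains \<open>B\<close>.\<close>
  have B2: "B = 0" if "?q = 0" using that by (simp add: B_def)
  have Cq: "C e \<psi> vs = (-1) ^ (?q div 2) * (A + B)" if "even ?q" "?q \<le> 7"
    using that star_contract[OF alt, of vs e] star_diff[of E vol "wedge m e \<psi>" "\<lambda>us. \<psi> (e # us)" vs]
    by (simp add: clifford_def A_def B_def dim7)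
  have C0: "C e \<psi> vs = 0" if "odd ?q \<or> ?q > 7"
    using that by (auto simp: clifford_def star_too_long dim7)
  have se: "{..7 :: nat} = {0, 1, 2, 3, 4, 5, 6, 7}" by auto
  define q where "q = ?q"
  consider "odd q" | "q > 7" | "q = 0" | "q = 2" | "q = 4" | "q = 6"
  proof -
    have "odd q \<or> q > 7 \<or> q = 0 \<or> q = 2 \<or> q = 4 \<or> q = 6" by presburger
    then show ?thesis using that by blast
  qed
  then show ?thesis
  proof cases
    case 1
    then have "(if ?q \<le> 8 \<and> k = 8 - ?q then B else 0) = 0" for k using B0 by (auto simp: q_def)
    then show ?thesis unfolding w1 w2 using 1 A0 C0 by (simp add: q_def cong: if_cong)
  next
    case 2
    then have "B = 0" using B1 by (auto simp: q_def)
    then show ?thesis unfolding w1 w2 using 2 C0 by (simp add: q_def cong: if_cong)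
  next
    case 3
    then show ?thesis unfolding w1 w2 using Cq B2 by (simp add: q_def se)
  next
    case 4
    then show ?thesis unfolding w1 w2 using Cq by (simp add: q_def se)
  next
    case 5
    then show ?thesis unfolding w1 w2 using Cq by (simp add: q_def se)
  next
    case 6
    then show ?thesis unfolding w1 w2 using Cq by (simp add: q_def se)
  qed
qed

lemma even_alt_dirderiv: "smooth_form \<omega> \<Longrightarrow> even_form \<omega> \<Longrightarrow> even_alt (dirderiv v \<omega> x)"
  by (simp add: even_alt_def alt_dirderiv) (simp add: dirderiv_def even_form_def)

lemma signature_operator_eq:
  assumes \<omega>: "smooth_form \<omega>" and ev: "even_form \<omega>"
  shows "signature_operator m vol \<omega> x vs = (\<Sum>e\<in>E. C e (dirderiv e \<omega> x) vs)"
proof -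
  define \<phi> where "\<phi> = (\<lambda>k. degree_part k \<omega>)"
  have \<phi>: "degree_part k \<omega> = \<phi> k" for k by (simp add: \<phi>_def)
  have s\<phi>: "smooth_form (\<phi> k)" for k unfolding \<phi>_def by (rule smooth_form_degree_part[OF \<omega>])
  have ext: "exterior_derivative (\<phi> k) x = (\<lambda>vs. \<Sum>e\<in>E. wedge m e (degree_component k (dirderiv e \<omega> x)) vs)" for k x
    using exterior_derivative_eq[OF s\<phi>] by (simp add: \<phi>_def dirderiv_degree_part fun_eq_iff)
  have 1: "hodge_star m vol (exterior_derivative (\<phi> k)) x vs
    = (\<Sum>e\<in>E. star E vol (wedge m e (degree_component k (dirderiv e \<omega> x))) vs)" for k
  proof -
    have "alt (exterior_derivative (\<phi> k) x)"
      unfolding ext by (intro alt_sum_wedge alt_degree_component alt_dirderiv \<omega>)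
    from hodge_star_eq[where \<omega> = "exterior_derivative (\<phi> k)", OF this] show ?thesis
      unfolding ext star_sum by simp
  qed
  have 2: "exterior_derivative (hodge_star m vol (\<phi> k)) x vs
    = (\<Sum>e\<in>E. wedge m e (star E vol (degree_component k (dirderiv e \<omega> x))) vs)" for k
  proof -
    have "hodge_star m vol (\<phi> k) = (\<lambda>x. star E vol (\<phi> k x))"
      by (simp add: fun_eq_iff hodge_star_eq smooth_formD(1)[OF s\<phi>])
    then show ?thesis
      using exterior_derivative_eq[OF smooth_form_star(1)[OF s\<phi>]]
      by (simp add: smooth_form_star(2)[OF s\<phi>]) (simp add: \<phi>_def dirderiv_degree_part)
  qed
  have "signature_operator m vol \<omega> x vs = (\<Sum>k\<le>7. \<Sum>e\<in>E. (-1) ^ (2 + (k + 1) div 2 + 1) *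
      ((if even k then 1 else -1) * star E vol (wedge m e (degree_component k (dirderiv e \<omega> x))) vs
        - wedge m e (star E vol (degree_component k (dirderiv e \<omega> x))) vs))"
    unfolding signature_operator_def Let_def dim7 \<phi> 1 2
    by (intro sum.cong refl) (simp only: sum_distrib_left[symmetric] sum_subtractf, simp)
  also have "\<dots> = (\<Sum>e\<in>E. C e (dirderiv e \<omega> x) vs)"
    by (subst sum.swap) (simp only: clifford_degrees[OF even_alt_dirderiv[OF \<omega> ev]])
  finally show ?thesis .
qed

text \<open>The value of \<open>C v \<psi>\<close> at \<open>vs\<close> involves \<psi> only on
  tuples from \<open>E\<close> with one entry deleted or with \<open>v\<close> put in front. So
  Clifford multiplication is a finite sum with constant coefficients and commutes with directional
  derivatives and Fourier coefficients.\<close>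

definition clifford_support :: "'a \<Rightarrow> 'a list set" where
  "clifford_support v = {us. set us \<subseteq> insert v E \<and> length us \<le> 8}"

definition clifford_coeff :: "'a \<Rightarrow> 'a list \<Rightarrow> 'a list \<Rightarrow> real" where
  "clifford_coeff v vs us = C v (\<lambda>xs. if xs = us then 1 else 0) vs"

lemma finite_clifford_support: "finite (clifford_support v)"
  unfolding clifford_support_def by (rule finite_lists_length_le) (simp add: finite_E)

lemma clifford_local:
  assumes "\<And>us. us \<in> clifford_support v \<Longrightarrow> f us = g us"
  shows "C v f vs = C v g vs"
proof -
  have "wedge m v f us - f (v # us) = wedge m v g us - g (v # us)" if us: "us \<in> tuples E (7 - length vs)" for us
  proof -
    have "f (take i us @ drop (Suc i) us) = g (take i us @ drop (Suc i) us)" for i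
    proof (rule assms)
      show "take i us @ drop (Suc i) us \<in> clifford_support v"
        using us set_take_subset[of i us] set_drop_subset[of "Suc i" us]
        by (auto simp: clifford_support_def tuples_def)
    qed
    moreover have "f (v # us) = g (v # us)"
      using us by (intro assms) (auto simp: clifford_support_def tuples_def)
    ultimately show ?thesis by (simp add: wedge_eq_sum)
  qed
  then show ?thesis by (simp add: clifford_def star_def dim7)
qed

lemma clifford_expand:
  "C v \<psi> vs = (\<Sum>us\<in>clifford_support v. clifford_coeff v vs us *\<^sub>R \<psi> us)"
proof -
  have "C v \<psi> vs = C v (\<lambda>xs. \<Sum>us\<in>clifford_support v. (if xs = us then 1 else 0 :: real) *\<^sub>R \<psi> us) vs"
    by (rule clifford_local) (simp add: finite_clifford_support if_distrib[of "\<lambda>r. r *\<^sub>R _"] cong: if_cong)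
  also have "\<dots> = (\<Sum>us\<in>clifford_support v. C v (\<lambda>xs. (if xs = us then 1 else 0 :: real) *\<^sub>R \<psi> us) vs)"
    by (rule clifford_sum)
  also have "\<dots> = (\<Sum>us\<in>clifford_support v. clifford_coeff v vs us *\<^sub>R \<psi> us)"
  proof (rule sum.cong[OF refl])
    fix us
    have "linear (\<lambda>r::real. r *\<^sub>R \<psi> us)" by (rule linearI) (simp_all add: algebra_simps)
    from clifford_linear[OF this]
    show "C v (\<lambda>xs. (if xs = us then 1 else 0 :: real) *\<^sub>R \<psi> us) vs = clifford_coeff v vs us *\<^sub>R \<psi> us"
      unfolding clifford_coeff_def .
  qed
  finally show ?thesis .
qed

lemma smooth_form_clifford:
  assumes \<omega>: "smooth_form \<omega>"
  shows "smooth_form (\<lambda>x. C v (\<omega> x))" and "dirderiv u (\<lambda>x. C v (\<omega> x)) x = C v (dirderiv u \<omega> x)"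
    and "even_form (\<lambda>x. C v (\<omega> x))"
  using smooth_sum[where f = "\<lambda>us x. \<omega> x us", OF smooth_formD(2)[OF \<omega>]]
    even_alt_clifford[OF smooth_formD(1)[OF \<omega>]]
  by (auto simp: smooth_form_def dirderiv_def clifford_expand fun_eq_iff even_alt_def)
    (auto simp: even_form_def clifford_def)

end

no_notation vec_index (infixl "$" 100)
no_notation scalar_prod (infix "\<bullet>" 70)
no_notation fps_nth (infixl "$" 75)

section \<open>Fourier coefficients of periodic functions\<close>

definition unit_char :: "real \<Rightarrow> complex" where
  "unit_char t = cis (2 * pi * t)"

lemma unit_char_simps: "unit_char 0 = 1" "unit_char (s + t) = unit_char s * unit_char t"
  "norm (unit_char t) = 1" "unit_char t \<noteq> 0" "unit_char (- t) * unit_char t = 1"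
  by (simp_all add: unit_char_def cis_mult distrib_left)

lemma unit_char_int: "k \<in> \<int> \<Longrightarrow> unit_char k = 1"
  by (auto simp: unit_char_def cis_multiple_2pi elim!: Ints_cases)

lemma unit_char_diff_int: "k \<in> \<int> \<Longrightarrow> unit_char (t - k) = unit_char t" "k \<in> \<int> \<Longrightarrow> unit_char (- k - t) = unit_char (- t)"
  using unit_char_simps(2)[of t "- k"] unit_char_simps(2)[of "- k" "- t"] by (simp_all add: unit_char_int)

lemma continuous_unit_char: "continuous_on S g \<Longrightarrow> continuous_on S (\<lambda>x. unit_char (g x))"
  unfolding unit_char_def by (intro continuous_intros)

text \<open>Only the fractional part of the shift matters, and the part of the interval beyond 1 is
  moved back by one period.\<close>

lemma integral_periodic_shift:
  fixes F :: "real \<Rightarrow> complex"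
  assumes cont: "continuous_on UNIV F" and per: "\<And>t. F (t + 1) = F t"
  shows "integral {0..1} (\<lambda>t. F (s + t)) = integral {0..1} F"
proof -
  have int: "F integrable_on {a..b}" for a b
    using cont by (intro integrable_continuous_interval) (auto intro: continuous_on_subset)
  have shift: "integral {a..b} (\<lambda>t. F (c + t)) = integral {c + a..c + b} F" for a b c
    using integral_shift[of a c b F] continuous_on_subset[OF cont] by (simp add: o_def add.commute)
  have per_nat: "F (t + real n) = F t" for t n
  proof (induction n)
    case (Suc n)
    then show ?case using per[of "t + real n"] by (simp add: algebra_simps)
  qed simp
  have per_int: "F (of_int n + t) = F t" for t n
  proof (cases "n \<ge> 0")
    case True
    then show ?thesis using per_nat[of t "nat n"] by (simp add: add.commute)
  next
    case False
    then show ?thesis using per_nat[of "of_int n + t" "nat (- n)"] by simp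
  qed
  define r where "r = frac s"
  have r: "0 \<le> r" "r \<le> 1" using frac_ge_0 frac_lt_1[of s] by (auto simp: r_def)
  have "F (s + t) = F (r + t)" for t
    using per_int[of "\<lfloor>s\<rfloor>" "r + t"] by (simp add: r_def frac_def algebra_simps)
  then have "integral {0..1} (\<lambda>t. F (s + t)) = integral {r..r + 1} F" using shift[of 0 1 r] by simp
  also have "\<dots> = integral {r..1} F + integral {1..r + 1} F"
    using r int by (intro Henstock_Kurzweil_Integration.integral_combine[symmetric]) auto
  also have "integral {1..r + 1} F = integral {0..r} F"
    using shift[of 0 r 1] per by (simp add: add.commute)
  also have "integral {r..1} F + integral {0..r} F = integral {0..1} F"
    using r int Henstock_Kurzweil_Integration.integral_combine[of 0 r 1 F] by (simp add: add.commute)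
  finally show ?thesis .
qed

text \<open>The kernels \<open>((1 + cos (2 \<pi> t)) / 2) ^ N\<close> are trigonometric polynomials which concentrate at 0.\<close>

lemma fourier_complete_1d_at_0:
  fixes F :: "real \<Rightarrow> complex"
  assumes cont: "continuous_on UNIV F" and per: "\<And>t. F (t + 1) = F t"
    and zero: "\<And>k. k \<in> \<int> \<Longrightarrow> integral {0..1} (\<lambda>t. F t * unit_char (- k * t)) = 0"
  shows "F 0 = 0"
proof (rule ccontr)
  assume F0: "F 0 \<noteq> 0"
  define T where "T = (\<lambda>t. (1 + cos (2 * pi * t)) / 2)"
  have contT: "continuous_on S T" for S unfolding T_def by (intro continuous_intros) auto
  have contF: "continuous_on S F" for S using cont continuous_on_subset by blast
  have T_char: "complex_of_real (T t) * unit_char (- k * t) =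
      unit_char (- k * t) / 2 + unit_char (- (k + 1) * t) / 4 + unit_char (- (k - 1) * t) / 4" for t k
  proof -
    have "complex_of_real (T t) = 1 / 2 + unit_char t / 4 + unit_char (- t) / 4"
      by (simp add: T_def unit_char_def complex_eq_iff field_simps)
    moreover have "unit_char (- (k + 1) * t) = unit_char (- k * t) * unit_char (- t)"
      "unit_char (- (k - 1) * t) = unit_char (- k * t) * unit_char t"
      by (simp_all add: algebra_simps flip: unit_char_simps)
    ultimately show ?thesis by (simp only: ring_distribs) (simp add: mult.commute)
  qed
  \<comment> \<open>By \<open>T_char\<close> a factor \<open>T\<close> only mixes the coefficients
    at k, k + 1 and k - 1, so the vanishing of all coefficients passes on to
    \<open>T ^ N\<close>.\<close>
  have kernel: "integral {0..1} (\<lambda>t. F t * of_real (T t ^ N) * unit_char (- k * t)) = 0" if "k \<in> \<int>" for k N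
    using that
  proof (induction N arbitrary: k)
    case 0
    then show ?case using zero by simp
  next
    case (Suc N)
    have int: "(\<lambda>t. F t * of_real (T t ^ N) * unit_char (- k * t) / c) integrable_on {0..1}" for k c
      by (cases "c = 0") (auto intro!: integrable_continuous_interval continuous_intros contF contT continuous_unit_char)
    have "(\<lambda>t. F t * of_real (T t ^ Suc N) * unit_char (- k * t)) =
      (\<lambda>t. F t * of_real (T t ^ N) * unit_char (- k * t) / 2
        + F t * of_real (T t ^ N) * unit_char (- (k + 1) * t) / 4
        + F t * of_real (T t ^ N) * unit_char (- (k - 1) * t) / 4)"
    proof
      fix t
      have "F t * of_real (T t ^ Suc N) * unit_char (- k * t)
        = F t * of_real (T t ^ N) * (of_real (T t) * unit_char (- k * t))" by simp
      then show "F t * of_real (T t ^ Suc N) * unit_char (- k * t) =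
        F t * of_real (T t ^ N) * unit_char (- k * t) / 2
        + F t * of_real (T t ^ N) * unit_char (- (k + 1) * t) / 4
        + F t * of_real (T t ^ N) * unit_char (- (k - 1) * t) / 4"
        unfolding T_char by (simp add: algebra_simps)
    qed
    then show ?case
      using Suc.IH[of k] Suc.IH[of "k + 1"] Suc.IH[of "k - 1"] Suc.prems
      by (simp only: Henstock_Kurzweil_Integration.integral_add int integrable_add integral_divide Ints_add Ints_diff Ints_1) simp
  qed
  \<comment> \<open>\<open>u\<close> is real and \<open>u 0\<close> is the squared modulus of
    \<open>F 0\<close>, so it stays at least half of that near 0.\<close>
  define u where "u = (\<lambda>t. Re (F t * cnj (F 0)))"
  have contu: "continuous_on S u" for S unfolding u_def by (intro continuous_intros contF)
  define m where "m = u 0 / 2"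
  have m: "m > 0" using F0 by (simp add: m_def u_def complex_eq_iff sum_squares_gt_zero_iff)
  have perT: "T (t + 1) = T t" for t unfolding T_def using cos_periodic[of "2 * pi * t"] by (simp add: distrib_left)
  have uT: "integral {-1/2..1/2} (\<lambda>t. u t * T t ^ N) = 0" for N
  proof -
    have c: "continuous_on UNIV (\<lambda>t. F t * of_real (T t ^ N) * cnj (F 0))"
      by (intro continuous_intros contF contT)
    have "integral {0..1} (\<lambda>t. F t * of_real (T t ^ N) * cnj (F 0)) = 0"
      using kernel[of 0 N] by (simp add: unit_char_simps)
    then have "integral {0..1} (\<lambda>t. F (-1/2 + t) * of_real (T (-1/2 + t) ^ N) * cnj (F 0)) = 0"
      using integral_periodic_shift[OF c, of "-1/2"] per perT by force
    then have 0: "integral {-1/2..1/2} (\<lambda>t. F t * of_real (T t ^ N) * cnj (F 0)) = 0"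
      using integral_shift[of 0 "-1/2" 1 "\<lambda>t. F t * of_real (T t ^ N) * cnj (F 0)"] continuous_on_subset[OF c] F0
      by (simp add: o_def add.commute)
    have "((\<lambda>t. F t * of_real (T t ^ N) * cnj (F 0)) has_integral 0) {-1/2..1/2}"
      using integrable_integral[OF integrable_continuous_interval[OF continuous_on_subset[OF c]], of "-1/2" "1/2"] 0 by (simp only: subset_UNIV)
    from has_integral_linear[OF this bounded_linear_Re]
    have "((\<lambda>t. u t * T t ^ N) has_integral 0) {-1/2..1/2}"
      by (simp add: o_def u_def mult.assoc mult.commute mult.left_commute algebra_simps)
    then show ?thesis by (rule integral_unique)
  qed
  obtain d0 where d0: "d0 > 0" "\<And>t. \<bar>t\<bar> < d0 \<Longrightarrow> \<bar>u t - u 0\<bar> < m"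
    using contu[of UNIV] m unfolding continuous_on_iff dist_real_def by (metis UNIV_I diff_zero)
  define d where "d = min (d0 / 2) (1 / 4)"
  have d: "0 < d" "d < 1/2" "\<And>t. \<bar>t\<bar> \<le> d \<Longrightarrow> u t \<ge> m"
  proof -
    show "0 < d" "d < 1/2" using d0 by (auto simp: d_def)
    fix t assume "\<bar>t\<bar> \<le> d"
    then have "\<bar>t\<bar> < d0" using d0(1) by (auto simp: d_def)
    then have "\<bar>u t - 2 * m\<bar> < m" using d0(2) by (simp add: m_def)
    then show "u t \<ge> m" by linarith
  qed
  have "0 \<le> 1 + cos x" for x :: real using cos_ge_minus_one[of x] by linarith
  then have "0 \<le> (1 + cos x) / 2" for x :: real by simp
  then have T_nonneg: "0 \<le> T t" for t unfolding T_def .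
  have T_anti: "T t \<le> T s" if "\<bar>s\<bar> \<le> \<bar>t\<bar>" "\<bar>t\<bar> \<le> 1/2" for s t
  proof -
    have "cos (2 * pi * \<bar>t\<bar>) \<le> cos (2 * pi * \<bar>s\<bar>)"
      using that by (intro cos_monotone_0_pi_le) auto
    moreover have "cos (2 * pi * \<bar>r\<bar>) = cos (2 * pi * r)" for r :: real by (cases "r \<ge> 0") simp_all
    ultimately show ?thesis unfolding T_def by simp
  qed
  have T_strict: "T d < T (d / 2)"
  proof -
    have "cos (2 * pi * d) < cos (2 * pi * (d / 2))"
      using d by (intro cos_monotone_0_pi) (auto simp: field_simps)
    then show ?thesis by (simp add: T_def)
  qed
  have "bounded (u ` {-1/2..1/2})" using contu by (intro compact_imp_bounded compact_continuous_image) auto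
  then obtain M where "\<forall>y\<in>u ` {-1/2..1/2}. norm y \<le> M" unfolding bounded_iff by blast
  then have M: "\<bar>u t\<bar> \<le> M" if "t \<in> {-1/2..1/2}" for t using that by (metis imageI real_norm_def)
  have M0: "M \<ge> 0" using M[of 0] by simp
  \<comment> \<open>The constant added in \<open>w\<close> makes the integrand nonnegative
    everywhere, so its integral is at least the one over the middle interval, which has length
    \<open>d\<close>. As \<open>T d < T (d / 2)\<close>, letting \<open>N\<close> grow contradicts
    the inequality.\<close>
  have ineq: "d * m * T (d / 2) ^ N \<le> M * T d ^ N" for N
  proof -
    define w where "w = (\<lambda>t. u t * T t ^ N + M * T d ^ N)"
    have w: "continuous_on S w" for S unfolding w_def by (intro continuous_intros contu contT)
    have pos: "0 \<le> w t" if "t \<in> {-1/2..1/2}" for t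
    proof (cases "\<bar>t\<bar> \<le> d")
      case True
      then have "u t \<ge> 0" using d(3) m by force
      then show ?thesis unfolding w_def using T_nonneg M0 by simp
    next
      case False
      then have "T t ^ N \<le> T d ^ N" using that d by (intro power_mono T_anti T_nonneg) auto
      then have "\<bar>u t\<bar> * T t ^ N \<le> M * T d ^ N"
        using M[OF that] T_nonneg by (intro mult_mono) auto
      moreover have "- (\<bar>u t\<bar> * T t ^ N) \<le> u t * T t ^ N"
        using T_nonneg[of t] mult_right_mono[of "- \<bar>u t\<bar>" "u t" "T t ^ N"] by simp
      ultimately show ?thesis unfolding w_def by linarith
    qed
    have "d * (m * T (d / 2) ^ N) = integral {-(d/2)..d/2} (\<lambda>t. m * T (d / 2) ^ N)" using d by simp
    also have "\<dots> \<le> integral {-(d/2)..d/2} w"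
    proof (rule integral_le)
      fix t assume t: "t \<in> {-(d/2)..d/2}"
      have t1: "\<bar>t\<bar> \<le> d / 2" using t minus_le_iff[of t "d / 2"]
        by (simp only: abs_le_iff atLeastAtMost_iff)
      moreover have "d / 2 \<le> d" using d(1) by simp
      ultimately have t2: "m \<le> u t" by (intro d(3)) (rule order_trans)
      have "T (d / 2) \<le> T t" using t1 d by (intro T_anti) simp_all
      then have "m * T (d / 2) ^ N \<le> u t * T t ^ N"
        using t2 m T_nonneg by (intro mult_mono power_mono zero_le_power) simp_all
      then show "m * T (d / 2) ^ N \<le> w t" unfolding w_def using M0 T_nonneg[of d] by (simp add: add_increasing2)
    qed (auto intro!: integrable_continuous_interval w continuous_intros)
    also have "\<dots> \<le> integral {-1/2..1/2} w"
      using d pos by (intro integral_subset_le integrable_continuous_interval w) auto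
    also have "\<dots> = integral {-1/2..1/2} (\<lambda>t. u t * T t ^ N) + integral {-1/2..1/2} (\<lambda>t::real. M * T d ^ N)"
      unfolding w_def
      by (intro Henstock_Kurzweil_Integration.integral_add integrable_continuous_interval continuous_intros contu contT)
    also have "\<dots> = M * T d ^ N" unfolding uT by simp
    finally show ?thesis by (simp add: mult.assoc)
  qed
  have pos2: "0 < T (d / 2)" using T_strict T_nonneg[of d] by linarith
  define q where "q = T d / T (d / 2)"
  have q: "0 \<le> q" "q < 1" using T_strict T_nonneg[of d] pos2 by (auto simp: q_def)
  have "d * m \<le> M * q ^ N" for N
    using ineq[of N] pos2 by (simp add: q_def power_divide field_simps)
  moreover have "(\<lambda>N. M * q ^ N) \<longlonglongrightarrow> M * 0" using q by (intro tendsto_intros LIMSEQ_power_zero) auto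
  ultimately have "d * m \<le> 0" by (metis LIMSEQ_le_const mult_zero_right)
  then show False using d(1) m by (simp add: mult_le_0_iff)
qed

lemma fourier_complete_1d:
  fixes F :: "real \<Rightarrow> complex"
  assumes cont: "continuous_on UNIV F" and per: "\<And>t. F (t + 1) = F t"
    and zero: "\<And>k. k \<in> \<int> \<Longrightarrow> integral {0..1} (\<lambda>t. F t * unit_char (- k * t)) = 0"
  shows "F s = 0"
proof -
  have "F (s + 0) = 0"
  proof (rule fourier_complete_1d_at_0[where F = "\<lambda>t. F (s + t)"])
    show "continuous_on UNIV (\<lambda>t. F (s + t))"
      by (intro continuous_on_compose2[OF cont] continuous_intros) auto
    show "F (s + (t + 1)) = F (s + t)" for t using per[of "s + t"] by (simp add: add.assoc)
    fix k :: real assume k: "k \<in> \<int>"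
    have "integral {0..1} (\<lambda>t. F (s + t) * unit_char (- k * (s + t))) = integral {0..1} (\<lambda>t. F t * unit_char (- k * t))"
    proof (rule integral_periodic_shift)
      show "continuous_on UNIV (\<lambda>t. F t * unit_char (- k * t))"
        by (intro continuous_intros cont continuous_unit_char)
      show "F (t + 1) * unit_char (- k * (t + 1)) = F t * unit_char (- k * t)" for t
        using k by (simp add: per distrib_left unit_char_diff_int)
    qed
    moreover have "unit_char (- k * (s + t)) = unit_char (- k * t) * unit_char (- k * s)" for t
      by (simp add: algebra_simps flip: unit_char_simps(2))
    ultimately have "0 = integral {0..1} (\<lambda>t. F (s + t) * unit_char (- k * t) * unit_char (- k * s))"
      using zero[OF k] by (simp only: mult.assoc)
    then show "integral {0..1} (\<lambda>t. F (s + t) * unit_char (- k * t)) = 0"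
      by (simp add: unit_char_simps)
  qed
  then show ?thesis by simp
qed

section \<open>Fourier coefficients of functions on the torus\<close>

definition directional_mean :: "'a::real_normed_vector \<Rightarrow> real \<Rightarrow> ('a \<Rightarrow> complex) \<Rightarrow> 'a \<Rightarrow> complex" where
  "directional_mean b k f = (\<lambda>x. integral {0..1} (\<lambda>t. f (x + t *\<^sub>R b) * unit_char (- k * t)))"

lemma continuous_line_integrand:
  fixes f :: "'a::real_normed_vector \<Rightarrow> complex"
  assumes "continuous_on UNIV f" "continuous_on S g" "continuous_on S h"
  shows "continuous_on S (\<lambda>z. f (g z) * unit_char (h z))"
  by (intro continuous_intros continuous_unit_char continuous_on_compose2[OF assms(1)] assms(2,3)) auto

lemma continuous_directional_mean:
  assumes f: "continuous_on UNIV f"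
  shows "continuous_on UNIV (directional_mean b k f)"
proof -
  have "continuous_on (UNIV \<times> cbox 0 1) (\<lambda>(x, t). f (x + t *\<^sub>R b) * unit_char (- k * t))"
    unfolding case_prod_beta by (intro continuous_line_integrand f continuous_intros)
  from integral_continuous_on_param[OF this] show ?thesis by (simp add: directional_mean_def)
qed

lemma integrable_directional_mean:
  fixes f :: "'a::real_normed_vector \<Rightarrow> complex"
  shows
  "continuous_on UNIV f \<Longrightarrow> (\<lambda>t. f (x + t *\<^sub>R b) * unit_char (- k * t)) integrable_on {0..1}"
proof -
  assume f: "continuous_on UNIV f"
  have "continuous_on {0..1} (\<lambda>t. f (x + t *\<^sub>R b))"
  proof (rule continuous_on_compose2[OF f])
    show "continuous_on {0..1} (\<lambda>t. x + t *\<^sub>R b)" by (intro continuous_intros)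
  qed simp
  then show ?thesis
    by (intro integrable_continuous_interval continuous_on_mult continuous_unit_char continuous_intros)
qed

lemma directional_mean_combine:
  assumes "continuous_on UNIV f" "continuous_on UNIV g"
  shows "directional_mean b k (\<lambda>x. \<alpha> * f x + \<beta> * g x)
    = (\<lambda>x. \<alpha> * directional_mean b k f x + \<beta> * directional_mean b k g x)"
proof
  fix x
  note i = integrable_directional_mean[OF assms(1), of x b k] integrable_directional_mean[OF assms(2), of x b k]
  have "integral {0..1} (\<lambda>t. \<alpha> * (f (x + t *\<^sub>R b) * unit_char (- k * t)) + \<beta> * (g (x + t *\<^sub>R b) * unit_char (- k * t)))
    = \<alpha> * directional_mean b k f x + \<beta> * directional_mean b k g x"
    unfolding directional_mean_def using i
    by (subst Henstock_Kurzweil_Integration.integral_add) (auto intro!: integrable_on_mult_right)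
  then show "directional_mean b k (\<lambda>x. \<alpha> * f x + \<beta> * g x) x
    = \<alpha> * directional_mean b k f x + \<beta> * directional_mean b k g x"
    by (simp add: directional_mean_def distrib_right mult.assoc)
qed

lemma directional_mean_quasiperiodic:
  assumes f: "continuous_on UNIV f" and per: "\<And>x. f (x + b) = f x" and k: "k \<in> \<int>"
  shows "directional_mean b k f (x + s *\<^sub>R b) = unit_char (k * s) * directional_mean b k f x"
proof -
  define F where "F = (\<lambda>t. f (x + t *\<^sub>R b) * unit_char (- k * t))"
  have "integral {0..1} (\<lambda>t. F (s + t)) = integral {0..1} F"
  proof (rule integral_periodic_shift)
    show "continuous_on UNIV F" unfolding F_def by (intro continuous_line_integrand f continuous_intros)
    show "F (t + 1) = F t" for t
      using k per[of "x + t *\<^sub>R b"] by (simp add: F_def algebra_simps unit_char_diff_int)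
  qed
  moreover have "F (s + t) = unit_char (- k * s) * (f (x + s *\<^sub>R b + t *\<^sub>R b) * unit_char (- k * t))" for t
    using unit_char_simps(2)[of "- (k * s)" "- (k * t)"]
    by (simp add: F_def scaleR_add_left distrib_left add.assoc)
  ultimately have "unit_char (- k * s) * directional_mean b k f (x + s *\<^sub>R b) = directional_mean b k f x"
    by (simp add: directional_mean_def F_def)
  moreover have "unit_char (k * s) * unit_char (- k * s) = 1"
    using unit_char_simps(5)[of "k * s"] by (simp add: mult.commute)
  ultimately show ?thesis by (metis mult.assoc mult_1)
qed

lemma directional_mean_shift:
  "(\<And>x. f (x + c) = \<alpha> * f x) \<Longrightarrow> directional_mean b k f (x + c) = \<alpha> * directional_mean b k f x"
proof -
  assume f: "\<And>x. f (x + c) = \<alpha> * f x"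
  have "f (x + c + t *\<^sub>R b) = \<alpha> * f (x + t *\<^sub>R b)" for t using f[of "x + t *\<^sub>R b"] by (simp add: algebra_simps)
  then show ?thesis by (simp add: directional_mean_def mult.assoc)
qed

definition line_derivative :: "('a::real_normed_vector \<Rightarrow> complex) \<Rightarrow> 'a \<Rightarrow> ('a \<Rightarrow> complex) \<Rightarrow> bool" where
  "line_derivative f v g \<longleftrightarrow> (\<forall>x t. ((\<lambda>s. f (x + s *\<^sub>R v)) has_vector_derivative g (x + t *\<^sub>R v)) (at t))"

text \<open>Differentiation under the integral sign, for which \<open>line_derivative\<close>
  demands the derivative along whole lines.\<close>

lemma line_derivative_directional_mean:
  assumes f: "continuous_on UNIV f" and g: "continuous_on UNIV g" and d: "line_derivative f v g"
  shows "line_derivative (directional_mean b k f) v (directional_mean b k g)"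
  unfolding line_derivative_def
proof (intro allI)
  fix x t0
  have "((\<lambda>s. integral (cbox 0 1) (\<lambda>t. f (x + s *\<^sub>R v + t *\<^sub>R b) * unit_char (- k * t))) has_vector_derivative
     integral (cbox 0 1) (\<lambda>t. g (x + t0 *\<^sub>R v + t *\<^sub>R b) * unit_char (- k * t))) (at t0 within UNIV)"
  proof (rule leibniz_rule_vector_derivative)
    fix s t :: real
    have "((\<lambda>s. f ((x + t *\<^sub>R b) + s *\<^sub>R v)) has_vector_derivative g ((x + t *\<^sub>R b) + s *\<^sub>R v)) (at s)"
      using d unfolding line_derivative_def by blast
    from has_vector_derivative_mult_left[OF this, of "unit_char (- k * t)"]
    show "((\<lambda>s. f (x + s *\<^sub>R v + t *\<^sub>R b) * unit_char (- k * t)) has_vector_derivative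
        g (x + s *\<^sub>R v + t *\<^sub>R b) * unit_char (- k * t)) (at s within UNIV)"
      by (simp add: algebra_simps)
    show "(\<lambda>t. f (x + s *\<^sub>R v + t *\<^sub>R b) * unit_char (- k * t)) integrable_on cbox 0 1"
      using integrable_directional_mean[OF f] by simp
  next
    show "continuous_on (UNIV \<times> cbox 0 1) (\<lambda>(s, t). g (x + s *\<^sub>R v + t *\<^sub>R b) * unit_char (- k * t))"
      unfolding case_prod_beta by (intro continuous_line_integrand g continuous_intros)
  qed auto
  then show "((\<lambda>s. directional_mean b k f (x + s *\<^sub>R v)) has_vector_derivative
      directional_mean b k g (x + t0 *\<^sub>R v)) (at t0)"
    by (simp add: directional_mean_def)
qed

lemma directional_mean_nonzero:
  assumes f: "continuous_on UNIV f" and per: "\<And>x. f (x + b) = f x" and nz: "f x \<noteq> 0"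
  shows "\<exists>k\<in>\<int>. directional_mean b k f x \<noteq> 0"
proof (rule ccontr)
  assume "\<not> ?thesis"
  then have z: "\<And>k. k \<in> \<int> \<Longrightarrow> integral {0..1} (\<lambda>t. f (x + t *\<^sub>R b) * unit_char (- k * t)) = 0"
    by (auto simp: directional_mean_def)
  have "f (x + 0 *\<^sub>R b) = 0"
  proof (rule fourier_complete_1d[where F = "\<lambda>t. f (x + t *\<^sub>R b)", OF _ _ z])
    show "continuous_on UNIV (\<lambda>t. f (x + t *\<^sub>R b))"
      by (intro continuous_on_compose2[OF f] continuous_intros) auto
    show "f (x + (t + 1) *\<^sub>R b) = f (x + t *\<^sub>R b)" for t
      using per[of "x + t *\<^sub>R b"] by (simp add: algebra_simps)
  qed
  then show False using nz by simp
qed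

text \<open>One-dimensional integrals taken in turn over the basis directions replace the integral
  over a cube, so that each property follows from its one-dimensional case by induction on
  \<open>bs\<close>.\<close>

definition iterated_mean :: "'a::euclidean_space list \<Rightarrow> 'a \<Rightarrow> ('a \<Rightarrow> complex) \<Rightarrow> 'a \<Rightarrow> complex" where
  "iterated_mean bs \<xi> f = foldr (\<lambda>b. directional_mean b (\<xi> \<bullet> b)) bs f"

lemma iterated_mean_simps:
  "iterated_mean [] \<xi> f = f"
  "iterated_mean (b # bs) \<xi> f = directional_mean b (\<xi> \<bullet> b) (iterated_mean bs \<xi> f)"
  by (simp_all add: iterated_mean_def)

lemma continuous_iterated_mean: "continuous_on UNIV f \<Longrightarrow> continuous_on UNIV (iterated_mean bs \<xi> f)"
  by (induction bs) (simp_all add: iterated_mean_simps continuous_directional_mean)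

lemma iterated_mean_combine:
  assumes "continuous_on UNIV f" "continuous_on UNIV g"
  shows "iterated_mean bs \<xi> (\<lambda>x. \<alpha> * f x + \<beta> * g x)
    = (\<lambda>x. \<alpha> * iterated_mean bs \<xi> f x + \<beta> * iterated_mean bs \<xi> g x)"
  by (induction bs)
    (simp_all add: iterated_mean_simps directional_mean_combine continuous_iterated_mean assms)

lemma iterated_mean_shift:
  "(\<And>x. f (x + c) = \<alpha> * f x) \<Longrightarrow> iterated_mean bs \<xi> f (x + c) = \<alpha> * iterated_mean bs \<xi> f x"
  by (induction bs arbitrary: x) (simp_all add: iterated_mean_simps directional_mean_shift)

lemma line_derivative_iterated_mean:
  assumes "continuous_on UNIV f" "continuous_on UNIV g" "line_derivative f v g"
  shows "line_derivative (iterated_mean bs \<xi> f) v (iterated_mean bs \<xi> g)"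
  by (induction bs)
    (simp_all add: iterated_mean_simps line_derivative_directional_mean continuous_iterated_mean assms)

lemma iterated_mean_quasiperiodic:
  assumes f: "continuous_on UNIV f" and per: "\<And>b x. b \<in> set bs \<Longrightarrow> f (x + b) = f x"
    and \<xi>: "\<And>b. b \<in> set bs \<Longrightarrow> \<xi> \<bullet> b \<in> \<int>" and b: "b \<in> set bs"
  shows "iterated_mean bs \<xi> f (x + s *\<^sub>R b) = unit_char ((\<xi> \<bullet> b) * s) * iterated_mean bs \<xi> f x"
  using per \<xi> b
proof (induction bs arbitrary: x)
  case (Cons c bs)
  show ?case
  proof (cases "b = c")
    case True
    have "iterated_mean bs \<xi> f (x + c) = iterated_mean bs \<xi> f x" for x
      using iterated_mean_shift[of f c 1] Cons.prems(1)[of c] by simp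
    then show ?thesis using True Cons.prems(2)[of c]
      by (simp add: iterated_mean_simps directional_mean_quasiperiodic continuous_iterated_mean[OF f])
  next
    case False
    then have "iterated_mean bs \<xi> f (x + s *\<^sub>R b) = unit_char ((\<xi> \<bullet> b) * s) * iterated_mean bs \<xi> f x" for x
      using Cons.prems by (intro Cons.IH) auto
    then show ?thesis unfolding iterated_mean_simps by (rule directional_mean_shift)
  qed
qed simp

lemma iterated_mean_nonzero:
  assumes f: "continuous_on UNIV f" and per: "\<And>b x. b \<in> set bs \<Longrightarrow> f (x + b) = f x"
    and bs: "distinct bs" "set bs \<subseteq> Basis" and nz: "f x \<noteq> 0"
  shows "\<exists>\<xi>. (\<forall>b\<in>Basis. \<xi> \<bullet> b \<in> \<int>) \<and> iterated_mean bs \<xi> f x \<noteq> 0"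
  using per bs
proof (induction bs)
  case Nil
  then show ?case using nz by (intro exI[of _ 0]) (simp add: iterated_mean_simps)
next
  case (Cons b bs)
  then obtain \<xi> where \<xi>: "\<forall>b\<in>Basis. \<xi> \<bullet> b \<in> \<int>" "iterated_mean bs \<xi> f x \<noteq> 0" by auto
  have "iterated_mean bs \<xi> f (x + b) = iterated_mean bs \<xi> f x" for x
    using iterated_mean_shift[of f b 1] Cons.prems(1)[of b] by simp
  then obtain k where k: "k \<in> \<int>" "directional_mean b k (iterated_mean bs \<xi> f) x \<noteq> 0"
    using directional_mean_nonzero[OF continuous_iterated_mean[OF f] _ \<xi>(2)] by blast
  \<comment> \<open>Only the component of \<xi> along \<open>b\<close> changes, so the means already
    taken in the other directions are unaffected.\<close>
  define \<xi>' where "\<xi>' = \<xi> + (k - \<xi> \<bullet> b) *\<^sub>R b"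
  have b: "b \<in> Basis" using Cons.prems by simp
  have in1: "\<xi>' \<bullet> c = \<xi> \<bullet> c" if "c \<in> Basis" "c \<noteq> b" for c
    using that b by (simp add: \<xi>'_def inner_add_left inner_not_same_Basis)
  have in2: "\<xi>' \<bullet> b = k" using b by (simp add: \<xi>'_def inner_add_left inner_same_Basis)
  have "iterated_mean cs \<xi>' f = iterated_mean cs \<xi> f" if "set cs \<subseteq> Basis - {b}" for cs
    using that by (induction cs) (auto simp: iterated_mean_simps in1)
  then have "iterated_mean bs \<xi>' f = iterated_mean bs \<xi> f" using Cons.prems by auto
  then have "iterated_mean (b # bs) \<xi>' f x \<noteq> 0" using k in2 by (simp add: iterated_mean_simps)
  moreover have "\<forall>c\<in>Basis. \<xi>' \<bullet> c \<in> \<int>" using in1 in2 k(1) \<xi>(1) by metis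
  ultimately show ?case by blast
qed

text \<open>Frequencies are paired with the standard basis, whose integer span is the lattice of the
  torus; the flat metric enters only later, through \<open>qform\<close>.\<close>

definition dual_lattice :: "'a::euclidean_space set" where
  "dual_lattice = {\<xi>. \<forall>b\<in>Basis. \<xi> \<bullet> b \<in> \<int>}"

definition basis_list :: "'a::euclidean_space list" where
  "basis_list = (SOME bs. distinct bs \<and> set bs = Basis)"

lemma basis_list: "distinct (basis_list :: 'a::euclidean_space list)" "set (basis_list :: 'a list) = Basis"
proof -
  have "\<exists>bs :: 'a list. distinct bs \<and> set bs = Basis" using finite_distinct_list[OF finite_Basis] by blast
  from someI_ex[OF this] show "distinct (basis_list :: 'a list)" "set (basis_list :: 'a list) = Basis"
    by (auto simp: basis_list_def)
qed

text \<open>The iterated mean of a periodic function is a multiple of the character of \<xi> by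
  \<open>iterated_mean_char\<close>, so its value at 0 loses nothing.\<close>

definition fourier :: "'a::euclidean_space \<Rightarrow> ('a \<Rightarrow> complex) \<Rightarrow> complex" where
  "fourier \<xi> f = iterated_mean basis_list \<xi> f 0"

lemma fourier_combine:
  "continuous_on UNIV f \<Longrightarrow> continuous_on UNIV g \<Longrightarrow>
    fourier \<xi> (\<lambda>x. \<alpha> * f x + \<beta> * g x) = \<alpha> * fourier \<xi> f + \<beta> * fourier \<xi> g"
  by (simp add: fourier_def iterated_mean_combine)

lemma fourier_sum:
  assumes "\<And>i. i \<in> I \<Longrightarrow> continuous_on UNIV (f i)"
  shows "fourier \<xi> (\<lambda>x. \<Sum>i\<in>I. c i * f i x) = (\<Sum>i\<in>I. c i * fourier \<xi> (f i))"
  using assms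
proof (induction I rule: infinite_finite_induct)
  case (insert j F)
  then show ?case
    using fourier_combine[of "f j" "\<lambda>x. \<Sum>i\<in>F. c i * f i x" \<xi> "c j" 1]
    by (simp add: continuous_intros)
qed (use fourier_combine[of "\<lambda>x. 0" "\<lambda>x. 0" \<xi> 0 0] in simp_all)

lemma iterated_mean_char:
  assumes f: "continuous_on UNIV f" and per: "\<And>b x. b \<in> Basis \<Longrightarrow> f (x + b) = f x" and \<xi>: "\<xi> \<in> dual_lattice"
  shows "iterated_mean basis_list \<xi> f x = unit_char (\<xi> \<bullet> x) * fourier \<xi> f"
proof -
  have q: "iterated_mean basis_list \<xi> f (y + s *\<^sub>R b) = unit_char ((\<xi> \<bullet> b) * s) * iterated_mean basis_list \<xi> f y"
    if "b \<in> Basis" for y s b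
    using per \<xi> that by (intro iterated_mean_quasiperiodic[OF f]) (auto simp: basis_list dual_lattice_def)
  have "iterated_mean basis_list \<xi> f (\<Sum>b\<in>A. (x \<bullet> b) *\<^sub>R b) = unit_char (\<Sum>b\<in>A. (\<xi> \<bullet> b) * (x \<bullet> b)) * fourier \<xi> f"
    if "finite A" "A \<subseteq> Basis" for A
    using that
  proof (induction A)
    case empty then show ?case by (simp add: fourier_def unit_char_simps)
  next
    case (insert b A)
    then show ?case
      using q[of b "\<Sum>b\<in>A. (x \<bullet> b) *\<^sub>R b" "x \<bullet> b"] by (simp add: add.commute unit_char_simps(2))
  qed
  from this[OF finite_Basis subset_refl] show ?thesis by (simp add: euclidean_representation euclidean_inner[symmetric])
qed

lemma fourier_complete:
  assumes f: "continuous_on UNIV f" and per: "\<And>b x. b \<in> Basis \<Longrightarrow> f (x + b) = f x" and nz: "f x \<noteq> 0"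
  shows "\<exists>\<xi>\<in>dual_lattice. fourier \<xi> f \<noteq> 0"
  using iterated_mean_nonzero[of f basis_list, OF f per _ _ nz] iterated_mean_char[OF f per]
  by (fastforce simp: basis_list dual_lattice_def)

text \<open>Averaging turns \<open>f\<close> and \<open>g\<close> into multiples of the same
  character. The factor comes from differentiating that character along \<open>v\<close> and from
  the uniqueness of derivatives, without integration by parts.\<close>

lemma fourier_derivative:
  assumes f: "continuous_on UNIV f" and g: "continuous_on UNIV g" and d: "line_derivative f v g"
    and per: "\<And>b x. b \<in> Basis \<Longrightarrow> f (x + b) = f x" and \<xi>: "\<xi> \<in> dual_lattice"
  shows "fourier \<xi> g = \<i> * of_real (2 * pi * (\<xi> \<bullet> v)) * fourier \<xi> f"
proof -
  have "((\<lambda>s. iterated_mean basis_list \<xi> f (0 + s *\<^sub>R v)) has_vector_derivative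
      iterated_mean basis_list \<xi> g (0 + 0 *\<^sub>R v)) (at 0)"
    using line_derivative_iterated_mean[OF f g d, of basis_list \<xi>] unfolding line_derivative_def by blast
  then have 1: "((\<lambda>s. unit_char (s * (\<xi> \<bullet> v)) * fourier \<xi> f) has_vector_derivative fourier \<xi> g) (at 0)"
    by (simp add: iterated_mean_char[OF f per \<xi>] fourier_def[of \<xi> g])
  have "((\<lambda>s. exp (of_real s * (\<i> * of_real (2 * pi * (\<xi> \<bullet> v)))) * fourier \<xi> f)
      has_vector_derivative \<i> * of_real (2 * pi * (\<xi> \<bullet> v)) * fourier \<xi> f) (at 0)"
    by (rule has_vector_derivative_real_field) (auto intro!: derivative_eq_intros)
  moreover have "exp (of_real s * (\<i> * of_real (2 * pi * (\<xi> \<bullet> v)))) = unit_char (s * (\<xi> \<bullet> v))" for s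
    by (simp add: unit_char_def cis_conv_exp mult_ac)
  ultimately show ?thesis using vector_derivative_unique_at[OF 1] by simp
qed

section \<open>Analytic continuation of Dirichlet series with periodic coefficients\<close>

definition binomial_remainder :: "nat \<Rightarrow> complex \<Rightarrow> complex \<Rightarrow> complex" where
  "binomial_remainder M w z = (1 + z) powr w - (\<Sum>j<M. (w gchoose j) * z ^ j)"

lemma binomial_remainder_derivative:
  assumes "1 + z \<notin> \<real>\<^sub>\<le>\<^sub>0"
  shows "(binomial_remainder (Suc M) w has_field_derivative w * binomial_remainder M (w - 1) z) (at z)"
proof -
  have "((\<lambda>z. (1 + z) powr w - (1 + (\<Sum>j<M. (w gchoose Suc j) * z ^ Suc j))) has_field_derivative
     w * (1 + z) powr (w - 1) - (\<Sum>j<M. (w gchoose Suc j) * (of_nat (Suc j) * z ^ j))) (at z)"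
    using assms by (auto intro!: derivative_eq_intros sum.cong simp del: power_Suc of_nat_Suc)
  also have "(\<lambda>z. (1 + z) powr w - (1 + (\<Sum>j<M. (w gchoose Suc j) * z ^ Suc j))) = binomial_remainder (Suc M) w"
    unfolding binomial_remainder_def sum.lessThan_Suc_shift by simp
  also have "(\<Sum>j<M. (w gchoose Suc j) * (of_nat (Suc j) * z ^ j)) = w * (\<Sum>j<M. ((w - 1) gchoose j) * z ^ j)"
    unfolding sum_distrib_left
  proof (rule sum.cong[OF refl])
    fix j
    have "(w gchoose Suc j) * (of_nat (Suc j) * z ^ j) = (of_nat (Suc j) * (w gchoose Suc j)) * z ^ j"
      by (simp only: mult_ac)
    then show "(w gchoose Suc j) * (of_nat (Suc j) * z ^ j) = w * (((w - 1) gchoose j) * z ^ j)"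
      by (simp only: gbinomial_absorption mult.assoc)
  qed
  finally show ?thesis by (simp only: binomial_remainder_def[of M] right_diff_distrib)
qed

text \<open>Induction on \<open>M\<close> through \<open>binomial_remainder_derivative\<close>,
  which lowers the exponent \<open>w\<close> by 1 and so costs 1 in the radius \<open>K\<close>. A
  constant independent of \<open>w\<close> is what locally uniform convergence in s
  requires.\<close>

lemma binomial_remainder_bound:
  "\<exists>C\<ge>0. \<forall>w x. norm w \<le> K \<longrightarrow> 0 \<le> x \<longrightarrow> x \<le> 1 \<longrightarrow>
    norm (binomial_remainder M w (of_real x)) \<le> C * x ^ M"
proof (induction M arbitrary: K)
  case 0
  show ?case
  proof (intro exI[of _ "2 powr K"] conjI allI impI)
    fix w :: complex and x :: real assume w: "norm w \<le> K" and x: "0 \<le> x" "x \<le> 1"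
    have "norm ((1 + complex_of_real x) powr w) = norm (complex_of_real (1 + x) powr w)" by simp
    also have "\<dots> = (1 + x) powr Re w" using x by (subst norm_powr_real_powr) auto
    also have "\<dots> \<le> (1 + x) powr K" using x w abs_Re_le_cmod[of w] by (intro powr_mono) auto
    also have "\<dots> \<le> 2 powr K" using x order_trans[OF norm_ge_zero w] by (intro powr_mono2) auto
    finally show "norm (binomial_remainder 0 w (of_real x)) \<le> 2 powr K * x ^ 0"
      by (simp add: binomial_remainder_def)
  qed simp
next
  case (Suc M)
  obtain C where C: "C \<ge> 0" "\<And>w x. norm w \<le> K + 1 \<Longrightarrow> 0 \<le> x \<Longrightarrow> x \<le> 1 \<Longrightarrow>
    norm (binomial_remainder M w (of_real x)) \<le> C * x ^ M" using Suc.IH[of "K + 1"] by blast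
  show ?case
  proof (intro exI[of _ "\<bar>K\<bar> * C"] conjI allI impI)
    fix w :: complex and x :: real assume w: "norm w \<le> K" and x: "0 \<le> x" "x \<le> 1"
    have K: "K \<ge> 0" using w norm_ge_zero[of w] by linarith
    have "norm (binomial_remainder (Suc M) w (of_real x) - binomial_remainder (Suc M) w 0)
      \<le> (K * (C * x ^ M)) * norm (of_real x - 0 :: complex)"
    proof (rule field_differentiable_bound[OF convex_closed_segment[of 0 "of_real x"]])
      fix z assume "z \<in> closed_segment 0 (complex_of_real x)"
      then obtain u where u: "0 \<le> u" "u \<le> 1" "z = of_real (u * x)" by (auto simp: in_segment scaleR_conv_of_real)
      have ux: "0 \<le> u * x" "u * x \<le> x" using u x by (auto intro: mult_left_le_one_le)
      have "0 < Re (1 + z)" using ux u by simp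
      then have "1 + z \<notin> \<real>\<^sub>\<le>\<^sub>0" by (auto simp: complex_nonpos_Reals_iff)
      then show "(binomial_remainder (Suc M) w has_field_derivative w * binomial_remainder M (w - 1) z)
          (at z within closed_segment 0 (of_real x))"
        by (rule has_field_derivative_at_within[OF binomial_remainder_derivative])
      have w1: "norm (w - 1) \<le> K + 1"
        using w norm_triangle_ineq4[of w 1] unfolding norm_one by linarith
      have "norm (binomial_remainder M (w - 1) z) \<le> C * (u * x) ^ M"
        unfolding u(3) by (rule C(2)[OF w1 ux(1) order_trans[OF ux(2) x(2)]])
      also have "\<dots> \<le> C * x ^ M" using ux C(1) by (intro mult_left_mono power_mono) auto
      finally show "norm (w * binomial_remainder M (w - 1) z) \<le> K * (C * x ^ M)"
        unfolding norm_mult using w K C(1) x by (intro mult_mono) auto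
    qed auto
    moreover have "binomial_remainder (Suc M) w 0 = 0"
      unfolding binomial_remainder_def sum.lessThan_Suc_shift by simp
    ultimately show "norm (binomial_remainder (Suc M) w (of_real x)) \<le> \<bar>K\<bar> * C * x ^ Suc M"
      using K x by (simp add: mult_ac)
  qed (use C in simp)
qed

section \<open>The Hurwitz zeta function\<close>

definition hurwitz_term :: "real \<Rightarrow> nat \<Rightarrow> complex \<Rightarrow> nat \<Rightarrow> complex" where
  "hurwitz_term a M s n = of_real (real n + a) powr (1 - s) * binomial_remainder M (1 - s) (1 / of_real (real n + a))"

lemma of_real_powr_add:
  "0 < x \<Longrightarrow> complex_of_real x powr (u + v) = complex_of_real x powr u * complex_of_real x powr v"
  by (simp add: powr_add)

lemma hurwitz_term_eq:
  assumes a: "a > 0"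
  shows "hurwitz_term a M s n = of_real (real (Suc n) + a) powr (1 - s)
    - (\<Sum>j<M. ((1 - s) gchoose j) * of_real (real n + a) powr (1 - s - of_nat j))"
proof -
  let ?y = "real n + a"
  have y: "?y > 0" using a by simp
  have "real (Suc n) + a = ?y * (1 + 1 / ?y)" using y by (simp add: field_simps)
  then have "of_real (real (Suc n) + a) powr (1 - s) = (of_real ?y * complex_of_real (1 + 1 / ?y)) powr (1 - s)"
    by (simp only: of_real_mult)
  also have "\<dots> = of_real ?y powr (1 - s) * complex_of_real (1 + 1 / ?y) powr (1 - s)"
    using y by (subst powr_times_real) (auto simp: add_nonneg_nonneg)
  finally have 1: "of_real ?y powr (1 - s) * (1 + 1 / of_real ?y) powr (1 - s) = of_real (real (Suc n) + a) powr (1 - s)"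
    by simp
  have 2: "of_real ?y powr (1 - s) * (1 / of_real ?y) ^ j = complex_of_real ?y powr (1 - s - of_nat j)" for j
  proof -
    define Y where "Y = complex_of_real ?y"
    have Y: "Y \<noteq> 0" using y by (simp add: Y_def del: of_real_add)
    have "Y powr (1 - s) = Y powr (1 - s - of_nat j) * Y ^ j"
      using of_real_powr_add[OF y, of "1 - s - of_nat j" "of_nat j", folded Y_def] Y by (simp add: powr_nat')
    then show ?thesis using Y unfolding Y_def[symmetric] by (simp add: power_one_over)
  qed
  show ?thesis
    unfolding hurwitz_term_def binomial_remainder_def right_diff_distrib 1 sum_distrib_left
    by (simp only: mult.left_commute[of "of_real ?y powr (1 - s)"] 2)
qed

lemma hurwitz_term_holomorphic:
  assumes a: "a > 0"
  shows "(\<lambda>s. hurwitz_term a M s n) field_differentiable (at s)"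
proof -
  have "(\<lambda>s. of_real (real (Suc n) + a) powr (1 - s)
    - (\<Sum>j<M. (\<Prod>i=0..<j. 1 - s - of_nat i) / fact j * of_real (real n + a) powr (1 - s - of_nat j))) holomorphic_on UNIV"
    using a by (intro holomorphic_intros) auto
  then have "(\<lambda>s. hurwitz_term a M s n) holomorphic_on UNIV"
    by (simp add: hurwitz_term_eq[OF a] gbinomial_prod_rev)
  then show ?thesis by (simp add: holomorphic_on_def)
qed

lemma summable_shifted_powr:
  assumes "a > 0" "\<sigma> > 1" shows "summable (\<lambda>n. (real n + a) powr (- \<sigma>))"
proof (rule summable_comparison_test')
  show "summable (\<lambda>n. real n powr (- \<sigma>))" using assms by (simp add: summable_real_powr_iff)
  show "norm ((real n + a) powr (- \<sigma>)) \<le> real n powr (- \<sigma>)" if "n \<ge> 1" for n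
    using assms that by (simp add: powr_mono2')
qed

text \<open>The terms are of order n + a to the power 1 - Re s - M, hence summable for Re s > 2 - M.
  Each additional Taylor term thus gains one unit to the left.\<close>

lemma hurwitz_sum_holomorphic:
  assumes a: "a > 0"
  obtains g where "g holomorphic_on {s. Re s > 2 - real M}"
    "\<And>s. Re s > 2 - real M \<Longrightarrow> hurwitz_term a M s sums g s"
proof -
  let ?S = "{s. Re s > 2 - real M}"
  have "\<exists>d h. 0 < d \<and> summable h \<and> range h \<subseteq> \<real>\<^sub>\<ge>\<^sub>0 \<and>
    (\<forall>\<^sub>F n in sequentially. \<forall>y\<in>ball x d \<inter> ?S. cmod (hurwitz_term a M y n) \<le> cmod (h n))" if x: "x \<in> ?S" for x
  proof -
    \<comment> \<open>Half the distance to the boundary line, so that \<sigma>, a lower bound for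
      the real part on the ball, still exceeds 2 - M.\<close>
    define d where "d = (Re x - (2 - real M)) / 2"
    define \<sigma> where "\<sigma> = Re x - d"
    have d: "d > 0" using x by (simp add: d_def)
    have sd: "\<sigma> = 2 - real M + d" by (simp add: \<sigma>_def d_def field_simps)
    obtain C where C: "C \<ge> 0" "\<And>w x'. norm w \<le> 1 + norm x + d \<Longrightarrow> 0 \<le> x' \<Longrightarrow> x' \<le> 1 \<Longrightarrow>
      norm (binomial_remainder M w (of_real x')) \<le> C * x' ^ M" using binomial_remainder_bound[of "1 + norm x + d" M] by blast
    define h where "h = (\<lambda>n. complex_of_real (C * (real n + a) powr (- (\<sigma> + real M - 1))))"
    have "summable (\<lambda>n. C * (real n + a) powr (- (\<sigma> + real M - 1)))"
      using a d by (intro summable_mult summable_shifted_powr) (simp_all add: sd)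
    then have "summable h" unfolding h_def by (simp add: summable_of_real)
    moreover have "range h \<subseteq> \<real>\<^sub>\<ge>\<^sub>0" using C(1) by (auto simp: h_def)
    \<comment> \<open>From n = 1 on, 1 / (n + a) is at most 1, the range in which
      \<open>binomial_remainder_bound\<close> holds.\<close>
    moreover have "cmod (hurwitz_term a M y n) \<le> cmod (h n)" if n: "n \<ge> 1" and y: "y \<in> ball x d" for n y
    proof -
      let ?t = "real n + a"
      have t: "?t \<ge> 1" "?t > 0" using n a by auto
      have ny: "norm (x - y) < d" using y by (simp add: dist_norm)
      have "\<bar>Re x - Re y\<bar> < d" using ny abs_Re_le_cmod[of "x - y"] by simp
      then have "Re y \<ge> \<sigma>" unfolding \<sigma>_def by linarith
      have "norm y \<le> norm x + d" using ny norm_triangle_ineq4[of x "x - y"] by simp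
      then have w: "norm (1 - y) \<le> 1 + norm x + d" using norm_triangle_ineq4[of 1 y] by simp
      have "norm (binomial_remainder M (1 - y) (of_real (1 / ?t))) \<le> C * (1 / ?t) ^ M"
        using t by (intro C(2) w) auto
      then have 1: "norm (binomial_remainder M (1 - y) (1 / of_real ?t)) \<le> C * (1 / ?t) ^ M" by simp
      have "norm (complex_of_real ?t powr (1 - y)) = ?t powr (1 - Re y)"
        using t by (subst norm_powr_real_powr) auto
      also have "\<dots> \<le> ?t powr (1 - \<sigma>)" using t \<open>Re y \<ge> \<sigma>\<close> by (intro powr_mono) auto
      finally have "cmod (hurwitz_term a M y n) \<le> ?t powr (1 - \<sigma>) * (C * (1 / ?t) ^ M)"
        unfolding hurwitz_term_def norm_mult using 1 by (intro mult_mono) auto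
      also have "\<dots> = C * (?t powr (1 - \<sigma>) * ?t powr (- real M))"
        using t by (simp add: powr_minus powr_realpow power_one_over divide_simps)
      also have "\<dots> = C * ?t powr (- (\<sigma> + real M - 1))"
        by (simp add: algebra_simps flip: powr_add)
      finally show ?thesis unfolding h_def norm_of_real using C(1) by (simp add: abs_mult)
    qed
    ultimately show ?thesis using d
      by (intro exI[of _ d] exI[of _ h]) (auto intro!: eventually_sequentiallyI[of 1])
  qed
  then obtain g where g: "\<forall>s\<in>?S. (\<lambda>n. hurwitz_term a M s n) sums g s \<and> g field_differentiable (at s)"
    using series_differentiable_comparison_complex[of ?S "\<lambda>n s. hurwitz_term a M s n",
        OF open_halfspace_Re_gt hurwitz_term_holomorphic[OF a]] by blast
  then have "g holomorphic_on ?S" "\<And>s. s \<in> ?S \<Longrightarrow> hurwitz_term a M s sums g s"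
    by (simp_all add: holomorphic_on_def field_differentiable_at_within)
  then show ?thesis by (intro that[of g]) simp_all
qed

definition hurwitz_zeta :: "real \<Rightarrow> complex \<Rightarrow> complex" where
  "hurwitz_zeta a s = (\<Sum>n. of_real (real n + a) powr (- s))"

lemma summable_hurwitz:
  assumes "a > 0" "Re s > 1" shows "summable (\<lambda>n. norm (complex_of_real (real n + a) powr (- s)))"
proof -
  have "norm (complex_of_real (real n + a) powr (- s)) = (real n + a) powr (- Re s)" for n
    using assms by (subst norm_powr_real_powr) auto
  then show ?thesis using summable_shifted_powr[OF assms] by simp
qed

lemma hurwitz_zeta_sums:
  "a > 0 \<Longrightarrow> Re s > 1 \<Longrightarrow> (\<lambda>n. of_real (real n + a) powr (- s)) sums hurwitz_zeta a s"
  unfolding hurwitz_zeta_def by (rule summable_sums[OF summable_norm_cancel[OF summable_hurwitz]])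

text \<open>
  Summing the Taylor expansion of \<open>(x + 1) powr (1 - s)\<close> at \<open>x = n + a\<close> over \<open>n\<close> expresses
  \<open>(s - 1) \<zeta>(s, a)\<close> by the values at \<open>s + 1, s + 2, \<dots>\<close> and a remainder which is holomorphic
  further to the left.
\<close>

lemma hurwitz_recurrence:
  assumes a: "a > 0" and s: "Re s > 1" and M: "M \<ge> 2" and g: "hurwitz_term a M s sums g"
  shows "(s - 1) * hurwitz_zeta a s = of_real a powr (1 - s)
    + (\<Sum>j=2..<M. ((1 - s) gchoose j) * hurwitz_zeta a (s + of_nat j - 1)) + g"
proof -
  let ?y = "\<lambda>n. complex_of_real (real n + a)"
  have tel: "(\<lambda>n. ?y (Suc n) powr (1 - s) - ?y n powr (1 - s)) sums (0 - ?y 0 powr (1 - s))"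
  proof (rule telescope_sums)
    have "filterlim (\<lambda>n. real n + a) at_top sequentially"
      using filterlim_tendsto_add_at_top[OF tendsto_const filterlim_real_sequentially, of a] by (simp only: add.commute)
    then have "(\<lambda>n. (real n + a) powr (Re (1 - s))) \<longlonglongrightarrow> 0"
      using s by (intro tendsto_neg_powr) auto
    moreover have "norm (?y n powr (1 - s)) = (real n + a) powr (Re (1 - s))" for n
      using a by (subst norm_powr_real_powr) auto
    ultimately have "(\<lambda>n. norm (?y n powr (1 - s))) \<longlonglongrightarrow> 0" by simp
    then show "(\<lambda>n. ?y n powr (1 - s)) \<longlonglongrightarrow> 0" by (rule tendsto_norm_zero_cancel)
  qed
  have zeta: "(\<lambda>n. ((1 - s) gchoose j) * ?y n powr (1 - s - of_nat j)) sums
      (((1 - s) gchoose j) * hurwitz_zeta a (s + of_nat j - 1))" if "j \<ge> 1" for j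
  proof -
    have "- (s + of_nat j - 1) = 1 - s - of_nat j" by simp
    moreover have "Re (s + of_nat j - 1) > 1" using s that by simp
    ultimately show ?thesis
      using hurwitz_zeta_sums[OF a, of "s + of_nat j - 1"] by (intro sums_mult) (simp only:)
  qed
  have "hurwitz_term a M s = (\<lambda>n. ?y (Suc n) powr (1 - s) - ?y n powr (1 - s)
      - (\<Sum>j=1..<M. ((1 - s) gchoose j) * ?y n powr (1 - s - of_nat j)))"
  proof
    fix n
    have "{..<M} = insert 0 {1..<M}" using M by auto
    then show "hurwitz_term a M s n = ?y (Suc n) powr (1 - s) - ?y n powr (1 - s)
      - (\<Sum>j=1..<M. ((1 - s) gchoose j) * ?y n powr (1 - s - of_nat j))"
      by (simp add: hurwitz_term_eq[OF a])
  qed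
  moreover have "(\<lambda>n. \<Sum>j=1..<M. ((1 - s) gchoose j) * ?y n powr (1 - s - of_nat j)) sums
      (\<Sum>j=1..<M. ((1 - s) gchoose j) * hurwitz_zeta a (s + of_nat j - 1))"
    by (intro sums_sum zeta) simp
  ultimately have "hurwitz_term a M s sums (0 - ?y 0 powr (1 - s)
      - (\<Sum>j=1..<M. ((1 - s) gchoose j) * hurwitz_zeta a (s + of_nat j - 1)))"
    using sums_diff[OF tel] by (simp only:)
  then have "g = 0 - ?y 0 powr (1 - s) - (\<Sum>j=1..<M. ((1 - s) gchoose j) * hurwitz_zeta a (s + of_nat j - 1))"
    using g sums_unique2 by blast
  \<comment> \<open>The term j = 1 is \<open>(1 - s) * hurwitz_zeta a s\<close> and moves to the
    left-hand side.\<close>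
  moreover have "{1..<M} = insert 1 {2..<M}" using M by auto
  ultimately show ?thesis by (simp add: algebra_simps)
qed

text \<open>The quotient of \<open>(1 - s) gchoose j\<close> by s + j - 2. That divisor is the
  factor which removes the pole of the zeta function at the argument s + j - 1, so the recurrence
  can be written for \<open>Z\<close> alone.\<close>

definition hurwitz_coeff :: "nat \<Rightarrow> complex \<Rightarrow> complex" where
  "hurwitz_coeff j s = - (\<Prod>i<j - 1. 1 - s - of_nat i) / fact j"

lemma hurwitz_coeff:
  assumes "j \<ge> 2" shows "((1 - s) gchoose j) = hurwitz_coeff j s * (s + of_nat j - 2)"
proof -
  obtain i where j: "j = Suc i" using assms by (cases j) auto
  have "1 - s - of_nat i = - (s + of_nat j - 2)" by (simp add: j)
  then have "(\<Prod>k<j. 1 - s - of_nat k) = - (\<Prod>k<i. 1 - s - of_nat k) * (s + of_nat j - 2)"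
    by (simp add: j algebra_simps)
  then show ?thesis
    by (simp only: gbinomial_prod_rev hurwitz_coeff_def atLeast0LessThan) (simp add: j)
qed

lemma holomorphic_hurwitz_coeff [holomorphic_intros]: "hurwitz_coeff j holomorphic_on S"
  unfolding hurwitz_coeff_def by (intro holomorphic_intros) auto

lemma hurwitz_recurrence_Z:
  assumes a: "a > 0" and s: "Re s > 1" and M: "M \<ge> 2" and g: "hurwitz_term a M s sums g"
    and Z: "\<And>s. Re s > 1 \<Longrightarrow> Z s = (s - 1) * hurwitz_zeta a s"
  shows "Z s = of_real a powr (1 - s) + (\<Sum>j=2..<M. hurwitz_coeff j s * Z (s + of_nat j - 1)) + g"
proof -
  have "((1 - s) gchoose j) * hurwitz_zeta a (s + of_nat j - 1) = hurwitz_coeff j s * Z (s + of_nat j - 1)"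
    if "j \<in> {2..<M}" for j
    using that s by (subst Z) (simp_all add: hurwitz_coeff algebra_simps)
  then show ?thesis using hurwitz_recurrence[OF a s M g] Z[OF s] by simp
qed

lemma connected_halfplane: "connected {s. Re s > c}"
  by (intro convex_connected convex_halfspace_Re_gt)

text \<open>The recurrence evaluates \<open>Z\<close> only at s + j - 1 with j at least 2, hence at
  least one unit to the right; \<open>N + 3\<close> Taylor terms make the remainder holomorphic for
  Re s > - (N + 1).\<close>

lemma hurwitz_halfplane:
  assumes a: "a > 0"
  shows "\<exists>Z. Z holomorphic_on {s. Re s > - real N} \<and> (\<forall>s. Re s > 1 \<longrightarrow> Z s = (s - 1) * hurwitz_zeta a s)"
proof (induction N)
  case 0
  obtain g where g: "g holomorphic_on {s. Re s > 2 - real 2}" "\<And>s. Re s > 2 - real 2 \<Longrightarrow> hurwitz_term a 2 s sums g s"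
    using hurwitz_sum_holomorphic[OF a] by blast
  show ?case
  proof (intro exI[of _ "\<lambda>s. of_real a powr (1 - s) + g s"] conjI allI impI)
    show "(\<lambda>s. of_real a powr (1 - s) + g s) holomorphic_on {s. Re s > - real 0}"
      using g(1) a by (intro holomorphic_intros) auto
    show "of_real a powr (1 - s) + g s = (s - 1) * hurwitz_zeta a s" if "Re s > 1" for s
      using hurwitz_recurrence[OF a that, of 2 "g s"] g(2)[of s] that by simp
  qed
next
  case (Suc N)
  obtain Z where Z: "Z holomorphic_on {s. Re s > - real N}" "\<And>s. Re s > 1 \<Longrightarrow> Z s = (s - 1) * hurwitz_zeta a s"
    using Suc by blast
  obtain g where g: "g holomorphic_on {s. Re s > 2 - real (N + 3)}"
    "\<And>s. Re s > 2 - real (N + 3) \<Longrightarrow> hurwitz_term a (N + 3) s sums g s"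
    using hurwitz_sum_holomorphic[OF a] by blast
  let ?Z = "\<lambda>s. of_real a powr (1 - s) + (\<Sum>j=2..<N+3. hurwitz_coeff j s * Z (s + of_nat j - 1)) + g s"
  show ?case
  proof (intro exI[of _ ?Z] conjI allI impI)
    have "(\<lambda>s. Z (s + of_nat j - 1)) holomorphic_on {s. Re s > - real (Suc N)}" if "j \<in> {2..<N+3}" for j
      by (rule holomorphic_on_compose_gen[of _ _ Z "{s. Re s > - real N}", unfolded o_def, OF _ Z(1)])
        (use that in \<open>auto intro!: holomorphic_intros\<close>)
    then show "?Z holomorphic_on {s. Re s > - real (Suc N)}"
      using g(1) a by (intro holomorphic_intros) auto
    show "?Z s = (s - 1) * hurwitz_zeta a s" if "Re s > 1" for s
      using hurwitz_recurrence_Z[OF a that _ g(2) Z(2)] Z(2)[OF that] that by simp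
  qed
qed

lemma glue_halfplanes:
  assumes "\<And>N::nat. \<exists>F. F holomorphic_on {s. Re s > - real N} \<and> (\<forall>s. Re s > c \<longrightarrow> F s = D s)"
  shows "\<exists>F. F holomorphic_on UNIV \<and> (\<forall>s. Re s > c \<longrightarrow> F s = D s)"
proof -
  obtain F where F: "\<And>N. F N holomorphic_on {s. Re s > - real N}" "\<And>N s. Re s > c \<Longrightarrow> F N s = D s"
    using assms by metis
  have mono: "F N s = F M s" if "N \<le> M" "Re s > - real N" for N M s
  proof (rule analytic_continuation_open[where s = "{s. Re s > max c (- real N)}" and s' = "{s. Re s > - real N}"
        and f = "F N" and g = "F M"])
    show "open {s. Re s > max c (- real N)}" by (rule open_halfspace_Re_gt)
    have "of_real (max c (- real N) + 1) \<in> {s. Re s > max c (- real N)}"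
      unfolding mem_Collect_eq Re_complex_of_real by (rule less_add_one)
    then show "{s. Re s > max c (- real N)} \<noteq> {}" by blast
    show "F M holomorphic_on {s. Re s > - real N}"
      by (rule holomorphic_on_subset[OF F(1)]) (use that in auto)
  qed (use F that connected_halfplane open_halfspace_Re_gt in auto)
  \<comment> \<open>\<open>I s\<close> is some index whose half-plane contains s; by the identity
    theorem the value does not depend on the choice.\<close>
  define I where "I = (\<lambda>s. nat \<lceil>- Re s\<rceil> + 1)"
  have I: "Re s > - real (I s)" for s unfolding I_def by linarith
  define G where "G = (\<lambda>s. F (I s) s)"
  have G: "G s = F N s" if "Re s > - real N" for s N
    unfolding G_def using mono[OF _ that, of "I s"] mono[OF _ I, of s N] by (metis nat_le_linear)
  have "G field_differentiable (at z)" for z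
  proof -
    have "G holomorphic_on {s. Re s > - real (I z)}"
      by (rule holomorphic_transform[OF F(1)]) (simp add: G)
    then show ?thesis
      using I[of z] holomorphic_on_imp_differentiable_at[OF _ open_halfspace_Re_gt] by simp
  qed
  then have "G holomorphic_on UNIV" by (simp add: holomorphic_on_def)
  then show ?thesis using F(2) by (auto simp: G_def)
qed

lemma hurwitz_continuation:
  assumes a: "a > 0"
  shows "\<exists>Z. Z holomorphic_on UNIV \<and> (\<forall>s. Re s > 1 \<longrightarrow> Z s = (s - 1) * hurwitz_zeta a s) \<and> Z 0 = of_real (a - 1 / 2)"
proof -
  obtain Z where Z: "Z holomorphic_on UNIV" "\<And>s. Re s > 1 \<Longrightarrow> Z s = (s - 1) * hurwitz_zeta a s"
    using glue_halfplanes[OF hurwitz_halfplane[OF a]] by blast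
  have rec: "Z s = of_real a powr (1 - s) + (\<Sum>j=2..<M. hurwitz_coeff j s * Z (s + of_nat j - 1)) + (\<Sum>n. hurwitz_term a M s n)"
    if M: "M \<ge> 2" and s: "Re s > 2 - real M" for M s
  proof -
    obtain g where g: "g holomorphic_on {s. Re s > 2 - real M}"
      "\<And>s. Re s > 2 - real M \<Longrightarrow> hurwitz_term a M s sums g s"
      using hurwitz_sum_holomorphic[OF a] by blast
    have Zj: "(\<lambda>s. Z (s + of_nat j - 1)) holomorphic_on S" for j S
      by (rule holomorphic_on_compose_gen[of _ S Z UNIV, unfolded o_def, OF _ Z(1)]) (auto intro!: holomorphic_intros)
    have "Z s = of_real a powr (1 - s) + (\<Sum>j=2..<M. hurwitz_coeff j s * Z (s + of_nat j - 1)) + g s"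
    proof (rule analytic_continuation_open[where s = "{s. Re s > 1}" and s' = "{s. Re s > 2 - real M}" and f = Z
          and g = "\<lambda>s. of_real a powr (1 - s) + (\<Sum>j=2..<M. hurwitz_coeff j s * Z (s + of_nat j - 1)) + g s"])
      have "2 \<in> {s. Re s > 1}" by simp
      then show "{s. Re s > 1} \<noteq> {}" by blast
      show "{s. Re s > 1} \<subseteq> {s. Re s > 2 - real M}" using M by auto
      fix z assume "z \<in> {s. Re s > 1}"
      then have z: "Re z > 1" "Re z > 2 - real M" using M by auto
      show "Z z = of_real a powr (1 - z) + (\<Sum>j=2..<M. hurwitz_coeff j z * Z (z + of_nat j - 1)) + g z"
        by (rule hurwitz_recurrence_Z[OF a z(1) M g(2)[OF z(2)] Z(2)])
    next
      show "Z holomorphic_on {s. Re s > 2 - real M}" by (rule holomorphic_on_subset[OF Z(1)]) simp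
      show "(\<lambda>s. of_real a powr (1 - s) + (\<Sum>j=2..<M. hurwitz_coeff j s * Z (s + of_nat j - 1)) + g s)
          holomorphic_on {s. Re s > 2 - real M}"
        using a by (intro holomorphic_on_add holomorphic_on_sum holomorphic_on_mult g(1) Zj
            holomorphic_hurwitz_coeff holomorphic_on_powr holomorphic_on_diff holomorphic_on_const holomorphic_on_ident) auto
    qed (use s in \<open>simp_all add: connected_halfplane open_halfspace_Re_gt\<close>)
    then show ?thesis using g(2)[OF s] by (simp add: sums_iff)
  qed
  \<comment> \<open>At s = 1 and s = 0 the binomial series has exponent 0 and 1 and terminates, so
    the remainders vanish and the recurrence gives \<open>Z 1 = 1\<close>, then
    \<open>Z 0 = a - 1 / 2\<close>.\<close>
  have t2: "hurwitz_term a 2 1 n = 0" for n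
  proof -
    have "0 < 1 + 1 / (real n + a)" using a by (intro add_pos_nonneg) auto
    then have "complex_of_real (1 + 1 / (real n + a)) \<noteq> 0" by (simp only: of_real_eq_0_iff)
    then show ?thesis by (simp add: hurwitz_term_def binomial_remainder_def numeral_2_eq_2)
  qed
  have t3: "hurwitz_term a 3 0 n = 0" for n
    using a by (simp add: hurwitz_term_def binomial_remainder_def numeral_3_eq_3 gbinomial_prod_rev)
  have "Z 1 = 1" using rec[of 2 1] a by (simp add: t2)
  moreover have "{2..<3 :: nat} = {2}" by auto
  then have "Z 0 = of_real a + hurwitz_coeff 2 0 * Z 1" using rec[of 3 0] a by (simp add: t3)
  moreover have "hurwitz_coeff 2 0 = - 1 / 2" by (simp add: hurwitz_coeff_def)
  ultimately have "Z 0 = of_real (a - 1 / 2)" by simp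
  then show ?thesis using Z by blast
qed

text \<open>Splitting m = n r + j with 1 \<le> j \<le> r turns the series into a combination of
  Hurwitz zeta functions of j / r, whose values at 0 are 1 / 2 - j / r. The class of 0 is
  represented by j = r to keep j / r positive.\<close>

theorem periodic_dirichlet_continuation:
  fixes k :: "nat \<Rightarrow> real"
  assumes r: "r > 0" and per: "\<And>m. k (m + r) = k m"
  shows "\<exists>F. F meromorphic_on UNIV \<and> F analytic_on {0} \<and>
     F 0 = of_real (\<Sum>j=1..r. k j * (1 / 2 - real j / real r)) \<and>
     (\<forall>s. Re s > 1 \<longrightarrow> ((\<lambda>m. of_real (k m) * of_real (2 * pi * real m) powr (- s)) has_sum F s) {1..})"
proof -
  have "\<exists>Z. Z holomorphic_on UNIV \<and> (\<forall>s. Re s > 1 \<longrightarrow> Z s = (s - 1) * hurwitz_zeta a s) \<and> Z 0 = of_real (a - 1 / 2)"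
    if "a > 0" for a using hurwitz_continuation[OF that] .
  then obtain Z where Z: "\<And>a. a > 0 \<Longrightarrow> Z a holomorphic_on UNIV" "\<And>a s. a > 0 \<Longrightarrow> Re s > 1 \<Longrightarrow> Z a s = (s - 1) * hurwitz_zeta a s"
    "\<And>a. a > 0 \<Longrightarrow> Z a 0 = of_real (a - 1 / 2)" by metis
  define A where "A = (\<lambda>j. real j / real r)"
  have A: "A j > 0" if "j \<in> {1..r}" for j using that r by (simp add: A_def)
  define F where "F = (\<lambda>s. of_real (2 * pi * r) powr (- s) * (\<Sum>j=1..r. of_real (k j) * Z (A j) s) / (s - 1))"
  have num: "(\<lambda>s. of_real (2 * pi * r) powr (- s) * (\<Sum>j=1..r. of_real (k j) * Z (A j) s)) analytic_on UNIV"
    unfolding analytic_on_open[OF open_UNIV] using r A Z(1) by (intro holomorphic_intros) auto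
  have "F meromorphic_on UNIV" unfolding F_def
    by (intro meromorphic_on_divide analytic_on_imp_meromorphic_on[OF num] analytic_on_imp_meromorphic_on analytic_intros)
  moreover have "F analytic_on {0}" unfolding F_def
    by (intro analytic_on_divide analytic_on_subset[OF num] analytic_intros) auto
  moreover have "F 0 = of_real (\<Sum>j=1..r. k j * (1 / 2 - real j / real r))"
  proof -
    have "F 0 = - (\<Sum>j=1..r. of_real (k j) * Z (A j) 0)" using r by (simp add: F_def)
    also have "\<dots> = (\<Sum>j=1..r. of_real (k j * (1 / 2 - A j)))"
      unfolding sum_negf[symmetric] by (intro sum.cong refl) (simp add: Z(3)[OF A] algebra_simps)
    finally show ?thesis by (simp add: A_def)
  qed
  moreover have "((\<lambda>m. of_real (k m) * of_real (2 * pi * real m) powr (- s)) has_sum F s) {1..}" if s: "Re s > 1" for s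
  proof -
    define f where "f = (\<lambda>m. complex_of_real (k m) * of_real (2 * pi * real m) powr (- s))"
    have k: "k (n * r + j) = k j" for n j
    proof (induction n)
      case (Suc n)
      have "Suc n * r + j = (n * r + j) + r" by simp
      show ?case unfolding \<open>Suc n * r + j = (n * r + j) + r\<close> per Suc ..
    qed simp
    have fj: "((\<lambda>n. f (n * r + j)) has_sum of_real (2 * pi * r) powr (- s) * (of_real (k j) * hurwitz_zeta (A j) s)) UNIV"
      if j: "j \<in> {1..r}" for j
    proof -
      have eq: "f (n * r + j) = of_real (2 * pi * r) powr (- s) * (of_real (k j) * of_real (real n + A j) powr (- s))" for n
      proof -
        have "2 * pi * real (n * r + j) = (2 * pi * r) * (real n + A j)" using r by (simp add: A_def field_simps)
        then have "complex_of_real (2 * pi * real (n * r + j)) powr (- s)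
          = (complex_of_real (2 * pi * r) * complex_of_real (real n + A j)) powr (- s)" by (simp only: of_real_mult)
        also have "\<dots> = of_real (2 * pi * r) powr (- s) * of_real (real n + A j) powr (- s)"
          using A[OF j] r by (intro powr_times_real) auto
        finally show ?thesis by (simp add: f_def k mult_ac)
      qed
      have "((\<lambda>n. of_real (real n + A j) powr (- s)) has_sum hurwitz_zeta (A j) s) UNIV"
        using summable_hurwitz[OF A[OF j] s] hurwitz_zeta_sums[OF A[OF j] s] by (rule norm_summable_imp_has_sum)
      then show ?thesis unfolding eq by (intro has_sum_cmult_right)
    qed
    have "(f has_sum (\<Sum>j\<in>{1..r}. of_real (2 * pi * r) powr (- s) * (of_real (k j) * hurwitz_zeta (A j) s)))
        (\<Union>j\<in>{1..r}. range (\<lambda>n. n * r + j))"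
    proof (rule sum_has_sum)
      fix j assume j: "j \<in> {1..r}"
      have "inj (\<lambda>n. n * r + j)" using r by (auto simp: inj_def)
      then show "(f has_sum of_real (2 * pi * r) powr (- s) * (of_real (k j) * hurwitz_zeta (A j) s)) (range (\<lambda>n. n * r + j))"
        using fj[OF j] by (simp add: has_sum_reindex o_def)
      fix j' assume j': "j' \<in> {1..r}" "j \<noteq> j'"
      have "n * r + j \<noteq> n' * r + j'" for n n'
      proof
        assume "n * r + j = n' * r + j'"
        then have "n * r + (j - 1) = n' * r + (j' - 1)" using j j' by simp
        then have "(n * r + (j - 1)) mod r = (n' * r + (j' - 1)) mod r" by (simp only:)
        moreover have "j - 1 < r" "j' - 1 < r" using j j' by auto
        ultimately have "j - 1 = j' - 1" by simp
        then have "j = j'" using j j'(1) unfolding atLeastAtMost_iff by linarith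
        then show False using j'(2) by simp
      qed
      then show "range (\<lambda>n. n * r + j) \<inter> range (\<lambda>n. n * r + j') = {}" by blast
    qed simp
    also have "(\<Union>j\<in>{1..r}. range (\<lambda>n. n * r + j)) = {1..}"
    proof (intro equalityI subsetI)
      fix m :: nat assume "m \<in> {1..}"
      then have "m = (m - 1) div r * r + ((m - 1) mod r + 1)" "(m - 1) mod r + 1 \<in> {1..r}"
        using r by (simp_all add: Suc_leI)
      then show "m \<in> (\<Union>j\<in>{1..r}. range (\<lambda>n. n * r + j))" by blast
    qed auto
    also have "(\<Sum>j=1..r. of_real (2 * pi * r) powr (- s) * (of_real (k j) * hurwitz_zeta (A j) s)) = F s"
    proof -
      have "s \<noteq> 1" using s by auto
      then have "Z (A j) s / (s - 1) = hurwitz_zeta (A j) s" if "j \<in> {1..r}" for j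
        using Z(2)[OF A[OF that] s] by simp
      then show ?thesis
        by (simp add: F_def sum_divide_distrib sum_distrib_left flip: times_divide_eq_right)
    qed
    finally show ?thesis unfolding f_def .
  qed
  ultimately show ?thesis by blast
qed

section \<open>Linear algebra\<close>

lemma unit_char_eq_1_iff: "unit_char t = 1 \<longleftrightarrow> t \<in> \<int>"
proof
  assume "unit_char t = 1"
  then have "cos (2 * pi * t) = 1" by (simp add: unit_char_def complex_eq_iff)
  then obtain k where "2 * pi * t = of_int k * 2 * pi" by (auto simp: cos_one_2pi_int)
  then have "t = of_int k" by simp
  then show "t \<in> \<int>" by simp
qed (rule unit_char_int)

lemma unit_char_power: "unit_char t ^ n = unit_char (real n * t)"
  by (induction n) (simp_all add: unit_char_simps distrib_right)

lemma sum_unit_char_roots: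
  assumes r: "r > 0"
  shows "(\<Sum>j<r. unit_char (real j * of_int k / real r)) = (if int r dvd k then of_nat r else 0)"
proof -
  define x where "x = unit_char (of_int k / real r)"
  have p: "unit_char (real j * of_int k / real r) = x ^ j" for j by (simp add: x_def unit_char_power)
  have x1: "x = 1 \<longleftrightarrow> int r dvd k"
  proof -
    have "of_int k / real r \<in> \<int> \<longleftrightarrow> int r dvd k"
      using of_int_div_of_int_in_Ints_iff[of k "int r", where ?'a = real] r by simp
    then show ?thesis by (simp add: x_def unit_char_eq_1_iff)
  qed
  have "x ^ r = 1" using r by (simp add: x_def unit_char_power unit_char_int)
  then show ?thesis unfolding p using x1 geometric_sum[of x r] by (cases "x = 1") simp_all
qed

text \<open>Forms are functions, on which scalar multiplication is the explicit
  \<open>form_scale\<close> and not a type class operation; hence the linear algebra is done in a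
  locale.\<close>

locale real_vs = vector_space scale for scale :: "real \<Rightarrow> 'b::ab_group_add \<Rightarrow> 'b" (infixr "\<odot>" 75)
begin

lemma family_independent:
  assumes I: "finite I" and ind: "\<And>d i. (\<Sum>i\<in>I. d i \<odot> g i) = 0 \<Longrightarrow> i \<in> I \<Longrightarrow> d i = 0"
  shows "inj_on g I \<and> independent (g ` I)"
proof
  show inj: "inj_on g I"
  proof (rule inj_onI, rule ccontr)
    fix i j assume ij: "i \<in> I" "j \<in> I" "g i = g j" "i \<noteq> j"
    define d where "d = (\<lambda>k. if k = i then 1 else if k = j then -1 else (0::real))"
    have "(\<Sum>k\<in>I. d k \<odot> g k) = (\<Sum>k\<in>{i, j}. d k \<odot> g k)"
      using I ij by (intro sum.mono_neutral_right) (auto simp: d_def)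
    also have "\<dots> = 0" using ij by (simp add: d_def)
    finally have "d i = 0" using ind ij by blast
    then show False by (simp add: d_def)
  qed
  show "independent (g ` I)"
    unfolding dependent_finite[OF finite_imageI[OF I]]
  proof (intro notI, elim exE conjE bexE)
    fix u v assume v: "v \<in> g ` I" "u v \<noteq> 0" and s: "(\<Sum>v\<in>g ` I. u v \<odot> v) = 0"
    have "(\<Sum>i\<in>I. u (g i) \<odot> g i) = 0" using s by (simp add: sum.reindex[OF inj])
    then show False using ind[of "\<lambda>i. u (g i)"] v by blast
  qed
qed

lemma independent_family: "finite B \<Longrightarrow> independent B \<Longrightarrow> (\<Sum>b\<in>B. d b \<odot> b) = 0 \<Longrightarrow> b \<in> B \<Longrightarrow> d b = 0"
  by (simp add: dependent_finite) metis

text \<open>Operators such as \<open>J\<close> are linear on smooth forms but not on arbitrary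
  functions, since \<open>frechet_derivative\<close> is additive only where the derivatives
  exist.\<close>

definition linear_into :: "'b set \<Rightarrow> ('b \<Rightarrow> 'b) \<Rightarrow> 'b set \<Rightarrow> bool" where
  "linear_into V f W \<longleftrightarrow> (\<forall>x\<in>V. f x \<in> W) \<and> (\<forall>x\<in>V. \<forall>y\<in>V. f (x + y) = f x + f y)
     \<and> (\<forall>c. \<forall>x\<in>V. f (c \<odot> x) = c \<odot> f x)"

lemma linear_intoD:
  assumes "linear_into V f W"
  shows "x \<in> V \<Longrightarrow> f x \<in> W" "x \<in> V \<Longrightarrow> y \<in> V \<Longrightarrow> f (x + y) = f x + f y" "x \<in> V \<Longrightarrow> f (c \<odot> x) = c \<odot> f x"
  using assms by (auto simp: linear_into_def)

lemma linear_into_zero: "linear_into V f W \<Longrightarrow> subspace V \<Longrightarrow> f 0 = 0"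
  using linear_intoD(3)[of V f W 0 0] subspace_0[of V] by simp

lemma linear_into_neg: "linear_into V f W \<Longrightarrow> subspace V \<Longrightarrow> x \<in> V \<Longrightarrow> f (- x) = - f x"
  using linear_intoD(3)[of V f W x "-1"] by simp

lemma linear_into_diff: "linear_into V f W \<Longrightarrow> subspace V \<Longrightarrow> x \<in> V \<Longrightarrow> y \<in> V \<Longrightarrow> f (x - y) = f x - f y"
  using linear_intoD(2)[of V f W x "- y"] linear_into_neg[of V f W y] by (simp add: subspace_neg)

lemma linear_into_sum:
  assumes "linear_into V f W" "subspace V" "\<And>i. i \<in> I \<Longrightarrow> g i \<in> V"
  shows "f (\<Sum>i\<in>I. c i \<odot> g i) = (\<Sum>i\<in>I. c i \<odot> f (g i))"
  using assms(3)
proof (induction I rule: infinite_finite_induct)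
  case (insert j F)
  have "(\<Sum>i\<in>F. c i \<odot> g i) \<in> V" "c j \<odot> g j \<in> V"
    using insert by (auto intro!: subspace_sum subspace_scale assms(2))
  then show ?case using insert linear_intoD[OF assms(1)] by simp
qed (simp_all add: linear_into_zero[OF assms(1,2)])

text \<open>Induction on the functionals. If \<open>L i\<close> does not vanish on \<open>B\<close>,
  subtracting multiples of one \<open>b0\<close> with \<open>L i b0 \<noteq> 0\<close> moves the
  rest of \<open>B\<close> into the kernel of \<open>L i\<close> and keeps it independent.\<close>

lemma separating_functionals_finite:
  fixes L :: "'i \<Rightarrow> 'b \<Rightarrow> real"
  assumes "finite I" "subspace W"
    and "\<And>i x y. i \<in> I \<Longrightarrow> x \<in> W \<Longrightarrow> y \<in> W \<Longrightarrow> L i (x + y) = L i x + L i y"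
    and "\<And>i c x. i \<in> I \<Longrightarrow> x \<in> W \<Longrightarrow> L i (c \<odot> x) = c * L i x"
    and "\<And>x. x \<in> W \<Longrightarrow> (\<And>i. i \<in> I \<Longrightarrow> L i x = 0) \<Longrightarrow> x = 0"
    and "finite B" "B \<subseteq> W" "independent B"
  shows "card B \<le> card I"
  using assms
proof (induction I arbitrary: W B rule: finite_induct)
  case empty
  then have "B \<subseteq> {0}" by auto
  then have "B = {}" using \<open>independent B\<close> dependent_zero by blast
  then show ?case by simp
next
  case (insert i I)
  note W = \<open>subspace W\<close>
  define W' where "W' = {x \<in> W. L i x = 0}"
  have L0: "L i 0 = 0" using insert.prems(3)[of i 0 0] subspace_0[OF W] by simp
  have W': "subspace W'" unfolding W'_def
    using insert.prems(2,3)[of i] W L0 by (auto intro!: subspaceI simp: subspace_0 subspace_add subspace_scale)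
  have sep: "x = 0" if "x \<in> W'" "\<And>j. j \<in> I \<Longrightarrow> L j x = 0" for x
    by (rule insert.prems(4)) (use that in \<open>auto simp: W'_def\<close>)
  have IH: "card B' \<le> card I" if "finite B'" "B' \<subseteq> W'" "independent B'" for B'
    by (rule insert.IH[OF W' _ _ sep that]) (use insert.prems(2,3) in \<open>auto simp: W'_def\<close>)
  show ?case
  proof (cases "\<forall>b\<in>B. L i b = 0")
    case True
    then have "B \<subseteq> W'" using insert.prems by (auto simp: W'_def)
    then show ?thesis using IH[of B] insert.hyps insert.prems by simp
  next
    case False
    then obtain b0 where b0: "b0 \<in> B" "L i b0 \<noteq> 0" by blast
    define c where "c = (\<lambda>b. L i b / L i b0)"
    define g where "g = (\<lambda>b. b - c b \<odot> b0)"
    have BW: "b \<in> B \<Longrightarrow> b \<in> W" for b using insert.prems by blast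
    have "g b \<in> W'" if "b \<in> B" for b
    proof -
      have "g b = b + (- c b) \<odot> b0" by (simp add: g_def)
      moreover have "L i (b + (- c b) \<odot> b0) = L i b + (- c b) * L i b0"
        using insert.prems(2)[OF insertI1 BW[OF that] subspace_scale[OF W BW[OF b0(1)]], of "- c b"]
          insert.prems(3)[OF insertI1 BW[OF b0(1)], of "- c b"] by (simp only:)
      then have "L i (b + (- c b) \<odot> b0) = 0" using b0 by (simp add: c_def del: scale_minus_left)
      ultimately show ?thesis using BW that b0 W by (auto simp: W'_def subspace_diff subspace_scale)
    qed
    moreover have gi: "inj_on g (B - {b0}) \<and> independent (g ` (B - {b0}))"
    proof (rule family_independent)
      show "finite (B - {b0})" using insert.prems by simp
      fix d b assume s: "(\<Sum>b\<in>B - {b0}. d b \<odot> g b) = 0" and b: "b \<in> B - {b0}"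
      define d' where "d' = (\<lambda>b. if b = b0 then - (\<Sum>b\<in>B - {b0}. d b * c b) else d b)"
      have "(\<Sum>b\<in>B. d' b \<odot> b) = d' b0 \<odot> b0 + (\<Sum>b\<in>B - {b0}. d' b \<odot> b)"
        using b0 insert.prems by (intro sum.remove) auto
      also have "(\<Sum>b\<in>B - {b0}. d' b \<odot> b) = (\<Sum>b\<in>B - {b0}. d b \<odot> b)" by (intro sum.cong) (auto simp: d'_def)
      also have "d' b0 \<odot> b0 + (\<Sum>b\<in>B - {b0}. d b \<odot> b) = (\<Sum>b\<in>B - {b0}. d b \<odot> g b)"
        by (simp add: d'_def g_def scale_right_diff_distrib sum_subtractf scale_sum_left)
      finally have "(\<Sum>b\<in>B. d' b \<odot> b) = 0" using s by simp
      then have "d' b = 0" using independent_family[of B d' b] insert.prems b by auto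
      then show "d b = 0" using b by (simp add: d'_def)
    qed
    ultimately have "card (B - {b0}) \<le> card I"
      using IH[of "g ` (B - {b0})"] insert.prems by (auto simp: card_image)
    then show ?thesis using b0 insert.hyps insert.prems by simp
  qed
qed

text \<open>\<open>dim\<close> is 0 on spaces of infinite dimension, so a dimension count is
  meaningful only together with a finite spanning set; the second conclusion supplies it.\<close>

lemma separating_functionals_dim:
  fixes L :: "'i \<Rightarrow> 'b \<Rightarrow> real"
  assumes I: "finite I" and W: "subspace W"
    and L: "\<And>i x y. i \<in> I \<Longrightarrow> x \<in> W \<Longrightarrow> y \<in> W \<Longrightarrow> L i (x + y) = L i x + L i y"
      "\<And>i c x. i \<in> I \<Longrightarrow> x \<in> W \<Longrightarrow> L i (c \<odot> x) = c * L i x"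
      "\<And>x. x \<in> W \<Longrightarrow> (\<And>i. i \<in> I \<Longrightarrow> L i x = 0) \<Longrightarrow> x = 0"
  shows "dim W \<le> card I" and "\<exists>B. finite B \<and> W \<subseteq> span B"
proof -
  obtain B where B: "B \<subseteq> W" "independent B" "W \<subseteq> span B" "card B = dim W" using basis_exists by blast
  have *: "card B' \<le> card I" if "finite B'" "B' \<subseteq> B" for B'
    using B that independent_mono[OF B(2) that(2)] by (intro separating_functionals_finite[OF I W L]) auto
  have fin: "finite B"
  proof (rule ccontr)
    assume "infinite B"
    then obtain B' where "B' \<subseteq> B" "card B' = Suc (card I)" "finite B'" using infinite_arbitrarily_large by metis
    then show False using *[of B'] by simp
  qed
  then show "dim W \<le> card I" "\<exists>B. finite B \<and> W \<subseteq> span B" using *[of B] B by auto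
qed

lemma finite_independent_le_dim:
  assumes "finite F" "W \<subseteq> span F" "B \<subseteq> W" "independent B"
  shows "finite B \<and> card B \<le> dim W"
proof -
  obtain B' where B': "B' \<subseteq> W" "independent B'" "W \<subseteq> span B'" "card B' = dim W" using basis_exists by blast
  have "finite B'" using independent_span_bound[OF assms(1) B'(2)] B' assms by blast
  then show ?thesis using independent_span_bound[of B' B] B' assms by auto
qed

text \<open>
  Used with a map between the eigenspaces for \<open>l\<close> and \<open>- l\<close>: away from its kernel it is injective,
  and its image meets the kernel of the opposite map trivially.
\<close>

lemma dim_le_via_map:
  assumes W: "subspace W" "finite F" "W \<subseteq> span F" and W': "subspace W'" "finite F'" "W' \<subseteq> span F'"
    and f: "linear_into W f W'" and K: "K = {x \<in> W. f x = 0}" and L: "subspace L" "L \<subseteq> W'"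
    and inter: "\<And>x. x \<in> W \<Longrightarrow> f x \<in> L \<Longrightarrow> f x = 0"
  shows "dim W + dim L \<le> dim W' + dim K"
proof -
  obtain A where A: "A \<subseteq> K" "independent A" "K \<subseteq> span A" "card A = dim K" using basis_exists by blast
  obtain B where B: "A \<subseteq> B" "B \<subseteq> W" "independent B" "W \<subseteq> span B"
    using maximal_independent_subset_extend[of A W] A K by blast
  obtain C where C: "C \<subseteq> L" "independent C" "L \<subseteq> span C" "card C = dim L" using basis_exists by blast
  have fB: "finite B" and fC: "finite C"
    using finite_independent_le_dim[OF W(2,3) B(2,3)] finite_independent_le_dim[OF W'(2,3) _ C(2)] C L by auto
  have cB: "card B = dim W" using basis_card_eq_dim B by blast
  \<comment> \<open>The images of the vectors that complete \<open>A\<close> to a basis of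
    \<open>W\<close>, together with a basis of \<open>L\<close>, are shown to be independent in
    \<open>W'\<close>. Indexing by a disjoint sum keeps the two families apart until injectivity is
    proved.\<close>
  define g where "g = case_sum f (\<lambda>x. x)"
  define I where "I = (B - A) <+> C"
  have fI: "finite I" using fB fC by (simp add: I_def)
  have ind: "inj_on g I \<and> independent (g ` I)"
  proof (rule family_independent[OF fI])
    fix d i assume s: "(\<Sum>i\<in>I. d i \<odot> g i) = 0" and i: "i \<in> I"
    have BW: "b \<in> B - A \<Longrightarrow> b \<in> W" for b using B by blast
    define x where "x = (\<Sum>b\<in>B - A. d (Inl b) \<odot> b)"
    define y where "y = (\<Sum>c\<in>C. d (Inr c) \<odot> c)"
    have x: "x \<in> W" unfolding x_def using BW by (intro subspace_sum subspace_scale W)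
    have "f x = (\<Sum>b\<in>B - A. d (Inl b) \<odot> f b)" unfolding x_def using BW by (rule linear_into_sum[OF f W(1)])
    then have fxy: "f x + y = 0" using s fB fC unfolding I_def y_def by (simp add: sum.Plus g_def)
    have yL: "y \<in> L" unfolding y_def using C by (intro subspace_sum subspace_scale L) auto
    have "f x = - y" using fxy by (simp add: eq_neg_iff_add_eq_0)
    then have fx0: "f x = 0" using inter[OF x] yL subspace_neg[OF L(1)] by simp
    then have "y = 0" using fxy by simp
    then have dC: "d (Inr c) = 0" if "c \<in> C" for c
      using independent_family[OF fC C(2), of "\<lambda>c. d (Inr c)"] that by (simp add: y_def)
    have "x \<in> span A" using fx0 x K A by auto
    then obtain e where e: "x = (\<Sum>a\<in>A. e a \<odot> a)"
      using span_finite[OF finite_subset[OF B(1) fB]] by auto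
    define d' where "d' = (\<lambda>b. if b \<in> A then - e b else d (Inl b))"
    have "(\<Sum>b\<in>B. d' b \<odot> b) = (\<Sum>b\<in>B - A. d' b \<odot> b) + (\<Sum>b\<in>A. d' b \<odot> b)"
      by (rule sum.subset_diff[OF B(1) fB])
    also have "(\<Sum>b\<in>B - A. d' b \<odot> b) = x" unfolding x_def by (intro sum.cong) (auto simp: d'_def)
    also have "(\<Sum>b\<in>A. d' b \<odot> b) = - x" by (simp add: d'_def e sum_negf)
    finally have "(\<Sum>b\<in>B. d' b \<odot> b) = 0" by simp
    then have "d' b = 0" if "b \<in> B" for b using independent_family[OF fB B(3)] that by blast
    then have "d (Inl b) = 0" if "b \<in> B - A" for b using that by (force simp: d'_def)
    then show "d i = 0" using i dC by (auto simp: I_def)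
  qed
  have "g ` I \<subseteq> W'" using B C L linear_intoD(1)[OF f] by (auto simp: g_def I_def)
  then have "card (g ` I) \<le> dim W'" using finite_independent_le_dim[OF W'(2,3)] ind by blast
  moreover have "card (g ` I) = card B - card A + card C"
    using ind fB fC B(1) by (simp add: card_image I_def card_Plus card_Diff_subset finite_subset)
  moreover have "card A \<le> card B" using card_mono[OF fB B(1)] .
  ultimately show ?thesis using A C cB by simp
qed

end

subsection \<open>Determinants of operators commuting with a complex structure\<close>

text \<open>\<open>V\<close> is a subspace and not a type, so matrices refer to an ordered basis of
  it.\<close>

locale based_complex_structure = real_vs scale for scale :: "real \<Rightarrow> 'b::ab_group_add \<Rightarrow> 'b" (infixr "\<odot>" 75) +
  fixes V :: "'b set" and S :: "'b \<Rightarrow> 'b" and bs :: "'b list"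
  assumes bs: "distinct bs" "independent (set bs)" "span (set bs) = V"
    and S: "linear_into V S V" "\<And>x. x \<in> V \<Longrightarrow> S (S x) = - x"
begin

abbreviation "n \<equiv> length bs"

definition coord :: "'b \<Rightarrow> nat \<Rightarrow> real" where "coord x i = representation (set bs) x (bs ! i)"

lemma subspace_V: "subspace V" using bs(3) subspace_span by blast

lemma bs_in_V: "k < n \<Longrightarrow> bs ! k \<in> V"
  using span_base[of "bs ! k" "set bs"] bs(3) by simp

lemma coord_simps:
  assumes "x \<in> V"
  shows "y \<in> V \<Longrightarrow> coord (x + y) i = coord x i + coord y i" "y \<in> V \<Longrightarrow> coord (x - y) i = coord x i - coord y i"
    "coord (c \<odot> x) i = c * coord x i" "coord (- x) i = - coord x i"
  using assms bs unfolding coord_def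
  by (simp_all add: representation_add representation_diff representation_scale representation_neg)

lemma coord_basis: "k < n \<Longrightarrow> i < n \<Longrightarrow> coord (bs ! k) i = (if i = k then 1 else 0)"
  using bs by (simp add: coord_def representation_basis nth_eq_iff_index_eq)

lemma coord_expand: "x \<in> V \<Longrightarrow> x = (\<Sum>j<n. coord x j \<odot> bs ! j)"
proof -
  assume "x \<in> V"
  then have "x = (\<Sum>b\<in>set bs. representation (set bs) x b \<odot> b)"
    using sum_representation_eq[OF bs(2), of x "set bs"] bs(3) by simp
  also have "\<dots> = (\<Sum>j<n. coord x j \<odot> bs ! j)"
    unfolding coord_def by (rule sum.reindex_bij_betw[symmetric, OF bij_betw_nth]) (simp_all add: bs)
  finally show ?thesis .
qed

lemma coord_apply:
  assumes f: "linear_into V f V" and x: "x \<in> V"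
  shows "coord (f x) i = (\<Sum>j<n. coord x j * coord (f (bs ! j)) i)"
proof -
  have fb: "f (bs ! j) \<in> span (set bs)" if "j < n" for j using linear_intoD(1)[OF f bs_in_V[OF that]] bs(3) by simp
  have "f x = (\<Sum>j<n. coord x j \<odot> f (bs ! j))"
    by (subst coord_expand[OF x]) (rule linear_into_sum[OF f subspace_V], simp add: bs_in_V)
  moreover have "representation (set bs) (\<Sum>j<n. coord x j \<odot> f (bs ! j)) (bs ! i)
      = (\<Sum>j<n. coord x j * representation (set bs) (f (bs ! j)) (bs ! i))"
    by (subst representation_sum[OF bs(2)]) (auto intro!: span_scale fb simp: representation_scale[OF bs(2) fb])
  ultimately show ?thesis by (simp only: coord_def)
qed

text \<open>The matrix of f + i g on the complexification of \<open>V\<close>.\<close>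

definition cmat :: "('b \<Rightarrow> 'b) \<Rightarrow> ('b \<Rightarrow> 'b) \<Rightarrow> complex mat" where
  "cmat f g = mat n n (\<lambda>(i, k). Complex (coord (f (bs ! k)) i) (coord (g (bs ! k)) i))"

lemma cmat_carrier: "cmat f g \<in> carrier_mat n n" by (simp add: cmat_def)

lemma cmat_cong: "(\<And>x. x \<in> V \<Longrightarrow> f x = f' x) \<Longrightarrow> (\<And>x. x \<in> V \<Longrightarrow> g x = g' x) \<Longrightarrow> cmat f g = cmat f' g'"
  unfolding cmat_def by (intro cong_mat) (simp_all add: bs_in_V)

lemma cmat_mult:
  assumes f: "linear_into V f V" "linear_into V g V" and f': "linear_into V f' V" "linear_into V g' V"
  shows "cmat f g * cmat f' g' = cmat (\<lambda>x. f (f' x) - g (g' x)) (\<lambda>x. f (g' x) + g (f' x))"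
proof (rule eq_matI)
  fix i k assume "i < dim_row (cmat (\<lambda>x. f (f' x) - g (g' x)) (\<lambda>x. f (g' x) + g (f' x)))"
    "k < dim_col (cmat (\<lambda>x. f (f' x) - g (g' x)) (\<lambda>x. f (g' x) + g (f' x)))"
  then have ik: "i < n" "k < n" by (auto simp: cmat_def)
  let ?b = "bs ! k"
  have v: "f' ?b \<in> V" "g' ?b \<in> V" using linear_intoD(1)[OF f'(1)] linear_intoD(1)[OF f'(2)] bs_in_V[OF ik(2)] by auto
  have v2: "f (f' ?b) \<in> V" "g (g' ?b) \<in> V" "f (g' ?b) \<in> V" "g (f' ?b) \<in> V"
    using v linear_intoD(1)[OF f(1)] linear_intoD(1)[OF f(2)] by auto
  have "(cmat f g * cmat f' g') $$ (i, k) = (\<Sum>j<n. Complex (coord (f (bs ! j)) i) (coord (g (bs ! j)) i)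
      * Complex (coord (f' ?b) j) (coord (g' ?b) j))"
    using ik by (simp add: cmat_def scalar_prod_def atLeast0LessThan)
  also have "\<dots> = Complex (coord (f (f' ?b)) i - coord (g (g' ?b)) i) (coord (f (g' ?b)) i + coord (g (f' ?b)) i)"
    unfolding coord_apply[OF f(1) v(1)] coord_apply[OF f(1) v(2)] coord_apply[OF f(2) v(1)] coord_apply[OF f(2) v(2)]
    by (simp add: complex_eq_iff sum_subtractf sum.distrib mult.commute)
  finally show "(cmat f g * cmat f' g') $$ (i, k) = cmat (\<lambda>x. f (f' x) - g (g' x)) (\<lambda>x. f (g' x) + g (f' x)) $$ (i, k)"
    using ik v2 by (simp add: cmat_def coord_simps)
qed (simp_all add: cmat_def)

lemma cmat_double:
  assumes "linear_into V f V" "linear_into V g V"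
  shows "cmat (\<lambda>x. f x + f x) (\<lambda>x. g x + g x) = 2 \<cdot>\<^sub>m cmat f g"
  using linear_intoD(1)[OF assms(1) bs_in_V] linear_intoD(1)[OF assms(2) bs_in_V]
  by (intro eq_matI) (auto simp: cmat_def coord_simps complex_eq_iff)

lemma cmat_id: "cmat (\<lambda>x. x) (\<lambda>x. 0) = 1\<^sub>m n"
  using coord_simps(3)[OF subspace_0[OF subspace_V], of 0]
  by (intro eq_matI) (auto simp: cmat_def coord_basis complex_eq_iff)

definition commuting :: "('b \<Rightarrow> 'b) \<Rightarrow> bool" where
  "commuting \<rho> \<longleftrightarrow> linear_into V \<rho> V \<and> (\<forall>x\<in>V. \<rho> (S x) = S (\<rho> x))"

text \<open>
  With \<open>P = (1 - i S) / 2\<close>, the projection of the complexification to the \<open>i\<close>-eigenspace of \<open>S\<close>,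
  this is the matrix of \<open>2 (\<rho> P + (1 - P))\<close>, so \<open>Cdet \<rho>\<close> is, up to the factor \<open>2 ^ n\<close>, the
  determinant of \<open>\<rho>\<close> as a map which is complex linear with respect to \<open>S\<close>.
\<close>

definition Cmat :: "('b \<Rightarrow> 'b) \<Rightarrow> complex mat" where
  "Cmat \<rho> = cmat (\<lambda>x. \<rho> x + x) (\<lambda>x. S x - \<rho> (S x))"

text \<open>The conjugate of \<open>Cmat\<close>: the matrix of
  \<open>2 (\<rho> Q + (1 - Q))\<close> with \<open>Q = (1 + i S) / 2\<close>, the projection to the
  other eigenspace of \<open>S\<close>.\<close>

definition Cmat' :: "('b \<Rightarrow> 'b) \<Rightarrow> complex mat" where
  "Cmat' \<rho> = cmat (\<lambda>x. \<rho> x + x) (\<lambda>x. \<rho> (S x) - S x)"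

definition Cdet :: "('b \<Rightarrow> 'b) \<Rightarrow> complex" where "Cdet \<rho> = det (Cmat \<rho>)"

lemma Cmat_carrier: "Cmat \<rho> \<in> carrier_mat n n" "Cmat' \<rho> \<in> carrier_mat n n"
  by (simp_all add: Cmat_def Cmat'_def cmat_carrier)

lemma commutingD:
  assumes "commuting \<rho>"
  shows "linear_into V \<rho> V" "x \<in> V \<Longrightarrow> \<rho> (S x) = S (\<rho> x)" "x \<in> V \<Longrightarrow> \<rho> x \<in> V"
    "x \<in> V \<Longrightarrow> y \<in> V \<Longrightarrow> \<rho> (x + y) = \<rho> x + \<rho> y" "x \<in> V \<Longrightarrow> y \<in> V \<Longrightarrow> \<rho> (x - y) = \<rho> x - \<rho> y"
    "x \<in> V \<Longrightarrow> \<rho> (- x) = - \<rho> x"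
  using assms linear_intoD[of V \<rho> V] linear_into_diff[OF _ subspace_V] linear_into_neg[OF _ subspace_V]
  by (auto simp: commuting_def)

lemmas S_simps = linear_intoD(1,2)[OF S(1)] linear_into_diff[OF S(1) subspace_V] linear_into_neg[OF S(1) subspace_V] S(2)
lemmas V_simps = subspace_add[OF subspace_V] subspace_diff[OF subspace_V] subspace_neg[OF subspace_V] subspace_scale[OF subspace_V]

lemma commuting_parts:
  assumes "commuting \<rho>"
  shows "linear_into V (\<lambda>x. \<rho> x + x) V" "linear_into V (\<lambda>x. S x - \<rho> (S x)) V" "linear_into V (\<lambda>x. \<rho> (S x) - S x) V"
  using commutingD[OF assms] linear_intoD(3)[OF S(1)] linear_intoD(3)[OF commutingD(1)[OF assms]]
  by (auto simp: linear_into_def S_simps V_simps algebra_simps scale_right_distrib scale_right_diff_distrib)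

lemma commuting_compose: "commuting \<rho> \<Longrightarrow> commuting \<sigma> \<Longrightarrow> commuting (\<lambda>x. \<rho> (\<sigma> x))"
  by (auto simp: commuting_def linear_into_def)

text \<open>As \<rho> and \<sigma> commute with the projection \<open>P\<close>, the product of
  \<open>\<rho> P + (1 - P)\<close> and \<open>\<sigma> P + (1 - P)\<close> is
  \<open>\<rho> \<sigma> P + (1 - P)\<close>; of the two factors 2 one remains in front.\<close>

lemma Cmat_mult:
  assumes \<rho>: "commuting \<rho>" and \<sigma>: "commuting \<sigma>"
  shows "Cmat \<rho> * Cmat \<sigma> = 2 \<cdot>\<^sub>m Cmat (\<lambda>x. \<rho> (\<sigma> x))"
proof -
  note r = commutingD(2-)[OF \<rho>] and s = commutingD(2-)[OF \<sigma>]
  have "Cmat \<rho> * Cmat \<sigma> = cmat (\<lambda>x. (\<rho> (\<sigma> x) + x) + (\<rho> (\<sigma> x) + x)) (\<lambda>x. (S x - \<rho> (\<sigma> (S x))) + (S x - \<rho> (\<sigma> (S x))))"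
    unfolding Cmat_def cmat_mult[OF commuting_parts(1,2)[OF \<rho>] commuting_parts(1,2)[OF \<sigma>]]
    by (rule cmat_cong) (simp_all add: r s S_simps V_simps algebra_simps)
  also have "\<dots> = 2 \<cdot>\<^sub>m Cmat (\<lambda>x. \<rho> (\<sigma> x))"
    unfolding Cmat_def by (rule cmat_double) (rule commuting_parts[OF commuting_compose[OF \<rho> \<sigma>]])+
  finally show ?thesis .
qed

lemma Cdet_mult:
  assumes "commuting \<rho>" "commuting \<sigma>"
  shows "Cdet \<rho> * Cdet \<sigma> = 2 ^ n * Cdet (\<lambda>x. \<rho> (\<sigma> x))"
  using det_mult[OF Cmat_carrier(1) Cmat_carrier(1), of \<rho> \<sigma>]
  by (simp add: Cdet_def Cmat_mult[OF assms] det_smult carrier_matD(2)[OF Cmat_carrier(1)])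

lemma Cdet_id: "Cdet (\<lambda>x. x) = 2 ^ n"
proof -
  have "Cmat (\<lambda>x. x) = cmat (\<lambda>x. x + x) (\<lambda>x. 0 + 0)" unfolding Cmat_def by simp
  also have "\<dots> = 2 \<cdot>\<^sub>m 1\<^sub>m n"
    unfolding cmat_id[symmetric]
    by (rule cmat_double) (auto simp: linear_into_def subspace_0[OF subspace_V])
  finally show ?thesis by (simp add: Cdet_def det_smult)
qed

lemma det_Cmat': 
  assumes "commuting \<rho>" shows "det (Cmat' \<rho>) = cnj (Cdet \<rho>)"
proof -
  interpret cnj: comm_ring_hom cnj by unfold_locales auto
  have "Cmat' \<rho> = map_mat cnj (Cmat \<rho>)"
    using commutingD[OF assms] by (intro eq_matI) (auto simp: Cmat_def Cmat'_def cmat_def bs_in_V coord_simps S_simps complex_eq_iff)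
  then show ?thesis by (simp add: Cdet_def)
qed

text \<open>\<open>T\<close> exchanges the two eigenspaces of \<open>S\<close>, so it intertwines
  \<open>Cmat \<sigma>\<close> with its conjugate \<open>Cmat' \<sigma>\<close>; as \<open>T\<close>
  is invertible, the determinant equals its own conjugate.\<close>

lemma Cdet_real:
  assumes \<sigma>: "commuting \<sigma>" and T: "linear_into V T V" "\<And>x. x \<in> V \<Longrightarrow> T (T x) = x"
    "\<And>x. x \<in> V \<Longrightarrow> T (S x) = - S (T x)" "\<And>x. x \<in> V \<Longrightarrow> T (\<sigma> x) = \<sigma> (T x)"
  shows "Cdet \<sigma> \<in> \<real>"
proof -
  have z: "linear_into V (\<lambda>x. 0) V" by (auto simp: linear_into_def subspace_0[OF subspace_V])
  note s = commutingD(2-)[OF \<sigma>]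
  note t = linear_intoD(1,2)[OF T(1)] linear_into_diff[OF T(1) subspace_V] linear_into_neg[OF T(1) subspace_V] T(2-)
  let ?T = "cmat T (\<lambda>x. 0)"
  have "?T * Cmat \<sigma> = Cmat' \<sigma> * ?T"
    unfolding Cmat_def Cmat'_def cmat_mult[OF T(1) z commuting_parts(1,2)[OF \<sigma>]]
      cmat_mult[OF commuting_parts(1,3)[OF \<sigma>] T(1) z]
    by (rule cmat_cong)
      (simp_all add: s t S_simps V_simps linear_into_zero[OF S(1) subspace_V] linear_into_zero[OF commutingD(1)[OF \<sigma>] subspace_V]
        algebra_simps)
  then have "det ?T * Cdet \<sigma> = det (Cmat' \<sigma>) * det ?T"
    using det_mult[OF cmat_carrier Cmat_carrier(1), of T "\<lambda>x. 0" \<sigma>]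
      det_mult[OF Cmat_carrier(2) cmat_carrier, of \<sigma> T "\<lambda>x. 0"] by (auto simp: Cdet_def)
  moreover have "det ?T \<noteq> 0"
  proof -
    have "?T * ?T = cmat (\<lambda>x. x) (\<lambda>x. 0)"
      unfolding cmat_mult[OF T(1) z T(1) z] by (rule cmat_cong) (simp_all add: t linear_into_zero[OF T(1) subspace_V])
    then have "det ?T * det ?T = 1" using det_mult[OF cmat_carrier cmat_carrier, of T "\<lambda>x. 0" T "\<lambda>x. 0"] by (simp add: cmat_id)
    then show ?thesis by auto
  qed
  ultimately have "Cdet \<sigma> = cnj (Cdet \<sigma>)" by (simp add: det_Cmat'[OF \<sigma>])
  then show ?thesis by (metis Reals_cnj_iff)
qed

lemma Cdet_real_compose:
  assumes "commuting \<rho>" "commuting \<sigma>" "Cdet \<rho> \<in> \<real>" "Cdet \<sigma> \<in> \<real>"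
  shows "Cdet (\<lambda>x. \<rho> (\<sigma> x)) \<in> \<real>"
proof -
  have "Cdet (\<lambda>x. \<rho> (\<sigma> x)) = Cdet \<rho> * Cdet \<sigma> / 2 ^ n" using Cdet_mult[OF assms(1,2)] by simp
  then show ?thesis using assms by (simp add: Reals_mult Reals_divide Reals_power)
qed

text \<open>With \<open>P\<close> and \<open>Q\<close> the projections to the eigenspaces of
  \<open>S\<close> for i and -i, \<open>Cmat \<rho> * Cmat' \<rho>'\<close> is the matrix of
  \<open>4 (\<rho> P + \<rho>' Q)\<close>. On the two parts of \<open>bs ! k\<close> both \<rho> and
  its inverse act by \<open>cis (\<theta> k)\<close>, because inversion and conjugation cancel; so
  the product is diagonal although \<open>S\<close> need not be. \<open>Cdet \<rho>'\<close> is
  \<open>4 ^ n / Cdet \<rho>\<close>, hence real, and the conjugation drops out of the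
  determinant.\<close>

lemma prod_eigenvalues_1:
  assumes \<rho>: "commuting \<rho>" "commuting \<rho>'" and inv: "\<And>x. x \<in> V \<Longrightarrow> \<rho> (\<rho>' x) = x" "\<And>x. x \<in> V \<Longrightarrow> \<rho>' (\<rho> x) = x"
    and real: "Cdet \<rho> \<in> \<real>"
    and eig: "\<And>k. k < n \<Longrightarrow> \<rho> (bs ! k) = cos (\<theta> k) \<odot> bs ! k + sin (\<theta> k) \<odot> S (bs ! k)"
  shows "(\<Prod>k<n. cis (\<theta> k)) = 1"
proof -
  note r = commutingD(2-)[OF \<rho>(1)] and r' = commutingD(2-)[OF \<rho>(2)]
  have inv_eig: "\<rho>' (bs ! k) = cos (\<theta> k) \<odot> bs ! k - sin (\<theta> k) \<odot> S (bs ! k)" if k: "k < n" for k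
  proof -
    let ?b = "bs ! k" and ?c = "cos (\<theta> k)" and ?s = "sin (\<theta> k)"
    have b: "?b \<in> V" using bs_in_V[OF k] .
    have "\<rho> (?c \<odot> ?b - ?s \<odot> S ?b) = ?c \<odot> \<rho> ?b - ?s \<odot> S (\<rho> ?b)"
      using b r linear_intoD(3)[OF commutingD(1)[OF \<rho>(1)]] by (simp add: S_simps V_simps)
    also have "\<dots> = (?c * ?c) \<odot> ?b + (?s * ?s) \<odot> ?b"
      using b linear_intoD(3)[OF S(1)]
      by (simp add: eig[OF k] S_simps V_simps scale_right_distrib scale_left_distrib scale_right_diff_distrib mult.commute)
    also have "\<dots> = (?c * ?c + ?s * ?s) \<odot> ?b" by (simp only: scale_left_distrib)
    also have "?c * ?c + ?s * ?s = 1" using sin_cos_squared_add2[of "\<theta> k"] by (simp add: power2_eq_square)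
    finally have "\<rho> (?c \<odot> ?b - ?s \<odot> S ?b) = ?b" by simp
    then show ?thesis using inv(2)[of "?c \<odot> ?b - ?s \<odot> S ?b"] b by (simp add: S_simps V_simps)
  qed
  have "Cmat \<rho> * Cmat' \<rho>' = cmat (\<lambda>x. (\<rho> x + \<rho>' x) + (\<rho> x + \<rho>' x)) (\<lambda>x. (S (\<rho>' x) - \<rho> (S x)) + (S (\<rho>' x) - \<rho> (S x)))"
    unfolding Cmat_def Cmat'_def cmat_mult[OF commuting_parts(1,2)[OF \<rho>(1)] commuting_parts(1,3)[OF \<rho>(2)]]
    by (rule cmat_cong) (simp_all add: r r' inv S_simps V_simps algebra_simps)
  also have "\<dots> = mat n n (\<lambda>(i, k). if i = k then 4 * cis (\<theta> k) else 0)"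
    unfolding cmat_def
  proof (rule cong_mat)
    fix i k assume ik: "i < n" "k < n"
    let ?b = "bs ! k"
    have b: "?b \<in> V" using bs_in_V[OF ik(2)] .
    have "\<rho> ?b + \<rho>' ?b = (2 * cos (\<theta> k)) \<odot> ?b"
      unfolding eig[OF ik(2)] inv_eig[OF ik(2)] mult_2 scale_left_distrib by simp
    moreover have "S (\<rho>' ?b) - \<rho> (S ?b) = (2 * sin (\<theta> k)) \<odot> ?b"
    proof -
      have "S (\<rho>' ?b) = cos (\<theta> k) \<odot> S ?b + sin (\<theta> k) \<odot> ?b"
        unfolding inv_eig[OF ik(2)] using b linear_intoD(3)[OF S(1)] by (simp add: S_simps V_simps)
      moreover have "S (\<rho> ?b) = cos (\<theta> k) \<odot> S ?b - sin (\<theta> k) \<odot> ?b"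
        unfolding eig[OF ik(2)] using b linear_intoD(3)[OF S(1)] by (simp add: S_simps V_simps)
      moreover have "(2 * sin (\<theta> k)) \<odot> ?b = sin (\<theta> k) \<odot> ?b + sin (\<theta> k) \<odot> ?b"
        unfolding mult_2 by (rule scale_left_distrib)
      ultimately show ?thesis using r(1)[OF b] by simp
    qed
    ultimately show "(case (i, k) of (i, k) \<Rightarrow> Complex (coord (\<rho> (bs ! k) + \<rho>' (bs ! k) + (\<rho> (bs ! k) + \<rho>' (bs ! k))) i)
        (coord (S (\<rho>' (bs ! k)) - \<rho> (S (bs ! k)) + (S (\<rho>' (bs ! k)) - \<rho> (S (bs ! k)))) i))
      = (case (i, k) of (i, k) \<Rightarrow> if i = k then 4 * cis (\<theta> k) else 0)"
      using b ik by (simp add: coord_simps V_simps coord_basis complex_eq_iff)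
  qed simp_all
  finally have prod: "Cmat \<rho> * Cmat' \<rho>' = mat n n (\<lambda>(i, k). if i = k then 4 * cis (\<theta> k) else 0)" .
  have "det (mat n n (\<lambda>(i, k). if i = k then 4 * cis (\<theta> k) else 0)) = (\<Prod>k<n. 4 * cis (\<theta> k))"
    by (subst det_upper_triangular[of _ n]) (auto simp: upper_triangular_def prod_list_diag_prod atLeast0LessThan)
  also have "\<dots> = 4 ^ n * (\<Prod>k<n. cis (\<theta> k))" by (simp add: prod.distrib)
  finally have 1: "Cdet \<rho> * cnj (Cdet \<rho>') = 4 ^ n * (\<Prod>k<n. cis (\<theta> k))"
    using det_mult[OF Cmat_carrier(1) Cmat_carrier(2), of \<rho> \<rho>'] det_Cmat'[OF \<rho>(2)] by (simp add: Cdet_def prod)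
  have "Cmat (\<lambda>x. \<rho> (\<rho>' x)) = Cmat (\<lambda>x. x)"
    unfolding Cmat_def by (rule cmat_cong) (simp_all add: inv S_simps)
  then have 2: "Cdet \<rho> * Cdet \<rho>' = 4 ^ n"
    using Cdet_mult[OF \<rho>] Cdet_id by (simp add: Cdet_def flip: power_mult_distrib)
  then have "Cdet \<rho>' = 4 ^ n / Cdet \<rho>" by (cases "Cdet \<rho> = 0") (auto simp: field_simps)
  then have "Cdet \<rho>' \<in> \<real>" using real by (simp add: Reals_divide Reals_power)
  then have "cnj (Cdet \<rho>') = Cdet \<rho>'" by (simp add: Reals_cnj_iff)
  then show ?thesis using 1 2 by simp
qed

end

section \<open>Operators of finite order commuting with a complex structure\<close>

context real_vs
begin

definition eigenspace_of :: "'b set \<Rightarrow> ('b \<Rightarrow> 'b) \<Rightarrow> ('b \<Rightarrow> 'b) \<Rightarrow> real \<Rightarrow> 'b set" where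
  "eigenspace_of V S \<rho> \<theta> = {x \<in> V. \<rho> x = cos \<theta> \<odot> x + sin \<theta> \<odot> S x}"

text \<open>Since the r-th power of \<rho> is the identity, \<open>V\<close> is the direct sum of
  its eigenspaces, and a basis adapted to the sum fits \<open>prod_eigenvalues_1\<close>: the angles
  2 pi j / r, each counted with the real dimension, add up to a multiple of 2 pi. The factorisation
  of \<rho> gives the reality of \<open>Cdet \<rho>\<close> factor by factor.\<close>

theorem eigenvalue_sum_divisible:
  fixes V S \<rho> and r :: nat
  assumes V: "subspace V" "finite F" "V \<subseteq> span F"
    and S: "linear_into V S V" "\<And>x. x \<in> V \<Longrightarrow> S (S x) = - x"
    and \<rho>: "\<And>x. x \<in> V \<Longrightarrow> (\<rho> ^^ r) x = x" and r: "r > 0"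
    and \<sigma>s: "\<And>x. x \<in> V \<Longrightarrow> \<rho> x = foldr (\<lambda>\<sigma> y. \<sigma> y) \<sigma>s x"
    and \<sigma>: "\<And>\<sigma>. \<sigma> \<in> set \<sigma>s \<Longrightarrow> linear_into V \<sigma> V \<and> (\<forall>x\<in>V. \<sigma> (S x) = S (\<sigma> x)) \<and>
      (\<exists>T. linear_into V T V \<and> (\<forall>x\<in>V. T (T x) = x \<and> T (S x) = - S (T x) \<and> T (\<sigma> x) = \<sigma> (T x)))"
  shows "r dvd (\<Sum>j<r. j * dim (eigenspace_of V S \<rho> (2 * pi * real j / real r)))"
proof -
  define U where "U = (\<lambda>j. eigenspace_of V S \<rho> (2 * pi * real j / real r))"
  \<comment> \<open>Makes \<open>V\<close> a complex vector space in which \<open>S\<close> is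
    multiplication by i.\<close>
  define act where "act = (\<lambda>c x. Re c \<odot> x + Im c \<odot> S x)"
  define \<zeta> where "\<zeta> = (\<lambda>k::int. unit_char (of_int k / real r))"
  have \<zeta>: "\<zeta> (k + l) = \<zeta> k * \<zeta> l" "\<zeta> 0 = 1" "\<zeta> (int r * k) = 1" for k l
    using r by (simp_all add: \<zeta>_def add_divide_distrib unit_char_simps unit_char_int)
  note Vs = subspace_add[OF V(1)] subspace_diff[OF V(1)] subspace_neg[OF V(1)] subspace_scale[OF V(1)] subspace_0[OF V(1)]
  note Ss = linear_intoD[OF S(1)]
  have commute_foldr: "linear_into V (foldr (\<lambda>\<sigma> y. \<sigma> y) \<tau>s) V \<and> (\<forall>x\<in>V. foldr (\<lambda>\<sigma> y. \<sigma> y) \<tau>s (S x) = S (foldr (\<lambda>\<sigma> y. \<sigma> y) \<tau>s x))"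
    if "set \<tau>s \<subseteq> set \<sigma>s" for \<tau>s
    using that
  proof (induction \<tau>s)
    case (Cons \<tau> \<tau>s)
    then show ?case using \<sigma>[of \<tau>] by (auto simp: linear_into_def)
  qed (simp add: linear_into_def)
  have \<rho>V: "linear_into V \<rho> V" and \<rho>S: "\<And>x. x \<in> V \<Longrightarrow> \<rho> (S x) = S (\<rho> x)"
    using commute_foldr[of \<sigma>s] \<sigma>s Vs Ss by (auto simp: linear_into_def)
  note rs = linear_intoD[OF \<rho>V]
  have act: "x \<in> V \<Longrightarrow> act c x \<in> V" "x \<in> V \<Longrightarrow> act c (act d x) = act (c * d) x"
    "x \<in> V \<Longrightarrow> y \<in> V \<Longrightarrow> act c (x + y) = act c x + act c y" "x \<in> V \<Longrightarrow> act (c + d) x = act c x + act d x"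
    "act 1 x = x" "x \<in> V \<Longrightarrow> \<rho> (act c x) = act c (\<rho> x)" "act 0 x = 0" for c d x y
    by (simp_all add: act_def Vs Ss rs \<rho>S S(2) scale_right_distrib scale_left_distrib scale_right_diff_distrib
        scale_left_diff_distrib algebra_simps)
  have act_0: "act c 0 = 0" for c using Ss(3)[OF Vs(5), of 0] by (simp add: act_def)
  have act_sum: "act c (\<Sum>i\<in>I. f i) = (\<Sum>i\<in>I. act c (f i))" if "\<And>i. i \<in> I \<Longrightarrow> f i \<in> V" for c I and f :: "'i \<Rightarrow> 'b"
    using that by (induction I rule: infinite_finite_induct) (simp_all add: act_0 act subspace_sum[OF V(1)])
  have act_sum_left: "act (\<Sum>i\<in>I. c i) x = (\<Sum>i\<in>I. act (c i) x)" if "x \<in> V" for I x and c :: "'i \<Rightarrow> complex"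
    by (induction I rule: infinite_finite_induct) (simp_all add: act that)
  have act_real: "act (of_real c) x = c \<odot> x" for c x by (simp add: act_def)
  have U: "x \<in> U j \<longleftrightarrow> x \<in> V \<and> \<rho> x = act (\<zeta> (int j)) x" for j x
    by (simp add: U_def eigenspace_of_def act_def \<zeta>_def unit_char_def)
  have U_sub: "subspace (U j)" for j
  proof (rule subspaceI)
    show "0 \<in> U j" using rs(3)[OF Vs(5), of 0] by (simp add: U Vs act_0)
    show "x + y \<in> U j" if "x \<in> U j" "y \<in> U j" for x y using that by (simp add: U Vs rs act)
    show "c \<odot> x \<in> U j" if "x \<in> U j" for c x
      using that act(2)[of x "of_real c" "\<zeta> (int j)"] act(2)[of x "\<zeta> (int j)" "of_real c"]
      by (simp add: U Vs rs act_real mult.commute)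
  qed
  have pow_V: "(\<rho> ^^ t) x \<in> V" if "x \<in> V" for t x using that by (induction t) (simp_all add: rs)
  \<comment> \<open>The usual projection to an eigenspace of an operator of finite order: the
    average of its powers, weighted by the inverse powers of the eigenvalue
    \<open>\<zeta> j\<close>.\<close>
  define \<pi> where "\<pi> = (\<lambda>j x. act (1 / of_nat r) (\<Sum>t<r. act (\<zeta> (- int (j * t))) ((\<rho> ^^ t) x)))"
  have sum_V: "(\<Sum>t<r. act (c t) ((\<rho> ^^ t) x)) \<in> V" if "x \<in> V" for c x
    using that by (intro subspace_sum[OF V(1)] act pow_V)
  have \<pi>U: "\<pi> j x \<in> U j" if x: "x \<in> V" for j x
  proof -
    define f where "f = (\<lambda>t. act (\<zeta> (- int (j * t))) ((\<rho> ^^ t) x))"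
    have fV: "f t \<in> V" for t unfolding f_def by (intro act pow_V x)
    have step: "\<rho> (f t) = act (\<zeta> (int j)) (f (Suc t))" for t
    proof -
      have "\<zeta> (int j) * \<zeta> (- int (j * Suc t)) = \<zeta> (- int (j * t))" by (simp add: algebra_simps flip: \<zeta>)
      then show ?thesis
        unfolding f_def act(2)[OF pow_V[OF x]] act(6)[OF pow_V[OF x]] by (simp only: funpow.simps o_apply)
    qed
    have fr: "f r = f 0" using \<zeta>(3)[of "- int j"] \<rho>[OF x] by (simp add: f_def mult.commute \<zeta>)
    have "\<rho> (\<Sum>t<r. f t) = (\<Sum>t<r. \<rho> (f t))"
      using linear_into_sum[OF \<rho>V V(1), of "{..<r}" f "\<lambda>_. 1"] fV by simp
    also have "\<dots> = act (\<zeta> (int j)) (\<Sum>t<r. f (Suc t))" unfolding step using fV by (simp add: act_sum)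
    also have "(\<Sum>t<r. f (Suc t)) = (\<Sum>t<r. f t)"
    proof -
      have "f 0 + (\<Sum>t<r. f (Suc t)) = (\<Sum>t<Suc r. f t)" by (simp only: sum.lessThan_Suc_shift)
      then show ?thesis using fr by (simp add: add.commute)
    qed
    finally have "\<rho> (\<Sum>t<r. f t) = act (\<zeta> (int j)) (\<Sum>t<r. f t)" .
    moreover have "(\<Sum>t<r. f t) \<in> V" using fV by (intro subspace_sum[OF V(1)])
    ultimately have "\<rho> (act (1 / of_nat r) (\<Sum>t<r. f t)) = act (\<zeta> (int j)) (act (1 / of_nat r) (\<Sum>t<r. f t))"
      by (simp add: act mult.commute)
    then show ?thesis using \<open>(\<Sum>t<r. f t) \<in> V\<close> by (simp add: U \<pi>_def act f_def)
  qed
  have \<pi>_sum: "(\<Sum>j<r. \<pi> j x) = x" if x: "x \<in> V" for x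
  proof -
    have "(\<Sum>j<r. \<pi> j x) = act (1 / of_nat r) (\<Sum>j<r. \<Sum>t<r. act (\<zeta> (- int (j * t))) ((\<rho> ^^ t) x))"
      unfolding \<pi>_def using sum_V[OF x] by (simp add: act_sum)
    also have "(\<Sum>j<r. \<Sum>t<r. act (\<zeta> (- int (j * t))) ((\<rho> ^^ t) x)) = (\<Sum>t<r. act (\<Sum>j<r. \<zeta> (- int (j * t))) ((\<rho> ^^ t) x))"
      by (subst sum.swap) (simp add: act_sum_left pow_V x)
    also have "\<dots> = (\<Sum>t<r. if t = 0 then act (of_nat r) x else 0)"
    proof (rule sum.cong[OF refl])
      fix t assume t: "t \<in> {..<r}"
      have "(\<Sum>j<r. \<zeta> (- int (j * t))) = (\<Sum>j<r. unit_char (real j * of_int (- int t) / real r))" by (simp add: \<zeta>_def)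
      also have "\<dots> = (if int r dvd - int t then of_nat r else 0)" by (rule sum_unit_char_roots[OF r])
      also have "int r dvd - int t \<longleftrightarrow> t = 0" using t by (auto dest: dvd_imp_le)
      finally show "act (\<Sum>j<r. \<zeta> (- int (j * t))) ((\<rho> ^^ t) x) = (if t = 0 then act (of_nat r) x else 0)" by (simp add: act)
    qed
    also have "\<dots> = act (of_nat r) x" using r by simp
    finally show ?thesis using x r by (simp add: act)
  qed
  have \<pi>_U: "\<pi> j x = (if j = k then x else 0)" if x: "x \<in> U k" and jk: "j < r" "k < r" for j k x
  proof -
    have xV: "x \<in> V" using x U by blast
    have pw: "(\<rho> ^^ t) x = act (\<zeta> (int (k * t))) x" for t
    proof (induction t)
      case (Suc t)
      have "(\<rho> ^^ Suc t) x = act (\<zeta> (int (k * t))) (act (\<zeta> (int k)) x)" using Suc x by (simp add: act xV U)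
      then show ?case by (simp add: act xV algebra_simps \<zeta>)
    qed (simp add: \<zeta> act)
    have "(\<Sum>t<r. act (\<zeta> (- int (j * t))) ((\<rho> ^^ t) x)) = act (\<Sum>t<r. unit_char (real t * of_int (int k - int j) / real r)) x"
      unfolding act_sum_left[OF xV] pw
      by (intro sum.cong refl) (simp add: act xV \<zeta>_def algebra_simps diff_divide_distrib add_divide_distrib flip: unit_char_simps)
    also have "(\<Sum>t<r. unit_char (real t * of_int (int k - int j) / real r)) = (if int r dvd int k - int j then of_nat r else 0)"
      by (rule sum_unit_char_roots[OF r])
    also have "int r dvd int k - int j \<longleftrightarrow> j = k"
    proof
      assume "int r dvd int k - int j"
      moreover have "\<bar>int k - int j\<bar> < int r" using jk by simp
      ultimately show "j = k" using dvd_imp_le_int[of "int k - int j" "int r"] by fastforce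
    qed simp
    finally show ?thesis using r by (simp add: \<pi>_def act xV act_0)
  qed
  have \<pi>_add: "\<pi> j (\<Sum>i\<in>I. f i) = (\<Sum>i\<in>I. \<pi> j (f i))" if "\<And>i. i \<in> I \<Longrightarrow> f i \<in> V" for j I and f :: "nat \<Rightarrow> 'b"
  proof -
    have p: "(\<rho> ^^ t) (\<Sum>i\<in>I. f i) = (\<Sum>i\<in>I. (\<rho> ^^ t) (f i))" for t
    proof (induction t)
      case (Suc t)
      then show ?case
        using linear_into_sum[OF \<rho>V V(1), of I "\<lambda>i. (\<rho> ^^ t) (f i)" "\<lambda>_. 1"] pow_V that by simp
    qed simp
    have "(\<Sum>t<r. act (\<zeta> (- int (j * t))) (\<Sum>i\<in>I. (\<rho> ^^ t) (f i)))
      = (\<Sum>i\<in>I. \<Sum>t<r. act (\<zeta> (- int (j * t))) ((\<rho> ^^ t) (f i)))"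
      using that pow_V by (subst sum.swap) (simp add: act_sum)
    then show ?thesis unfolding \<pi>_def p using sum_V[OF that] by (simp only: act_sum)
  qed
  have "\<exists>B. B \<subseteq> U j \<and> independent B \<and> U j \<subseteq> span B \<and> card B = dim (U j)" for j using basis_exists by metis
  then obtain B where B: "\<And>j. B j \<subseteq> U j" "\<And>j. independent (B j)" "\<And>j. U j \<subseteq> span (B j)" "\<And>j. card (B j) = dim (U j)" by metis
  have UV: "U j \<subseteq> V" for j using U by blast
  have finB: "finite (B j)" for j
    using finite_independent_le_dim[OF V(2,3), of "B j"] B UV by blast
  have disj: "B j \<inter> B k = {}" if "j < r" "k < r" "j \<noteq> k" for j k
  proof -
    have "b = 0" if "b \<in> B j" "b \<in> B k" for b
      using \<pi>_U[of b k k] \<pi>_U[of b j k] that \<open>j < r\<close> \<open>k < r\<close> \<open>j \<noteq> k\<close> B(1)[of j] B(1)[of k]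
      by (auto simp: subset_iff)
    then show ?thesis using dependent_zero B(2) by blast
  qed
  define BB where "BB = (\<Union>j<r. B j)"
  have finBB: "finite BB" by (simp add: BB_def finB)
  have spanBB: "span BB = V"
  proof
    have "BB \<subseteq> V" using B(1) UV by (auto simp: BB_def)
    then show "span BB \<subseteq> V" by (rule span_minimal[OF _ V(1)])
    show "V \<subseteq> span BB"
    proof
      fix x assume x: "x \<in> V"
      have "\<pi> j x \<in> span BB" if "j < r" for j
        using \<pi>U[OF x, of j] B(3)[of j] span_mono[of "B j" BB] that by (auto simp: BB_def)
      then have "(\<Sum>j<r. \<pi> j x) \<in> span BB" by (intro span_sum) auto
      then show "x \<in> span BB" using \<pi>_sum[OF x] by simp
    qed
  qed
  have indBB: "independent BB"
  proof -
    have "d b = 0" if s: "(\<Sum>b\<in>BB. d b \<odot> b) = 0" and b: "b \<in> BB" for d b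
    proof -
      obtain k where k: "k < r" "b \<in> B k" using b by (auto simp: BB_def)
      have inU: "(\<Sum>b\<in>B j. d b \<odot> b) \<in> U j" for j using B(1) by (intro subspace_sum[OF U_sub] subspace_scale[OF U_sub]) auto
      have "(\<Sum>b\<in>BB. d b \<odot> b) = (\<Sum>j<r. \<Sum>b\<in>B j. d b \<odot> b)"
        unfolding BB_def using finB disj by (intro sum.UNION_disjoint) auto
      then have "0 = \<pi> k (\<Sum>j<r. \<Sum>b\<in>B j. d b \<odot> b)"
        using s \<pi>_add[of "{}" "\<lambda>_. 0" k] by simp
      also have "\<dots> = (\<Sum>j<r. \<pi> k (\<Sum>b\<in>B j. d b \<odot> b))" using inU UV by (intro \<pi>_add) blast
      also have "\<dots> = (\<Sum>j<r. if j = k then (\<Sum>b\<in>B j. d b \<odot> b) else 0)"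
        using \<pi>_U[OF inU _ k(1)] \<pi>_U[OF inU k(1)] k by (intro sum.cong) auto
      also have "\<dots> = (\<Sum>b\<in>B k. d b \<odot> b)" using k by simp
      finally show ?thesis using independent_family[OF finB B(2)] k by metis
    qed
    then show ?thesis using family_independent[OF finBB, of "\<lambda>b. b"] by auto
  qed
  obtain bs where bs_BB: "set bs = BB" "distinct bs" using finite_distinct_list[OF finBB] by blast
  interpret based_complex_structure scale V S bs
    by unfold_locales (use bs_BB indBB spanBB S in auto)
  define \<rho>' where "\<rho>' = \<rho> ^^ (r - 1)"
  have inv: "\<rho> (\<rho>' x) = x" "\<rho>' (\<rho> x) = x" if "x \<in> V" for x
    using \<rho>[OF that] r funpow_Suc_right[of "r - 1" \<rho>] funpow.simps(2)[of "r - 1" \<rho>] by (auto simp: \<rho>'_def o_def fun_eq_iff)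
  have c\<rho>: "commuting \<rho>" using \<rho>V \<rho>S by (simp add: commuting_def)
  have "commuting (\<rho> ^^ t)" for t
    by (induction t) (use c\<rho> commuting_compose[of \<rho>] in \<open>simp_all add: o_def commuting_def linear_into_def\<close>)
  then have c\<rho>': "commuting \<rho>'" by (simp add: \<rho>'_def)
  have "Cdet (foldr (\<lambda>\<sigma> y. \<sigma> y) \<tau>s) \<in> \<real>" if "set \<tau>s \<subseteq> set \<sigma>s" for \<tau>s
    using that
  proof (induction \<tau>s)
    case Nil
    then show ?case using Cdet_id by (simp add: id_def Reals_power)
  next
    case (Cons \<tau> \<tau>s)
    obtain T where T: "linear_into V T V" "\<forall>x\<in>V. T (T x) = x \<and> T (S x) = - S (T x) \<and> T (\<tau> x) = \<tau> (T x)"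
      using \<sigma>[of \<tau>] Cons.prems by auto
    have c: "commuting \<tau>" using \<sigma>[of \<tau>] Cons.prems by (simp add: commuting_def)
    have "Cdet \<tau> \<in> \<real>" by (rule Cdet_real[OF c T(1)]) (use T(2) in auto)
    moreover have "commuting (foldr (\<lambda>\<sigma> y. \<sigma> y) \<tau>s)" using commute_foldr[of \<tau>s] Cons.prems by (simp add: commuting_def)
    ultimately show ?case using Cdet_real_compose[OF c] Cons by (simp add: o_def)
  qed
  then have "Cdet (foldr (\<lambda>\<sigma> y. \<sigma> y) \<sigma>s) \<in> \<real>" by simp
  moreover have "Cmat (foldr (\<lambda>\<sigma> y. \<sigma> y) \<sigma>s) = Cmat \<rho>" unfolding Cmat_def by (rule cmat_cong) (simp_all add: \<sigma>s S_simps)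
  ultimately have real: "Cdet \<rho> \<in> \<real>" by (simp add: Cdet_def)
  define lab where "lab = (\<lambda>b. THE j. j < r \<and> b \<in> B j)"
  have lab: "lab b = j" if "j < r" "b \<in> B j" for b j
    unfolding lab_def using that disj by (intro the_equality) blast+
  have "(\<Prod>k<length bs. cis (2 * pi * real (lab (bs ! k)) / real r)) = 1"
  proof (rule prod_eigenvalues_1[OF c\<rho> c\<rho>' inv real])
    fix k assume "k < length bs"
    then have "bs ! k \<in> BB" using bs_BB(1) nth_mem[of k bs] by simp
    then obtain j where j: "j < r" "bs ! k \<in> B j" by (auto simp: BB_def)
    then have "bs ! k \<in> U j" using B(1) by blast
    then show "\<rho> (bs ! k) = cos (2 * pi * real (lab (bs ! k)) / real r) \<odot> bs ! k + sin (2 * pi * real (lab (bs ! k)) / real r) \<odot> S (bs ! k)"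
      unfolding lab[OF j] by (simp add: U_def eigenspace_of_def)
  qed
  moreover have "(\<Prod>k<length bs. cis (2 * pi * real (lab (bs ! k)) / real r)) = (\<Prod>b\<in>BB. cis (2 * pi * real (lab b) / real r))"
    unfolding bs_BB(1)[symmetric] by (rule prod.reindex_bij_betw[OF bij_betw_nth]) (simp_all add: bs_BB)
  moreover have "\<dots> = (\<Prod>j<r. \<Prod>b\<in>B j. cis (2 * pi * real (lab b) / real r))"
    unfolding BB_def using finB disj by (intro prod.UNION_disjoint) auto
  moreover have "\<dots> = (\<Prod>j<r. unit_char (real (j * dim (U j)) / real r))"
  proof (intro prod.cong refl)
    fix j assume j: "j \<in> {..<r}"
    have "(\<Prod>b\<in>B j. cis (2 * pi * real (lab b) / real r)) = (\<Prod>b\<in>B j. unit_char (real j / real r))"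
      using j lab by (intro prod.cong) (auto simp: unit_char_def)
    also have "\<dots> = unit_char (real (j * dim (U j)) / real r)" by (simp add: unit_char_power B(4) mult.commute)
    finally show "(\<Prod>b\<in>B j. cis (2 * pi * real (lab b) / real r)) = unit_char (real (j * dim (U j)) / real r)" .
  qed
  moreover have "\<dots> = unit_char (real (\<Sum>j<r. j * dim (U j)) / real r)"
  proof -
    have "(\<Prod>j<r'. unit_char (real (j * dim (U j)) / real r)) = unit_char (real (\<Sum>j<r'. j * dim (U j)) / real r)" for r'
      by (induction r') (simp_all add: unit_char_simps add_divide_distrib)
    then show ?thesis .
  qed
  ultimately have "real (\<Sum>j<r. j * dim (U j)) / real r \<in> \<int>" unfolding unit_char_eq_1_iff[symmetric] by simp
  then have "r dvd (\<Sum>j<r. j * dim (U j))"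
    using of_int_div_of_int_in_Ints_iff[of "int (\<Sum>j<r. j * dim (U j))" "int r", where ?'a = real] r
    by (simp del: of_nat_sum of_nat_mult)
  then show ?thesis by (simp add: U_def)
qed

end

hide_const (open) Determinant.det

section \<open>Eigenspaces of the signature operator\<close>

text \<open>\<open>g0\<close> is the holonomy rotation and \<open>e0\<close> the circle direction.
  The condition \<open>deck\<close> couples the two: a deck transformation with linear part
  \<open>g0 ^^ k\<close> advances along the circle by k / r modulo 1. \<open>generator\<close> asks
  for one with linear part \<open>g0\<close> and an advance of exactly 1 / r.\<close>

locale flat_quotient = seven_space m vol E
  for m :: "'a::euclidean_space \<Rightarrow> 'a \<Rightarrow> real" and vol E +
  fixes \<Gamma> :: "('a \<Rightarrow> 'a) set" and e0 :: 'a and g0 :: "'a \<Rightarrow> 'a" and r :: nat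
  assumes e0: "e0 \<in> E"
    and g0: "linear g0" "\<And>u v. m (g0 u) (g0 v) = m u v" "\<And>vs. vol (map g0 vs) = vol vs" "g0 e0 = e0" "g0 ^^ r = id"
    and r: "r > 0"
    and lattice_shift: "\<And>b. b \<in> Basis \<Longrightarrow> (\<lambda>x. x + b) \<in> \<Gamma>"
    and deck: "\<And>\<gamma>. \<gamma> \<in> \<Gamma> \<Longrightarrow> \<exists>k c. \<gamma> = (\<lambda>x. (g0 ^^ k) x + c) \<and> m c e0 - real k / real r \<in> \<int>"
    and generator: "\<exists>c. (\<lambda>x. g0 x + c) \<in> \<Gamma> \<and> m c e0 = 1 / real r"
begin

sublocale forms: real_vs "form_scale :: real \<Rightarrow> 'a form \<Rightarrow> 'a form"
  unfolding real_vs_def by (rule vector_space_form_scale)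

lemma onb_inner: "e \<in> E \<Longrightarrow> e' \<in> E \<Longrightarrow> m e e' = (if e = e' then 1 else 0)"
  using onb by (auto simp: orthonormal_basis_def)

lemma m_e0: "m e0 e0 = 1"
  using onb_inner[OF e0 e0] by simp

lemma g0_pow: "linear (g0 ^^ k)" "m ((g0 ^^ k) u) ((g0 ^^ k) v) = m u v" "vol (map (g0 ^^ k) vs) = vol vs" "(g0 ^^ k) e0 = e0"
proof -
  show "linear (g0 ^^ k)" by (induction k) (simp_all add: linear_iff linear_add[OF g0(1)] linear_scale[OF g0(1)])
  show "m ((g0 ^^ k) u) ((g0 ^^ k) v) = m u v" by (induction k) (simp_all add: g0)
  show "vol (map (g0 ^^ k) vs) = vol vs"
  proof (induction k)
    case (Suc k)
    have "map (g0 ^^ Suc k) vs = map g0 (map (g0 ^^ k) vs)" by simp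
    then show ?case using g0(3)[of "map (g0 ^^ k) vs"] Suc by (simp add: o_def)
  qed simp
  show "(g0 ^^ k) e0 = e0" by (induction k) (simp_all add: g0)
qed

lemma affine_has_derivative:
  assumes "linear (g :: 'a \<Rightarrow> 'a)"
  shows "((\<lambda>x. g x + c) has_derivative g) (at x)"
proof -
  have "bounded_linear g" using assms by (simp add: linear_conv_bounded_linear)
  from has_derivative_add_const[OF bounded_linear_imp_has_derivative[OF this]] show ?thesis .
qed

lemma pullback_affine:
  assumes "linear (g :: 'a \<Rightarrow> 'a)"
  shows "form_pullback (\<lambda>x. g x + c) \<omega> x vs = \<omega> (g x + c) (map g vs)"
  unfolding form_pullback_def frechet_derivative_at[OF affine_has_derivative[OF assms], symmetric] ..

definition invariant :: "'a form \<Rightarrow> bool" where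
  "invariant \<omega> \<longleftrightarrow> (\<forall>k c. (\<lambda>x. (g0 ^^ k) x + c) \<in> \<Gamma> \<longrightarrow> (\<forall>x vs. \<omega> ((g0 ^^ k) x + c) (map (g0 ^^ k) vs) = \<omega> x vs))"

lemma invariant_iff: "(\<forall>\<gamma>\<in>\<Gamma>. form_pullback \<gamma> \<omega> = \<omega>) \<longleftrightarrow> invariant \<omega>"
proof
  assume "\<forall>\<gamma>\<in>\<Gamma>. form_pullback \<gamma> \<omega> = \<omega>"
  then have "form_pullback (\<lambda>x. (g0 ^^ k) x + c) \<omega> x vs = \<omega> x vs" if "(\<lambda>x. (g0 ^^ k) x + c) \<in> \<Gamma>" for k c x vs
    using that by simp
  then show "invariant \<omega>" by (simp add: invariant_def pullback_affine[OF g0_pow(1)])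
next
  assume i: "invariant \<omega>"
  show "\<forall>\<gamma>\<in>\<Gamma>. form_pullback \<gamma> \<omega> = \<omega>"
  proof
    fix \<gamma> assume \<gamma>: "\<gamma> \<in> \<Gamma>"
    then obtain k c where eq: "\<gamma> = (\<lambda>x. (g0 ^^ k) x + c)" using deck by blast
    have "form_pullback \<gamma> \<omega> x vs = \<omega> x vs" for x vs
      using i \<gamma> unfolding eq pullback_affine[OF g0_pow(1)] invariant_def by blast
    then show "form_pullback \<gamma> \<omega> = \<omega>" by (simp add: fun_eq_iff)
  qed
qed

definition Eig :: "real \<Rightarrow> 'a form set" where
  "Eig l = {\<omega>. smooth_form \<omega> \<and> invariant \<omega> \<and> even_form \<omega> \<and>
    (\<forall>x vs. (\<Sum>e\<in>E. C e (dirderiv e \<omega> x) vs) = l * \<omega> x vs)}"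

lemma even_eigenspace_eq: "even_eigenspace \<Gamma> m vol l = Eig l"
proof -
  have "quotient_form \<Gamma> \<omega> \<longleftrightarrow> smooth_form \<omega> \<and> invariant \<omega>" for \<omega>
    by (auto simp: quotient_form_def smooth_form_def alternating_iff_alt invariant_iff)
  then show ?thesis
    by (auto simp: even_eigenspace_def Eig_def form_scale_def fun_eq_iff signature_operator_eq)
qed

lemma EigD:
  assumes "\<omega> \<in> Eig l"
  shows "smooth_form \<omega>" "invariant \<omega>" "even_form \<omega>" "(\<Sum>e\<in>E. C e (dirderiv e \<omega> x) vs) = l * \<omega> x vs" "even_alt (\<omega> x)"
  using assms smooth_formD(1)[of \<omega> x] by (auto simp: Eig_def even_alt_def even_form_def)

lemma Eig_combine:
  assumes "\<omega> \<in> Eig l" "\<eta> \<in> Eig l"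
  shows "(\<lambda>x vs. a * \<omega> x vs + b * \<eta> x vs) \<in> Eig l"
proof -
  note w = EigD[OF assms(1)] and h = EigD[OF assms(2)]
  have "C e (dirderiv e (\<lambda>x vs. a * \<omega> x vs + b * \<eta> x vs) x) vs
    = a * C e (dirderiv e \<omega> x) vs + b * C e (dirderiv e \<eta> x) vs" for e x vs
    unfolding dirderiv_combine[OF w(1) h(1)]
    using clifford_add[of m vol E e "\<lambda>vs. a *\<^sub>R dirderiv e \<omega> x vs" "\<lambda>vs. b *\<^sub>R dirderiv e \<eta> x vs" vs]
    by (simp add: clifford_scaleR[where ?'a = real, simplified] clifford_scaleR[of m vol E e a "dirderiv e \<omega> x" vs, simplified] clifford_scaleR[of m vol E e b "dirderiv e \<eta> x" vs, simplified])
  then show ?thesis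
    using w h by (auto simp: Eig_def smooth_form_combine invariant_def even_form_def sum.distrib algebra_simps
        simp flip: sum_distrib_left)
qed

lemma subspace_Eig: "forms.subspace (Eig l)"
proof (rule forms.subspaceI)
  have "smooth_form (\<lambda>x vs. 0 :: real)"
    by (simp add: smooth_form_def smooth_zero alt_def linear_zero)
  moreover have "dirderiv e (\<lambda>x vs. 0 :: real) = (\<lambda>x vs. 0)" for e :: 'a by (simp add: dirderiv_def)
  ultimately show "0 \<in> Eig l"
    by (simp add: Eig_def invariant_def even_form_def zero_fun_def clifford_zero)
  show "\<omega> + \<eta> \<in> Eig l" if "\<omega> \<in> Eig l" "\<eta> \<in> Eig l" for \<omega> \<eta>
    using Eig_combine[OF that, of 1 1] by (simp add: plus_fun_def)
  show "form_scale c \<omega> \<in> Eig l" if "\<omega> \<in> Eig l" for c \<omega>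
    using Eig_combine[OF that that, of c 0] by (simp add: form_scale_def)
qed

subsection \<open>Fourier coefficients of invariant forms\<close>

text \<open>Invariance under the lattice translations only. Unlike full invariance it survives a
  derivative or a Clifford multiplication in a single direction that the holonomy may move, so the
  Fourier analysis is done in this class.\<close>

definition periodic_form :: "'a form \<Rightarrow> bool" where
  "periodic_form \<omega> \<longleftrightarrow> smooth_form \<omega> \<and> (\<forall>b\<in>Basis. \<forall>x vs. \<omega> (x + b) vs = \<omega> x vs)"

lemma invariant_periodic:
  assumes "smooth_form \<omega>" "invariant \<omega>" shows "periodic_form \<omega>"
  unfolding periodic_form_def
proof (intro conjI ballI allI)
  fix b x vs assume b: "b \<in> (Basis :: 'a set)"
  have "(\<lambda>x. (g0 ^^ 0) x + b) \<in> \<Gamma>" using lattice_shift[OF b] by simp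
  then have "\<omega> ((g0 ^^ 0) x + b) (map (g0 ^^ 0) vs) = \<omega> x vs" using assms(2) unfolding invariant_def by blast
  then show "\<omega> (x + b) vs = \<omega> x vs" by (simp add: id_def)
qed (rule assms)

lemma periodic_dirderiv: "periodic_form \<omega> \<Longrightarrow> periodic_form (dirderiv v \<omega>)"
proof -
  assume \<omega>: "periodic_form \<omega>"
  have "dirderiv v \<omega> (x + b) vs = dirderiv v \<omega> x vs" if "b \<in> Basis" for x b vs
  proof -
    have s: "smooth_function (\<lambda>x. \<omega> x vs)" using \<omega> by (simp add: periodic_form_def smooth_form_def)
    have "((\<lambda>y. \<omega> (y + b) vs) has_derivative fderiv (\<lambda>y. \<omega> y vs) (x + b)) (at x)"
      using has_derivative_compose[OF has_derivative_add_const[OF has_derivative_ident, of b] smooth_function_has_derivative[OF s]] .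
    then have "((\<lambda>y. \<omega> y vs) has_derivative fderiv (\<lambda>y. \<omega> y vs) (x + b)) (at x)"
      using \<omega> that by (simp add: periodic_form_def)
    then have "fderiv (\<lambda>y. \<omega> y vs) (x + b) = fderiv (\<lambda>y. \<omega> y vs) x" by (rule frechet_derivative_at)
    then show ?thesis by (simp add: dirderiv_def)
  qed
  then show ?thesis using \<omega> smooth_form_dirderiv by (auto simp: periodic_form_def)
qed

lemma periodic_clifford: "periodic_form \<omega> \<Longrightarrow> periodic_form (\<lambda>x. C v (\<omega> x))"
  using smooth_form_clifford(1)[of \<omega> v] by (auto simp: periodic_form_def clifford_expand)

lemma periodic_combine: "periodic_form \<omega> \<Longrightarrow> periodic_form \<eta> \<Longrightarrow> periodic_form (\<lambda>x vs. a * \<omega> x vs + b * \<eta> x vs)"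
  by (simp add: periodic_form_def smooth_form_combine)

definition fc :: "'a \<Rightarrow> 'a form \<Rightarrow> 'a list \<Rightarrow> complex" where
  "fc \<xi> \<omega> vs = fourier \<xi> (\<lambda>x. of_real (\<omega> x vs))"

lemma continuous_coefficient: "smooth_form \<omega> \<Longrightarrow> continuous_on UNIV (\<lambda>x. complex_of_real (\<omega> x vs))"
  using smooth_functionD(3)[OF smooth_formD(2), of \<omega> vs] by (intro continuous_intros)

lemma fc_combine:
  "smooth_form \<omega> \<Longrightarrow> smooth_form \<eta> \<Longrightarrow>
    fc \<xi> (\<lambda>x vs. a * \<omega> x vs + b * \<eta> x vs) vs = of_real a * fc \<xi> \<omega> vs + of_real b * fc \<xi> \<eta> vs"
  using fourier_combine[OF continuous_coefficient continuous_coefficient, of \<omega> \<eta> \<xi> "of_real a" vs "of_real b" vs]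
  by (simp add: fc_def)

lemma fc_clifford:
  assumes "smooth_form \<omega>"
  shows "fc \<xi> (\<lambda>x. C v (\<omega> x)) = C v (fc \<xi> \<omega>)"
proof
  fix vs
  have "fc \<xi> (\<lambda>x. C v (\<omega> x)) vs
    = fourier \<xi> (\<lambda>x. \<Sum>us\<in>clifford_support v. of_real (clifford_coeff v vs us) * of_real (\<omega> x us))"
    by (simp add: fc_def clifford_expand)
  also have "\<dots> = (\<Sum>us\<in>clifford_support v. of_real (clifford_coeff v vs us) * fc \<xi> \<omega> us)"
    unfolding fc_def by (rule fourier_sum) (rule continuous_coefficient[OF assms])
  finally show "fc \<xi> (\<lambda>x. C v (\<omega> x)) vs = C v (fc \<xi> \<omega>) vs" by (simp add: clifford_expand scaleR_conv_of_real)
qed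

lemma fc_dirderiv:
  assumes \<omega>: "periodic_form \<omega>" and \<xi>: "\<xi> \<in> dual_lattice"
  shows "fc \<xi> (dirderiv v \<omega>) vs = \<i> * of_real (2 * pi * (\<xi> \<bullet> v)) * fc \<xi> \<omega> vs"
  unfolding fc_def
proof (rule fourier_derivative)
  have s: "smooth_form \<omega>" using \<omega> by (simp add: periodic_form_def)
  show "continuous_on UNIV (\<lambda>x. complex_of_real (\<omega> x vs))" "continuous_on UNIV (\<lambda>x. complex_of_real (dirderiv v \<omega> x vs))"
    using continuous_coefficient s smooth_form_dirderiv by blast+
  show "line_derivative (\<lambda>x. complex_of_real (\<omega> x vs)) v (\<lambda>x. complex_of_real (dirderiv v \<omega> x vs))"
    unfolding line_derivative_def dirderiv_def
    using has_vector_derivative_of_real[OF smooth_line_derivative[OF smooth_formD(2)[OF s]]]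
    by blast
  show "complex_of_real (\<omega> (x + b) vs) = complex_of_real (\<omega> x vs)" if "b \<in> Basis" for b x
    using \<omega> that by (simp add: periodic_form_def)
qed (rule \<xi>)

lemma fc_complete:
  assumes \<omega>: "periodic_form \<omega>" and z: "\<And>\<xi>. \<xi> \<in> dual_lattice \<Longrightarrow> fc \<xi> \<omega> vs = 0"
  shows "\<omega> x vs = 0"
proof (rule ccontr)
  assume "\<omega> x vs \<noteq> 0"
  then have "\<exists>\<xi>\<in>dual_lattice. fourier \<xi> (\<lambda>x. complex_of_real (\<omega> x vs)) \<noteq> 0"
    using \<omega> continuous_coefficient[of \<omega> vs] by (intro fourier_complete[where x = x]) (auto simp: periodic_form_def)
  then show False using z by (auto simp: fc_def)
qed

lemma fc_even_alt:
  assumes \<omega>: "smooth_form \<omega>" "even_form \<omega>" shows "even_alt (fc \<xi> \<omega>)"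
proof -
  note c = continuous_coefficient[OF \<omega>(1)] and a = smooth_formD(1)[OF \<omega>(1)]
  have z: "fourier \<xi> (\<lambda>x. 0) = 0" using fourier_combine[of "\<lambda>x. 0" "\<lambda>x. 0" \<xi> 0 0] by simp
  have "linear (\<lambda>v. fc \<xi> \<omega> (us @ v # vs))" for us vs
  proof (rule linearI)
    fix v w and t :: real
    show "fc \<xi> \<omega> (us @ (v + w) # vs) = fc \<xi> \<omega> (us @ v # vs) + fc \<xi> \<omega> (us @ w # vs)"
      using fourier_combine[OF c[of "us @ v # vs"] c[of "us @ w # vs"], of \<xi> 1 1] by (simp add: fc_def alt_add[OF a])
    show "fc \<xi> \<omega> (us @ (t *\<^sub>R v) # vs) = t *\<^sub>R fc \<xi> \<omega> (us @ v # vs)"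
      using fourier_combine[OF c[of "us @ v # vs"] c[of "us @ v # vs"], of \<xi> "of_real t" 0]
      by (simp add: fc_def alt_scale[OF a] scaleR_conv_of_real)
  qed
  moreover have "fc \<xi> \<omega> (us @ v # v # vs) = 0" for us v vs by (simp add: fc_def alt_adj[OF a] z)
  moreover have "fc \<xi> \<omega> vs = 0" if "odd (length vs)" for vs using \<omega>(2) that by (simp add: fc_def even_form_def z)
  ultimately show ?thesis by (simp add: even_alt_def alt_def)
qed

text \<open>The vector dual to \<xi> with respect to \<open>m\<close>; \<open>qform \<xi>\<close> is
  its squared length, by \<open>m_freq\<close>.\<close>

definition freq :: "'a \<Rightarrow> 'a" where "freq \<xi> = (\<Sum>e\<in>E. (\<xi> \<bullet> e) *\<^sub>R e)"

definition qform :: "'a \<Rightarrow> real" where "qform \<xi> = (\<Sum>e\<in>E. (\<xi> \<bullet> e)\<^sup>2)"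

lemma m_freq: "m (freq \<xi>) (freq \<xi>) = qform \<xi>"
proof -
  have "m (freq \<xi>) e = \<xi> \<bullet> e" if "e \<in> E" for e
  proof -
    have "m (freq \<xi>) e = (\<Sum>e'\<in>E. if e' = e then \<xi> \<bullet> e else 0)"
      unfolding freq_def inner_product_on_sum(1)[OF ip] using that by (intro sum.cong) (auto simp: onb_inner)
    then show ?thesis using that finite_E by simp
  qed
  then show ?thesis
    by (subst (2) freq_def) (simp add: inner_product_on_sum(2)[OF ip] qform_def power2_eq_square)
qed

lemma clifford_complex_scale: "C v (\<lambda>us. z * f us) vs = z * C v f vs" for z :: complex
  by (rule clifford_linear) (simp add: linear_iff algebra_simps)

text \<open>Each derivative becomes the factor 2 pi i (\<xi> \<bullet> e), and linearity of
  \<open>C\<close> in the vector collects these factors into \<open>freq \<xi>\<close>.\<close>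

lemma fc_eigen:
  assumes \<omega>: "\<omega> \<in> Eig l" and \<xi>: "\<xi> \<in> dual_lattice"
  shows "\<i> * of_real (2 * pi) * C (freq \<xi>) (fc \<xi> \<omega>) vs = of_real l * fc \<xi> \<omega> vs"
proof -
  note w = EigD[OF \<omega>]
  note p = invariant_periodic[OF w(1,2)]
  have a: "alt (fc \<xi> \<omega>)" using fc_even_alt[OF w(1,3)] by (simp add: even_alt_def)
  have d: "fc \<xi> (dirderiv e \<omega>) = (\<lambda>vs. \<i> * of_real (2 * pi * (\<xi> \<bullet> e)) * fc \<xi> \<omega> vs)" for e
    by (rule ext) (rule fc_dirderiv[OF p \<xi>])
  have "of_real l * fc \<xi> \<omega> vs = fourier \<xi> (\<lambda>x. of_real (l * \<omega> x vs))"
    using fc_combine[OF w(1) w(1), of \<xi> l 0 vs] by (simp add: fc_def)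
  also have "\<dots> = fourier \<xi> (\<lambda>x. \<Sum>e\<in>E. 1 * of_real (C e (dirderiv e \<omega> x) vs))"
    by (simp flip: w(4))
  also have "\<dots> = (\<Sum>e\<in>E. 1 * fc \<xi> (\<lambda>x. C e (dirderiv e \<omega> x)) vs)"
    unfolding fc_def by (intro fourier_sum continuous_coefficient smooth_form_clifford smooth_form_dirderiv w)
  also have "\<dots> = (\<Sum>e\<in>E. \<i> * of_real (2 * pi * (\<xi> \<bullet> e)) * C e (fc \<xi> \<omega>) vs)"
    by (simp add: fc_clifford[OF smooth_form_dirderiv[OF w(1)]] d clifford_complex_scale)
  also have "\<dots> = \<i> * of_real (2 * pi) * C (freq \<xi>) (fc \<xi> \<omega>) vs"
    unfolding freq_def clifford_vector_sum[OF a] by (simp add: sum_distrib_left scaleR_conv_of_real mult_ac)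
  finally show ?thesis by simp
qed

text \<open>Applying \<open>fc_eigen\<close> twice and then \<open>clifford_square\<close> shows
  that an eigenform contains only frequencies of dual length |l| / (2 pi).\<close>

lemma fc_support:
  assumes \<omega>: "\<omega> \<in> Eig l" and \<xi>: "\<xi> \<in> dual_lattice" and nz: "fc \<xi> \<omega> vs \<noteq> 0"
  shows "4 * pi\<^sup>2 * qform \<xi> = l\<^sup>2"
proof -
  note w = EigD[OF \<omega>]
  define f where "f = fc \<xi> \<omega>"
  define z where "z = \<i> * of_real (2 * pi)"
  have f: "even_alt f" unfolding f_def by (rule fc_even_alt[OF w(1,3)])
  have eig: "z * C (freq \<xi>) f vs = of_real l * f vs" for vs unfolding f_def z_def by (rule fc_eigen[OF \<omega> \<xi>])
  have "of_real l * (of_real l * f vs) = of_real l * (z * C (freq \<xi>) f vs)" by (simp only: eig)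
  also have "\<dots> = z * C (freq \<xi>) (\<lambda>us. of_real l * f us) vs"
    unfolding clifford_complex_scale by (rule mult.left_commute)
  also have "\<dots> = z * C (freq \<xi>) (\<lambda>us. z * C (freq \<xi>) f us) vs" by (simp only: eig)
  also have "\<dots> = z * (z * (- qform \<xi> *\<^sub>R f vs))"
    unfolding clifford_complex_scale clifford_square[OF f] m_freq ..
  also have "\<dots> = of_real (4 * pi\<^sup>2 * qform \<xi>) * f vs" by (simp add: z_def scaleR_conv_of_real power2_eq_square)
  finally have "of_real (l\<^sup>2) * f vs = of_real (4 * pi\<^sup>2 * qform \<xi>) * f vs" by (simp add: power2_eq_square mult.assoc)
  then have "complex_of_real (l\<^sup>2) = of_real (4 * pi\<^sup>2 * qform \<xi>)" using nz by (simp add: f_def del: of_real_power of_real_mult)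
  then show ?thesis by (simp only: of_real_eq_iff)
qed

subsection \<open>The pairing of opposite eigenvalues\<close>

definition J :: "real \<Rightarrow> 'a form \<Rightarrow> 'a form" where
  "J l \<omega> = (\<lambda>x vs. dirderiv e0 \<omega> x vs + l * C e0 (\<omega> x) vs)"

lemma smooth_form_J: "smooth_form \<omega> \<Longrightarrow> smooth_form (J l \<omega>)"
  using smooth_form_combine[OF smooth_form_dirderiv smooth_form_clifford(1), of \<omega> \<omega> 1 e0 l e0] by (simp add: J_def)

lemma periodic_J: "periodic_form \<omega> \<Longrightarrow> periodic_form (J l \<omega>)"
  using periodic_combine[OF periodic_dirderiv periodic_clifford, of \<omega> \<omega> 1 e0 l e0] by (simp add: J_def)

lemma clifford_pullback_g0: "alt \<psi> \<Longrightarrow> C e0 \<psi> (map (g0 ^^ k) vs) = C e0 (\<lambda>us. \<psi> (map (g0 ^^ k) us)) vs"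
  using clifford_pullback[OF g0_pow(1,2), of k 1 \<psi> e0 vs] by (simp add: g0_pow(3,4))

text \<open>Both parts of \<open>J\<close> are natural under \<open>g0\<close>, an
  orientation-preserving isometry, because \<open>g0\<close> fixes \<open>e0\<close>.\<close>

lemma invariant_J:
  assumes \<omega>: "smooth_form \<omega>" "invariant \<omega>" shows "invariant (J l \<omega>)"
  unfolding invariant_def
proof (intro allI impI)
  fix k c x vs assume \<gamma>: "(\<lambda>x. (g0 ^^ k) x + c) \<in> \<Gamma>"
  have inv: "\<omega> ((g0 ^^ k) y + c) (map (g0 ^^ k) us) = \<omega> y us" for y us
    using \<omega>(2) \<gamma> unfolding invariant_def by blast
  have "((\<lambda>y. \<omega> ((g0 ^^ k) y + c) (map (g0 ^^ k) vs)) has_derivative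
      (\<lambda>v. fderiv (\<lambda>y. \<omega> y (map (g0 ^^ k) vs)) ((g0 ^^ k) x + c) ((g0 ^^ k) v))) (at x)"
    by (rule has_derivative_compose[OF affine_has_derivative[OF g0_pow(1)]])
      (rule smooth_function_has_derivative[OF smooth_formD(2)[OF \<omega>(1)]])
  then have "fderiv (\<lambda>y. \<omega> y vs) x = (\<lambda>v. fderiv (\<lambda>y. \<omega> y (map (g0 ^^ k) vs)) ((g0 ^^ k) x + c) ((g0 ^^ k) v))"
    unfolding inv using frechet_derivative_at by metis
  then have "dirderiv e0 \<omega> ((g0 ^^ k) x + c) (map (g0 ^^ k) vs) = dirderiv e0 \<omega> x vs"
    by (simp add: dirderiv_def g0_pow(4))
  then show "J l \<omega> ((g0 ^^ k) x + c) (map (g0 ^^ k) vs) = J l \<omega> x vs"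
    by (simp add: J_def clifford_pullback_g0[OF smooth_formD(1)[OF \<omega>(1)]] inv)
qed

text \<open>\<open>X\<close> and \<open>Y\<close> are the operator applied to the derivative along
  \<open>e0\<close> and to \<open>C e0\<close>: derivatives commute with the operator, while moving
  \<open>C e0\<close> in front of it by \<open>clifford_anticommute\<close> costs twice the
  derivative along \<open>e0\<close>.\<close>

lemma J_Eig:
  assumes \<omega>: "\<omega> \<in> Eig l" shows "J l \<omega> \<in> Eig (- l)"
proof -
  note w = EigD[OF \<omega>]
  note sd = smooth_form_dirderiv[OF w(1)] and sc = smooth_form_clifford(1)[OF w(1)]
  have alt: "alt (\<omega> x)" "even_alt (\<omega> x)" "alt (dirderiv e \<omega> x)" "even_alt (dirderiv e \<omega> x)" for e x
    using smooth_formD(1)[OF w(1)] w(5) alt_dirderiv[OF w(1)] even_alt_dirderiv[OF w(1,3)] by auto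
  have "even_form (J l \<omega>)"
    using w(3) by (simp add: even_form_def J_def dirderiv_def clifford_def)
  moreover have "(\<Sum>e\<in>E. C e (dirderiv e (J l \<omega>) x) vs) = - l * J l \<omega> x vs" for x vs
  proof -
    have "dirderiv e (J l \<omega>) x us = dirderiv e0 (dirderiv e \<omega>) x us + l * C e0 (dirderiv e \<omega> x) us" for e us
      using dirderiv_combine[OF sd sc, of e 1 e0 l e0] smooth_form_clifford(2)[OF w(1)]
      by (simp add: J_def dirderiv_commute[OF w(1), of e e0] fun_eq_iff)
    then have "dirderiv e (J l \<omega>) x = (\<lambda>us. dirderiv e0 (dirderiv e \<omega>) x us + l * C e0 (dirderiv e \<omega> x) us)" for e
      by (rule ext)
    then have *: "C e (dirderiv e (J l \<omega>) x) vs = C e (dirderiv e0 (dirderiv e \<omega>) x) vs + l * C e (C e0 (dirderiv e \<omega> x)) vs" for e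
      using clifford_add[of m vol E e "dirderiv e0 (dirderiv e \<omega>) x" "\<lambda>us. l *\<^sub>R C e0 (dirderiv e \<omega> x) us" vs]
        clifford_scaleR[of m vol E e l "C e0 (dirderiv e \<omega> x)" vs]
      by simp
    have X: "(\<Sum>e\<in>E. C e (dirderiv e0 (dirderiv e \<omega>) x) vs) = l * dirderiv e0 \<omega> x vs"
    proof -
      have s: "smooth_function (\<lambda>x. C e (dirderiv e \<omega> x) vs)" for e
        by (rule smooth_formD(2)[OF smooth_form_clifford(1)[OF sd]])
      have "(\<Sum>e\<in>E. C e (dirderiv e0 (dirderiv e \<omega>) x) vs) = (\<Sum>e\<in>E. 1 * fderiv (\<lambda>x. C e (dirderiv e \<omega> x) vs) x e0)"
        using smooth_form_clifford(2)[OF sd] by (simp add: dirderiv_def fun_eq_iff)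
      also have "\<dots> = fderiv (\<lambda>x. \<Sum>e\<in>E. 1 * C e (dirderiv e \<omega> x) vs) x e0"
        using smooth_sum[of E "\<lambda>e x. C e (dirderiv e \<omega> x) vs" "\<lambda>_. 1" x e0] s by simp
      also have "\<dots> = fderiv (\<lambda>x. l * \<omega> x vs + 0 * \<omega> x vs) x e0" by (simp add: w(4))
      also have "\<dots> = l * dirderiv e0 \<omega> x vs"
        using fderiv_combine(1)[OF smooth_functionD(1)[OF smooth_formD(2)[OF w(1), of vs], of x]
            smooth_functionD(1)[OF smooth_formD(2)[OF w(1), of vs], of x], of l 0 e0]
        by (simp add: dirderiv_def)
      finally show ?thesis .
    qed
    have Y: "(\<Sum>e\<in>E. C e (C e0 (dirderiv e \<omega> x)) vs) = - l * C e0 (\<omega> x) vs - 2 * dirderiv e0 \<omega> x vs"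
    proof -
      have ac: "C e (C e0 (dirderiv e \<omega> x)) vs = - C e0 (C e (dirderiv e \<omega> x)) vs - (2 * m e e0) * dirderiv e \<omega> x vs" for e
        using clifford_anticommute[OF alt(4)[of e x], of e e0 vs] by simp
      have "(\<Sum>e\<in>E. (2 * m e e0) * dirderiv e \<omega> x vs) = (\<Sum>e\<in>E. if e = e0 then 2 * dirderiv e0 \<omega> x vs else 0)"
        using e0 by (intro sum.cong) (auto simp: onb_inner)
      then have "(\<Sum>e\<in>E. (2 * m e e0) * dirderiv e \<omega> x vs) = 2 * dirderiv e0 \<omega> x vs" using e0 finite_E by simp
      moreover have "(\<Sum>e\<in>E. C e0 (C e (dirderiv e \<omega> x)) vs) = l * C e0 (\<omega> x) vs"
        using clifford_sum[of m vol E e0 "\<lambda>e. C e (dirderiv e \<omega> x)" E vs] clifford_scaleR[of m vol E e0 l "\<omega> x" vs]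
        by (simp add: w(4))
      ultimately show ?thesis unfolding ac by (simp add: sum_subtractf sum_negf)
    qed
    show ?thesis
      unfolding * sum.distrib sum_distrib_left[symmetric] X Y by (simp add: J_def algebra_simps)
  qed
  ultimately show ?thesis
    using smooth_form_J[OF w(1)] invariant_J[OF w(1,2)] by (simp add: Eig_def)
qed

lemma linear_into_J: "forms.linear_into (Eig l) (J l) (Eig (- l))"
proof -
  have comb: "J l (\<lambda>x vs. a * \<omega> x vs + b * \<eta> x vs) = (\<lambda>x vs. a * J l \<omega> x vs + b * J l \<eta> x vs)"
    if "\<omega> \<in> Eig l" "\<eta> \<in> Eig l" for a b \<omega> \<eta>
    using clifford_add[of m vol E e0 "\<lambda>vs. a *\<^sub>R \<omega> x vs" "\<lambda>vs. b *\<^sub>R \<eta> x vs" for x]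
    by (simp add: J_def dirderiv_combine[OF EigD(1)[OF that(1)] EigD(1)[OF that(2)]] fun_eq_iff
        clifford_scaleR[of m vol E e0 a "\<omega> _", simplified] clifford_scaleR[of m vol E e0 b "\<eta> _", simplified] algebra_simps)
  show ?thesis unfolding forms.linear_into_def
  proof (intro conjI ballI allI J_Eig)
    show "J l (\<omega> + \<eta>) = J l \<omega> + J l \<eta>" if "\<omega> \<in> Eig l" "\<eta> \<in> Eig l" for \<omega> \<eta>
      using comb[OF that, of 1 1] by (simp add: plus_fun_def)
    show "J l (form_scale c \<omega>) = form_scale c (J l \<omega>)" if "\<omega> \<in> Eig l" for c \<omega>
      using comb[OF that that, of c 0] by (simp add: form_scale_def)
  qed
qed

lemma fc_J:
  assumes \<omega>: "periodic_form \<omega>" and \<xi>: "\<xi> \<in> dual_lattice"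
  shows "fc \<xi> (J l \<omega>) vs = \<i> * of_real (2 * pi * (\<xi> \<bullet> e0)) * fc \<xi> \<omega> vs + of_real l * C e0 (fc \<xi> \<omega>) vs"
proof -
  have s: "smooth_form \<omega>" using \<omega> by (simp add: periodic_form_def)
  show ?thesis
    using fc_combine[OF smooth_form_dirderiv[OF s] smooth_form_clifford(1)[OF s], of \<xi> 1 e0 l e0 vs]
    by (simp add: J_def fc_dirderiv[OF \<omega> \<xi>] fc_clifford[OF s])
qed

text \<open>On the mode \<xi>, \<open>J (- l)\<close> after \<open>J l\<close> is multiplication by
  l^2 - (2 pi \<xi> \<bullet> e0)^2. If this vanishes, comparison with \<open>fc_support\<close>
  leaves no room for the other components of \<xi>.\<close>

lemma J_J_support:
  assumes \<omega>: "\<omega> \<in> Eig l" and JJ: "J (- l) (J l \<omega>) = 0" and \<xi>: "\<xi> \<in> dual_lattice" and nz: "fc \<xi> \<omega> us \<noteq> 0"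
  shows "(2 * pi * (\<xi> \<bullet> e0))\<^sup>2 = l\<^sup>2" and "e \<in> E \<Longrightarrow> e \<noteq> e0 \<Longrightarrow> \<xi> \<bullet> e = 0"
proof -
  note w = EigD[OF \<omega>]
  note p = invariant_periodic[OF w(1,2)]
  define f where "f = fc \<xi> \<omega>"
  define a where "a = 2 * pi * (\<xi> \<bullet> e0)"
  have f: "even_alt f" unfolding f_def by (rule fc_even_alt[OF w(1,3)])
  have sq: "C e0 (C e0 f) vs = - f vs" for vs using clifford_square[OF f, of e0] by (simp add: m_e0)
  have "fc \<xi> (J (- l) (J l \<omega>)) us = 0"
    unfolding JJ using fourier_combine[of "\<lambda>x. 0" "\<lambda>x. 0" \<xi> 0 0] by (simp add: fc_def zero_fun_def)
  moreover have "fc \<xi> (J l \<omega>) = (\<lambda>vs. \<i> * of_real a * f vs + of_real l * C e0 f vs)"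
    by (rule ext) (simp only: fc_J[OF p \<xi>] f_def a_def)
  ultimately have "0 = \<i> * of_real a * (\<i> * of_real a * f us + of_real l * C e0 f us)
      + of_real (- l) * (\<i> * of_real a * C e0 f us + of_real l * C e0 (C e0 f) us)"
    using fc_J[OF periodic_J[OF p] \<xi>, of "- l" l us]
    by (simp add: a_def[symmetric] clifford_add clifford_complex_scale)
  also have "\<dots> = of_real (l\<^sup>2 - a\<^sup>2) * f us" by (simp add: sq power2_eq_square algebra_simps)
  finally have "l\<^sup>2 - a\<^sup>2 = 0" using nz by (simp add: f_def del: of_real_diff of_real_power)
  then show 1: "(2 * pi * (\<xi> \<bullet> e0))\<^sup>2 = l\<^sup>2" by (simp add: a_def)
  have "4 * pi\<^sup>2 * (\<xi> \<bullet> e0)\<^sup>2 = 4 * pi\<^sup>2 * qform \<xi>"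
    using 1 fc_support[OF \<omega> \<xi> nz] by (simp add: power_mult_distrib)
  then have "(\<xi> \<bullet> e0)\<^sup>2 = qform \<xi>" by simp
  moreover have "qform \<xi> = (\<xi> \<bullet> e0)\<^sup>2 + (\<Sum>e\<in>E - {e0}. (\<xi> \<bullet> e)\<^sup>2)"
    unfolding qform_def by (rule sum.remove[OF finite_E e0])
  ultimately have "(\<Sum>e\<in>E - {e0}. (\<xi> \<bullet> e)\<^sup>2) = 0" by simp
  then show "\<xi> \<bullet> e = 0" if "e \<in> E" "e \<noteq> e0"
    using that finite_E by (subst (asm) sum_nonneg_eq_0_iff) auto
qed

text \<open>For frequencies along \<open>e0\<close> the eigenvalue equation equates l f with 2 pi i
  (\<xi> \<bullet> e0) \<open>C e0 f\<close>; applying \<open>C e0\<close> once more shows that the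
  two terms of \<open>J l\<close> cancel. This provides the hypothesis \<open>inter\<close> of
  \<open>dim_le_via_map\<close>.\<close>

lemma J_J_kernel:
  assumes \<omega>: "\<omega> \<in> Eig l" and JJ: "J (- l) (J l \<omega>) = 0"
  shows "J l \<omega> = 0"
proof -
  note w = EigD[OF \<omega>]
  note p = invariant_periodic[OF w(1,2)]
  have "fc \<xi> (J l \<omega>) vs = 0" if \<xi>: "\<xi> \<in> dual_lattice" for \<xi> vs
  proof (cases "\<exists>us. fc \<xi> \<omega> us \<noteq> 0")
    case True
    then obtain us where us: "fc \<xi> \<omega> us \<noteq> 0" by blast
    have f: "even_alt (fc \<xi> \<omega>)" by (rule fc_even_alt[OF w(1,3)])
    have "freq \<xi> = (\<Sum>e\<in>E. if e = e0 then (\<xi> \<bullet> e0) *\<^sub>R e0 else 0)"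
      unfolding freq_def using J_J_support(2)[OF \<omega> JJ \<xi> us] by (intro sum.cong) auto
    then have fr: "freq \<xi> = (\<xi> \<bullet> e0) *\<^sub>R e0" using e0 finite_E by simp
    have eig: "of_real l * fc \<xi> \<omega> vs = \<i> * of_real (2 * pi * (\<xi> \<bullet> e0)) * C e0 (fc \<xi> \<omega>) vs" for vs
      using fc_eigen[OF \<omega> \<xi>, of vs] clifford_vector_combine[of "fc \<xi> \<omega>" "\<xi> \<bullet> e0" e0 0 0 vs] f
      by (simp add: fr even_alt_def scaleR_conv_of_real mult_ac)
    have "of_real l * C e0 (fc \<xi> \<omega>) vs = C e0 (\<lambda>us. of_real l * fc \<xi> \<omega> us) vs" by (simp add: clifford_complex_scale)
    also have "\<dots> = \<i> * of_real (2 * pi * (\<xi> \<bullet> e0)) * C e0 (C e0 (fc \<xi> \<omega>)) vs" by (simp only: eig clifford_complex_scale)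
    also have "\<dots> = - (\<i> * of_real (2 * pi * (\<xi> \<bullet> e0)) * fc \<xi> \<omega> vs)"
      using clifford_square[OF f, of e0 vs] by (simp add: m_e0)
    finally show ?thesis using fc_J[OF p \<xi>, of l vs] by simp
  next
    case False
    then have "fc \<xi> \<omega> = (\<lambda>us. 0)" by auto
    then show ?thesis using fc_J[OF p \<xi>, of l vs] by (simp add: clifford_zero)
  qed
  then show ?thesis
    using fc_complete[OF periodic_J[OF p]] by (simp add: fun_eq_iff)
qed

definition Ker :: "real \<Rightarrow> 'a form set" where "Ker l = {\<omega> \<in> Eig l. J l \<omega> = 0}"

lemma J_zero: "J l 0 = 0"
  by (simp add: J_def dirderiv_def zero_fun_def clifford_zero)

text \<open>The kernel of \<open>J l\<close> lies in that of the double application, so by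
  \<open>J_J_support\<close> only frequencies along \<open>e0\<close> occur.\<close>

lemma Ker_constant_directions:
  assumes \<omega>: "\<omega> \<in> Ker l" and e: "e \<in> E" "e \<noteq> e0"
  shows "dirderiv e \<omega> x vs = 0"
proof -
  have w: "\<omega> \<in> Eig l" and JJ: "J (- l) (J l \<omega>) = 0" using \<omega> J_zero by (auto simp: Ker_def)
  note p = invariant_periodic[OF EigD(1,2)[OF w]]
  show ?thesis
  proof (rule fc_complete[OF periodic_dirderiv[OF p]])
    fix \<xi> :: 'a assume \<xi>: "\<xi> \<in> dual_lattice"
    show "fc \<xi> (dirderiv e \<omega>) vs = 0"
      using fc_dirderiv[OF p \<xi>, of e vs] J_J_support(2)[OF w JJ \<xi> _ e, of vs] by (cases "fc \<xi> \<omega> vs = 0") auto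
  qed
qed

subsection \<open>Multiplicity bounds\<close>

definition Freqs :: "real \<Rightarrow> 'a set" where "Freqs l = {\<xi> \<in> dual_lattice. 4 * pi\<^sup>2 * qform \<xi> = l\<^sup>2}"

definition elists :: "'a list set" where "elists = {vs. set vs \<subseteq> E \<and> length vs \<le> 7}"

lemma finite_elists: "finite elists"
  unfolding elists_def by (rule finite_lists_length_le[OF finite_E])

lemma alt_zero_elists:
  assumes f: "alt f" and z: "\<And>vs. vs \<in> elists \<Longrightarrow> f vs = 0" shows "f vs = 0"
proof (cases "length vs \<le> 7")
  case True
  have z': "alt (\<lambda>vs :: 'a list. 0)" by (simp add: alt_def linear_zero)
  show ?thesis
    by (rule alt_eq_on_basis[OF f z' finite_E orthonormal_basis_span[OF ip onb]]) (use z True in \<open>auto simp: elists_def\<close>)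
qed (use alt_exceeds_dim[OF f] dim7 in auto)

text \<open>The separating functionals are the real and imaginary parts, whence the factor 2, of the
  Fourier coefficients at the frequencies in \<open>Freqs l\<close>, evaluated on lists of basis
  vectors.\<close>

lemma Eig_dim:
  assumes fin: "finite (Freqs l)"
  shows "forms.dim (Eig l) \<le> 2 * card elists * card (Freqs l)" and "\<exists>B. finite B \<and> Eig l \<subseteq> forms.span B"
proof -
  define L where "L = (\<lambda>(\<xi>, vs, b) \<omega>. if b then Re (fc \<xi> \<omega> vs) else Im (fc \<xi> \<omega> vs))"
  define I where "I = Freqs l \<times> elists \<times> (UNIV :: bool set)"
  have I: "finite I" using fin finite_elists by (simp add: I_def)
  have add: "L i (\<omega> + \<eta>) = L i \<omega> + L i \<eta>" if "\<omega> \<in> Eig l" "\<eta> \<in> Eig l" for i \<omega> \<eta>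
    using fc_combine[OF EigD(1)[OF that(1)] EigD(1)[OF that(2)], of _ 1 1]
    by (cases i) (auto simp: L_def plus_fun_def)
  have scale: "L i (form_scale c \<omega>) = c * L i \<omega>" if "\<omega> \<in> Eig l" for i c \<omega>
    using fc_combine[OF EigD(1)[OF that] EigD(1)[OF that], of _ c 0]
    by (cases i) (auto simp: L_def form_scale_def)
  have sep: "\<omega> = 0" if \<omega>: "\<omega> \<in> Eig l" and z: "\<And>i. i \<in> I \<Longrightarrow> L i \<omega> = 0" for \<omega>
  proof -
    note w = EigD[OF \<omega>]
    have "\<omega> x vs = 0" if vs: "vs \<in> elists" for x vs
    proof (rule fc_complete[OF invariant_periodic[OF w(1,2)]])
      fix \<xi> :: 'a assume \<xi>: "\<xi> \<in> dual_lattice"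
      show "fc \<xi> \<omega> vs = 0"
      proof (cases "\<xi> \<in> Freqs l")
        case True
        then have "(\<xi>, vs, True) \<in> I" "(\<xi>, vs, False) \<in> I" using vs by (auto simp: I_def)
        then show ?thesis using z[of "(\<xi>, vs, True)"] z[of "(\<xi>, vs, False)"] by (simp add: L_def complex_eq_iff)
      next
        case False
        then show ?thesis using fc_support[OF \<omega> \<xi>, of vs] \<xi> by (auto simp: Freqs_def)
      qed
    qed
    then have "\<omega> x vs = 0" for x vs using alt_zero_elists[OF smooth_formD(1)[OF w(1)]] by blast
    then show ?thesis by (simp add: fun_eq_iff)
  qed
  have c: "card I = 2 * card elists * card (Freqs l)" by (simp add: I_def card_cartesian_product)
  show "forms.dim (Eig l) \<le> 2 * card elists * card (Freqs l)"
    unfolding c[symmetric]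
    by (rule forms.separating_functionals_dim(1)[OF I subspace_Eig, where L = L]) (rule add scale sep; assumption)+
  show "\<exists>B. finite B \<and> Eig l \<subseteq> forms.span B"
    by (rule forms.separating_functionals_dim(2)[OF I subspace_Eig, where L = L]) (rule add scale sep; assumption)+
qed

lemma Ker_subspace: "forms.subspace (Ker l)"
proof (rule forms.subspaceI)
  note lin = forms.linear_intoD[OF linear_into_J[of l]]
  show "0 \<in> Ker l" using forms.subspace_0[OF subspace_Eig] J_zero by (simp add: Ker_def)
  show "\<omega> + \<eta> \<in> Ker l" if "\<omega> \<in> Ker l" "\<eta> \<in> Ker l" for \<omega> \<eta>
    using that forms.subspace_add[OF subspace_Eig] by (simp add: Ker_def lin(2))
  show "form_scale c \<omega> \<in> Ker l" if "\<omega> \<in> Ker l" for c \<omega>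
    using that forms.subspace_scale[OF subspace_Eig] by (simp add: Ker_def lin(3))
qed

lemma Freqs_neg: "Freqs (- l) = Freqs l" by (simp add: Freqs_def)

text \<open>\<open>dim_le_via_map\<close> for l and for -l gives opposite inequalities.\<close>

lemma dim_Eig_difference:
  assumes fin: "finite (Freqs l)"
  shows "real (forms.dim (Eig l)) - real (forms.dim (Eig (- l))) = real (forms.dim (Ker l)) - real (forms.dim (Ker (- l)))"
proof -
  have le: "forms.dim (Eig l) + forms.dim (Ker (- l)) \<le> forms.dim (Eig (- l)) + forms.dim (Ker l)"
    if fin: "finite (Freqs l)" for l
  proof -
    obtain B where B: "finite B" "Eig l \<subseteq> forms.span B" using Eig_dim(2)[OF fin] by blast
    obtain B' where B': "finite B'" "Eig (- l) \<subseteq> forms.span B'" using Eig_dim(2)[of "- l"] fin Freqs_neg by metis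
    show ?thesis
    proof (rule forms.dim_le_via_map[OF subspace_Eig B subspace_Eig B' linear_into_J Ker_def Ker_subspace])
      show "Ker (- l) \<subseteq> Eig (- l)" by (auto simp: Ker_def)
      show "J l \<omega> = 0" if "\<omega> \<in> Eig l" "J l \<omega> \<in> Ker (- l)" for \<omega>
        using that J_J_kernel by (auto simp: Ker_def)
    qed
  qed
  show ?thesis using le[OF fin] le[of "- l"] fin by (simp add: Freqs_neg)
qed

end

context real_vs
begin

lemma dim_zero: "dim {0} = 0"
  by (rule dim_unique[of "{}"]) (auto simp: independent_empty)

lemma dim_le_injective:
  assumes W: "subspace W" "finite F" "W \<subseteq> span F" and W': "subspace W'" "finite F'" "W' \<subseteq> span F'"
    and f: "linear_into W f W'" and inj: "\<And>x. x \<in> W \<Longrightarrow> f x = 0 \<Longrightarrow> x = 0"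
  shows "dim W \<le> dim W'"
proof -
  have K: "{0} = {x \<in> W. f x = 0}" using inj subspace_0[OF W(1)] linear_into_zero[OF f W(1)] by auto
  show ?thesis
    using dim_le_via_map[OF W W' f K, of "{0}"] subspace_0[OF W'(1)] by (simp add: dim_zero subspace_single_0)
qed

end

text \<open>Derivatives stay in this family with other coefficients, hence the generalisation over
  \<open>p\<close> and \<open>q\<close>.\<close>

lemma Ck_trig: "Ck k (\<lambda>x :: 'a::euclidean_space. cos (m x) * p + sin (m x) * q)" if "linear (m :: 'a \<Rightarrow> real)"
proof (induction k arbitrary: p q)
  case 0
  have "continuous_on UNIV m" using that by (simp add: linear_continuous_on linear_conv_bounded_linear)
  then show ?case by (auto intro!: continuous_intros)
next
  case (Suc k)
  have "bounded_linear m" using that by (simp add: linear_conv_bounded_linear)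
  then have d: "((\<lambda>x. cos (m x) * p + sin (m x) * q) has_derivative
      (\<lambda>v. cos (m x) * (m v * q) + sin (m x) * (- m v * p))) (at x)" for x
    by (auto intro!: derivative_eq_intros bounded_linear_imp_has_derivative simp: algebra_simps)
  show ?case
    unfolding Ck.simps
  proof (intro conjI allI)
    show "(\<lambda>x. cos (m x) * p + sin (m x) * q) differentiable (at x)" for x by (rule differentiableI[OF d])
    show "Ck k (\<lambda>x. frechet_derivative (\<lambda>x. cos (m x) * p + sin (m x) * q) (at x) v)" for v
      unfolding frechet_derivative_at[OF d, symmetric] by (rule Suc)
  qed
qed

text \<open>1 / 2 - j / r changes sign when j is replaced by r - j, so the sum folds to that of
  \<kappa> j (1 - 2 j / r) over 0 < j < r: an integer minus twice the quotient provided by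
  \<open>dvd\<close>. At j = r the coefficient is \<kappa> r - \<kappa> 0 = 0.\<close>

lemma periodic_sum_value_integer:
  fixes \<kappa> :: "nat \<Rightarrow> nat"
  assumes r: "r > 0" and dvd: "r dvd (\<Sum>j<r. j * \<kappa> j)" and per: "\<kappa> r = \<kappa> 0"
  shows "(\<Sum>j=1..r. (real (\<kappa> j) - real (\<kappa> (r - j))) * (1 / 2 - real j / real r)) \<in> \<int>"
proof -
  define h where "h = (\<lambda>j. 1 / 2 - real j / real r)"
  have h: "h (r - j) = - h j" if "j \<le> r" for j using r that by (simp add: h_def field_simps of_nat_diff)
  have "(\<Sum>j=1..r. (real (\<kappa> j) - real (\<kappa> (r - j))) * h j) = (\<Sum>j=1..<r. (real (\<kappa> j) - real (\<kappa> (r - j))) * h j)"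
  proof -
    have "{1..r} = insert r {1..<r}" using r by auto
    then show ?thesis by (simp add: per)
  qed
  also have "\<dots> = (\<Sum>j=1..<r. real (\<kappa> j) * h j) - (\<Sum>j=1..<r. real (\<kappa> (r - j)) * h j)"
    by (simp add: left_diff_distrib sum_subtractf)
  also have "(\<Sum>j=1..<r. real (\<kappa> (r - j)) * h j) = (\<Sum>j=1..<r. real (\<kappa> j) * h (r - j))"
    by (rule sum.reindex_bij_witness[of _ "\<lambda>j. r - j" "\<lambda>j. r - j"]) auto
  also have "\<dots> = - (\<Sum>j=1..<r. real (\<kappa> j) * h j)"
    unfolding sum_negf[symmetric] by (intro sum.cong) (auto simp: h)
  also have "(\<Sum>j=1..<r. real (\<kappa> j) * h j) - - (\<Sum>j=1..<r. real (\<kappa> j) * h j) = (\<Sum>j=1..<r. real (\<kappa> j) - 2 * (real (j * \<kappa> j) / real r))"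
    by (simp add: h_def algebra_simps flip: sum.distrib)
  also have "\<dots> = real (\<Sum>j=1..<r. \<kappa> j) - 2 * (real (\<Sum>j=1..<r. j * \<kappa> j) / real r)"
    by (simp add: sum_subtractf sum_divide_distrib sum_distrib_left)
  also have "(\<Sum>j=1..<r. j * \<kappa> j) = (\<Sum>j<r. j * \<kappa> j)"
    by (rule sum.mono_neutral_left) auto
  finally have eq: "(\<Sum>j=1..r. (real (\<kappa> j) - real (\<kappa> (r - j))) * h j)
    = real (\<Sum>j=1..<r. \<kappa> j) - 2 * (real (\<Sum>j<r. j * \<kappa> j) / real r)" .
  obtain q where q: "(\<Sum>j<r. j * \<kappa> j) = r * q" using dvd by blast
  have "real (\<Sum>j<r. j * \<kappa> j) / real r = real q" unfolding q using r by simp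
  then show ?thesis using eq unfolding h_def by (simp del: of_nat_sum)
qed

section \<open>Kernel forms and the holonomy representation on constant forms\<close>

context flat_quotient
begin

text \<open>Even elements of the exterior algebra are kept as constant forms, so that their
  dimensions are taken in the same space as those of the eigenspaces and maps between the two are
  instances of \<open>linear_into\<close>.\<close>

definition Vc :: "'a form set" where "Vc = {\<omega>. \<exists>w. even_alt w \<and> \<omega> = (\<lambda>x. w)}"

definition Sf :: "'a form \<Rightarrow> 'a form" where "Sf \<omega> = (\<lambda>x. C e0 (\<omega> x))"

definition pb :: "('a \<Rightarrow> 'a) \<Rightarrow> 'a form \<Rightarrow> 'a form" where "pb g \<omega> = (\<lambda>x vs. \<omega> x (map g vs))"

abbreviation U :: "real \<Rightarrow> 'a form set" where "U \<theta> \<equiv> forms.eigenspace_of Vc Sf (pb g0) \<theta>"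

lemma clifford_e0_twice: "even_alt w \<Longrightarrow> C e0 (C e0 w) vs = - w vs"
  using clifford_square[of w e0 vs] by (simp add: m_e0)

lemma clifford_real_combine: "C v (\<lambda>us. a * f us + b * g us) vs = a * C v f vs + b * C v g vs" for f g :: "'a list \<Rightarrow> real"
  using clifford_add[of m vol E v "\<lambda>us. a *\<^sub>R f us" "\<lambda>us. b *\<^sub>R g us" vs]
    clifford_scaleR[of m vol E v a f vs] clifford_scaleR[of m vol E v b g vs] by simp

lemma even_alt_real_combine: "even_alt f \<Longrightarrow> even_alt g \<Longrightarrow> even_alt (\<lambda>us. a * f us + b * g us)" for f g :: "'a list \<Rightarrow> real"
  using even_alt_combine[of f g a b] by simp

lemma even_alt_zero: "even_alt (\<lambda>us :: 'a list. 0 :: real)"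
  by (simp add: even_alt_def alt_def linear_zero)

lemma Vc_subspace: "forms.subspace Vc"
proof (rule forms.subspaceI)
  show "0 \<in> Vc" using even_alt_zero by (auto simp: Vc_def zero_fun_def)
  show "x + y \<in> Vc" if "x \<in> Vc" "y \<in> Vc" for x y
    using that even_alt_real_combine[of _ _ 1 1] by (fastforce simp: Vc_def plus_fun_def)
  show "form_scale c x \<in> Vc" if "x \<in> Vc" for c x
    using that even_alt_real_combine[of _ _ c 0] by (fastforce simp: Vc_def form_scale_def)
qed

lemma Vc_finite: "\<exists>B. finite B \<and> Vc \<subseteq> forms.span B"
proof (rule forms.separating_functionals_dim(2)[OF finite_elists Vc_subspace, where L = "\<lambda>vs \<omega>. \<omega> 0 vs"])
  show "x = 0" if "x \<in> Vc" "\<And>vs. vs \<in> elists \<Longrightarrow> x 0 vs = 0" for x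
    using that alt_zero_elists by (fastforce simp: Vc_def even_alt_def fun_eq_iff)
qed (simp_all add: form_scale_def)

lemma Sf_Vc: "forms.linear_into Vc Sf Vc" "x \<in> Vc \<Longrightarrow> Sf (Sf x) = - x"
proof -
  have add: "Sf (x + y) = Sf x + Sf y" for x y
    by (intro ext) (simp add: Sf_def plus_fun_def clifford_add)
  have scale: "Sf (form_scale c x) = form_scale c (Sf x)" for c x
    using clifford_scaleR[of m vol E e0 c "x _"] by (intro ext) (simp add: Sf_def form_scale_def)
  have "Sf x \<in> Vc" if "x \<in> Vc" for x
    using that even_alt_clifford by (auto simp: Vc_def Sf_def even_alt_def)
  then show "forms.linear_into Vc Sf Vc" by (simp add: forms.linear_into_def add scale)
  show "Sf (Sf x) = - x" if x: "x \<in> Vc"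
  proof -
    obtain w where w: "even_alt w" "x = (\<lambda>x. w)" using x unfolding Vc_def by blast
    show ?thesis unfolding w(2) by (intro ext) (simp add: Sf_def clifford_e0_twice[OF w(1)])
  qed
qed

lemma pb_linear: "pb g (x + y) = pb g x + pb g y" "pb g (form_scale c x) = form_scale c (pb g x)"
  by (simp_all add: pb_def plus_fun_def form_scale_def)

lemma pb_Vc:
  assumes g: "linear g" shows "forms.linear_into Vc (pb g) Vc"
proof -
  have alt: "alt (\<lambda>vs. w (map g vs))" if "alt w" for w :: "'a list \<Rightarrow> real"
    unfolding alt_def
  proof (intro conjI allI)
    show "linear (\<lambda>v. w (map g (us @ v # vs)))" for us vs
      using alt_add[OF that] alt_scale[OF that] by (intro linearI) (simp_all add: linear_add[OF g] linear_scale[OF g])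
  qed (simp add: alt_adj[OF that])
  have "pb g x \<in> Vc" if x: "x \<in> Vc" for x
  proof -
    obtain w where w: "even_alt w" "x = (\<lambda>x. w)" using x by (auto simp: Vc_def)
    then have "even_alt (\<lambda>vs. w (map g vs))" using alt[of w] by (simp add: even_alt_def)
    then show ?thesis using w(2) by (auto simp: Vc_def pb_def)
  qed
  then show ?thesis by (simp add: forms.linear_into_def pb_linear)
qed

lemma pb_Sf:
  assumes g: "linear g" "\<And>u v. m (g u) (g v) = m u v" "\<And>vs. vol (map g vs) = \<delta> * vol vs" "\<delta> * \<delta> = 1" "g e0 = e0" and x: "x \<in> Vc"
  shows "Sf (pb g x) = form_scale \<delta> (pb g (Sf x))"
proof -
  obtain w where w: "even_alt w" "x = (\<lambda>x. w)" using x by (auto simp: Vc_def)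
  then have "alt w" by (simp add: even_alt_def)
  from clifford_pullback[OF g(1-4) this, of e0] show ?thesis
    by (simp add: Sf_def pb_def w form_scale_def g(5) fun_eq_iff)
qed

lemma pb_pow: "(pb g0 ^^ k) x = pb (g0 ^^ k) x"
proof (induction k)
  case 0 show ?case by (simp add: pb_def id_def)
next
  case (Suc k)
  have eq: "map (g0 ^^ k) (map g0 vs) = map (g0 ^^ Suc k) vs" for vs by (simp only: map_map funpow_Suc_right)
  have "(pb g0 ^^ Suc k) x = pb g0 (pb (g0 ^^ k) x)" using Suc by simp
  also have "\<dots> = pb (g0 ^^ Suc k) x" unfolding pb_def eq ..
  finally show ?case .
qed

lemma U_iff: "(\<lambda>x. w) \<in> U \<theta> \<longleftrightarrow> even_alt w \<and> (\<forall>vs. w (map g0 vs) = cos \<theta> * w vs + sin \<theta> * C e0 w vs)"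
proof -
  have "(\<lambda>x::'a. w) \<in> Vc \<longleftrightarrow> even_alt w" unfolding Vc_def mem_Collect_eq by metis
  then show ?thesis
    by (simp add: forms.eigenspace_of_def pb_def Sf_def form_scale_def plus_fun_def fun_eq_iff)
qed

lemma U_obtain: "x \<in> U \<theta> \<Longrightarrow> \<exists>w. x = (\<lambda>x. w)"
  by (auto simp: forms.eigenspace_of_def Vc_def)

lemma U_subspace: "forms.subspace (U \<theta>)"
proof (rule forms.subspaceI)
  have "(\<lambda>x. \<lambda>vs. 0) \<in> U \<theta>" unfolding U_iff using even_alt_zero by (simp add: clifford_zero)
  then show "0 \<in> U \<theta>" by (simp add: zero_fun_def)
  have comb: "(\<lambda>x. \<lambda>vs. a * w vs + b * w' vs) \<in> U \<theta>" if "(\<lambda>x. w) \<in> U \<theta>" "(\<lambda>x. w') \<in> U \<theta>" for a b w w'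
    using that unfolding U_iff by (simp add: even_alt_real_combine clifford_real_combine algebra_simps)
  show "x + y \<in> U \<theta>" if "x \<in> U \<theta>" "y \<in> U \<theta>" for x y
    using U_obtain[OF that(1)] U_obtain[OF that(2)] comb[of _ _ 1 1] that by (auto simp: plus_fun_def)
  show "form_scale c x \<in> U \<theta>" if "x \<in> U \<theta>" for c x
    using U_obtain[OF that] comb[of _ _ c 0] that by (auto simp: form_scale_def)
qed

lemma U_pow:
  assumes w: "(\<lambda>x. w) \<in> U \<theta>"
  shows "w (map (g0 ^^ k) vs) = cos (real k * \<theta>) * w vs + sin (real k * \<theta>) * C e0 w vs"
proof -
  have ea: "even_alt w" and eq: "\<And>vs. w (map g0 vs) = cos \<theta> * w vs + sin \<theta> * C e0 w vs" using w by (auto simp: U_iff)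
  have a: "alt w" using ea by (simp add: even_alt_def)
  show ?thesis
  proof (induction k arbitrary: vs)
    case (Suc k)
    have "map (g0 ^^ Suc k) vs = map g0 (map (g0 ^^ k) vs)" by simp
    then have "w (map (g0 ^^ Suc k) vs) = cos \<theta> * w (map (g0 ^^ k) vs) + sin \<theta> * C e0 w (map (g0 ^^ k) vs)" by (simp only: eq)
    also have "C e0 w (map (g0 ^^ k) vs) = C e0 (\<lambda>us. cos (real k * \<theta>) * w us + sin (real k * \<theta>) * C e0 w us) vs"
      unfolding clifford_pullback_g0[OF a] Suc ..
    also have "\<dots> = cos (real k * \<theta>) * C e0 w vs - sin (real k * \<theta>) * w vs"
      by (simp add: clifford_real_combine clifford_e0_twice[OF ea])
    finally show ?case
      unfolding Suc by (simp add: distrib_right cos_add sin_add algebra_simps)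
  qed (simp add: id_def)
qed

text \<open>By \<open>g0 ^^ r = id\<close> the rotation by l acts trivially on \<open>w\<close>.
  Together with its image under \<open>C e0\<close> this is a linear system for \<open>w\<close> and
  \<open>C e0 w\<close> with determinant (1 - cos l)^2 + (sin l)^2, which must vanish when
  \<open>w\<close> is nonzero.\<close>

lemma U_frequency:
  assumes w: "(\<lambda>x. w) \<in> U (l / real r)" and nz: "w vs \<noteq> 0"
  shows "\<exists>n::int. l = 2 * pi * of_int n"
proof -
  have ea: "even_alt w" using w by (simp add: U_iff)
  have eq: "(1 - cos l) * w vs + (- sin l) * C e0 w vs = 0" for vs
    using U_pow[OF w, of r vs] r by (simp add: g0 id_def algebra_simps)
  have "(1 - cos l) * C e0 w vs + (- sin l) * (- w vs) = C e0 (\<lambda>us. (1 - cos l) * w us + (- sin l) * C e0 w us) vs"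
    unfolding clifford_real_combine clifford_e0_twice[OF ea] ..
  then have eq2: "(1 - cos l) * C e0 w vs + sin l * w vs = 0" unfolding eq by (simp add: clifford_zero)
  have ident: "((1 - c)\<^sup>2 + s\<^sup>2) * a = (1 - c) * ((1 - c) * a + (- s) * b) + s * ((1 - c) * b + s * a)" for a b c s :: real
    by (simp add: power2_eq_square algebra_simps)
  have "((1 - cos l)\<^sup>2 + (sin l)\<^sup>2) * w vs
      = (1 - cos l) * ((1 - cos l) * w vs + (- sin l) * C e0 w vs) + sin l * ((1 - cos l) * C e0 w vs + sin l * w vs)"
    by (rule ident)
  then have "((1 - cos l)\<^sup>2 + (sin l)\<^sup>2) * w vs = 0" unfolding eq eq2 by simp
  then have "(1 - cos l)\<^sup>2 + (sin l)\<^sup>2 = 0" using nz by simp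
  then have "cos l = 1" by (simp add: sum_power2_eq_zero_iff)
  then obtain n :: int where "l = of_int n * 2 * pi" by (auto simp: cos_one_2pi_int)
  then show ?thesis by (intro exI[of _ n]) simp
qed

text \<open>On constant forms this is exp (- l t C(e0)) with t = \<open>m x e0\<close>: the solution
  of \<open>J l \<omega> = 0\<close> with the given value at the origin that is constant in the
  other directions.\<close>

definition Tl :: "real \<Rightarrow> 'a form \<Rightarrow> 'a form" where
  "Tl l \<omega> = (\<lambda>x vs. cos (l * m x e0) * \<omega> x vs + - sin (l * m x e0) * C e0 (\<omega> x) vs)"

lemma linear_height: "linear (\<lambda>x. l * m x e0)"
  by (rule linearI) (simp_all add: m_simps algebra_simps)

lemma Ker_form:
  assumes \<omega>: "\<omega> \<in> Ker l"
  shows "\<omega> = Tl l (\<lambda>x. \<omega> 0)" and "(\<lambda>x. \<omega> 0) \<in> U (l / real r)"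
proof -
  have w: "\<omega> \<in> Eig l" and J0: "J l \<omega> = 0" using \<omega> by (auto simp: Ker_def)
  note w' = EigD[OF w]
  have d0: "dirderiv e0 \<omega> x vs = - l * C e0 (\<omega> x) vs" for x vs
  proof -
    have "J l \<omega> x vs = 0" using J0 by simp
    then show ?thesis by (simp add: J_def)
  qed
  have d: "fderiv (\<lambda>x. \<omega> x vs) x v = - l * m v e0 * C e0 (\<omega> x) vs" for v x vs
  proof -
    have "dirderiv v \<omega> x vs = (\<Sum>e\<in>E. m v e * dirderiv e \<omega> x vs)"
      using linear_sum[OF linear_dirderiv[OF w'(1), of x vs], of "\<lambda>e. m v e *\<^sub>R e" E]
      unfolding expand[of v, symmetric] by (simp add: linear_scale[OF linear_dirderiv[OF w'(1)]])
    also have "\<dots> = (\<Sum>e\<in>E. if e = e0 then m v e0 * dirderiv e0 \<omega> x vs else 0)"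
      using Ker_constant_directions[OF \<omega>] by (intro sum.cong) auto
    also have "\<dots> = m v e0 * dirderiv e0 \<omega> x vs" using e0 finite_E by simp
    finally show ?thesis by (simp add: dirderiv_def[of v] d0)
  qed
  have hd: "((\<lambda>x. \<omega> x vs) has_derivative (\<lambda>v. - l * m v e0 * C e0 (\<omega> x) vs)) (at x)" for x vs
  proof -
    have "fderiv (\<lambda>x. \<omega> x vs) x = (\<lambda>v. - l * m v e0 * C e0 (\<omega> x) vs)" by (rule ext) (rule d)
    with smooth_function_has_derivative[OF smooth_formD(2)[OF w'(1), of vs], of x] show ?thesis by simp
  qed
  have hdC: "((\<lambda>x. C e0 (\<omega> x) vs) has_derivative (\<lambda>v. l * m v e0 * \<omega> x vs)) (at x)" for x vs
  proof -
    note s = smooth_form_clifford(1)[OF w'(1), of e0]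
    have "fderiv (\<lambda>x. C e0 (\<omega> x) vs) x = (\<lambda>v. l * m v e0 * \<omega> x vs)"
    proof
      fix v
      have "fderiv (\<lambda>x. C e0 (\<omega> x) vs) x v = C e0 (dirderiv v \<omega> x) vs"
        using fun_cong[OF smooth_form_clifford(2)[OF w'(1), of v e0 x], of vs] by (simp add: dirderiv_def[of v "\<lambda>x. C e0 (\<omega> x)"])
      also have "dirderiv v \<omega> x = (\<lambda>us. (- l * m v e0) * C e0 (\<omega> x) us + 0 * \<omega> x us)" by (simp add: dirderiv_def d fun_eq_iff)
      also have "C e0 \<dots> vs = l * m v e0 * \<omega> x vs" unfolding clifford_real_combine clifford_e0_twice[OF w'(5)] by simp
      finally show "fderiv (\<lambda>x. C e0 (\<omega> x) vs) x v = l * m v e0 * \<omega> x vs" .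
    qed
    with smooth_function_has_derivative[OF smooth_formD(2)[OF s, of vs], of x] show ?thesis by simp
  qed
  have bl: "((\<lambda>x. m x e0) has_derivative (\<lambda>v. m v e0)) (at x)" for x
    using linear_height[of 1] by (intro bounded_linear_imp_has_derivative) (simp add: linear_conv_bounded_linear)
  \<comment> \<open>The inverse exponential applied to \<omega>; its derivative vanishes, so it
    equals its value at the origin, where the angle is 0.\<close>
  define P where "P = (\<lambda>vs x. cos (l * m x e0) * \<omega> x vs + sin (l * m x e0) * C e0 (\<omega> x) vs)"
  have "(P vs has_derivative (\<lambda>v. 0)) (at x)" for vs x
    unfolding P_def
    by (rule has_derivative_eq_rhs)
      (auto intro!: derivative_eq_intros bl hd hdC simp: fun_eq_iff algebra_simps)
  then have "\<exists>c. \<forall>x\<in>UNIV. P vs x = c" for vs by (intro has_derivative_zero_constant) auto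
  then have P0: "P vs x = \<omega> 0 vs" for vs x by (metis P_def UNIV_I m_simps(5) mult_zero_right cos_zero sin_zero mult_1 mult_zero_left add.right_neutral)
  have rot: "c * (c * a + s * b) + - s * (c * b - s * a) = (c * c + s * s) * a"
    "c * (c * a + - s * b) + s * (c * b + s * a) = (c * c + s * s) * a" for a b c s :: real
    by (simp_all add: algebra_simps)
  have main: "\<omega> x vs = cos (l * m x e0) * \<omega> 0 vs + - sin (l * m x e0) * C e0 (\<omega> 0) vs" for x vs
  proof -
    let ?c = "cos (l * m x e0)" and ?s = "sin (l * m x e0)"
    have "C e0 (\<omega> 0) vs = C e0 (\<lambda>us. ?c * \<omega> x us + ?s * C e0 (\<omega> x) us) vs"
      by (rule arg_cong[where f = "\<lambda>f. C e0 f vs"]) (rule ext, rule P0[unfolded P_def, symmetric])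
    also have "\<dots> = ?c * C e0 (\<omega> x) vs - ?s * \<omega> x vs" by (simp add: clifford_real_combine clifford_e0_twice[OF w'(5)])
    finally have C0: "C e0 (\<omega> 0) vs = ?c * C e0 (\<omega> x) vs - ?s * \<omega> x vs" .
    have "?c * \<omega> 0 vs + - ?s * C e0 (\<omega> 0) vs = (?c * ?c + ?s * ?s) * \<omega> x vs"
    proof -
      have W0: "\<omega> 0 vs = ?c * \<omega> x vs + ?s * C e0 (\<omega> x) vs" using P0[of vs x] by (simp only: P_def)
      show ?thesis by (subst W0, subst C0) (rule rot(1))
    qed
    also have "?c * ?c + ?s * ?s = 1" using sin_cos_squared_add2[of "l * m x e0"] by (simp add: power2_eq_square)
    finally show ?thesis by simp
  qed
  show "\<omega> = Tl l (\<lambda>x. \<omega> 0)" unfolding Tl_def by (intro ext) (rule main)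
  \<comment> \<open>Invariance under the generator, evaluated at the origin, compares the value of
    \<omega> at \<open>c\<close>, where the angle is l / r, with that at 0. Solving for the pullback
    \<open>u\<close> of the value at 0 gives the relation that defines \<open>U\<close>.\<close>
  obtain c where c: "(\<lambda>x. g0 x + c) \<in> \<Gamma>" "m c e0 = 1 / real r" using generator by blast
  have "(\<lambda>x. (g0 ^^ 1) x + c) \<in> \<Gamma>" using c by simp
  then have inv: "\<omega> c (map g0 vs) = \<omega> 0 vs" for vs
    using w'(2)[unfolded invariant_def, rule_format, of 1 c 0 vs] linear_0[OF g0(1)] by simp
  define u where "u = (\<lambda>vs. \<omega> 0 (map g0 vs))"
  let ?c = "cos (l / real r)" and ?s = "sin (l / real r)"
  have Cu: "C e0 (\<omega> 0) (map g0 vs) = C e0 u vs" for vs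
    using clifford_pullback_g0[OF smooth_formD(1)[OF w'(1), of 0], of 1 vs] by (simp add: u_def)
  have eq: "\<omega> 0 vs = ?c * u vs + - ?s * C e0 u vs" for vs
    using inv[of vs] main[of c "map g0 vs"] c(2) by (simp add: u_def Cu[unfolded u_def])
  have "(\<lambda>x. u) \<in> Vc" using forms.linear_intoD(1)[OF pb_Vc[OF g0(1)], of "\<lambda>x. \<omega> 0"] w'(5)[of 0] by (auto simp: Vc_def pb_def u_def)
  then have eu: "even_alt u" unfolding Vc_def mem_Collect_eq by metis
  have "C e0 (\<omega> 0) vs = ?c * C e0 u vs + ?s * u vs" for vs
  proof -
    have "C e0 (\<omega> 0) vs = C e0 (\<lambda>us. ?c * u us + - ?s * C e0 u us) vs" by (simp only: eq[symmetric])
    moreover have "C e0 (\<lambda>us. a * u us + b * C e0 u us) vs = a * C e0 u vs - b * u vs" for a b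
      by (simp add: clifford_real_combine clifford_e0_twice[OF eu])
    from this[of ?c "- ?s"] have "C e0 (\<lambda>us. ?c * u us + - ?s * C e0 u us) vs = ?c * C e0 u vs + ?s * u vs" by (simp only: minus_mult_left[symmetric] diff_minus_eq_add)
    ultimately show ?thesis by (rule trans)
  qed
  then have C1: "C e0 (\<omega> 0) vs = ?c * C e0 u vs + ?s * u vs" for vs .
  have "?c * \<omega> 0 vs + ?s * C e0 (\<omega> 0) vs = (?c * ?c + ?s * ?s) * u vs" for vs
  proof -
    show ?thesis by (simp only: eq[of vs] C1[of vs]) (rule rot(2))
  qed
  moreover have "?c * ?c + ?s * ?s = 1" using sin_cos_squared_add2[of "l / real r"] by (simp add: power2_eq_square)
  ultimately show "(\<lambda>x. \<omega> 0) \<in> U (l / real r)" unfolding U_iff using w'(5) by (simp add: u_def)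
qed

lemma Tl_Ker:
  assumes w: "(\<lambda>x. w) \<in> U (l / real r)"
  shows "Tl l (\<lambda>x. w) \<in> Ker l"
proof -
  define \<omega> where "\<omega> = Tl l (\<lambda>x. w)"
  have \<omega>: "\<omega> x vs = cos (l * m x e0) * w vs + - sin (l * m x e0) * C e0 w vs" for x vs by (simp add: \<omega>_def Tl_def)
  have ea: "even_alt w" using w by (simp add: U_iff)
  have eC: "even_alt (C e0 w)" using ea even_alt_clifford[of w e0] by (simp add: even_alt_def)
  have \<omega>x: "\<omega> x = (\<lambda>vs. cos (l * m x e0) * w vs + - sin (l * m x e0) * C e0 w vs)" for x by (rule ext) (rule \<omega>)
  have eax: "even_alt (\<omega> x)" for x unfolding \<omega>x by (rule even_alt_real_combine[OF ea eC])
  have sm: "smooth_form \<omega>"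
    unfolding smooth_form_def
  proof (intro conjI allI)
    show "alt (\<omega> x)" for x using eax by (simp add: even_alt_def)
    show "smooth_function (\<lambda>x. \<omega> x vs)" for vs
      using Ck_trig[OF linear_height, of _ l "w vs" "- C e0 w vs"] by (simp add: smooth_function_def \<omega>)
  qed
  have ev: "even_form \<omega>" using eax by (simp add: even_form_def even_alt_def)
  have dd: "dirderiv e \<omega> x = (\<lambda>vs. (- l * m e e0 * sin (l * m x e0)) * w vs + (- l * m e e0 * cos (l * m x e0)) * C e0 w vs)" for e x
  proof
    fix vs
    have bl: "((\<lambda>x. m x e0) has_derivative (\<lambda>v. m v e0)) (at x)"
      using linear_height[of 1] by (intro bounded_linear_imp_has_derivative) (simp add: linear_conv_bounded_linear)
    have "((\<lambda>x. \<omega> x vs) has_derivative (\<lambda>v. (- l * m v e0 * sin (l * m x e0)) * w vs + (- l * m v e0 * cos (l * m x e0)) * C e0 w vs)) (at x)"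
      unfolding \<omega> by (auto intro!: derivative_eq_intros bl simp: algebra_simps)
    from frechet_derivative_at[OF this, symmetric]
    show "dirderiv e \<omega> x vs = (- l * m e e0 * sin (l * m x e0)) * w vs + (- l * m e e0 * cos (l * m x e0)) * C e0 w vs"
      by (simp add: dirderiv_def)
  qed
  have C\<omega>: "C e0 (\<omega> x) vs = cos (l * m x e0) * C e0 w vs + sin (l * m x e0) * w vs" for x vs
    unfolding \<omega>x clifford_real_combine clifford_e0_twice[OF ea] by simp
  have eig: "(\<Sum>e\<in>E. C e (dirderiv e \<omega> x) vs) = l * \<omega> x vs" for x vs
  proof -
    have "C e (dirderiv e \<omega> x) vs = (if e = e0 then l * \<omega> x vs else 0)" if "e \<in> E" for e
      unfolding dd clifford_real_combine using that e0
      by (auto simp: onb_inner clifford_e0_twice[OF ea] \<omega> algebra_simps)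
    then show ?thesis using e0 finite_E by simp
  qed
  have inv: "invariant \<omega>"
    unfolding invariant_def
  proof (intro allI impI)
    fix k c x vs assume "(\<lambda>x. (g0 ^^ k) x + c) \<in> \<Gamma>"
    \<comment> \<open>\<open>deck\<close> may return another exponent; comparison at the origin
      shows that the translations, and then the linear parts, coincide.\<close>
    then obtain k' c' where kc: "(\<lambda>x. (g0 ^^ k) x + c) = (\<lambda>x. (g0 ^^ k') x + c')" "m c' e0 - real k' / real r \<in> \<int>"
      using deck by blast
    have cc: "c = c'" using fun_cong[OF kc(1), of 0] linear_0[OF g0_pow(1)] by simp
    then have gk: "g0 ^^ k = g0 ^^ k'" using kc(1) by (simp add: fun_eq_iff)
    have "m ((g0 ^^ k') x) e0 = m x e0" using g0_pow(2)[of k' x e0] by (simp add: g0_pow(4))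
    then have h: "m ((g0 ^^ k') x + c') e0 = m x e0 + m c' e0" by (simp add: m_simps)
    \<comment> \<open>The translation advances the angle by \<open>l * m c' e0\<close> and the
      pullback takes back k' l / r. The difference is l times an integer, harmless because l is a
      multiple of 2 pi unless \<open>w\<close> is 0.\<close>
    define \<alpha> where "\<alpha> = l * (m x e0 + m c' e0)"
    define \<beta> where "\<beta> = real k' * (l / real r)"
    have wk: "w (map (g0 ^^ k') vs) = cos \<beta> * w vs + sin \<beta> * C e0 w vs" for vs
      unfolding \<beta>_def by (rule U_pow[OF w])
    have "C e0 w (map (g0 ^^ k') vs) = C e0 (\<lambda>us. cos \<beta> * w us + sin \<beta> * C e0 w us) vs"
      using clifford_pullback_g0[of w k' vs] ea by (simp add: even_alt_def wk)
    then have Cwk: "C e0 w (map (g0 ^^ k') vs) = cos \<beta> * C e0 w vs - sin \<beta> * w vs"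
      by (simp add: clifford_real_combine clifford_e0_twice[OF ea])
    have 1: "\<omega> ((g0 ^^ k') x + c') (map (g0 ^^ k') vs) = cos (\<alpha> - \<beta>) * w vs + - sin (\<alpha> - \<beta>) * C e0 w vs"
      unfolding \<omega> h wk Cwk \<alpha>_def[symmetric] by (simp add: cos_diff sin_diff algebra_simps)
    have "\<omega> ((g0 ^^ k') x + c') (map (g0 ^^ k') vs) = \<omega> x vs"
    proof (cases "\<exists>us. w us \<noteq> 0")
      case True
      then obtain n :: int where n: "l = 2 * pi * of_int n" using U_frequency[OF w] by blast
      obtain q where q: "m c' e0 - real k' / real r = of_int q" using kc(2) Ints_cases by blast
      have "\<alpha> - \<beta> = l * m x e0 + l * (m c' e0 - real k' / real r)" by (simp add: \<alpha>_def \<beta>_def algebra_simps)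
      also have "\<dots> = l * m x e0 + of_int (n * q) * (2 * pi)" unfolding q by (simp add: n)
      finally have ab: "\<alpha> - \<beta> = l * m x e0 + of_int (n * q) * (2 * pi)" .
      have "cos (\<alpha> - \<beta>) = cos (l * m x e0)" "sin (\<alpha> - \<beta>) = sin (l * m x e0)"
        unfolding ab using sin.plus_of_int[of "l * m x e0" "n * q"] cos.plus_of_int[of "l * m x e0" "n * q"] by (simp_all add: mult_ac)
      then show ?thesis unfolding 1 by (simp add: \<omega>)
    next
      case False
      then have "w = (\<lambda>us. 0)" by auto
      then show ?thesis unfolding 1 by (simp add: \<omega> clifford_zero)
    qed
    then show "\<omega> ((g0 ^^ k) x + c) (map (g0 ^^ k) vs) = \<omega> x vs" by (simp add: cc gk)
  qed
  have "J l \<omega> = 0"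
    by (simp add: J_def dd C\<omega> m_e0 fun_eq_iff algebra_simps)
  then show ?thesis using sm ev inv eig unfolding \<omega>_def[symmetric] by (simp add: Ker_def Eig_def)
qed

lemma U_finite: "\<exists>B. finite B \<and> U \<theta> \<subseteq> forms.span B"
  using Vc_finite by (auto simp: forms.eigenspace_of_def)

text \<open>Evaluation at the origin and \<open>Tl l\<close> are injective maps in the two
  directions, which is all that the equality of dimensions needs.\<close>

lemma dim_Ker:
  assumes fin: "finite (Freqs l)"
  shows "forms.dim (Ker l) = forms.dim (U (l / real r))"
proof (rule antisym)
  obtain B where B: "finite B" "Eig l \<subseteq> forms.span B" using Eig_dim(2)[OF fin] by blast
  have BK: "Ker l \<subseteq> forms.span B" using B by (auto simp: Ker_def)
  obtain B' where B': "finite B'" "U (l / real r) \<subseteq> forms.span B'" using U_finite by blast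
  show "forms.dim (Ker l) \<le> forms.dim (U (l / real r))"
  proof (rule forms.dim_le_injective[OF Ker_subspace B(1) BK U_subspace B'])
    show "forms.linear_into (Ker l) (\<lambda>\<omega> x. \<omega> 0) (U (l / real r))"
      by (simp add: forms.linear_into_def Ker_form(2) plus_fun_def form_scale_def)
    show "\<omega> = 0" if "\<omega> \<in> Ker l" "(\<lambda>x. \<omega> 0) = 0" for \<omega>
    proof -
      have z: "\<omega> 0 = (\<lambda>vs. 0)" using fun_cong[OF that(2)] by (simp add: zero_fun_def)
      have "\<omega> x vs = Tl l (\<lambda>x. \<omega> 0) x vs" for x vs by (rule fun_cong[OF fun_cong[OF Ker_form(1)[OF that(1)]]])
      then have "\<omega> x vs = 0" for x vs unfolding Tl_def z by (simp add: clifford_zero)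
      then show ?thesis by (simp add: fun_eq_iff)
    qed
  qed
  show "forms.dim (U (l / real r)) \<le> forms.dim (Ker l)"
  proof (rule forms.dim_le_injective[OF U_subspace B' Ker_subspace B(1) BK])
    show "forms.linear_into (U (l / real r)) (Tl l) (Ker l)"
      unfolding forms.linear_into_def
    proof (intro conjI ballI allI)
      show "Tl l x \<in> Ker l" if "x \<in> U (l / real r)" for x using U_obtain[OF that] that Tl_Ker by blast
      show "Tl l (x + y) = Tl l x + Tl l y" for x y by (simp add: Tl_def fun_eq_iff clifford_add plus_fun_def algebra_simps)
      show "Tl l (form_scale c x) = form_scale c (Tl l x)" for c x
        using clifford_scaleR[of m vol E e0 c "x _"] by (simp add: Tl_def fun_eq_iff form_scale_def algebra_simps)
    qed
    show "x = 0" if x: "x \<in> U (l / real r)" "Tl l x = 0" for x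
    proof -
      obtain w where w: "x = (\<lambda>x. w)" using U_obtain[OF x(1)] by blast
      have "Tl l x 0 vs = 0" for vs using x(2) by simp
      then show ?thesis by (simp add: w Tl_def m_simps fun_eq_iff)
    qed
  qed
qed

lemma U_dim_zero:
  assumes "\<nexists>n::int. l = 2 * pi * of_int n" shows "forms.dim (U (l / real r)) = 0"
proof -
  have "x = 0" if x: "x \<in> U (l / real r)" for x
  proof -
    obtain w where w: "x = (\<lambda>x. w)" using U_obtain[OF x] by blast
    then have "w vs = 0" for vs using U_frequency[of w l vs] x assms by blast
    then show ?thesis by (simp add: w fun_eq_iff)
  qed
  then have "U (l / real r) = {0}" using forms.subspace_0[OF U_subspace] by blast
  then show ?thesis using forms.dim_zero by metis
qed

lemma kappa_divisible:
  assumes hs: "g0 = foldr (\<circ>) hs id"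
    and h: "\<And>h. h \<in> set hs \<Longrightarrow> linear h \<and> (\<forall>u v. m (h u) (h v) = m u v) \<and> (\<forall>vs. vol (map h vs) = vol vs) \<and> h e0 = e0 \<and>
      (\<exists>t. linear t \<and> (\<forall>u v. m (t u) (t v) = m u v) \<and> (\<forall>vs. vol (map t vs) = - vol vs) \<and> t e0 = e0
        \<and> (\<forall>x. t (t x) = x) \<and> (\<forall>x. t (h x) = h (t x)))"
  shows "r dvd (\<Sum>j<r. j * forms.dim (U (2 * pi * real j / real r)))"
proof -
  obtain F where F: "finite F" "Vc \<subseteq> forms.span F" using Vc_finite by blast
  \<comment> \<open>Pullback reverses compositions, hence \<open>rev\<close>.\<close>
  have fold: "pb (foldr (\<circ>) gs id) x = foldr (\<lambda>\<sigma> y. \<sigma> y) (map pb (rev gs)) x" for gs and x :: "'a form"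
  proof (induction gs arbitrary: x)
    case Nil show ?case by (simp add: pb_def id_def)
  next
    case (Cons g gs)
    have "foldr (\<lambda>\<sigma> y. \<sigma> y) (map pb (rev (g # gs))) x = pb (foldr (\<circ>) gs id) (pb g x)" by (simp add: Cons)
    also have "\<dots> = pb (foldr (\<circ>) (g # gs) id) x" by (simp add: pb_def)
    finally show ?case by (rule sym)
  qed
  show ?thesis
  proof (rule forms.eigenvalue_sum_divisible[OF Vc_subspace F Sf_Vc _ r, where \<sigma>s = "map pb (rev hs)"])
    show "(pb g0 ^^ r) x = x" if "x \<in> Vc" for x by (simp add: pb_pow g0) (simp add: pb_def id_def)
    show "pb g0 x = foldr (\<lambda>\<sigma> y. \<sigma> y) (map pb (rev hs)) x" for x by (rule fold[of hs x, folded hs])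
    fix \<sigma> assume "\<sigma> \<in> set (map pb (rev hs))"
    then obtain g where g: "g \<in> set hs" "\<sigma> = pb g" by auto
    obtain t where t: "linear t" "\<forall>u v. m (t u) (t v) = m u v" "\<forall>vs. vol (map t vs) = - vol vs" "t e0 = e0"
      "\<forall>x. t (t x) = x" "\<forall>x. t (g x) = g (t x)" using h[OF g(1)] by blast
    have gS: "pb g (Sf x) = Sf (pb g x)" if "x \<in> Vc" for x
      using pb_Sf[of g 1 x] h[OF g(1)] that by (simp add: form_scale_def)
    \<comment> \<open>\<open>t\<close> reverses the orientation, so \<open>pb_Sf\<close> applies
      with \<delta> = -1.\<close>
    have tS: "pb t (Sf x) = - Sf (pb t x)" if "x \<in> Vc" for x
      using pb_Sf[of t "-1" x] t that by (simp add: form_scale_def fun_eq_iff)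
    have tt: "pb t (pb t x) = x" for x using t(5) by (simp add: pb_def o_def)
    have tg: "pb t (pb g x) = pb g (pb t x)" for x using t(6) by (simp add: pb_def o_def)
    show "forms.linear_into Vc \<sigma> Vc \<and> (\<forall>x\<in>Vc. \<sigma> (Sf x) = Sf (\<sigma> x)) \<and>
      (\<exists>T. forms.linear_into Vc T Vc \<and> (\<forall>x\<in>Vc. T (T x) = x \<and> T (Sf x) = - Sf (T x) \<and> T (\<sigma> x) = \<sigma> (T x)))"
      unfolding g(2) using pb_Vc[of g] pb_Vc[OF t(1)] h[OF g(1)] gS tS tt tg
      by (intro conjI ballI exI[of _ "pb t"]) simp_all
  qed
qed

end

section \<open>Lattice sums and uniqueness of the continuation\<close>

lemma int_weight_bound:
  "\<exists>W \<ge> 0. \<forall>K. finite K \<longrightarrow> (\<Sum>k\<in>K. 1 / (1 + \<bar>real_of_int k\<bar>)\<^sup>2) \<le> W"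
proof -
  define f where "f = (\<lambda>n::nat. 1 / (1 + real n)\<^sup>2)"
  have "summable (\<lambda>n. inverse (of_nat (Suc n) ^ 2 :: real))"
    using inverse_power_summable[of 2, where 'a = real] by (subst summable_Suc_iff) simp
  then have sf: "summable f" unfolding f_def by (simp add: inverse_eq_divide add_ac)
  have f0: "f n \<ge> 0" for n by (simp add: f_def)
  have le: "(\<Sum>k\<in>K. f (g k)) \<le> suminf f" if "finite K" "inj_on g K" for K :: "int set" and g
  proof -
    have "(\<Sum>k\<in>K. f (g k)) = sum f (g ` K)" using that by (simp add: sum.reindex)
    also have "\<dots> \<le> suminf f" using that f0 by (intro sum_le_suminf sf) auto
    finally show ?thesis .
  qed
  have "(\<Sum>k\<in>K. 1 / (1 + \<bar>real_of_int k\<bar>)\<^sup>2) \<le> 2 * suminf f" if K: "finite K" for K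
  proof -
    have "(\<Sum>k\<in>K. 1 / (1 + \<bar>real_of_int k\<bar>)\<^sup>2) = (\<Sum>k\<in>K. f (nat \<bar>k\<bar>))" by (simp add: f_def)
    also have "\<dots> = (\<Sum>k\<in>K \<inter> {0..}. f (nat \<bar>k\<bar>)) + (\<Sum>k\<in>K \<inter> {..<0}. f (nat \<bar>k\<bar>))"
      using K by (subst sum.union_disjoint[symmetric]) (auto intro!: sum.cong)
    also have "\<dots> \<le> suminf f + suminf f"
      using K by (intro add_mono le) (auto simp: inj_on_def)
    finally show ?thesis by simp
  qed
  moreover have "2 * suminf f \<ge> 0" using suminf_nonneg[OF sf f0] by simp
  ultimately show ?thesis by blast
qed

text \<open>A finite set of frequencies is enclosed in a box \<open>PiE\<close>, over which the sum
  of the products is a product of one-dimensional sums. With seven coordinates the quadratic weights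
  lead to the exponent 14 below.\<close>

lemma dual_lattice_weight_bound:
  "\<exists>W \<ge> 0. \<forall>F \<subseteq> dual_lattice. finite F \<longrightarrow> (\<Sum>\<xi>\<in>F. \<Prod>b\<in>(Basis :: 'a::euclidean_space set). 1 / (1 + \<bar>\<xi> \<bullet> b\<bar>)\<^sup>2) \<le> W"
proof -
  obtain W where W: "W \<ge> 0" "\<And>K. finite K \<Longrightarrow> (\<Sum>k\<in>K. 1 / (1 + \<bar>real_of_int k\<bar>)\<^sup>2) \<le> W"
    using int_weight_bound by blast
  have "(\<Sum>\<xi>\<in>F. \<Prod>b\<in>(Basis :: 'a set). 1 / (1 + \<bar>\<xi> \<bullet> b\<bar>)\<^sup>2) \<le> W ^ card (Basis :: 'a set)"
    if F: "F \<subseteq> dual_lattice" "finite F" for F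
  proof -
    define \<phi> where "\<phi> = (\<lambda>\<xi>::'a. restrict (\<lambda>b. \<lfloor>\<xi> \<bullet> b\<rfloor>) Basis)"
    define K where "K = (\<lambda>(\<xi>, b). \<lfloor>\<xi> \<bullet> b\<rfloor>) ` (F \<times> (Basis :: 'a set))"
    have fK: "finite K" using F(2) by (simp add: K_def)
    have fl: "of_int \<lfloor>\<xi> \<bullet> b\<rfloor> = \<xi> \<bullet> b" if "\<xi> \<in> F" "b \<in> Basis" for \<xi> b
    proof -
      have "\<xi> \<in> dual_lattice" using that(1) F(1) by (rule subsetD[rotated])
      then have "\<xi> \<bullet> b \<in> \<int>" using that(2) unfolding dual_lattice_def by blast
      then show ?thesis by (elim Ints_cases) simp
    qed
    have inj: "inj_on \<phi> F"
    proof (rule inj_onI)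
      fix \<xi> \<eta> assume a: "\<xi> \<in> F" "\<eta> \<in> F" "\<phi> \<xi> = \<phi> \<eta>"
      have "\<xi> \<bullet> b = \<eta> \<bullet> b" if "b \<in> Basis" for b
      proof -
        have fe: "\<lfloor>\<xi> \<bullet> b\<rfloor> = \<lfloor>\<eta> \<bullet> b\<rfloor>" using fun_cong[OF a(3), of b] that by (simp add: \<phi>_def)
        have "\<xi> \<bullet> b = of_int \<lfloor>\<xi> \<bullet> b\<rfloor>" by (rule fl[OF a(1) that, symmetric])
        also have "\<dots> = of_int \<lfloor>\<eta> \<bullet> b\<rfloor>" by (simp only: fe)
        also have "\<dots> = \<eta> \<bullet> b" by (rule fl[OF a(2) that])
        finally show ?thesis .
      qed
      then show "\<xi> = \<eta>" by (rule euclidean_eqI)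
    qed
    have "(\<Sum>\<xi>\<in>F. \<Prod>b\<in>(Basis :: 'a set). 1 / (1 + \<bar>\<xi> \<bullet> b\<bar>)\<^sup>2) = (\<Sum>p\<in>\<phi> ` F. \<Prod>b\<in>Basis. 1 / (1 + \<bar>real_of_int (p b)\<bar>)\<^sup>2)"
      by (subst sum.reindex[OF inj], rule sum.cong[OF refl], unfold o_def, rule prod.cong[OF refl]) (simp add: \<phi>_def fl)
    also have "\<dots> \<le> (\<Sum>p\<in>PiE (Basis :: 'a set) (\<lambda>_. K). \<Prod>b\<in>Basis. 1 / (1 + \<bar>real_of_int (p b)\<bar>)\<^sup>2)"
    proof (rule sum_mono2)
      show "finite (PiE (Basis :: 'a set) (\<lambda>_. K))" using fK by (intro finite_PiE) auto
      show "\<phi> ` F \<subseteq> PiE Basis (\<lambda>_. K)" by (force simp: \<phi>_def K_def)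
    qed (auto intro!: prod_nonneg)
    also have "\<dots> = (\<Prod>b\<in>(Basis :: 'a set). \<Sum>k\<in>K. 1 / (1 + \<bar>real_of_int k\<bar>)\<^sup>2)"
      using fK by (intro prod_sum_PiE[symmetric]) auto
    also have "\<dots> = (\<Sum>k\<in>K. 1 / (1 + \<bar>real_of_int k\<bar>)\<^sup>2) ^ card (Basis :: 'a set)" by simp
    also have "\<dots> \<le> W ^ card (Basis :: 'a set)"
      by (rule power_mono[OF W(2)[OF fK]]) (auto intro: sum_nonneg)
    finally show ?thesis .
  qed
  then show ?thesis using zero_le_power[OF W(1)] by blast
qed

text \<open>The difference of two continuations vanishes on a right half-plane, hence off a sparse
  set by the identity theorem. The point 0 might belong to that set; analyticity at 0 gives
  continuity, which settles the value there.\<close>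

lemma eta_continuation_unique:
  assumes "eta_continuation \<Gamma> m vol F" "eta_continuation \<Gamma> m vol G"
  shows "F 0 = G 0"
proof -
  define D where "D = (\<lambda>s. F s - G s)"
  obtain c d where c: "\<And>s. Re s > c \<Longrightarrow> ((\<lambda>l. of_real (sgn l) * of_nat (multiplicity_of \<Gamma> m vol l) * of_real \<bar>l\<bar> powr (- s))
          has_sum F s) (eigenvalues \<Gamma> m vol - {0})"
      "\<And>s. Re s > d \<Longrightarrow> ((\<lambda>l. of_real (sgn l) * of_nat (multiplicity_of \<Gamma> m vol l) * of_real \<bar>l\<bar> powr (- s))
          has_sum G s) (eigenvalues \<Gamma> m vol - {0})"
    using assms unfolding eta_continuation_def by blast
  define z where "z = complex_of_real (max c d + 1)"
  have half: "D s = 0" if "Re s > max c d" for s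
    using has_sum_unique[OF c(1)[of s] c(2)[of s]] that by (simp add: D_def)
  have "open {s. Re s > max c d}" by (rule open_halfspace_Re_gt)
  then have "eventually (\<lambda>s. s \<in> {s. Re s > max c d}) (at z)"
    by (rule eventually_at_in_open') (simp add: z_def max_def)
  then have z0: "eventually (\<lambda>s. D s = 0) (at z)" by eventually_elim (rule half, simp)
  have "D meromorphic_on UNIV"
    unfolding D_def using assms by (intro meromorphic_on_diff) (auto simp: eta_continuation_def)
  from meromorphic_imp_constant_or_avoid[OF this open_UNIV connected_UNIV, of 0]
  have "eventually (\<lambda>s. D s = 0) (cosparse UNIV) \<or> eventually (\<lambda>s. D s \<noteq> 0) (cosparse UNIV)" by simp
  moreover have False if "eventually (\<lambda>s. D s \<noteq> 0) (cosparse UNIV)"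
  proof -
    have "eventually (\<lambda>s. D s \<noteq> 0) (at z)" by (rule eventually_cosparse_imp_eventually_at[OF that]) simp
    with z0 have "eventually (\<lambda>s. False) (at z)" by eventually_elim simp
    then show False by simp
  qed
  ultimately have "eventually (\<lambda>s. D s = 0) (cosparse UNIV)" by blast
  then have "eventually (\<lambda>s. D s = 0) (at 0)" by (rule eventually_cosparse_imp_eventually_at) simp
  then have l0: "(D \<longlongrightarrow> 0) (at 0)" by (rule tendsto_eventually)
  have "D analytic_on {0}" unfolding D_def using assms by (intro analytic_on_diff) (auto simp: eta_continuation_def)
  then have "isCont D 0" by (rule analytic_at_imp_isCont)
  then have "(D \<longlongrightarrow> D 0) (at 0)" by (simp add: isCont_def)
  from LIM_unique[OF this l0] show ?thesis by (simp add: D_def)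
qed

section \<open>Convergence and value of the eta function\<close>

context flat_quotient
begin

lemma frequency_bound:
  "\<exists>A > 0. \<forall>\<xi>. \<forall>b\<in>Basis. \<bar>\<xi> \<bullet> b\<bar> \<le> A * sqrt (qform \<xi>)"
proof -
  define A where "A = 1 + (\<Sum>b\<in>Basis. \<Sum>e\<in>E. \<bar>m b e\<bar>)"
  have A: "A > 0" unfolding A_def by (intro add_pos_nonneg sum_nonneg) auto
  have "\<bar>\<xi> \<bullet> b\<bar> \<le> A * sqrt (qform \<xi>)" if b: "b \<in> Basis" for \<xi> b
  proof -
    have q0: "qform \<xi> \<ge> 0" unfolding qform_def by (intro sum_nonneg) simp
    have ele: "\<bar>\<xi> \<bullet> e\<bar> \<le> sqrt (qform \<xi>)" if "e \<in> E" for e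
    proof -
      have "(\<xi> \<bullet> e)\<^sup>2 \<le> qform \<xi>" unfolding qform_def using that finite_E by (intro member_le_sum) auto
      then show ?thesis by (metis real_sqrt_abs real_sqrt_le_mono)
    qed
    have "\<xi> \<bullet> b = \<xi> \<bullet> (\<Sum>e\<in>E. m b e *\<^sub>R e)" by (rule arg_cong[OF expand])
    also have "\<dots> = (\<Sum>e\<in>E. m b e * (\<xi> \<bullet> e))" by (simp add: inner_sum_right)
    finally have "\<bar>\<xi> \<bullet> b\<bar> \<le> (\<Sum>e\<in>E. \<bar>m b e\<bar> * \<bar>\<xi> \<bullet> e\<bar>)" by (simp add: abs_mult[symmetric] sum_abs)
    also have "\<dots> \<le> (\<Sum>e\<in>E. \<bar>m b e\<bar> * sqrt (qform \<xi>))" by (intro sum_mono mult_left_mono ele) auto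
    also have "\<dots> = (\<Sum>e\<in>E. \<bar>m b e\<bar>) * sqrt (qform \<xi>)" by (simp add: sum_distrib_right)
    also have "\<dots> \<le> A * sqrt (qform \<xi>)"
    proof (rule mult_right_mono)
      have "(\<Sum>e\<in>E. \<bar>m b e\<bar>) \<le> (\<Sum>b\<in>Basis. \<Sum>e\<in>E. \<bar>m b e\<bar>)"
        using b by (intro member_le_sum sum_nonneg) auto
      then show "(\<Sum>e\<in>E. \<bar>m b e\<bar>) \<le> A" by (simp add: A_def)
    qed (simp add: q0)
    finally show ?thesis .
  qed
  with A show ?thesis by blast
qed

text \<open>A nonzero lattice frequency has a coordinate of modulus at least 1, so |l| is bounded
  below and 1 + |\<xi> \<bullet> b| is at most B |l| for every b. Squaring and multiplying over the
  seven directions gives the power 14.\<close>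

lemma Freqs_weight:
  "\<exists>B > 0. \<forall>l \<xi>. l \<noteq> 0 \<longrightarrow> \<xi> \<in> Freqs l \<longrightarrow> 1 \<le> B * \<bar>l\<bar> \<and> 1 / \<bar>l\<bar> ^ 14 \<le> B ^ 14 * (\<Prod>b\<in>Basis. 1 / (1 + \<bar>\<xi> \<bullet> b\<bar>)\<^sup>2)"
proof -
  obtain A where A: "A > 0" "\<And>\<xi> b. b \<in> Basis \<Longrightarrow> \<bar>\<xi> \<bullet> b\<bar> \<le> A * sqrt (qform \<xi>)" using frequency_bound by blast
  \<comment> \<open>The dual length of \<xi> is |l| / (2 pi), so its coordinates are at most B |l| /
    2; the other half covers the 1 in the weights.\<close>
  define B where "B = A / pi"
  have B: "B > 0" using A by (simp add: B_def)
  have "1 \<le> B * \<bar>l\<bar> \<and> 1 / \<bar>l\<bar> ^ 14 \<le> B ^ 14 * (\<Prod>b\<in>Basis. 1 / (1 + \<bar>\<xi> \<bullet> b\<bar>)\<^sup>2)" if l: "l \<noteq> 0" and \<xi>: "\<xi> \<in> Freqs l" for l \<xi>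
  proof -
    have q: "4 * pi\<^sup>2 * qform \<xi> = l\<^sup>2" and dl: "\<xi> \<in> dual_lattice" using \<xi> by (auto simp: Freqs_def)
    have "qform \<xi> = (l / (2 * pi))\<^sup>2" using q by (simp add: power_divide power_mult_distrib field_simps)
    then have sq: "sqrt (qform \<xi>) = \<bar>l\<bar> / (2 * pi)" by (simp add: abs_divide)
    have le: "\<bar>\<xi> \<bullet> b\<bar> \<le> B * \<bar>l\<bar> / 2" if "b \<in> Basis" for b using A(2)[OF that, of \<xi>] by (simp add: sq B_def)
    have "\<xi> \<noteq> 0" using q l by (auto simp: qform_def)
    then obtain b0 where b0: "b0 \<in> Basis" "\<xi> \<bullet> b0 \<noteq> 0" using euclidean_all_zero_iff by blast
    have "\<xi> \<bullet> b0 \<in> \<int>" using dl b0 by (simp add: dual_lattice_def)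
    then have "1 \<le> \<bar>\<xi> \<bullet> b0\<bar>" using b0(2) by (rule Ints_nonzero_abs_ge1)
    with le[OF b0(1)] have one: "1 \<le> B * \<bar>l\<bar> / 2" by linarith
    have Bl: "B * \<bar>l\<bar> > 0" using B l by simp
    have "(\<Prod>b\<in>(Basis::'a set). 1 / (B * \<bar>l\<bar>)\<^sup>2) \<le> (\<Prod>b\<in>Basis. 1 / (1 + \<bar>\<xi> \<bullet> b\<bar>)\<^sup>2)"
    proof (intro prod_mono conjI)
      fix b :: 'a assume "b \<in> Basis"
      then have "1 + \<bar>\<xi> \<bullet> b\<bar> \<le> B * \<bar>l\<bar>" using le[of b] one by linarith
      then have "(1 + \<bar>\<xi> \<bullet> b\<bar>)\<^sup>2 \<le> (B * \<bar>l\<bar>)\<^sup>2" by (rule power_mono) simp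
      then show "1 / (B * \<bar>l\<bar>)\<^sup>2 \<le> 1 / (1 + \<bar>\<xi> \<bullet> b\<bar>)\<^sup>2" by (intro divide_left_mono) (auto intro!: mult_pos_pos zero_less_power Bl add_pos_nonneg)
    qed simp
    also have "(\<Prod>b\<in>(Basis::'a set). 1 / (B * \<bar>l\<bar>)\<^sup>2) = 1 / (B ^ 14 * \<bar>l\<bar> ^ 14)"
      using dim7 by (simp add: power_divide power_mult_distrib flip: power_mult)
    finally have "B ^ 14 * (1 / (B ^ 14 * \<bar>l\<bar> ^ 14)) \<le> B ^ 14 * (\<Prod>b\<in>Basis. 1 / (1 + \<bar>\<xi> \<bullet> b\<bar>)\<^sup>2)"
      using B by (intro mult_left_mono) auto
    then show ?thesis using B one by auto
  qed
  with B show ?thesis by blast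
qed

text \<open>The sets \<open>S l\<close> are arbitrary finite subsets because the finiteness of
  \<open>Freqs l\<close> is itself deduced from this bound. \<open>inj_on abs L\<close> excludes l
  together with -l, which have the same frequencies.\<close>

lemma Freqs_sum_bound:
  "\<exists>W. \<forall>L S. finite L \<and> 0 \<notin> L \<and> inj_on abs L \<and> (\<forall>l\<in>L. finite (S l) \<and> S l \<subseteq> Freqs l)
    \<longrightarrow> (\<Sum>l\<in>L. real (card (S l)) / \<bar>l\<bar> ^ 14) \<le> W"
proof -
  obtain B where B: "B > 0" "\<And>l \<xi>. l \<noteq> 0 \<Longrightarrow> \<xi> \<in> Freqs l \<Longrightarrow> 1 / \<bar>l\<bar> ^ 14 \<le> B ^ 14 * (\<Prod>b\<in>Basis. 1 / (1 + \<bar>\<xi> \<bullet> b\<bar>)\<^sup>2)"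
    using Freqs_weight by blast
  obtain W where W: "W \<ge> 0" "\<And>F. F \<subseteq> dual_lattice \<Longrightarrow> finite F \<Longrightarrow> (\<Sum>\<xi>\<in>F. \<Prod>b\<in>(Basis :: 'a set). 1 / (1 + \<bar>\<xi> \<bullet> b\<bar>)\<^sup>2) \<le> W"
    using dual_lattice_weight_bound by blast
  have "(\<Sum>l\<in>L. real (card (S l)) / \<bar>l\<bar> ^ 14) \<le> B ^ 14 * W"
    if "finite L \<and> 0 \<notin> L \<and> inj_on abs L \<and> (\<forall>l\<in>L. finite (S l) \<and> S l \<subseteq> Freqs l)" for L S
  proof -
    have L: "finite L" "0 \<notin> L" "inj_on abs L" and S: "\<forall>l\<in>L. finite (S l) \<and> S l \<subseteq> Freqs l" using that by blast+
    have disj: "S l \<inter> S l' = {}" if "l \<in> L" "l' \<in> L" "l \<noteq> l'" for l l'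
    proof -
      have "\<bar>l\<bar> \<noteq> \<bar>l'\<bar>" using that L(3) by (auto simp: inj_on_def)
      then have "l\<^sup>2 \<noteq> l'\<^sup>2" by (simp add: power2_eq_iff abs_eq_iff)
      then have "Freqs l \<inter> Freqs l' = {}" by (auto simp: Freqs_def)
      then show ?thesis using S that by blast
    qed
    have "(\<Sum>l\<in>L. real (card (S l)) / \<bar>l\<bar> ^ 14) = (\<Sum>l\<in>L. \<Sum>\<xi>\<in>S l. 1 / \<bar>l\<bar> ^ 14)" by simp
    also have "\<dots> \<le> (\<Sum>l\<in>L. \<Sum>\<xi>\<in>S l. B ^ 14 * (\<Prod>b\<in>Basis. 1 / (1 + \<bar>\<xi> \<bullet> b\<bar>)\<^sup>2))"
      using L(2) S by (intro sum_mono B(2)) auto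
    also have "\<dots> = B ^ 14 * (\<Sum>l\<in>L. \<Sum>\<xi>\<in>S l. \<Prod>b\<in>Basis. 1 / (1 + \<bar>\<xi> \<bullet> b\<bar>)\<^sup>2)" by (simp only: sum_distrib_left)
    also have "(\<Sum>l\<in>L. \<Sum>\<xi>\<in>S l. \<Prod>b\<in>Basis. 1 / (1 + \<bar>\<xi> \<bullet> b\<bar>)\<^sup>2) = (\<Sum>\<xi>\<in>(\<Union>l\<in>L. S l). \<Prod>b\<in>Basis. 1 / (1 + \<bar>\<xi> \<bullet> b\<bar>)\<^sup>2)"
      using L(1) S disj by (intro sum.UNION_disjoint[symmetric]) auto
    also have "\<dots> \<le> W" using L(1) S by (intro W(2)) (auto simp: Freqs_def)
    finally show ?thesis using B(1) by simp
  qed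
  then show ?thesis by (intro exI[of _ "B ^ 14 * W"] allI impI)
qed

lemma finite_Freqs: "finite (Freqs l)"
proof (cases "l = 0")
  case True
  obtain A where A: "A > 0" "\<And>\<xi> b. b \<in> Basis \<Longrightarrow> \<bar>\<xi> \<bullet> b\<bar> \<le> A * sqrt (qform \<xi>)" using frequency_bound by blast
  have "\<xi> = 0" if "\<xi> \<in> Freqs l" for \<xi>
  proof -
    have "qform \<xi> = 0" using that True by (simp add: Freqs_def)
    then have "\<xi> \<bullet> b = 0" if "b \<in> Basis" for b using A(2)[OF that, of \<xi>] by simp
    then show ?thesis using euclidean_all_zero_iff by blast
  qed
  then have "Freqs l \<subseteq> {0}" by blast
  then show ?thesis by (rule finite_subset) simp
next
  case False
  from Freqs_sum_bound obtain W where W: "\<forall>L S. finite L \<and> 0 \<notin> L \<and> inj_on abs L \<and> (\<forall>l\<in>L. finite (S l) \<and> S l \<subseteq> Freqs l)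
    \<longrightarrow> (\<Sum>l\<in>L. real (card (S l)) / \<bar>l\<bar> ^ 14) \<le> W" ..
  \<comment> \<open>The bound for the single eigenvalue l limits the size of all finite
    subsets.\<close>
  have "card S \<le> nat \<lceil>W * \<bar>l\<bar> ^ 14\<rceil>" if "S \<subseteq> Freqs l" "finite S" for S
  proof -
    have "real (card S) / \<bar>l\<bar> ^ 14 \<le> W" using W[rule_format, of "{l}" "\<lambda>_. S"] that False by simp
    then have "real (card S) \<le> W * \<bar>l\<bar> ^ 14" using False by (simp add: pos_divide_le_eq)
    then show ?thesis by linarith
  qed
  then show ?thesis using finite_if_finite_subsets_card_bdd[of "Freqs l"] by blast
qed

abbreviation mult :: "real \<Rightarrow> nat" where "mult l \<equiv> forms.dim (Eig l)"

lemma multiplicity_bound: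
  "\<exists>W. \<forall>L. finite L \<longrightarrow> 0 \<notin> L \<longrightarrow> inj_on abs L \<longrightarrow> (\<Sum>l\<in>L. real (mult l) / \<bar>l\<bar> ^ 14) \<le> W"
proof -
  from Freqs_sum_bound obtain W where W: "\<forall>L S. finite L \<and> 0 \<notin> L \<and> inj_on abs L \<and> (\<forall>l\<in>L. finite (S l) \<and> S l \<subseteq> Freqs l)
    \<longrightarrow> (\<Sum>l\<in>L. real (card (S l)) / \<bar>l\<bar> ^ 14) \<le> W" ..
  define N where "N = real (2 * card elists)"
  have "(\<Sum>l\<in>L. real (mult l) / \<bar>l\<bar> ^ 14) \<le> N * W" if L: "finite L" "0 \<notin> L" "inj_on abs L" for L
  proof -
    have "real (mult l) / \<bar>l\<bar> ^ 14 \<le> N * (real (card (Freqs l)) / \<bar>l\<bar> ^ 14)" for l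
    proof -
      have "real (mult l) \<le> real (2 * card elists * card (Freqs l))" using Eig_dim(1)[OF finite_Freqs, of l] by (rule of_nat_mono)
      also have "\<dots> = N * real (card (Freqs l))" by (simp add: N_def)
      finally have "real (mult l) / \<bar>l\<bar> ^ 14 \<le> (N * real (card (Freqs l))) / \<bar>l\<bar> ^ 14" by (rule divide_right_mono) simp
      then show ?thesis by simp
    qed
    then have "(\<Sum>l\<in>L. real (mult l) / \<bar>l\<bar> ^ 14) \<le> (\<Sum>l\<in>L. N * (real (card (Freqs l)) / \<bar>l\<bar> ^ 14))" by (intro sum_mono)
    also have "\<dots> = N * (\<Sum>l\<in>L. real (card (Freqs l)) / \<bar>l\<bar> ^ 14)" by (simp only: sum_distrib_left)
    also have "\<dots> \<le> N * W" using L finite_Freqs by (intro mult_left_mono W[rule_format]) (auto simp: N_def)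
    finally show ?thesis .
  qed
  then show ?thesis by blast
qed

definition eta_term :: "complex \<Rightarrow> real \<Rightarrow> complex" where
  "eta_term s l = of_real (sgn l) * of_nat (mult l) * of_real \<bar>l\<bar> powr (- s)"

lemma eta_term_summable:
  assumes s: "Re s > 14" and L: "0 \<notin> L" "inj_on abs L"
  shows "eta_term s summable_on L"
proof (rule abs_summable_summable, rule nonneg_bdd_above_summable_on)
  obtain W where W: "\<And>L. finite L \<Longrightarrow> 0 \<notin> L \<Longrightarrow> inj_on abs L \<Longrightarrow> (\<Sum>l\<in>L. real (mult l) / \<bar>l\<bar> ^ 14) \<le> W"
    using multiplicity_bound by blast
  obtain B where B: "B > 0" "\<And>l \<xi>. l \<noteq> 0 \<Longrightarrow> \<xi> \<in> Freqs l \<Longrightarrow> 1 \<le> B * \<bar>l\<bar>" using Freqs_weight by blast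
  \<comment> \<open>Where the multiplicity is nonzero |l| is at least 1 / B, so the surplus factor
    |l|^(14 - Re s) is at most this constant.\<close>
  define M where "M = B powr (Re s - 14)"
  have le: "norm (eta_term s l) \<le> M * (real (mult l) / \<bar>l\<bar> ^ 14)" if l: "l \<noteq> 0" for l
  proof (cases "mult l = 0")
    case True then show ?thesis by (simp add: eta_term_def)
  next
    case False
    have "Freqs l \<noteq> {}" using Eig_dim(1)[OF finite_Freqs, of l] False by auto
    then have one: "1 \<le> B * \<bar>l\<bar>" using B(2)[OF l] by blast
    have "norm (eta_term s l) = real (mult l) * \<bar>l\<bar> powr (- Re s)"
      using l by (simp add: eta_term_def norm_mult norm_powr_real_powr sgn_real_def)
    also have "\<bar>l\<bar> powr (- Re s) = \<bar>l\<bar> powr (14 - Re s) / \<bar>l\<bar> ^ 14"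
    proof -
      have "\<bar>l\<bar> ^ 14 = \<bar>l\<bar> powr 14" using powr_realpow[of "\<bar>l\<bar>" 14] l by simp
      then show ?thesis by (simp only: powr_diff[symmetric]) simp
    qed
    finally have eq: "norm (eta_term s l) = real (mult l) * (\<bar>l\<bar> powr (14 - Re s) / \<bar>l\<bar> ^ 14)" .
    have "\<bar>l\<bar> powr (14 - Re s) \<le> M"
    proof -
      have "(B * \<bar>l\<bar>) powr (14 - Re s) \<le> 1" using powr_mono[of "14 - Re s" 0 "B * \<bar>l\<bar>"] one s B(1) l by simp
      then have "M * (B powr (14 - Re s) * \<bar>l\<bar> powr (14 - Re s)) \<le> M * 1"
        using B(1) by (intro mult_left_mono) (auto simp: powr_mult M_def)
      moreover have "M * B powr (14 - Re s) = 1" using B(1) by (simp add: M_def powr_add[symmetric])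
      ultimately show ?thesis by (simp add: mult.assoc[symmetric])
    qed
    then have "real (mult l) * (\<bar>l\<bar> powr (14 - Re s) / \<bar>l\<bar> ^ 14) \<le> real (mult l) * (M / \<bar>l\<bar> ^ 14)"
      by (intro mult_left_mono divide_right_mono) auto
    then show ?thesis unfolding eq by (simp add: mult.commute)
  qed
  have M0: "M \<ge> 0" by (simp add: M_def)
  show "bdd_above (sum (\<lambda>l. norm (eta_term s l)) ` {F. F \<subseteq> L \<and> finite F})"
  proof (rule bdd_aboveI2)
    fix F assume F: "F \<in> {F. F \<subseteq> L \<and> finite F}"
    have "(\<Sum>l\<in>F. norm (eta_term s l)) \<le> (\<Sum>l\<in>F. M * (real (mult l) / \<bar>l\<bar> ^ 14))"
      using F L by (intro sum_mono le) auto
    also have "\<dots> = M * (\<Sum>l\<in>F. real (mult l) / \<bar>l\<bar> ^ 14)" by (simp only: sum_distrib_left)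
    also have "\<dots> \<le> M * W" using F L M0 by (intro mult_left_mono W) (auto intro: inj_on_subset)
    finally show "(\<Sum>l\<in>F. norm (eta_term s l)) \<le> M * W" .
  qed
qed simp

lemma U_periodic: "U (\<theta> + 2 * pi * of_int n) = U \<theta>"
proof -
  have "cos (\<theta> + 2 * pi * of_int n) = cos \<theta>" "sin (\<theta> + 2 * pi * of_int n) = sin \<theta>"
    using sin.plus_of_int[of \<theta> n] cos.plus_of_int[of \<theta> n] by (simp_all add: mult_ac)
  then show ?thesis by (simp only: forms.eigenspace_of_def)
qed

definition kappa :: "nat \<Rightarrow> nat" where "kappa j = forms.dim (U (2 * pi * real j / real r))"

text \<open>Negative angles are used in place of \<open>kappa (r - j)\<close>, whose subtraction
  truncates for j > r; in this form periodicity holds for all j.\<close>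

definition asym :: "nat \<Rightarrow> real" where
  "asym j = real (kappa j) - real (forms.dim (U (- (2 * pi * real j / real r))))"

lemma kappa_periodic: "kappa (j + r) = kappa j"
proof -
  have "2 * pi * real (j + r) / real r = 2 * pi * real j / real r + 2 * pi * of_int 1" using r by (simp add: field_simps)
  then show ?thesis unfolding kappa_def by (simp only: U_periodic)
qed

lemma kappa_neg:
  assumes "j \<le> r" shows "forms.dim (U (- (2 * pi * real j / real r))) = kappa (r - j)"
proof -
  have "2 * pi * real (r - j) / real r = - (2 * pi * real j / real r) + 2 * pi * of_int 1"
    using r assms by (simp add: field_simps of_nat_diff)
  then show ?thesis unfolding kappa_def by (simp only: U_periodic)
qed

lemma asym_periodic: "asym (j + r) = asym j"
proof -
  have "- (2 * pi * real j / real r) = - (2 * pi * real (j + r) / real r) + 2 * pi * of_int 1"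
    using r by (simp add: field_simps)
  then have "U (- (2 * pi * real j / real r)) = U (- (2 * pi * real (j + r) / real r))" by (simp only: U_periodic)
  then show ?thesis by (simp add: asym_def kappa_periodic)
qed

lemma asym_eq: "j \<le> r \<Longrightarrow> asym j = real (kappa j) - real (kappa (r - j))"
  by (simp add: asym_def kappa_neg)

lemma mult_difference: "real (mult l) - real (mult (- l)) = real (forms.dim (U (l / real r))) - real (forms.dim (U (- (l / real r))))"
  using dim_Eig_difference[OF finite_Freqs, of l] dim_Ker[OF finite_Freqs, of l] dim_Ker[OF finite_Freqs, of "- l"] by simp

text \<open>Convergence on each half-line allows l to be paired with -l. By
  \<open>mult_difference\<close> a pair contributes 0 unless l is a multiple of 2 pi, and then it
  contributes the term with \<open>asym n\<close>. The sum may run over all nonzero reals, since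
  \<open>eta_term\<close> vanishes where the multiplicity is 0.\<close>

lemma eta_term_sum:
  assumes s: "Re s > 14"
    and F: "((\<lambda>n. of_real (asym n) * of_real (2 * pi * real n) powr (- s)) has_sum F) {1..}"
  shows "(eta_term s has_sum F) (- {0})"
proof -
  obtain a where a: "(eta_term s has_sum a) {0<..}"
    using eta_term_summable[OF s, of "{0<..}"] by (auto simp: summable_on_def inj_on_def)
  obtain b where b: "(eta_term s has_sum b) {..<0}"
    using eta_term_summable[OF s, of "{..<0}"] by (auto simp: summable_on_def inj_on_def)
  have b': "((\<lambda>l. eta_term s (- l)) has_sum b) {0<..}"
    using b by (subst has_sum_reindex_bij_witness[of _ uminus uminus "{..<0}" "eta_term s" _ b b]) auto
  define P where "P = (\<lambda>l. eta_term s l + eta_term s (- l))"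
  have P: "(P has_sum (a + b)) {0<..}" unfolding P_def by (rule has_sum_add[OF a b'])
  have Pv: "P l = of_real (real (mult l) - real (mult (- l))) * of_real l powr (- s)" if "l > 0" for l
    using that by (simp add: P_def eta_term_def algebra_simps)
  have inj: "inj_on (\<lambda>n. 2 * pi * real n) {1..}" by (simp add: inj_on_def)
  have Pn: "P (2 * pi * real n) = of_real (asym n) * of_real (2 * pi * real n) powr (- s)" if "n \<ge> 1" for n
  proof -
    have "2 * pi * real n > 0" using that by simp
    from Pv[OF this] show ?thesis unfolding mult_difference asym_def kappa_def .
  qed
  have "(P has_sum F) ((\<lambda>n. 2 * pi * real n) ` {1..})"
    unfolding has_sum_reindex[OF inj]
    by (rule has_sum_cong[THEN iffD1, OF _ F]) (simp only: o_def Pn atLeast_iff)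
  moreover have "P l = 0" if "l > 0" "l \<notin> (\<lambda>n. 2 * pi * real n) ` {1..}" for l
  proof -
    have "\<nexists>n::int. l = 2 * pi * of_int n"
    proof
      assume "\<exists>n::int. l = 2 * pi * of_int n"
      then obtain n :: int where n: "l = 2 * pi * of_int n" by blast
      with that(1) have "n > 0" by (simp add: zero_less_mult_iff)
      then have "l = 2 * pi * real (nat n)" "nat n \<in> {1..}" using n by auto
      then have "l \<in> (\<lambda>n. 2 * pi * real n) ` {1..}" by (rule image_eqI)
      with that(2) show False by (rule notE)
    qed
    moreover have "\<nexists>n::int. - l = 2 * pi * of_int n"
    proof
      assume "\<exists>n::int. - l = 2 * pi * of_int n"
      then obtain n :: int where "- l = 2 * pi * of_int n" by blast
      then have "l = 2 * pi * of_int (- n)" by simp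
      with \<open>\<nexists>n::int. l = 2 * pi * of_int n\<close> show False by blast
    qed
    ultimately show ?thesis using U_dim_zero[of l] U_dim_zero[of "- l"] mult_difference[of l] by (simp add: Pv[OF that(1)])
  qed
  ultimately have "(P has_sum F) {0<..}"
    by (subst has_sum_cong_neutral[where T = "(\<lambda>n. 2 * pi * real n) ` {1..}" and g = P]) auto
  then have "a + b = F" by (rule has_sum_unique[OF P])
  moreover have "(eta_term s has_sum (a + b)) ({0<..} \<union> {..<0})" by (rule has_sum_Un_disjoint[OF a b]) auto
  moreover have "{0<..} \<union> {..<0} = - {0::real}" by auto
  ultimately show ?thesis by simp
qed

lemma eta_invariant_integer:
  assumes dvd: "r dvd (\<Sum>j<r. j * forms.dim (U (2 * pi * real j / real r)))"
  shows "eta_invariant \<Gamma> m vol \<in> \<int>"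
proof -
  obtain F where F: "F meromorphic_on UNIV" "F analytic_on {0}"
    "F 0 = of_real (\<Sum>j=1..r. asym j * (1 / 2 - real j / real r))"
    "\<And>s. Re s > 1 \<Longrightarrow> ((\<lambda>n. of_real (asym n) * of_real (2 * pi * real n) powr (- s)) has_sum F s) {1..}"
    using periodic_dirichlet_continuation[of r asym, OF r asym_periodic] by blast
  have mlt: "multiplicity_of \<Gamma> m vol l = mult l" for l by (simp add: multiplicity_of_def even_eigenspace_eq)
  have "((\<lambda>l. of_real (sgn l) * of_nat (multiplicity_of \<Gamma> m vol l) * of_real \<bar>l\<bar> powr (- s)) has_sum F s) (eigenvalues \<Gamma> m vol - {0})"
    if s: "Re s > 14" for s
  proof -
    have "(eta_term s has_sum F s) (- {0})" using s by (intro eta_term_sum F(4)) auto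
    moreover have "eta_term s l = 0" if "l \<notin> eigenvalues \<Gamma> m vol" for l
    proof -
      have "Eig l = {0}" using that forms.subspace_0[OF subspace_Eig, of l] by (auto simp: eigenvalues_def even_eigenspace_eq)
      then show ?thesis by (simp add: eta_term_def forms.dim_zero)
    qed
    ultimately have "(eta_term s has_sum F s) (eigenvalues \<Gamma> m vol - {0})"
      by (subst has_sum_cong_neutral[where T = "- {0}" and g = "eta_term s"]) auto
    then show ?thesis unfolding mlt eta_term_def .
  qed
  with F have ec: "eta_continuation \<Gamma> m vol F" unfolding eta_continuation_def by blast
  have "eta_invariant \<Gamma> m vol = F 0"
    unfolding eta_invariant_def using ec eta_continuation_unique by (intro the_equality) blast+
  also have "\<dots> = of_real (\<Sum>j=1..r. (real (kappa j) - real (kappa (r - j))) * (1 / 2 - real j / real r))"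
    unfolding F(3) by (simp add: asym_eq)
  also have "\<dots> \<in> \<int>"
  proof -
    have "kappa r = kappa 0" using kappa_periodic[of 0] by simp
    from periodic_sum_value_integer[OF r dvd[folded kappa_def] this]
    obtain z where z: "(\<Sum>j=1..r. (real (kappa j) - real (kappa (r - j))) * (1 / 2 - real j / real r)) = of_int z" by (rule Ints_cases)
    show ?thesis unfolding z by simp
  qed
  finally show ?thesis .
qed

end

section \<open>Reflections\<close>

definition reflection :: "('a::euclidean_space \<Rightarrow> 'a \<Rightarrow> real) \<Rightarrow> 'a \<Rightarrow> 'a \<Rightarrow> 'a" where
  "reflection m w x = x - (2 * m x w / m w w) *\<^sub>R w"

lemma linear_reflection: "inner_product_on m \<Longrightarrow> linear (reflection m w)"
  by (rule linearI)
    (simp_all add: reflection_def inner_product_onD(4-) add_divide_distrib scaleR_add_left scaleR_diff_right distrib_left)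

lemma reflection_inner:
  assumes m: "inner_product_on m" and w: "w \<noteq> 0"
  shows "m (reflection m w x) w = - m x w"
  using inner_product_onD(3)[OF m w] by (simp add: reflection_def inner_product_onD(4-)[OF m])

lemma reflection_isometry:
  assumes m: "inner_product_on m" and w: "w \<noteq> 0"
  shows "m (reflection m w x) (reflection m w y) = m x y"
proof -
  have "m (reflection m w x) (reflection m w y) = m (reflection m w x) y - 2 * m y w / m w w * m (reflection m w x) w"
    by (subst (2) reflection_def) (simp add: inner_product_onD(4-)[OF m])
  also have "m (reflection m w x) y = m x y - 2 * m x w / m w w * m y w"
    by (simp add: reflection_def inner_product_onD(4-)[OF m] inner_product_onD(2)[OF m, of w y])
  finally show ?thesis by (simp add: reflection_inner[OF m w])
qed

lemma reflection_involution:
  assumes m: "inner_product_on m" and w: "w \<noteq> 0"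
  shows "reflection m w (reflection m w x) = x"
proof -
  have "reflection m w (reflection m w x) = reflection m w x - (2 * - m x w / m w w) *\<^sub>R w"
    unfolding reflection_def[of m w "reflection m w x"] reflection_inner[OF m w] ..
  then show ?thesis by (simp add: reflection_def)
qed

lemma reflection_commute:
  assumes m: "inner_product_on m" and o: "m w v = 0"
  shows "reflection m w (reflection m v x) = reflection m v (reflection m w x)"
proof -
  have "m v w = 0" using o inner_product_onD(2)[OF m, of v w] by simp
  then show ?thesis using o by (simp add: reflection_def inner_product_onD(4-)[OF m])
qed

lemma reflection_basis:
  fixes m :: "'a::euclidean_space \<Rightarrow> 'a \<Rightarrow> real"
  assumes m: "inner_product_on m" and w: "w \<noteq> 0"
  obtains u F where "orthonormal_basis m F" "u \<in> F" "reflection m w u = - u"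
    "\<And>x. x \<in> F \<Longrightarrow> x \<noteq> u \<Longrightarrow> reflection m w x = x"
proof -
  define s where "s = sqrt (m w w)"
  define u where "u = (1 / s) *\<^sub>R w"
  have s: "s > 0" "s * s = m w w" using inner_product_onD(3)[OF m w] by (simp_all add: s_def)
  have "m u u = 1" using s by (simp add: u_def inner_product_onD(4-)[OF m] s(2)[symmetric])
  then have "orthonormal_on m {u}" by (simp add: orthonormal_on_def)
  then obtain F where F: "{u} \<subseteq> F" "orthonormal_basis m F" using orthonormal_basis_extend[OF m] by blast
  have "reflection m w u = - u"
  proof -
    have "reflection m w w = - w" using inner_product_onD(3)[OF m w] by (simp add: reflection_def scaleR_2)
    then show ?thesis by (simp add: u_def linear_scale[OF linear_reflection[OF m]])
  qed
  moreover have "reflection m w x = x" if "x \<in> F" "x \<noteq> u" for x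
  proof -
    have "m x u = 0" using that F by (simp add: orthonormal_basis_def)
    then have "m x w = 0" using s by (simp add: u_def inner_product_onD(4-)[OF m])
    then show ?thesis by (simp add: reflection_def)
  qed
  ultimately show thesis using that F by blast
qed

text \<open>Checked on an orthonormal basis containing the normalised \<open>w\<close>, where
  exactly one entry changes sign.\<close>

lemma (in oriented_inner_product) reflection_volume:
  assumes w: "w \<noteq> 0"
  shows "vol (map (reflection m w) vs) = - vol vs"
proof -
  obtain u F where F: "orthonormal_basis m F" "u \<in> F" "reflection m w u = - u"
    "\<And>x. x \<in> F \<Longrightarrow> x \<noteq> u \<Longrightarrow> reflection m w x = x" using reflection_basis[OF ip w] by metis
  note L = linear_reflection[OF ip, of w]
  have a1: "alt (\<lambda>vs. vol (map (reflection m w) vs))"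
    unfolding alt_def
  proof (intro conjI allI)
    fix us vs and x :: 'a
    show "linear (\<lambda>v. vol (map (reflection m w) (us @ v # vs)))"
      using linear_compose[OF L alt_linear[OF alt_vol, of "map (reflection m w) us" "map (reflection m w) vs"]] by (simp add: o_def)
    show "vol (map (reflection m w) (us @ x # x # vs)) = 0"
      using alt_vol by (simp add: alt_def)
  qed
  have a2: "alt (\<lambda>vs. - vol vs)" using alt_combine[OF alt_vol alt_vol, of "- 1" 0] by simp
  show ?thesis
  proof (rule alt_eq_on_basis[OF a1 a2 _ orthonormal_basis_span[OF ip F(1)]])
    show fF: "finite F" using F(1) by (simp add: orthonormal_basis_def)
    fix us assume us: "set us \<subseteq> F" "length us = length vs"
    show "vol (map (reflection m w) us) = - vol us"
    proof (cases "distinct us \<and> length us = DIM('a)")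
      case True
      have "set us = F" using F(1) us True fF by (intro card_subset_eq) (auto simp: orthonormal_basis_def distinct_card)
      then obtain ps qs where s: "us = ps @ u # qs" using F(2) by (metis split_list)
      have nu: "u \<notin> set ps" "u \<notin> set qs" using True s by auto
      have "map (reflection m w) ps = ps" "map (reflection m w) qs = qs"
        using F(4) us(1) s nu by (auto intro!: map_idI)
      then have "vol (map (reflection m w) us) = vol (ps @ (- u) # qs)" by (simp add: s F(3))
      also have "\<dots> = - vol us" unfolding s by (rule linear_neg[OF alt_linear[OF alt_vol]])
      finally show ?thesis .
    next
      case False
      then show ?thesis
        using vol_length[of us] vol_length[of "map (reflection m w) us"] alt_not_distinct[OF alt_vol, of us] alt_not_distinct[OF a1, of us]
        by auto
    qed
  qed
qed

text \<open>In a basis adapted to \<open>w\<close> the reflection is the diagonal matrix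
  \<open>D\<close>. The basis is orthonormal for \<open>h\<close> and not for the standard inner
  product, so the inverse of the change of basis \<open>P\<close> is built from \<open>h\<close> as
  the matrix \<open>Q\<close>.\<close>

lemma det_reflection:
  fixes h :: "real ^ 'n \<Rightarrow> real ^ 'n \<Rightarrow> real"
  assumes h: "inner_product_on h" and w: "w \<noteq> 0"
  shows "det (matrix (reflection h w)) = - 1"
proof -
  obtain u F where F: "orthonormal_basis h F" "u \<in> F" "reflection h w u = - u"
    "\<And>x. x \<in> F \<Longrightarrow> x \<noteq> u \<Longrightarrow> reflection h w x = x" using reflection_basis[OF h w] by metis
  have "card (UNIV :: 'n set) = card F" "finite F" using F(1) by (simp_all add: orthonormal_basis_def)
  then obtain \<sigma> where \<sigma>: "bij_betw \<sigma> (UNIV :: 'n set) F" using finite_same_card_bij[of "UNIV :: 'n set" F] by auto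
  have inj: "\<sigma> i = \<sigma> j \<longleftrightarrow> i = j" for i j using \<sigma> by (auto simp: bij_betw_def inj_on_def)
  have in_F: "\<sigma> i \<in> F" for i using \<sigma> by (auto simp: bij_betw_def)
  obtain k where k: "\<sigma> k = u" using \<sigma> F(2) by (auto simp: bij_betw_def)
  define P :: "real ^ 'n ^ 'n" where "P = (\<chi> i j. \<sigma> j $ i)"
  define Q :: "real ^ 'n ^ 'n" where "Q = (\<chi> i j. h (\<sigma> i) (axis j 1))"
  define D :: "real ^ 'n ^ 'n" where "D = (\<chi> i j. if i = j then if j = k then - 1 else 1 else 0)"
  have "Q ** P = Finite_Cartesian_Product.mat 1"
  proof -
    have "(\<Sum>l\<in>UNIV. h (\<sigma> i) (axis l 1) * \<sigma> j $ l) = (if i = j then 1 else 0)" for i j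
    proof -
      have "(\<Sum>l\<in>UNIV. \<sigma> j $ l * h (\<sigma> i) (axis l 1)) = h (\<sigma> i) (\<Sum>l\<in>UNIV. \<sigma> j $ l *\<^sub>R axis l 1)"
        by (rule inner_product_on_sum(2)[OF h, symmetric])
      also have "(\<Sum>l\<in>UNIV. \<sigma> j $ l *\<^sub>R axis l 1) = \<sigma> j" using basis_expansion[of "\<sigma> j"] by (simp add: scalar_mult_eq_scaleR)
      also have "h (\<sigma> i) (\<sigma> j) = (if i = j then 1 else 0)" using F(1) in_F by (simp add: orthonormal_basis_def inj)
      finally show ?thesis by (simp only: mult.commute)
    qed
    then show ?thesis by (simp add: Q_def P_def matrix_matrix_mult_def Finite_Cartesian_Product.mat_def Finite_Cartesian_Product.vec_eq_iff)
  qed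
  then have "det Q * det P = 1" by (metis det_mul det_I)
  then have nz: "det P \<noteq> 0" by auto
  have "matrix (reflection h w) ** P = P ** D"
  proof -
    have "(matrix (reflection h w) ** P) $ i $ j = (P ** D) $ i $ j" for i j
    proof -
      have "(matrix (reflection h w) ** P) $ i $ j = (matrix (reflection h w) *v \<sigma> j) $ i"
        by (simp add: matrix_matrix_mult_def matrix_vector_mult_def P_def)
      also have "matrix (reflection h w) *v \<sigma> j = reflection h w (\<sigma> j)"
        by (simp add: linear_reflection[OF h] matrix_vector_mul)
      also have "reflection h w (\<sigma> j) = (if j = k then - \<sigma> j else \<sigma> j)"
        using F(3,4) in_F[of j] k inj[of j k] by auto
      finally have 1: "(matrix (reflection h w) ** P) $ i $ j = (if j = k then - \<sigma> j else \<sigma> j) $ i" .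
      have "(P ** D) $ i $ j = (\<Sum>l\<in>UNIV. if l = j then \<sigma> j $ i * (if j = k then - 1 else 1) else 0)"
        by (simp only: matrix_matrix_mult_def P_def D_def vec_lambda_beta) (intro sum.cong, auto)
      also have "\<dots> = \<sigma> j $ i * (if j = k then - 1 else 1)" by simp
      finally show ?thesis using 1 by simp
    qed
    then show ?thesis by (simp add: Finite_Cartesian_Product.vec_eq_iff)
  qed
  then have "det (matrix (reflection h w)) * det P = det P * det D" by (metis det_mul)
  moreover have "det D = - 1"
  proof -
    have "det D = (\<Prod>i\<in>UNIV. D $ i $ i)" by (rule det_diagonal) (simp add: D_def)
    also have "\<dots> = (\<Prod>i\<in>UNIV. if i = k then - 1 else 1)" by (simp add: D_def)
    finally show ?thesis by simp
  qed
  ultimately have "(det (matrix (reflection h w)) + 1) * det P = 0" by (simp add: distrib_right)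
  then show ?thesis using nz by (simp add: add_eq_0_iff)
qed

lemma det_reflections:
  fixes h :: "real ^ 'n \<Rightarrow> real ^ 'n \<Rightarrow> real"
  assumes h: "inner_product_on h" and "\<forall>w\<in>set ws. w \<noteq> 0"
  shows "linear (foldr (\<circ>) (map (reflection h) ws) id) \<and> det (matrix (foldr (\<circ>) (map (reflection h) ws) id)) = (- 1) ^ length ws"
  using assms(2)
proof (induction ws)
  case Nil
  have "matrix (id :: real ^ 'n \<Rightarrow> real ^ 'n) = Finite_Cartesian_Product.mat 1"
    by (simp add: matrix_def Finite_Cartesian_Product.mat_def axis_def Finite_Cartesian_Product.vec_eq_iff eq_commute)
  moreover have "foldr (\<circ>) (map (reflection h) []) id = id" by (simp add: fun_eq_iff)
  ultimately show ?case by (simp only: det_I linear_id list.size power_0 simp_thms)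
next
  case (Cons w ws)
  define f where "f = foldr (\<circ>) (map (reflection h) ws) id"
  have "\<forall>w\<in>set ws. w \<noteq> 0" using Cons.prems by simp
  from Cons.IH[OF this] have "linear f" "det (matrix f) = (- 1) ^ length ws" unfolding f_def by blast+
  moreover have "det (matrix (reflection h w)) = - 1" using Cons.prems by (intro det_reflection[OF h]) simp
  ultimately have "linear (reflection h w \<circ> f)" "det (matrix (reflection h w \<circ> f)) = (- 1) ^ length (w # ws)"
    using linear_compose[of f "reflection h w"] linear_reflection[OF h, of w]
    by (simp_all add: matrix_compose det_mul)
  moreover have "foldr (\<circ>) (map (reflection h) (w # ws)) id = reflection h w \<circ> f" by (simp add: f_def)
  ultimately show ?case by (simp only: simp_thms)
qed

text \<open>The reflection in u = f e - e sends f e back to e, and it fixes every x with f x = x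
  because such an x is orthogonal to u. So the number of basis vectors moved by f drops.\<close>

lemma isometry_product_of_reflections:
  fixes f :: "'a::euclidean_space \<Rightarrow> 'a"
  assumes h: "inner_product_on h" and "linear f" "\<And>u v. h (f u) (f v) = h u v"
  shows "\<exists>ws. (\<forall>w\<in>set ws. w \<noteq> 0) \<and> f = foldr (\<circ>) (map (reflection h) ws) id"
proof -
  obtain B where B: "orthonormal_basis h B" using orthonormal_basis_exists[OF h] by blast
  have fB: "finite B" using B by (simp add: orthonormal_basis_def)
  from assms(2,3) show ?thesis
  proof (induction "card {e \<in> B. f e \<noteq> e}" arbitrary: f rule: less_induct)
    case less
    note f = less.prems
    show ?case
    proof (cases "\<exists>e\<in>B. f e \<noteq> e")
      case False
      have "f x = x" for x
      proof -
        have "f x = f (\<Sum>e\<in>B. h x e *\<^sub>R e)" by (rule arg_cong[OF orthonormal_basis_expand[OF h B]])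
        also have "\<dots> = (\<Sum>e\<in>B. h x e *\<^sub>R e)"
          using False by (simp add: linear_sum[OF f(1)] linear_scale[OF f(1)])
        also have "\<dots> = x" by (rule orthonormal_basis_expand[OF h B, symmetric])
        finally show ?thesis .
      qed
      then show ?thesis by (intro exI[of _ "[]"]) auto
    next
      case True
      then obtain e where e: "e \<in> B" "f e \<noteq> e" by blast
      define u where "u = f e - e"
      have u: "u \<noteq> 0" using e by (simp add: u_def)
      define f' where "f' = reflection h u \<circ> f"
      have "h u u = 2 * h (f e) u"
        using f(2)[of e e] inner_product_onD(2)[OF h, of e "f e"] by (simp add: u_def inner_product_onD(4-)[OF h])
      then have "f' e = e" using inner_product_onD(3)[OF h u] by (simp add: f'_def reflection_def) (simp add: u_def)
      moreover have "f' x = x" if "f x = x" for x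
      proof -
        have "h x u = 0" using f(2)[of x e] that by (simp add: u_def inner_product_onD(4-)[OF h])
        then show ?thesis by (simp add: f'_def that reflection_def)
      qed
      ultimately have "{x \<in> B. f' x \<noteq> x} \<subset> {x \<in> B. f x \<noteq> x}" using e by auto
      then have "card {x \<in> B. f' x \<noteq> x} < card {x \<in> B. f x \<noteq> x}" using fB by (intro psubset_card_mono) auto
      moreover have "linear f'" unfolding f'_def by (rule linear_compose[OF f(1) linear_reflection[OF h]])
      moreover have "h (f' x) (f' y) = h x y" for x y by (simp add: f'_def reflection_isometry[OF h u] f(2))
      ultimately obtain ws where ws: "\<forall>w\<in>set ws. w \<noteq> 0" "f' = foldr (\<circ>) (map (reflection h) ws) id"
        using less.hyps[of f'] by blast
      have "f = reflection h u \<circ> f'" by (simp add: f'_def fun_eq_iff reflection_involution[OF h u])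
      with ws u show ?thesis by (intro exI[of _ "u # ws"]) simp
    qed
  qed
qed

lemma foldr_pair_up:
  assumes "even (length ws)"
  shows "\<exists>hs. foldr (\<circ>) (map \<rho> ws) id = foldr (\<circ>) hs id \<and> (\<forall>g\<in>set hs. \<exists>u\<in>set ws. \<exists>v\<in>set ws. g = \<rho> u \<circ> \<rho> v)"
  using assms
proof (induction ws rule: induct_list012)
  case 1 then show ?case by (intro exI[of _ "[]"]) simp
next
  case (2 x) then show ?case by simp
next
  case (3 x y zs)
  then have "even (length zs)" by simp
  from 3(1)[OF this] obtain hs where hs: "foldr (\<circ>) (map \<rho> zs) id = foldr (\<circ>) hs id"
    "\<forall>g\<in>set hs. \<exists>u\<in>set zs. \<exists>v\<in>set zs. g = \<rho> u \<circ> \<rho> v" by metis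
  have "foldr (\<circ>) (map \<rho> (x # y # zs)) id = foldr (\<circ>) ((\<rho> x \<circ> \<rho> y) # hs) id"
    by (simp only: list.map foldr.simps o_apply hs(1) comp_assoc)
  moreover have "\<forall>g\<in>set ((\<rho> x \<circ> \<rho> y) # hs). \<exists>u\<in>set (x # y # zs). \<exists>v\<in>set (x # y # zs). g = \<rho> u \<circ> \<rho> v"
    using hs(2) by (simp only: list.set) blast
  ultimately show ?case by (intro exI[of _ "(\<rho> x \<circ> \<rho> y) # hs"] conjI)
qed

text \<open>Two linear conditions on a space of dimension 6. The reflection in this vector will be
  the orientation-reversing map that commutes with a pair of reflections.\<close>

lemma common_orthogonal_vector:
  fixes h :: "real ^ 6 \<Rightarrow> real ^ 6 \<Rightarrow> real"
  assumes h: "inner_product_on h"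
  obtains w where "w \<noteq> 0" "h w u = 0" "h w v = 0"
proof -
  define L where "L = (\<lambda>x. (h x u, h x v))"
  have L: "linear L" by (rule linearI) (simp_all add: L_def inner_product_onD(4-)[OF h])
  have "\<not> inj L"
  proof
    assume "inj L"
    then have "dim (L ` UNIV) = dim (UNIV :: (real ^ 6) set)" by (intro dim_image_eq[OF L]) simp
    moreover have "dim (L ` UNIV) \<le> DIM(real \<times> real)" by (rule dim_subset_UNIV)
    ultimately show False by simp
  qed
  then obtain w where "L w = 0" "w \<noteq> 0" using linear_injective_0[OF L] by blast
  then show thesis using that by (simp add: L_def zero_prod_def)
qed

section \<open>Quotients of the torus\<close>

lemma inner_product_on_product_metric:
  assumes h: "inner_product_on h"
  shows "inner_product_on (product_metric h)"
  unfolding inner_product_on_def bilinear_def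
proof (intro conjI allI impI)
  note hs = inner_product_onD(4-)[OF h]
  fix u v :: "real \<times> (real ^ 6)"
  show "linear (product_metric h u)"
    by (rule linearI) (auto simp: product_metric_def hs algebra_simps split: prod.splits)
  show "linear (\<lambda>u. product_metric h u v)"
    by (rule linearI) (auto simp: product_metric_def hs algebra_simps split: prod.splits)
  show "product_metric h u v = product_metric h v u"
    using inner_product_onD(2)[OF h] by (simp add: product_metric_def case_prod_beta mult.commute)
  assume v: "v \<noteq> 0"
  have pos: "h x x \<ge> 0" for x using inner_product_onD(3)[OF h, of x] inner_product_onD(8)[OF h] by (cases "x = 0") auto
  show "product_metric h v v > 0"
  proof (cases "fst v = 0")
    case True
    then have "h (snd v) (snd v) > 0" using v inner_product_onD(3)[OF h] by (simp add: prod_eq_iff)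
    then show ?thesis using True by (simp add: product_metric_def case_prod_beta)
  next
    case False
    then have "fst v * fst v > 0" by (metis not_real_square_gt_zero)
    then show ?thesis using pos[of "snd v"] by (simp add: product_metric_def case_prod_beta)
  qed
qed

lemma reflection_product_metric:
  assumes h: "inner_product_on h"
  shows "reflection (product_metric h) (0, w) = map_prod id (reflection h w)"
  by (intro ext) (auto simp: reflection_def product_metric_def)

lemma integer_lattice_iff: "v \<in> integer_lattice \<longleftrightarrow> fst v \<in> \<int> \<and> (\<forall>i. snd v $ i \<in> \<int>)"
  by (cases v) (auto simp: integer_lattice_def)

lemma integer_lattice_add: "u \<in> integer_lattice \<Longrightarrow> v \<in> integer_lattice \<Longrightarrow> u + v \<in> integer_lattice"
  by (simp add: integer_lattice_iff)

lemma integer_lattice_diff: "u \<in> integer_lattice \<Longrightarrow> v \<in> integer_lattice \<Longrightarrow> u - v \<in> integer_lattice"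
  by (simp add: integer_lattice_iff)

lemma torus_point_eq_iff: "torus_point p = torus_point q \<longleftrightarrow> p - q \<in> integer_lattice"
proof
  assume "torus_point p = torus_point q"
  moreover have "p \<in> torus_point p" by (simp add: torus_point_def integer_lattice_iff)
  ultimately show "p - q \<in> integer_lattice" by (simp add: torus_point_def)
next
  assume l: "p - q \<in> integer_lattice"
  have "x - p \<in> integer_lattice \<longleftrightarrow> x - q \<in> integer_lattice" for x
  proof
    assume "x - p \<in> integer_lattice"
    then have "(x - p) + (p - q) \<in> integer_lattice" using l by (rule integer_lattice_add)
    then show "x - q \<in> integer_lattice" by simp
  next
    assume "x - q \<in> integer_lattice"
    then have "(x - q) - (p - q) \<in> integer_lattice" using l by (rule integer_lattice_diff)
    then show "x - p \<in> integer_lattice" by simp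
  qed
  then show "torus_point p = torus_point q" by (simp add: torus_point_def)
qed

text \<open>If \<open>f u\<close> had a nonzero component, scaling \<open>u\<close> would make it 1
  / 2, and two integers would differ by 1 / 2.\<close>

lemma linear_integer_zero:
  fixes f :: "real ^ 'n \<Rightarrow> real ^ 'm"
  assumes f: "linear f" and int: "\<And>u i. (f u + c) $ i \<in> \<int>"
  shows "f u = 0"
proof (rule ccontr)
  assume "f u \<noteq> 0"
  then obtain i where i: "f u $ i \<noteq> 0" by (auto simp: Finite_Cartesian_Product.vec_eq_iff)
  have "c $ i \<in> \<int>" using int[of 0 i] by (simp add: linear_0[OF f])
  moreover have "(f ((1 / (2 * f u $ i)) *\<^sub>R u) + c) $ i \<in> \<int>" by (rule int)
  then have "1 / 2 + c $ i \<in> \<int>" using i by (simp add: linear_scale[OF f])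
  ultimately have "(1 / 2 + c $ i) - c $ i \<in> \<int>" by (rule Ints_diff[rotated])
  then have "(1 / 2 :: real) \<in> \<int>" by simp
  then obtain k :: int where "(1 / 2 :: real) = of_int k" by (elim Ints_cases)
  then have "(1::real) = of_int (2 * k)" by simp
  then have "1 = 2 * k" using of_int_eq_iff[of 1 "2 * k", where 'a = real] by simp
  then show False by presburger
qed

lemma continuous_integer_constant:
  fixes f :: "'a::real_normed_vector \<Rightarrow> real"
  assumes "continuous_on UNIV f" "\<And>x. f x \<in> \<int>"
  shows "f x = f y"
proof -
  have "f constant_on UNIV"
  proof (rule continuous_discrete_range_constant[OF connected_UNIV assms(1)])
    fix x :: 'a
    have "1 \<le> norm (f y - f x)" if "f y \<noteq> f x" for y
      using Ints_nonzero_abs_ge1[OF Ints_diff[OF assms(2) assms(2)], of y x] that by simp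
    then show "\<exists>e>0. \<forall>y. y \<in> UNIV \<and> f y \<noteq> f x \<longrightarrow> e \<le> norm (f y - f x)" by (intro exI[of _ 1]) auto
  qed
  then show ?thesis by (auto simp: constant_on_def)
qed

lemma of_int_div_nat_Ints:
  assumes "int r dvd k - l" "r > 0"
  shows "(of_int k - of_int l) / real r \<in> \<int>"
proof -
  obtain q where "k - l = int r * q" using assms(1) by (elim dvdE)
  then have "of_int k - of_int l = real r * of_int q" by (metis of_int_diff of_int_mult of_int_of_nat_eq)
  then show ?thesis using assms(2) by simp
qed

locale torus_quotient =
  fixes G :: "('g, 'b) monoid_scheme" (structure)
    and \<phi> :: "'g \<Rightarrow> (real \<times> (real ^ 6)) set \<Rightarrow> (real \<times> (real ^ 6)) set"
    and h :: "(real ^ 6) \<Rightarrow> (real ^ 6) \<Rightarrow> real"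
    and a :: "'g \<Rightarrow> real" and b :: "'g \<Rightarrow> real ^ 6" and A :: "'g \<Rightarrow> real ^ 6 ^ 6"
    and vol :: "(real \<times> (real ^ 6)) list \<Rightarrow> real"
  assumes flat_metric: "inner_product_on h"
    and grp: "group G" and fin: "finite (carrier G)"
    and action: "group_action G torus \<phi>"
    and action_formula: "\<And>g x xb. g \<in> carrier G \<Longrightarrow>
          \<phi> g (torus_point (x, xb)) = torus_point (x + a g, A g *v xb + b g)"
    and A_det: "\<And>g. g \<in> carrier G \<Longrightarrow> det (A g) = 1"
    and isometric: "\<And>g u v. g \<in> carrier G \<Longrightarrow> h (A g *v u) (A g *v v) = h u v"
    and holonomy: "\<And>v. (\<lambda>p. p + v) \<in> deck_group G \<phi> \<longleftrightarrow> v \<in> integer_lattice"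
    and a_nonzero: "\<And>g. g \<in> carrier G \<Longrightarrow> g \<noteq> \<one> \<Longrightarrow> a g \<notin> \<int>"
    and orientation: "volume_form (product_metric h) vol"
begin

sublocale group G by (rule grp)

text \<open>Lifts to the universal cover compose only up to lattice vectors, so \<open>a\<close> is
  additive modulo \<int>. The linear parts compose exactly, by \<open>linear_integer_zero\<close>
  applied to their difference.\<close>

lemma compose:
  assumes g: "g \<in> carrier G" "g' \<in> carrier G"
  shows "a (g \<otimes> g') - (a g' + a g) \<in> \<int>"
    and "A (g \<otimes> g') *v u = A g *v (A g' *v u)"
proof -
  have "torus_point (x + a (g \<otimes> g'), A (g \<otimes> g') *v xb + b (g \<otimes> g'))
    = torus_point (x + a g' + a g, A g *v (A g' *v xb + b g') + b g)" for x xb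
  proof -
    have "torus_point (x, xb) \<in> torus" by (simp add: torus_def)
    from group_action.composition_rule[OF action this g] g show ?thesis by (simp add: action_formula)
  qed
  then have l: "(x + a (g \<otimes> g'), A (g \<otimes> g') *v xb + b (g \<otimes> g')) - (x + a g' + a g, A g *v (A g' *v xb + b g') + b g) \<in> integer_lattice" for x xb
    by (simp only: torus_point_eq_iff)
  show "a (g \<otimes> g') - (a g' + a g) \<in> \<int>" using l[of 0 0] by (simp add: integer_lattice_iff)
  define f where "f = (\<lambda>u. A (g \<otimes> g') *v u - A g *v (A g' *v u))"
  define c where "c = b (g \<otimes> g') - A g *v b g' - b g"
  have "linear f" unfolding f_def
    by (rule linearI) (simp_all add: matrix_vector_right_distrib matrix_vector_mult_scaleR scaleR_diff_right)
  moreover have "(f u + c) $ i \<in> \<int>" for u i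
  proof -
    have "f u + c = snd ((0 + a (g \<otimes> g'), A (g \<otimes> g') *v u + b (g \<otimes> g')) - (0 + a g' + a g, A g *v (A g' *v u + b g') + b g))"
      by (simp add: f_def c_def matrix_vector_right_distrib)
    then show ?thesis using l[of 0 u] by (simp only: integer_lattice_iff)
  qed
  ultimately have "f u = 0" by (rule linear_integer_zero)
  then show "A (g \<otimes> g') *v u = A g *v (A g' *v u)" by (simp add: f_def)
qed

lemma unit: "a \<one> \<in> \<int>" "A \<one> *v u = u"
proof -
  have "torus_point (x + a \<one>, A \<one> *v xb + b \<one>) = torus_point (x, xb)" for x xb
  proof -
    have "torus_point (x, xb) \<in> torus" by (simp add: torus_def)
    then have "\<phi> \<one> (torus_point (x, xb)) = torus_point (x, xb)"
      by (simp add: group_action.id_eq_one[OF action, symmetric])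
    then show ?thesis by (simp add: action_formula)
  qed
  then have l: "(x + a \<one>, A \<one> *v xb + b \<one>) - (x, xb) \<in> integer_lattice" for x xb by (simp only: torus_point_eq_iff)
  show "a \<one> \<in> \<int>" using l[of 0 0] by (simp add: integer_lattice_iff)
  define f where "f = (\<lambda>u. A \<one> *v u - u)"
  have "linear f" unfolding f_def
    by (rule linearI) (simp_all add: matrix_vector_right_distrib matrix_vector_mult_scaleR scaleR_diff_right)
  moreover have "(f u + b \<one>) $ i \<in> \<int>" for u i
  proof -
    have "f u + b \<one> = snd ((0 + a \<one>, A \<one> *v u + b \<one>) - (0, u))" by (simp add: f_def)
    then show ?thesis using l[of 0 u] by (simp only: integer_lattice_iff)
  qed
  ultimately have "f u = 0" by (rule linear_integer_zero)
  then show "A \<one> *v u = u" by (simp add: f_def)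
qed

lemma pow:
  fixes k :: nat
  assumes g: "g \<in> carrier G"
  shows "a (g [^] k) - real k * a g \<in> \<int>" "A (g [^] k) *v u = ((*v) (A g) ^^ k) u"
proof -
  have "a (g [^] k) - real k * a g \<in> \<int> \<and> (\<forall>u. A (g [^] k) *v u = ((*v) (A g) ^^ k) u)"
  proof (induction k)
    case 0 then show ?case by (simp add: unit)
  next
    case (Suc k)
    have c: "g [^] k \<in> carrier G" using g by simp
    have "(a (g [^] k \<otimes> g) - (a g + a (g [^] k))) + (a (g [^] k) - real k * a g) \<in> \<int>"
      using compose(1)[OF c g] Suc by (intro Ints_add) auto
    then have "a (g [^] Suc k) - real (Suc k) * a g \<in> \<int>" by (simp add: algebra_simps)
    moreover have "A (g [^] Suc k) *v u = ((*v) (A g) ^^ Suc k) u" for u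
      using compose(2)[OF c g] Suc by (simp add: funpow_swap1)
    ultimately show ?case by blast
  qed
  then show "a (g [^] k) - real k * a g \<in> \<int>" "A (g [^] k) *v u = ((*v) (A g) ^^ k) u" by auto
qed

text \<open>By \<open>compose\<close>, \<open>a\<close> is a homomorphism to the circle group, and
  \<open>a_nonzero\<close> says that its kernel is trivial.\<close>

lemma a_injective:
  assumes g: "g \<in> carrier G" "g' \<in> carrier G" and d: "a g - a g' \<in> \<int>"
  shows "g = g'"
proof -
  define k where "k = g \<otimes> inv g'"
  have k: "k \<in> carrier G" using g by (simp add: k_def)
  have kg: "k \<otimes> g' = g" using g by (simp add: k_def m_assoc)
  have "(a g - a g') - (a (k \<otimes> g') - (a g' + a k)) \<in> \<int>" by (rule Ints_diff[OF d compose(1)[OF k g(2)]])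
  then have "a k \<in> \<int>" unfolding kg by simp
  then have "k = \<one>" using a_nonzero[OF k] by blast
  then show ?thesis using kg g by simp
qed

definition r :: nat where "r = card (carrier G)"

lemma r_pos: "r > 0"
  using fin one_closed by (auto simp: r_def card_gt_0_iff)

text \<open>Left translation permutes the group, so summing
  \<open>a (g \<otimes> x) - (a x + a g)\<close> over all x leaves - r a g.\<close>

lemma r_times_a:
  assumes g: "g \<in> carrier G" shows "real r * a g \<in> \<int>"
proof -
  have inj: "inj_on (\<lambda>x. g \<otimes> x) (carrier G)" using g by (auto simp: inj_on_def)
  have "(\<lambda>x. g \<otimes> x) ` carrier G = carrier G" using g inj fin by (intro endo_inj_surj) auto
  then have s: "(\<Sum>x\<in>carrier G. a (g \<otimes> x)) = (\<Sum>x\<in>carrier G. a x)"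
    using sum.reindex[OF inj, of a] by (simp add: o_def)
  have "(\<Sum>x\<in>carrier G. a (g \<otimes> x) - (a x + a g)) \<in> \<int>" using compose(1)[OF g] by (intro Ints_sum) auto
  also have "(\<Sum>x\<in>carrier G. a (g \<otimes> x) - (a x + a g)) = - (real r * a g)"
    by (simp add: sum_subtractf sum.distrib s r_def)
  finally show ?thesis by simp
qed

definition height :: "'g \<Rightarrow> int" where "height g = \<lfloor>real r * a g\<rfloor>"

lemma height: "g \<in> carrier G \<Longrightarrow> a g = of_int (height g) / real r"
  using r_times_a[of g] r_pos by (auto simp: height_def field_simps elim: Ints_cases)

text \<open>The numerators of the \<open>r\<close> values of \<open>a\<close> are distinct modulo
  \<open>r\<close> by \<open>a_injective\<close>, so every residue is attained. The residue 1
  singles out the element that turns the circle by 1 / r, as the locale \<open>flat_quotient\<close>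
  demands.\<close>

lemma generator_exists: "\<exists>g\<in>carrier G. int r dvd height g - 1"
proof -
  define N where "N = (\<lambda>g. height g mod int r)"
  have "inj_on N (carrier G)"
  proof (rule inj_onI)
    fix g g' assume g: "g \<in> carrier G" "g' \<in> carrier G" "N g = N g'"
    then have "int r dvd height g - height g'" by (simp add: N_def mod_eq_dvd_iff)
    from of_int_div_nat_Ints[OF this r_pos] have "a g - a g' \<in> \<int>"
      using height g by (simp add: diff_divide_distrib)
    then show "g = g'" by (rule a_injective[OF g(1,2)])
  qed
  then have "card (N ` carrier G) = r" by (simp add: card_image r_def)
  moreover have sub: "N ` carrier G \<subseteq> {0..<int r}" using r_pos by (auto simp: N_def)
  ultimately have "N ` carrier G = {0..<int r}" by (intro card_subset_eq) auto
  \<comment> \<open>Written with \<open>mod\<close> to cover the trivial group, where r = 1.\<close>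
  moreover have "1 mod int r \<in> {0..<int r}" using r_pos by simp
  ultimately obtain g where "g \<in> carrier G" "N g = 1 mod int r" by (metis imageE)
  then show ?thesis by (auto simp: N_def mod_eq_dvd_iff)
qed

definition gen :: 'g where "gen = (SOME g. g \<in> carrier G \<and> int r dvd height g - 1)"

lemma gen: "gen \<in> carrier G" "int r dvd height gen - 1"
  using someI_ex[of "\<lambda>g. g \<in> carrier G \<and> int r dvd height g - 1"] generator_exists by (auto simp: gen_def)

lemma gen_pow: "A (gen [^] k) *v u = ((*v) (A gen) ^^ k) u" for k :: nat
  by (rule pow(2)[OF gen(1)])

lemma gen_pow_r: "gen [^] r = \<one>"
proof (rule a_injective)
  have "(a (gen [^] r) - real r * a gen) + real r * a gen - a \<one> \<in> \<int>"
    by (intro Ints_add Ints_diff pow(1) gen(1) r_times_a unit(1))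
  then show "a (gen [^] r) - a \<one> \<in> \<int>" by simp
qed (use gen in auto)

lemma power_of_gen:
  assumes g: "g \<in> carrier G"
  obtains k :: nat where "g = gen [^] k" "a g - real k / real r \<in> \<int>"
proof -
  define k where "k = nat (height g mod int r)"
  have ik: "int k = height g mod int r" using r_pos by (simp add: k_def)
  have d: "int r dvd height g - int k" unfolding ik by (simp add: minus_mod_eq_mult_div)
  have "(of_int (height g) - of_int (int k)) / real r \<in> \<int>" by (rule of_int_div_nat_Ints[OF d r_pos])
  then have 1: "a g - real k / real r \<in> \<int>" by (simp add: height[OF g] diff_divide_distrib)
  have "(of_int (height gen) - of_int 1) / real r \<in> \<int>" by (rule of_int_div_nat_Ints[OF gen(2) r_pos])
  then have "a gen - 1 / real r \<in> \<int>" by (simp add: height[OF gen(1)] diff_divide_distrib)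
  then have "real k * (a gen - 1 / real r) \<in> \<int>" by (intro Ints_mult) auto
  then have "(a g - real k / real r) - real k * (a gen - 1 / real r) - (a (gen [^] k) - real k * a gen) \<in> \<int>"
    by (intro Ints_diff[OF Ints_diff[OF 1] pow(1)[OF gen(1)]])
  then have "a g - a (gen [^] k) \<in> \<int>" by (simp add: algebra_simps)
  then have "g = gen [^] k" using gen(1) by (intro a_injective[OF g]) auto
  then show thesis using 1 by (rule that)
qed

text \<open>A continuous lift differs from the affine map belonging to g by a continuous function
  with values in the lattice, which is constant.\<close>

lemma deck_group_iff:
  "\<gamma> \<in> deck_group G \<phi> \<longleftrightarrow> (\<exists>g\<in>carrier G. \<exists>v\<in>integer_lattice. \<gamma> = (\<lambda>p. map_prod id ((*v) (A g)) p + ((a g, b g) + v)))"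
proof
  assume \<gamma>: "\<gamma> \<in> deck_group G \<phi>"
  then obtain g where g: "g \<in> carrier G" and c: "continuous_on UNIV \<gamma>" and e: "\<And>p. torus_point (\<gamma> p) = \<phi> g (torus_point p)"
    by (auto simp: deck_group_def)
  define f where "f = (\<lambda>p. \<gamma> p - (map_prod id ((*v) (A g)) p + (a g, b g)))"
  have l: "f p \<in> integer_lattice" for p
    using e[of p] action_formula[OF g, of "fst p" "snd p"] by (cases p) (simp add: f_def torus_point_eq_iff)
  have lin: "linear (map_prod id ((*v) (A g)) :: real \<times> (real ^ 6) \<Rightarrow> real \<times> (real ^ 6))"
    by (rule linearI) (auto simp: matrix_vector_right_distrib matrix_vector_mult_scaleR)
  have cf: "continuous_on UNIV f" unfolding f_def
    by (rule continuous_on_diff[OF c continuous_on_add[OF linear_continuous_on continuous_on_const]])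
      (use lin linear_conv_bounded_linear in blast)
  have "fst (f p) = fst (f 0)" for p
    by (rule continuous_integer_constant[of "\<lambda>p. fst (f p)"]) (use l continuous_on_fst[OF cf] in \<open>auto simp: integer_lattice_iff\<close>)
  moreover have "snd (f p) $ i = snd (f 0) $ i" for p i
    by (rule continuous_integer_constant[of "\<lambda>p. snd (f p) $ i"])
      (use l continuous_on_component[OF continuous_on_snd[OF cf]] in \<open>auto simp: integer_lattice_iff\<close>)
  ultimately have fc: "f p = f 0" for p by (simp add: prod_eq_iff Finite_Cartesian_Product.vec_eq_iff)
  have "\<gamma> p = map_prod id ((*v) (A g)) p + ((a g, b g) + f 0)" for p
  proof -
    have "\<gamma> p = map_prod id ((*v) (A g)) p + ((a g, b g) + f p)" by (simp add: f_def)
    then show ?thesis by (simp only: fc[of p])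
  qed
  then have "\<gamma> = (\<lambda>p. map_prod id ((*v) (A g)) p + ((a g, b g) + f 0))" by (rule ext)
  then show "\<exists>g\<in>carrier G. \<exists>v\<in>integer_lattice. \<gamma> = (\<lambda>p. map_prod id ((*v) (A g)) p + ((a g, b g) + v))"
    using g l by blast
next
  assume "\<exists>g\<in>carrier G. \<exists>v\<in>integer_lattice. \<gamma> = (\<lambda>p. map_prod id ((*v) (A g)) p + ((a g, b g) + v))"
  then obtain g v where g: "g \<in> carrier G" and v: "v \<in> integer_lattice"
    and \<gamma>: "\<gamma> = (\<lambda>p. map_prod id ((*v) (A g)) p + ((a g, b g) + v))" by blast
  have lin: "linear (map_prod id ((*v) (A g)) :: real \<times> (real ^ 6) \<Rightarrow> real \<times> (real ^ 6))"
    by (rule linearI) (auto simp: matrix_vector_right_distrib matrix_vector_mult_scaleR)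
  have "continuous_on UNIV \<gamma>" unfolding \<gamma>
    by (rule continuous_on_add[OF linear_continuous_on continuous_on_const])
      (use lin linear_conv_bounded_linear in blast)
  moreover have "torus_point (\<gamma> p) = \<phi> g (torus_point p)" for p
  proof -
    have "\<phi> g (torus_point p) = torus_point (map_prod id ((*v) (A g)) p + (a g, b g))"
      using action_formula[OF g, of "fst p" "snd p"] by (cases p) simp
    then show ?thesis using v by (simp add: torus_point_eq_iff \<gamma>)
  qed
  ultimately show "\<gamma> \<in> deck_group G \<phi>" using g by (auto simp: deck_group_def)
qed

definition rot :: "real \<times> (real ^ 6) \<Rightarrow> real \<times> (real ^ 6)" where "rot = map_prod id ((*v) (A gen))"

lemma rot_pow: "(rot ^^ k) p = map_prod id ((*v) (A (gen [^] k))) p"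
proof -
  have "(rot ^^ k) p = (fst p, ((*v) (A gen) ^^ k) (snd p))"
    by (induction k) (simp_all add: rot_def)
  then show ?thesis by (simp add: gen_pow map_prod_def case_prod_beta)
qed

lemma rot_factors:
  "\<exists>hs. rot = foldr (\<circ>) hs id \<and> (\<forall>g\<in>set hs. \<exists>u v. u \<noteq> 0 \<and> v \<noteq> 0 \<and>
     g = reflection (product_metric h) (0, u) \<circ> reflection (product_metric h) (0, v))"
proof -
  have lin: "linear ((*v) (A gen))" by (rule matrix_vector_mul_linear)
  have iso: "h (A gen *v u) (A gen *v v) = h u v" for u v by (rule isometric[OF gen(1)])
  obtain ws where ws: "\<forall>w\<in>set ws. w \<noteq> 0" "(*v) (A gen) = foldr (\<circ>) (map (reflection h) ws) id"
    using isometry_product_of_reflections[of h "(*v) (A gen)", OF flat_metric lin iso] by metis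
  have "det (matrix ((*v) (A gen))) = (- 1) ^ length ws"
    unfolding ws(2) using det_reflections[OF flat_metric ws(1)] by blast
  then have "(- 1 :: real) ^ length ws = 1" using A_det[OF gen(1)] by simp
  then have ev: "even (length ws)" by (cases "even (length ws)") auto
  define \<rho> where "\<rho> = (\<lambda>w. reflection (product_metric h) (0 :: real, w))"
  have "map_prod id (foldr (\<circ>) (map (reflection h) vs) id) = foldr (\<circ>) (map \<rho> vs) id" for vs
  proof (induction vs)
    case Nil show ?case by (simp add: fun_eq_iff)
  next
    case (Cons v vs)
    have "map_prod id (foldr (\<circ>) (map (reflection h) (v # vs)) id)
      = map_prod id (reflection h v) \<circ> map_prod id (foldr (\<circ>) (map (reflection h) vs) id)" by (simp add: fun_eq_iff)
    also have "\<dots> = \<rho> v \<circ> foldr (\<circ>) (map \<rho> vs) id" unfolding Cons \<rho>_def reflection_product_metric[OF flat_metric] ..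
    also have "\<dots> = foldr (\<circ>) (map \<rho> (v # vs)) id" by (simp only: list.map foldr.simps o_apply)
    finally show ?case .
  qed
  then have rw: "rot = foldr (\<circ>) (map \<rho> ws) id" unfolding rot_def ws(2) .
  obtain hs where hs: "foldr (\<circ>) (map \<rho> ws) id = foldr (\<circ>) hs id" "\<forall>g\<in>set hs. \<exists>u\<in>set ws. \<exists>v\<in>set ws. g = \<rho> u \<circ> \<rho> v"
    using foldr_pair_up[OF ev, of \<rho>] by metis
  have "rot = foldr (\<circ>) hs id" unfolding rw by (rule hs(1))
  moreover have "\<exists>u v. u \<noteq> 0 \<and> v \<noteq> 0 \<and> g = reflection (product_metric h) (0, u) \<circ> reflection (product_metric h) (0, v)"
    if g: "g \<in> set hs" for g
  proof -
    obtain u v where "u \<in> set ws" "v \<in> set ws" "g = \<rho> u \<circ> \<rho> v" using hs(2) g by blast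
    then show ?thesis using ws(1) unfolding \<rho>_def by blast
  qed
  ultimately show ?thesis by blast
qed

theorem eta_integer: "eta_invariant (deck_group G \<phi>) (product_metric h) vol \<in> \<int>"
proof -
  define m where "m = product_metric h"
  have ip: "inner_product_on m" unfolding m_def by (rule inner_product_on_product_metric[OF flat_metric])
  define e0 where "e0 = (1 :: real, 0 :: real ^ 6)"
  have me0: "m c e0 = fst c" for c by (simp add: m_def e0_def product_metric_def case_prod_beta inner_product_onD(9)[OF flat_metric])
  have "orthonormal_on m {e0}" by (simp add: orthonormal_on_def me0) (simp add: e0_def)
  then obtain E where E: "e0 \<in> E" "orthonormal_basis m E" using orthonormal_basis_extend[OF ip] by (metis insert_subset)
  interpret seven_space m vol E
    by unfold_locales (use ip E(2) orientation in \<open>simp_all add: m_def\<close>)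
  obtain hs where hs: "rot = foldr (\<circ>) hs id"
    "\<And>g. g \<in> set hs \<Longrightarrow> \<exists>u v. u \<noteq> 0 \<and> v \<noteq> 0 \<and> g = reflection m (0, u) \<circ> reflection m (0, v)"
    using rot_factors unfolding m_def by blast
  have re0: "reflection m (0, w) e0 = e0" for w
    using inner_product_onD(2)[OF ip, of e0 "(0, w)"] me0[of "(0, w)"] by (simp add: reflection_def zero_prod_def[symmetric])
  have factor: "linear g \<and> (\<forall>u v. m (g u) (g v) = m u v) \<and> (\<forall>vs. vol (map g vs) = vol vs) \<and> g e0 = e0 \<and>
      (\<exists>t. linear t \<and> (\<forall>u v. m (t u) (t v) = m u v) \<and> (\<forall>vs. vol (map t vs) = - vol vs) \<and> t e0 = e0
        \<and> (\<forall>x. t (t x) = x) \<and> (\<forall>x. t (g x) = g (t x)))" if "g \<in> set hs" for g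
  proof -
    obtain u v where uv: "u \<noteq> 0" "v \<noteq> 0" and g: "g = reflection m (0, u) \<circ> reflection m (0, v)" using hs(2)[OF \<open>g \<in> set hs\<close>] by blast
    have nz: "(0 :: real, u) \<noteq> 0" "(0 :: real, v) \<noteq> 0" using uv by (auto simp: zero_prod_def)
    obtain w where w: "w \<noteq> 0" "h w u = 0" "h w v = 0" using common_orthogonal_vector[OF flat_metric] by metis
    have wnz: "(0 :: real, w) \<noteq> 0" using w by (auto simp: zero_prod_def)
    have o: "m (0, w) (0, u) = 0" "m (0, w) (0, v) = 0" using w by (simp_all add: m_def product_metric_def)
    define t where "t = reflection m (0 :: real, w)"
    have "linear g" unfolding g by (rule linear_compose[OF linear_reflection[OF ip] linear_reflection[OF ip]])
    moreover have "m (g x) (g y) = m x y" for x y by (simp add: g reflection_isometry[OF ip nz(1)] reflection_isometry[OF ip nz(2)])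
    moreover have "vol (map g vs) = vol vs" for vs
      using reflection_volume[OF nz(1), of "map (reflection m (0, v)) vs"] reflection_volume[OF nz(2), of vs] by (simp add: g)
    moreover have "g e0 = e0" by (simp add: g re0)
    moreover have "linear t" unfolding t_def by (rule linear_reflection[OF ip])
    moreover have "m (t x) (t y) = m x y" for x y unfolding t_def by (rule reflection_isometry[OF ip wnz])
    moreover have "vol (map t vs) = - vol vs" for vs unfolding t_def by (rule reflection_volume[OF wnz])
    moreover have "t e0 = e0" unfolding t_def by (rule re0)
    moreover have "t (t x) = x" for x unfolding t_def by (rule reflection_involution[OF ip wnz])
    moreover have "t (g x) = g (t x)" for x
      by (simp add: t_def g reflection_commute[OF ip o(1)] reflection_commute[OF ip o(2)])
    ultimately show ?thesis by blast
  qed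
  have vol_rot: "vol (map rot vs) = vol vs" for vs
  proof -
    have "vol (map (foldr (\<circ>) gs id) vs) = vol vs" if "set gs \<subseteq> set hs" for gs
      using that
    proof (induction gs)
      case Nil show ?case by simp
    next
      case (Cons g gs)
      have "map (foldr (\<circ>) (g # gs) id) vs = map g (map (foldr (\<circ>) gs id) vs)" by simp
      then show ?case using Cons factor[of g] by (metis insert_subset list.simps(15))
    qed
    then show ?thesis unfolding hs(1) by blast
  qed
  have rot: "linear rot" "m (rot u) (rot v) = m u v" "rot e0 = e0" "rot ^^ r = id" for u v
  proof -
    show "linear rot" unfolding rot_def by (rule linearI) (auto simp: matrix_vector_right_distrib matrix_vector_mult_scaleR)
    show "m (rot u) (rot v) = m u v" by (simp add: m_def product_metric_def rot_def case_prod_beta isometric[OF gen(1)])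
    show "rot e0 = e0" by (simp add: rot_def e0_def)
    show "rot ^^ r = id" by (intro ext) (simp add: rot_pow gen_pow_r unit(2) map_prod_def case_prod_beta)
  qed
  interpret flat_quotient m vol E "deck_group G \<phi>" e0 rot r
  proof (rule flat_quotient.intro[OF seven_space_axioms], rule flat_quotient_axioms.intro)
    show "e0 \<in> E" by (rule E(1))
    show "linear rot" "rot e0 = e0" "rot ^^ r = id" by (rule rot)+
    show "m (rot u) (rot v) = m u v" for u v by (rule rot(2))
    show "vol (map rot vs) = vol vs" for vs by (rule vol_rot)
    show "r > 0" by (rule r_pos)
    show "(\<lambda>x. x + b) \<in> deck_group G \<phi>" if "b \<in> Basis" for b
      using that unfolding holonomy by (auto simp: integer_lattice_iff Basis_prod_def Basis_vec_def axis_def)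
    show "\<exists>k c. \<gamma> = (\<lambda>x. (rot ^^ k) x + c) \<and> m c e0 - real k / real r \<in> \<int>" if \<gamma>: "\<gamma> \<in> deck_group G \<phi>" for \<gamma>
    proof -
      obtain g v where g: "g \<in> carrier G" and v: "v \<in> integer_lattice"
        and \<gamma>g: "\<gamma> = (\<lambda>p. map_prod id ((*v) (A g)) p + ((a g, b g) + v))" using \<gamma> unfolding deck_group_iff by blast
      obtain k where k: "g = gen [^] (k::nat)" "a g - real k / real r \<in> \<int>" by (rule power_of_gen[OF g])
      have "\<gamma> = (\<lambda>x. (rot ^^ k) x + ((a g, b g) + v))" unfolding \<gamma>g rot_pow k(1)[symmetric] ..
      moreover have "m ((a g, b g) + v) e0 - real k / real r \<in> \<int>"
      proof -
        have "(a g - real k / real r) + fst v \<in> \<int>" using k(2) v by (intro Ints_add) (auto simp: integer_lattice_iff)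
        then show ?thesis by (simp add: me0 algebra_simps)
      qed
      ultimately show ?thesis by blast
    qed
    show "\<exists>c. (\<lambda>x. rot x + c) \<in> deck_group G \<phi> \<and> m c e0 = 1 / real r"
    proof -
      have "(of_int (height gen) - of_int 1) / real r \<in> \<int>" by (rule of_int_div_nat_Ints[OF gen(2) r_pos])
      \<comment> \<open>A lattice translation corrects the lift of \<open>gen\<close> so that its
        advance is exactly 1 / r and not only modulo 1.\<close>
      then have l: "(1 / real r - a gen, 0) \<in> integer_lattice"
        using Ints_minus[of "a gen - 1 / real r"] by (simp add: integer_lattice_iff height[OF gen(1)] diff_divide_distrib)
      have "(\<lambda>x. rot x + ((a gen, b gen) + (1 / real r - a gen, 0))) \<in> deck_group G \<phi>"
        unfolding deck_group_iff rot_def using gen(1) l by blast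
      then show ?thesis by (intro exI[of _ "(a gen, b gen) + (1 / real r - a gen, 0)"]) (simp add: me0)
    qed
  qed
  show ?thesis
    using eta_invariant_integer[OF kappa_divisible[OF hs(1) factor]] unfolding m_def .
qed

end

theorem theorem1:
  fixes G :: "('g, 'b) monoid_scheme"
    and \<phi> :: "'g \<Rightarrow> (real \<times> (real ^ 6)) set \<Rightarrow> (real \<times> (real ^ 6)) set"
    and h :: "(real ^ 6) \<Rightarrow> (real ^ 6) \<Rightarrow> real"
    and a :: "'g \<Rightarrow> real" and b :: "'g \<Rightarrow> real ^ 6" and A :: "'g \<Rightarrow> real ^ 6 ^ 6"
    and vol :: "(real \<times> (real ^ 6)) list \<Rightarrow> real"
  assumes flat_metric: "inner_product_on h"
    and cyclic: "group G" "finite (carrier G)" "cyclic_group G"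
    and action: "group_action G torus \<phi>"
    and action_formula: "\<And>g x xb. g \<in> carrier G \<Longrightarrow>
          \<phi> g (torus_point (x, xb)) = torus_point (x + a g, A g *v xb + b g)"
    and A_integral: "\<And>g i j. g \<in> carrier G \<Longrightarrow> A g $ i $ j \<in> \<int>"
    and A_det: "\<And>g. g \<in> carrier G \<Longrightarrow> det (A g) = 1"
    and isometric: "\<And>g u v. g \<in> carrier G \<Longrightarrow> h (A g *v u) (A g *v v) = h u v"
    and free: "\<And>g y. g \<in> carrier G \<Longrightarrow> y \<in> torus \<Longrightarrow> \<phi> g y = y \<Longrightarrow> g = \<one>\<^bsub>G\<^esub>"
    and holonomy: "\<And>v. (\<lambda>p. p + v) \<in> deck_group G \<phi> \<longleftrightarrow> v \<in> integer_lattice"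
    and a_nonzero: "\<And>g. g \<in> carrier G \<Longrightarrow> g \<noteq> \<one>\<^bsub>G\<^esub> \<Longrightarrow> a g \<notin> \<int>"
    and orientation: "volume_form (product_metric h) vol"
  shows "eta_invariant (deck_group G \<phi>) (product_metric h) vol \<in> \<int>"
proof -
  interpret torus_quotient G \<phi> h a b A vol
    by (rule torus_quotient.intro) (fact assms)+
  show ?thesis by (rule eta_integer)
qed

end
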